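(* Let $k$ be a field with $\operatorname{char} k\neq 2$. Let $X$ be a $k$-scheme of dimension $n$. Let $V\to X$ be a relatively orientable vector bundle of rank $n$, and let $\rho:\det V\otimes\omega_X\xrightarrow{\cong}L^{\otimes 2}$ be a relative orientation of $V\to X$. Let $\sigma:X\to V$ be a section. If $p\in\sigma^{-1}(0)$ is a simple zero with separable residue field $k(p)/k$, then the local index of $\sigma$ at $p$ is equal to the intersection volume: $$\mathrm{ind}_p\sigma=\mathrm{Tr}_{k(p)/k}\langle\mathrm{Vol}(p)\rangle\quad\text{in }\mathrm{GW}(k).$$
   Context: $\mathrm{GW}(k)$ is the Grothendieck--Witt group of symmetric non-degenerate bilinear forms over $k$; $\langle a\rangle$ is the class of $(x,y)\mapsto axy$. For a finite separable extension $L/k$, $\mathrm{Tr}_{L/k}:\mathrm{GW}(L)\to\mathrm{GW}(k)$ is post-composition with the field trace. A relative orientation of $V\to X$ is a line bundle $L$ with an isomorphism $\rho:\det V\otimes\omega_X\cong L^{\otimes2}$, where $\omega_X=\det T^*X$ and $T^*X$ is the cotangent bundle. Nisnevich coordinates near a closed point $p$ are an open neighborhood $U$ of $p$ with an étale map $\varphi=(\varphi_1,\ldots,\varphi_n):U\to\mathbb{A}^n_k$ inducing an isomorphism of residue fields $k(\varphi(p))\cong k(p)$. They determine the basis element $d\varphi_1\wedge\cdots\wedge d\varphi_n$ of $\omega_X|_U$. A local trivialization $\psi$ of $V|_U$, with distinguished basis element $\det\psi$ of $\det V|_U$, is compatible with $\varphi$ and $(\rho,L)$ if $\rho(\det\psi\otimes(d\varphi_1\wedge\cdots\wedge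 d\varphi_n))=\ell\otimes\ell$ for some $\ell\in L(U)$ (shrink $U$ around $p$ if needed). In such data $\sigma$ is expressed near the isolated zero $p$ by polynomials $f_1,\ldots,f_n\in k[x_1,\ldots,x_n]$: the components of $\psi\circ\sigma$ agree with $\varphi^*f_1,\ldots,\varphi^*f_n$ modulo a sufficiently high power of the maximal ideal at $p$. The local index $\mathrm{ind}_p\sigma\in\mathrm{GW}(k)$ (in the sense of Kass--Wickelgren) is the local $\mathbb{A}^1$-degree $\deg^{\mathbb{A}^1}_{\varphi(p)}(f_1,\ldots,f_n)$; it is independent of the choices. The intersection volume is $\mathrm{Vol}(p)=\det(\partial f_i/\partial x_j)(\varphi(p))\in k(p)$, the Jacobian determinant. A zero $p$ is simple if the zero scheme of $\sigma$ is, near $p$, the reduced point $\operatorname{Spec}k(p)$. Local $\mathbb{A}^1$-degree. For $f=(f_1,\ldots,f_n):\mathbb{A}^n_k\to\mathbb{A}^n_k$ with isolated zero at a closed point $p$ with maximal ideal $\mathfrak m$, $\deg^{\mathbb{A}^1}_p(f)$ is the class of the Scheja--Storch form on $A=k[x_1,\ldots,x_n]_{\mathfrak{m}}/(f_1,\ldots,f_n)$: write $f_j(X)-f_j(Y)=\sum_i\Delta_{ij}(X_i-Y_i)$ with $\Delta_{ij}\in k[X,Y]$, let $\sum_l a_l\otimes b_l\in A\otimes_kA$ be the image of $\det(\Delta_{ij})$, let $\eta:A\to k$ be the unique $k$-linear map with $\sum_l\eta(a_l)b_l=1$; the form is $(x,y)\mapsto\eta(xy)$. *)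

theory Defs
  imports
    "HOL-Analysis.Abstract_Topology"
    "HOL-Algebra.Algebra"
    "HOL-Library.Poly_Mapping"
    "Jordan_Normal_Form.Determinant"
begin

section \<open>Commutative algebra\<close>

text \<open>The base field is a type of class \<open>field\<close>; all other rings are records of HOL-Algebra.\<close>

definition field_ring :: "'k::field ring" where
  "field_ring = \<lparr>carrier = UNIV, monoid.mult = (*), one = 1, ring.zero = 0, ring.add = (+)\<rparr>"

definition local_ring :: "('a, 'b) ring_scheme \<Rightarrow> bool" where
  "local_ring R \<longleftrightarrow> cring R \<and> (\<exists>!I. maximalideal I R)"

definition max_ideal :: "('a, 'b) ring_scheme \<Rightarrow> 'a set" where
  "max_ideal R = (THE I. maximalideal I R)"

fun ideal_pow :: "('a, 'b) ring_scheme \<Rightarrow> 'a set \<Rightarrow> nat \<Rightarrow> 'a set" where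
  "ideal_pow R I 0 = carrier R"
| "ideal_pow R I (Suc N) = ideal_prod R I (ideal_pow R I N)"

subsection \<open>Localization\<close>

text \<open>The fraction \<open>a/s\<close>, as the set of all pairs representing it.\<close>

definition fraction :: "('a, 'b) ring_scheme \<Rightarrow> 'a set \<Rightarrow> 'a \<Rightarrow> 'a \<Rightarrow> ('a \<times> 'a) set" where
  "fraction R S a s = {(b, t). b \<in> carrier R \<and> t \<in> S \<and>
     (\<exists>u\<in>S. u \<otimes>\<^bsub>R\<^esub> (a \<otimes>\<^bsub>R\<^esub> t) = u \<otimes>\<^bsub>R\<^esub> (b \<otimes>\<^bsub>R\<^esub> s))}"

definition localization :: "('a, 'b) ring_scheme \<Rightarrow> 'a set \<Rightarrow> ('a \<times> 'a) set ring" where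
  "localization R S =
    \<lparr>carrier = {fraction R S a s | a s. a \<in> carrier R \<and> s \<in> S},
     monoid.mult = (\<lambda>A B. \<Union>{fraction R S (a \<otimes>\<^bsub>R\<^esub> b) (s \<otimes>\<^bsub>R\<^esub> t) | a s b t. (a, s) \<in> A \<and> (b, t) \<in> B}),
     one = fraction R S \<one>\<^bsub>R\<^esub> \<one>\<^bsub>R\<^esub>,
     ring.zero = fraction R S \<zero>\<^bsub>R\<^esub> \<one>\<^bsub>R\<^esub>,
     ring.add = (\<lambda>A B. \<Union>{fraction R S (a \<otimes>\<^bsub>R\<^esub> t \<oplus>\<^bsub>R\<^esub> b \<otimes>\<^bsub>R\<^esub> s) (s \<otimes>\<^bsub>R\<^esub> t) |
                      a s b t. (a, s) \<in> A \<and> (b, t) \<in> B})\<rparr>"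

abbreviation localize_at :: "('a, 'b) ring_scheme \<Rightarrow> 'a set \<Rightarrow> ('a \<times> 'a) set ring" where
  "localize_at R P \<equiv> localization R (carrier R - P)"

subsection \<open>Modules\<close>

definition alg_module :: "('a \<Rightarrow> 'b) \<Rightarrow> ('b, 'c) ring_scheme \<Rightarrow> ('a, 'b) module" where
  "alg_module h B = \<lparr>carrier = carrier B, monoid.mult = monoid.mult B, one = one B,
     ring.zero = ring.zero B, ring.add = ring.add B,
     module.smult = (\<lambda>a b. h a \<otimes>\<^bsub>B\<^esub> b)\<rparr>"

definition restrict_scalars :: "('a \<Rightarrow> 'b) \<Rightarrow> ('b, 'm) module \<Rightarrow> ('a, 'm) module" where
  "restrict_scalars h M = \<lparr>carrier = carrier M, monoid.mult = monoid.mult M, one = one M,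
     ring.zero = ring.zero M,
     ring.add = ring.add M, module.smult = (\<lambda>a m. h a \<odot>\<^bsub>M\<^esub> m)\<rparr>"

definition lincomb :: "('a, 'm) module \<Rightarrow> nat \<Rightarrow> (nat \<Rightarrow> 'a) \<Rightarrow> (nat \<Rightarrow> 'm) \<Rightarrow> 'm" where
  "lincomb M n a e = (\<Oplus>\<^bsub>M\<^esub>i\<in>{..<n}. a i \<odot>\<^bsub>M\<^esub> e i)"

definition is_basis :: "('a, 'c) ring_scheme \<Rightarrow> ('a, 'm) module \<Rightarrow> nat \<Rightarrow> (nat \<Rightarrow> 'm) \<Rightarrow> bool" where
  "is_basis R M n e \<longleftrightarrow> e \<in> {..<n} \<rightarrow> carrier M \<and>
     (\<forall>v\<in>carrier M. \<exists>!a. a \<in> {..<n} \<rightarrow>\<^sub>E carrier R \<and> v = lincomb M n a e)"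

definition coords ::
    "('a, 'c) ring_scheme \<Rightarrow> ('a, 'm) module \<Rightarrow> nat \<Rightarrow> (nat \<Rightarrow> 'm) \<Rightarrow> 'm \<Rightarrow> nat \<Rightarrow> 'a" where
  "coords R M n e v = (THE a. a \<in> {..<n} \<rightarrow>\<^sub>E carrier R \<and> v = lincomb M n a e)"

subsection \<open>Modules by generators and relations\<close>

text \<open>The fields \<open>mult\<close> and \<open>one\<close>, which a module record inherits from rings, are meaningless in
  the records below.\<close>

definition free_module :: "('a, 'c) ring_scheme \<Rightarrow> 's set \<Rightarrow> ('a, 's \<Rightarrow> 'a) module" where
  "free_module R S =
    \<lparr>carrier = {v. (\<forall>s. v s \<in> carrier R) \<and> {s. v s \<noteq> \<zero>\<^bsub>R\<^esub>} \<subseteq> S \<and> finite {s. v s \<noteq> \<zero>\<^bsub>R\<^esub>}},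
     monoid.mult = (\<lambda>_ _. undefined), one = undefined,
     ring.zero = (\<lambda>_. \<zero>\<^bsub>R\<^esub>), ring.add = (\<lambda>v w s. v s \<oplus>\<^bsub>R\<^esub> w s), module.smult = (\<lambda>a v s. a \<otimes>\<^bsub>R\<^esub> v s)\<rparr>"

definition gen :: "('a, 'c) ring_scheme \<Rightarrow> 's \<Rightarrow> 's \<Rightarrow> 'a" where
  "gen R s = (\<lambda>t. if t = s then \<one>\<^bsub>R\<^esub> else \<zero>\<^bsub>R\<^esub>)"

definition mspan :: "('a, 'c) ring_scheme \<Rightarrow> ('a, 'm) module \<Rightarrow> 'm set \<Rightarrow> 'm set" where
  "mspan R M A = \<Inter>{H. submodule H R M \<and> A \<subseteq> H}"

definition quot_module :: "('a, 'm) module \<Rightarrow> 'm set \<Rightarrow> ('a, 'm set) module" where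
  "quot_module M H =
    \<lparr>carrier = a_rcosets\<^bsub>M\<^esub> H, monoid.mult = (\<lambda>_ _. undefined), one = undefined,
     ring.zero = H, ring.add = set_add M, module.smult = (\<lambda>a C. \<Union>v\<in>C. H +>\<^bsub>M\<^esub> (a \<odot>\<^bsub>M\<^esub> v))\<rparr>"

definition pres_module ::
    "('a, 'c) ring_scheme \<Rightarrow> 's set \<Rightarrow> ('s \<Rightarrow> 'a) set \<Rightarrow> ('a, ('s \<Rightarrow> 'a) set) module" where
  "pres_module R S E = quot_module (free_module R S) (mspan R (free_module R S) E)"

definition pres_class ::
    "('a, 'c) ring_scheme \<Rightarrow> 's set \<Rightarrow> ('s \<Rightarrow> 'a) set \<Rightarrow> ('s \<Rightarrow> 'a) \<Rightarrow> ('s \<Rightarrow> 'a) set" where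
  "pres_class R S E v = mspan R (free_module R S) E +>\<^bsub>free_module R S\<^esub> v"

text \<open>The semilinear map into the module with generators \<open>S\<close> and relations \<open>E\<close> over \<open>R\<close> that is
  given by \<open>h\<close> on scalars and by \<open>g\<close> on generators.\<close>

definition pres_map ::
    "('b, 'c) ring_scheme \<Rightarrow> 't set \<Rightarrow> ('t \<Rightarrow> 'b) set \<Rightarrow> ('a \<Rightarrow> 'b) \<Rightarrow> ('s \<Rightarrow> 't) \<Rightarrow>
     ('s \<Rightarrow> 'a) set \<Rightarrow> ('t \<Rightarrow> 'b) set" where
  "pres_map R S E h g C =
     (\<Union>v\<in>C. pres_class R S E (\<lambda>t. \<Oplus>\<^bsub>R\<^esub>s\<in>{s. g s = t \<and> h (v s) \<noteq> \<zero>\<^bsub>R\<^esub>}. h (v s)))"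

definition tensor_gens :: "('a, 'm) module \<Rightarrow> ('a, 'n) module \<Rightarrow> ('m \<times> 'n) set" where
  "tensor_gens M N = carrier M \<times> carrier N"

definition tensor_rels ::
    "('a, 'c) ring_scheme \<Rightarrow> ('a, 'm) module \<Rightarrow> ('a, 'n) module \<Rightarrow> ('m \<times> 'n \<Rightarrow> 'a) set" where
  "tensor_rels R M N =
    {\<lambda>z. gen R (m \<oplus>\<^bsub>M\<^esub> m', n) z \<ominus>\<^bsub>R\<^esub> gen R (m, n) z \<ominus>\<^bsub>R\<^esub> gen R (m', n) z | m m' n.
       m \<in> carrier M \<and> m' \<in> carrier M \<and> n \<in> carrier N} \<union>
    {\<lambda>z. gen R (m, n \<oplus>\<^bsub>N\<^esub> n') z \<ominus>\<^bsub>R\<^esub> gen R (m, n) z \<ominus>\<^bsub>R\<^esub> gen R (m, n') z | m n n'.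
       m \<in> carrier M \<and> n \<in> carrier N \<and> n' \<in> carrier N} \<union>
    {\<lambda>z. gen R (a \<odot>\<^bsub>M\<^esub> m, n) z \<ominus>\<^bsub>R\<^esub> a \<otimes>\<^bsub>R\<^esub> gen R (m, n) z | a m n.
       a \<in> carrier R \<and> m \<in> carrier M \<and> n \<in> carrier N} \<union>
    {\<lambda>z. gen R (m, a \<odot>\<^bsub>N\<^esub> n) z \<ominus>\<^bsub>R\<^esub> a \<otimes>\<^bsub>R\<^esub> gen R (m, n) z | a m n.
       a \<in> carrier R \<and> m \<in> carrier M \<and> n \<in> carrier N}"

definition ext_gens :: "nat \<Rightarrow> ('a, 'm) module \<Rightarrow> (nat \<Rightarrow> 'm) set" where
  "ext_gens n M = {..<n} \<rightarrow>\<^sub>E carrier M"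

definition ext_rels ::
    "('a, 'c) ring_scheme \<Rightarrow> nat \<Rightarrow> ('a, 'm) module \<Rightarrow> ((nat \<Rightarrow> 'm) \<Rightarrow> 'a) set" where
  "ext_rels R n M =
    {\<lambda>z. gen R (v(i := m \<oplus>\<^bsub>M\<^esub> m')) z \<ominus>\<^bsub>R\<^esub> gen R (v(i := m)) z \<ominus>\<^bsub>R\<^esub> gen R (v(i := m')) z |
       v i m m'. v \<in> ext_gens n M \<and> i < n \<and> m \<in> carrier M \<and> m' \<in> carrier M} \<union>
    {\<lambda>z. gen R (v(i := a \<odot>\<^bsub>M\<^esub> m)) z \<ominus>\<^bsub>R\<^esub> a \<otimes>\<^bsub>R\<^esub> gen R (v(i := m)) z |
       v i a m. v \<in> ext_gens n M \<and> i < n \<and> a \<in> carrier R \<and> m \<in> carrier M} \<union>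
    {gen R v | v i j. v \<in> ext_gens n M \<and> i < n \<and> j < n \<and> i \<noteq> j \<and> v i = v j}"

text \<open>Kaehler differentials of the \<open>'k\<close>-algebra \<open>B\<close> with structure map \<open>c\<close>: the generator \<open>b\<close>
  stands for \<open>db\<close>.\<close>

definition kaehler_rels :: "('k \<Rightarrow> 'b) \<Rightarrow> ('b, 'c) ring_scheme \<Rightarrow> ('b \<Rightarrow> 'b) set" where
  "kaehler_rels c B =
    {\<lambda>z. gen B (a \<oplus>\<^bsub>B\<^esub> b) z \<ominus>\<^bsub>B\<^esub> gen B a z \<ominus>\<^bsub>B\<^esub> gen B b z | a b.
       a \<in> carrier B \<and> b \<in> carrier B} \<union>
    {\<lambda>z. gen B (a \<otimes>\<^bsub>B\<^esub> b) z \<ominus>\<^bsub>B\<^esub> a \<otimes>\<^bsub>B\<^esub> gen B b z \<ominus>\<^bsub>B\<^esub> b \<otimes>\<^bsub>B\<^esub> gen B a z | a b.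
       a \<in> carrier B \<and> b \<in> carrier B} \<union>
    range (\<lambda>t. gen B (c t))"

subsection \<open>Properties of ring homomorphisms\<close>

text \<open>Flatness by the ideal criterion: \<open>I \<otimes> B \<rightarrow> B\<close> is injective for every ideal \<open>I\<close> of \<open>A\<close>.\<close>

definition flat_hom ::
    "('a, 'c) ring_scheme \<Rightarrow> ('b, 'd) ring_scheme \<Rightarrow> ('a \<Rightarrow> 'b) \<Rightarrow> bool" where
  "flat_hom A B h \<longleftrightarrow> (\<forall>I. ideal I A \<longrightarrow>
     (let N = alg_module id (A\<lparr>carrier := I\<rparr>); M = alg_module h B; F = free_module A (tensor_gens N M)
      in \<forall>v\<in>carrier F.
        (\<Oplus>\<^bsub>B\<^esub>z\<in>{z. v z \<noteq> \<zero>\<^bsub>A\<^esub>}. h (v z) \<otimes>\<^bsub>B\<^esub> (h (fst z) \<otimes>\<^bsub>B\<^esub> snd z)) = \<zero>\<^bsub>B\<^esub> \<longrightarrow>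
        v \<in> mspan A F (tensor_rels A N M)))"

definition finite_type_hom ::
    "('a, 'c) ring_scheme \<Rightarrow> ('b, 'd) ring_scheme \<Rightarrow> ('a \<Rightarrow> 'b) \<Rightarrow> bool" where
  "finite_type_hom A B h \<longleftrightarrow> (\<exists>G. finite G \<and> G \<subseteq> carrier B \<and>
     carrier B = generate_ring B (h ` carrier A \<union> G))"

definition finite_ext ::
    "('a, 'c) ring_scheme \<Rightarrow> ('b, 'd) ring_scheme \<Rightarrow> ('a \<Rightarrow> 'b) \<Rightarrow> bool" where
  "finite_ext F E h \<longleftrightarrow> (\<exists>n e. is_basis F (alg_module h E) n e)"

text \<open>Every element of \<open>E\<close> is a simple root of an irreducible polynomial over \<open>F\<close>.\<close>

definition separable_ext ::
    "('a, 'c) ring_scheme \<Rightarrow> ('b, 'd) ring_scheme \<Rightarrow> ('a \<Rightarrow> 'b) \<Rightarrow> bool" where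
  "separable_ext F E h \<longleftrightarrow> (\<forall>x\<in>carrier E. \<exists>p\<in>carrier (poly_ring F).
     pirreducible\<^bsub>F\<^esub> (carrier F) p \<and>
     (\<Oplus>\<^bsub>E\<^esub>i\<in>{..<length p}. h (ring.coeff F p i) \<otimes>\<^bsub>E\<^esub> x [^]\<^bsub>E\<^esub> i) = \<zero>\<^bsub>E\<^esub> \<and>
     (\<Oplus>\<^bsub>E\<^esub>i\<in>{1..<length p}. [i] \<cdot>\<^bsub>E\<^esub> (h (ring.coeff F p i) \<otimes>\<^bsub>E\<^esub> x [^]\<^bsub>E\<^esub> (i - 1))) \<noteq> \<zero>\<^bsub>E\<^esub>)"

text \<open>The trace of multiplication by \<open>x\<close> on the finite free \<open>F\<close>-algebra \<open>E\<close>.\<close>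

definition alg_trace ::
    "('a, 'c) ring_scheme \<Rightarrow> ('b, 'd) ring_scheme \<Rightarrow> ('a \<Rightarrow> 'b) \<Rightarrow> 'b \<Rightarrow> 'a" where
  "alg_trace F E h x = (THE t. \<exists>n e. is_basis F (alg_module h E) n e \<and>
     t = (\<Oplus>\<^bsub>F\<^esub>i\<in>{..<n}. coords F (alg_module h E) n e (x \<otimes>\<^bsub>E\<^esub> e i) i))"

section \<open>Polynomials in several variables\<close>

type_synonym 'k mpoly = "(nat \<Rightarrow>\<^sub>0 nat) \<Rightarrow>\<^sub>0 'k"

definition mpoly_ring :: "nat \<Rightarrow> 'k::field mpoly ring" where
  "mpoly_ring n = \<lparr>carrier = {f. \<forall>m\<in>Poly_Mapping.keys f. Poly_Mapping.keys m \<subseteq> {..<n}},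
     monoid.mult = (*), one = 1, ring.zero = 0, ring.add = (+)\<rparr>"

definition mconst :: "'k::field \<Rightarrow> 'k mpoly" where
  "mconst c = Poly_Mapping.single 0 c"

definition mvar :: "nat \<Rightarrow> 'k::field mpoly" where
  "mvar i = Poly_Mapping.single (Poly_Mapping.single i 1) 1"

definition partial_deriv :: "nat \<Rightarrow> 'k::field mpoly \<Rightarrow> 'k mpoly" where
  "partial_deriv j f = (\<Sum>m\<in>Poly_Mapping.keys f.
     Poly_Mapping.single (m - Poly_Mapping.single j 1)
       (of_nat (Poly_Mapping.lookup m j) * Poly_Mapping.lookup f m))"

definition jacobian :: "nat \<Rightarrow> (nat \<Rightarrow> 'k::field mpoly) \<Rightarrow> 'k mpoly" where
  "jacobian n f = Determinant.det (mat n n (\<lambda>(i, j). partial_deriv j (f i)))"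

definition shift_vars :: "nat \<Rightarrow> 'k::field mpoly \<Rightarrow> 'k mpoly" where
  "shift_vars n f = (\<Sum>m\<in>Poly_Mapping.keys f.
     Poly_Mapping.single
       (\<Sum>i\<in>Poly_Mapping.keys m. Poly_Mapping.single (n + i) (Poly_Mapping.lookup m i))
       (Poly_Mapping.lookup f m))"

section \<open>Grothendieck--Witt groups\<close>

text \<open>A pair consists of a module and a bilinear form on it.\<close>

type_synonym ('a, 'm) bform = "('a, 'm) module \<times> ('m \<Rightarrow> 'm \<Rightarrow> 'a)"

definition nondeg_symm_form :: "('a, 'c) ring_scheme \<Rightarrow> ('a, 'm) bform \<Rightarrow> bool" where
  "nondeg_symm_form F A \<longleftrightarrow> (case A of (M, b) \<Rightarrow>
     Module.module F M \<and> (\<exists>n e. is_basis F M n e) \<and>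
     (\<forall>x\<in>carrier M. \<forall>y\<in>carrier M. b x y \<in> carrier F \<and> b x y = b y x) \<and>
     (\<forall>x\<in>carrier M. \<forall>y\<in>carrier M. \<forall>z\<in>carrier M. b (x \<oplus>\<^bsub>M\<^esub> y) z = b x z \<oplus>\<^bsub>F\<^esub> b y z) \<and>
     (\<forall>a\<in>carrier F. \<forall>x\<in>carrier M. \<forall>y\<in>carrier M. b (a \<odot>\<^bsub>M\<^esub> x) y = a \<otimes>\<^bsub>F\<^esub> b x y) \<and>
     (\<forall>x\<in>carrier M. (\<forall>y\<in>carrier M. b x y = \<zero>\<^bsub>F\<^esub>) \<longrightarrow> x = \<zero>\<^bsub>M\<^esub>))"

definition isometric :: "('a, 'c) ring_scheme \<Rightarrow> ('a, 'm) bform \<Rightarrow> ('a, 'n) bform \<Rightarrow> bool" where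
  "isometric F A B \<longleftrightarrow> (case (A, B) of ((M, b), (N, c)) \<Rightarrow>
     \<exists>g. bij_betw g (carrier M) (carrier N) \<and>
       (\<forall>x\<in>carrier M. \<forall>y\<in>carrier M. g (x \<oplus>\<^bsub>M\<^esub> y) = g x \<oplus>\<^bsub>N\<^esub> g y) \<and>
       (\<forall>a\<in>carrier F. \<forall>x\<in>carrier M. g (a \<odot>\<^bsub>M\<^esub> x) = a \<odot>\<^bsub>N\<^esub> g x) \<and>
       (\<forall>x\<in>carrier M. \<forall>y\<in>carrier M. c (g x) (g y) = b x y))"

definition orth_sum ::
    "('a, 'c) ring_scheme \<Rightarrow> ('a, 'm) bform \<Rightarrow> ('a, 'n) bform \<Rightarrow> ('a, 'm \<times> 'n) bform" where
  "orth_sum F A B = (case (A, B) of ((M, b), (N, c)) \<Rightarrow>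
     (\<lparr>carrier = carrier M \<times> carrier N, monoid.mult = (\<lambda>_ _. undefined), one = undefined,
       ring.zero = (\<zero>\<^bsub>M\<^esub>, \<zero>\<^bsub>N\<^esub>), ring.add = (\<lambda>(x, y) (x', y'). (x \<oplus>\<^bsub>M\<^esub> x', y \<oplus>\<^bsub>N\<^esub> y')),
       module.smult = (\<lambda>a (x, y). (a \<odot>\<^bsub>M\<^esub> x, a \<odot>\<^bsub>N\<^esub> y))\<rparr>,
      \<lambda>(x, y) (x', y'). b x x' \<oplus>\<^bsub>F\<^esub> c y y'))"

definition std_space :: "('a, 'c) ring_scheme \<Rightarrow> nat \<Rightarrow> ('a, nat \<Rightarrow> 'a) module" where
  "std_space F n =
    \<lparr>carrier = {..<n} \<rightarrow>\<^sub>E carrier F, monoid.mult = (\<lambda>_ _. undefined), one = undefined,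
     ring.zero = (\<lambda>i\<in>{..<n}. \<zero>\<^bsub>F\<^esub>), ring.add = (\<lambda>x y. \<lambda>i\<in>{..<n}. x i \<oplus>\<^bsub>F\<^esub> y i),
     module.smult = (\<lambda>a x. \<lambda>i\<in>{..<n}. a \<otimes>\<^bsub>F\<^esub> x i)\<rparr>"

definition std_forms :: "('a, 'c) ring_scheme \<Rightarrow> ('a, nat \<Rightarrow> 'a) bform set" where
  "std_forms F = {(std_space F n, b) | n b. nondeg_symm_form F (std_space F n, b)}"

text \<open>Every form is isometric to one on some \<open>F^n\<close>. So elements of the Grothendieck group of
  isometry classes are modelled as classes of formal differences \<open>P - Q\<close> of such forms, which keeps
  the carrier within one type. \<open>gw_diff F A B\<close> is the element \<open>[A] - [B]\<close>; the forms \<open>A\<close> and \<open>B\<close> may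
  live on modules of any type.\<close>

definition gw_diff :: "('a, 'c) ring_scheme \<Rightarrow> ('a, 'm) bform \<Rightarrow> ('a, 'n) bform \<Rightarrow>
    (('a, nat \<Rightarrow> 'a) bform \<times> ('a, nat \<Rightarrow> 'a) bform) set" where
  "gw_diff F A B = {(P, Q). P \<in> std_forms F \<and> Q \<in> std_forms F \<and>
     (\<exists>R\<in>std_forms F. isometric F (orth_sum F (orth_sum F P B) R) (orth_sum F (orth_sum F Q A) R))}"

definition zero_form :: "('a, 'c) ring_scheme \<Rightarrow> ('a, nat \<Rightarrow> 'a) bform" where
  "zero_form F = (std_space F 0, \<lambda>_ _. \<zero>\<^bsub>F\<^esub>)"

definition GW :: "('a, 'c) ring_scheme \<Rightarrow>
    (('a, nat \<Rightarrow> 'a) bform \<times> ('a, nat \<Rightarrow> 'a) bform) set monoid" where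
  "GW F = \<lparr>carrier = {gw_diff F P Q | P Q. P \<in> std_forms F \<and> Q \<in> std_forms F},
     monoid.mult = (\<lambda>c d. \<Union>{gw_diff F (orth_sum F P P') (orth_sum F Q Q') | P Q P' Q'.
                       (P, Q) \<in> c \<and> (P', Q') \<in> d}),
     one = gw_diff F (zero_form F) (zero_form F)\<rparr>"

definition gw_class :: "('a, 'c) ring_scheme \<Rightarrow> ('a, 'm) bform \<Rightarrow>
    (('a, nat \<Rightarrow> 'a) bform \<times> ('a, nat \<Rightarrow> 'a) bform) set" where
  "gw_class F A = gw_diff F A (zero_form F)"

text \<open>The class \<open>\<langle>a\<rangle>\<close> of the form \<open>(x, y) \<mapsto> a x y\<close> on \<open>F\<close>.\<close>

definition gw_rank_one :: "('a, 'c) ring_scheme \<Rightarrow> 'a \<Rightarrow>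
    (('a, nat \<Rightarrow> 'a) bform \<times> ('a, nat \<Rightarrow> 'a) bform) set" where
  "gw_rank_one F a = gw_class F (alg_module id F, \<lambda>x y. a \<otimes>\<^bsub>F\<^esub> (x \<otimes>\<^bsub>F\<^esub> y))"

definition trace_form :: "('a, 'c) ring_scheme \<Rightarrow> ('b, 'd) ring_scheme \<Rightarrow> ('a \<Rightarrow> 'b) \<Rightarrow>
    ('b, 'm) bform \<Rightarrow> ('a, 'm) bform" where
  "trace_form F E h A = (case A of (M, b) \<Rightarrow>
     (restrict_scalars h M, \<lambda>x y. alg_trace F E h (b x y)))"

text \<open>The transfer \<open>GW(E) \<rightarrow> GW(F)\<close> of an extension \<open>h : F \<rightarrow> E\<close>.\<close>

definition gw_trace :: "('a, 'c) ring_scheme \<Rightarrow> ('b, 'd) ring_scheme \<Rightarrow> ('a \<Rightarrow> 'b) \<Rightarrow>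
    (('b, nat \<Rightarrow> 'b) bform \<times> ('b, nat \<Rightarrow> 'b) bform) set \<Rightarrow>
    (('a, nat \<Rightarrow> 'a) bform \<times> ('a, nat \<Rightarrow> 'a) bform) set" where
  "gw_trace F E h c = \<Union>{gw_diff F (trace_form F E h P) (trace_form F E h Q) | P Q. (P, Q) \<in> c}"

section \<open>The local A1-degree\<close>

text \<open>\<open>k[x]\<^sub>q / (f)\<close> for a maximal ideal \<open>q\<close>.\<close>

definition zero_algebra :: "nat \<Rightarrow> 'k::field mpoly set \<Rightarrow> (nat \<Rightarrow> 'k mpoly) \<Rightarrow>
    ('k mpoly \<times> 'k mpoly) set set ring" where
  "zero_algebra n q f = (let R = mpoly_ring n; A = localize_at R q in
     A Quot (genideal A ((\<lambda>i. fraction R (carrier R - q) (f i) 1) ` {..<n})))"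

definition to_zero_algebra :: "nat \<Rightarrow> 'k::field mpoly set \<Rightarrow> (nat \<Rightarrow> 'k mpoly) \<Rightarrow>
    'k mpoly \<Rightarrow> ('k mpoly \<times> 'k mpoly) set set" where
  "to_zero_algebra n q f g = (let R = mpoly_ring n; A = localize_at R q in
     genideal A ((\<lambda>i. fraction R (carrier R - q) (f i) 1) ` {..<n})
       +>\<^bsub>A\<^esub> fraction R (carrier R - q) g 1)"

text \<open>In \<open>k[X, Y]\<close> the variables \<open>X\<^sub>i\<close> and \<open>Y\<^sub>i\<close> have the numbers \<open>i\<close> and \<open>n + i\<close>, for \<open>i < n\<close>.\<close>

definition difference_matrix ::
    "nat \<Rightarrow> (nat \<Rightarrow> 'k::field mpoly) \<Rightarrow> (nat \<Rightarrow> nat \<Rightarrow> 'k mpoly) \<Rightarrow> bool" where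
  "difference_matrix n f \<Delta> \<longleftrightarrow>
     (\<forall>i<n. \<forall>j<n. \<Delta> i j \<in> carrier (mpoly_ring (2 * n))) \<and>
     (\<forall>j<n. f j - shift_vars n (f j) = (\<Sum>i<n. \<Delta> i j * (mvar i - mvar (n + i))))"

definition X_part :: "nat \<Rightarrow> (nat \<Rightarrow>\<^sub>0 nat) \<Rightarrow> (nat \<Rightarrow>\<^sub>0 nat)" where
  "X_part n m = (\<Sum>i<n. Poly_Mapping.single i (Poly_Mapping.lookup m i))"

definition Y_part :: "nat \<Rightarrow> (nat \<Rightarrow>\<^sub>0 nat) \<Rightarrow> (nat \<Rightarrow>\<^sub>0 nat)" where
  "Y_part n m = (\<Sum>i<n. Poly_Mapping.single i (Poly_Mapping.lookup m (n + i)))"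

text \<open>The image in \<open>A \<otimes> A\<close> of a polynomial \<open>D\<close> with coefficients \<open>D\<^sub>m\<close> is the sum of the tensors
  \<open>D\<^sub>m x^(X_part m) \<otimes> x^(Y_part m)\<close>; these serve as the \<open>a\<^sub>l \<otimes> b\<^sub>l\<close> in \<open>\<Sum>\<^sub>l \<eta>(a\<^sub>l) b\<^sub>l = 1\<close>.\<close>

definition scheja_storch_functional :: "nat \<Rightarrow> 'k::field mpoly set \<Rightarrow> (nat \<Rightarrow> 'k mpoly) \<Rightarrow>
    (nat \<Rightarrow> nat \<Rightarrow> 'k mpoly) \<Rightarrow> (('k mpoly \<times> 'k mpoly) set set \<Rightarrow> 'k) \<Rightarrow> bool" where
  "scheja_storch_functional n q f \<Delta> \<eta> \<longleftrightarrow>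
     (let A = zero_algebra n q f; \<pi> = to_zero_algebra n q f;
          D = Determinant.det (mat n n (\<lambda>(i, j). \<Delta> i j)) in
      (\<forall>x\<in>carrier A. \<forall>y\<in>carrier A. \<eta> (x \<oplus>\<^bsub>A\<^esub> y) = \<eta> x + \<eta> y) \<and>
      (\<forall>c. \<forall>x\<in>carrier A. \<eta> (\<pi> (mconst c) \<otimes>\<^bsub>A\<^esub> x) = c * \<eta> x) \<and>
      (\<Oplus>\<^bsub>A\<^esub>m\<in>Poly_Mapping.keys D.
         \<pi> (mconst (\<eta> (\<pi> (Poly_Mapping.single (X_part n m) (Poly_Mapping.lookup D m))))) \<otimes>\<^bsub>A\<^esub>
         \<pi> (Poly_Mapping.single (Y_part n m) 1)) = \<one>\<^bsub>A\<^esub>)"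

text \<open>The description is meant for an isolated zero \<open>q\<close> of \<open>f\<close>, where the class does not depend on
  the choice of \<open>\<Delta>\<close>.\<close>

definition local_A1_degree :: "nat \<Rightarrow> 'k::field mpoly set \<Rightarrow> (nat \<Rightarrow> 'k mpoly) \<Rightarrow>
    (('k, nat \<Rightarrow> 'k) bform \<times> ('k, nat \<Rightarrow> 'k) bform) set" where
  "local_A1_degree n q f = (THE c. \<exists>\<Delta> \<eta>.
     difference_matrix n f \<Delta> \<and> scheja_storch_functional n q f \<Delta> \<eta> \<and>
     c = gw_class field_ring
           (alg_module (\<lambda>t. to_zero_algebra n q f (mconst t)) (zero_algebra n q f),
            \<lambda>x y. \<eta> (x \<otimes>\<^bsub>zero_algebra n q f\<^esub> y)))"

section \<open>Schemes\<close>

subsection \<open>Sheaves and stalks\<close>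

definition presheaf_on :: "'p topology \<Rightarrow> ('p set \<Rightarrow> 's set) \<Rightarrow> ('p set \<Rightarrow> 'p set \<Rightarrow> 's \<Rightarrow> 's) \<Rightarrow> bool"
  where
  "presheaf_on T F r \<longleftrightarrow>
     (\<forall>U W. openin T U \<and> openin T W \<and> W \<subseteq> U \<longrightarrow> r U W \<in> F U \<rightarrow> F W) \<and>
     (\<forall>U. openin T U \<longrightarrow> (\<forall>s\<in>F U. r U U s = s)) \<and>
     (\<forall>U W W'. openin T U \<and> openin T W \<and> openin T W' \<and> W \<subseteq> U \<and> W' \<subseteq> W \<longrightarrow>
        (\<forall>s\<in>F U. r W W' (r U W s) = r U W' s))"

definition sheaf_on :: "'p topology \<Rightarrow> ('p set \<Rightarrow> 's set) \<Rightarrow> ('p set \<Rightarrow> 'p set \<Rightarrow> 's \<Rightarrow> 's) \<Rightarrow> bool"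
  where
  "sheaf_on T F r \<longleftrightarrow> presheaf_on T F r \<and>
     (\<forall>\<U> s. (\<forall>U\<in>\<U>. openin T U \<and> s U \<in> F U) \<and>
        (\<forall>U\<in>\<U>. \<forall>W\<in>\<U>. r U (U \<inter> W) (s U) = r W (U \<inter> W) (s W)) \<longrightarrow>
        (\<exists>!t. t \<in> F (\<Union>\<U>) \<and> (\<forall>U\<in>\<U>. r (\<Union>\<U>) U t = s U)))"

definition germ :: "'p topology \<Rightarrow> ('p set \<Rightarrow> 's set) \<Rightarrow> ('p set \<Rightarrow> 'p set \<Rightarrow> 's \<Rightarrow> 's) \<Rightarrow> 'p \<Rightarrow>
    'p set \<Rightarrow> 's \<Rightarrow> ('p set \<times> 's) set" where
  "germ T F r x U s = {(W, t). openin T W \<and> x \<in> W \<and> t \<in> F W \<and>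
     (\<exists>N. openin T N \<and> x \<in> N \<and> N \<subseteq> U \<inter> W \<and> r U N s = r W N t)}"

definition germs :: "'p topology \<Rightarrow> ('p set \<Rightarrow> 's set) \<Rightarrow> ('p set \<Rightarrow> 'p set \<Rightarrow> 's \<Rightarrow> 's) \<Rightarrow> 'p \<Rightarrow>
    ('p set \<times> 's) set set" where
  "germs T F r x = {germ T F r x U s | U s. openin T U \<and> x \<in> U \<and> s \<in> F U}"

text \<open>The operation on germs induced by a family of operations on sections.\<close>

definition germ_op :: "'p topology \<Rightarrow> ('p set \<Rightarrow> 's set) \<Rightarrow> ('p set \<Rightarrow> 'p set \<Rightarrow> 's \<Rightarrow> 's) \<Rightarrow> 'p \<Rightarrow>
    ('p set \<Rightarrow> 's \<Rightarrow> 's \<Rightarrow> 's) \<Rightarrow> ('p set \<times> 's) set \<Rightarrow> ('p set \<times> 's) set \<Rightarrow> ('p set \<times> 's) set" where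
  "germ_op T F r x f a b = \<Union>{germ T F r x U (f U s t) | U s t. (U, s) \<in> a \<and> (U, t) \<in> b}"

subsection \<open>Ringed spaces\<close>

record ('p, 'r) ringed_space =
  topo :: "'p topology"
  sect :: "'p set \<Rightarrow> 'r ring"
  rst :: "'p set \<Rightarrow> 'p set \<Rightarrow> 'r \<Rightarrow> 'r"

abbreviation pts :: "('p, 'r, 'z) ringed_space_scheme \<Rightarrow> 'p set" where
  "pts S \<equiv> topspace (topo S)"

definition ringed :: "('p, 'r, 'z) ringed_space_scheme \<Rightarrow> bool" where
  "ringed S \<longleftrightarrow> sheaf_on (topo S) (\<lambda>U. carrier (sect S U)) (rst S) \<and>
     (\<forall>U. openin (topo S) U \<longrightarrow> cring (sect S U)) \<and>
     (\<forall>U W. openin (topo S) U \<and> openin (topo S) W \<and> W \<subseteq> U \<longrightarrow>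
        rst S U W \<in> Ring.ring_hom (sect S U) (sect S W))"

definition fgerm :: "('p, 'r, 'z) ringed_space_scheme \<Rightarrow> 'p \<Rightarrow> 'p set \<Rightarrow> 'r \<Rightarrow> ('p set \<times> 'r) set" where
  "fgerm S = germ (topo S) (\<lambda>U. carrier (sect S U)) (rst S)"

definition stalk :: "('p, 'r, 'z) ringed_space_scheme \<Rightarrow> 'p \<Rightarrow> ('p set \<times> 'r) set ring" where
  "stalk S x = (let op = germ_op (topo S) (\<lambda>U. carrier (sect S U)) (rst S) x in
    \<lparr>carrier = germs (topo S) (\<lambda>U. carrier (sect S U)) (rst S) x,
     monoid.mult = op (\<lambda>U. monoid.mult (sect S U)),
     one = fgerm S x (pts S) \<one>\<^bsub>sect S (pts S)\<^esub>,
     ring.zero = fgerm S x (pts S) \<zero>\<^bsub>sect S (pts S)\<^esub>,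
     ring.add = op (\<lambda>U. ring.add (sect S U))\<rparr>)"

definition locally_ringed :: "('p, 'r, 'z) ringed_space_scheme \<Rightarrow> bool" where
  "locally_ringed S \<longleftrightarrow> ringed S \<and> (\<forall>x\<in>pts S. local_ring (stalk S x))"

definition residue_field ::
    "('p, 'r, 'z) ringed_space_scheme \<Rightarrow> 'p \<Rightarrow> ('p set \<times> 'r) set set ring" where
  "residue_field S x = stalk S x Quot max_ideal (stalk S x)"

text \<open>The value at \<open>x\<close> of a function \<open>s\<close> on \<open>U\<close>.\<close>

definition value_at ::
    "('p, 'r, 'z) ringed_space_scheme \<Rightarrow> 'p \<Rightarrow> 'p set \<Rightarrow> 'r \<Rightarrow> ('p set \<times> 'r) set set" where
  "value_at S x U s = max_ideal (stalk S x) +>\<^bsub>stalk S x\<^esub> fgerm S x U s"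

definition open_sub :: "('p, 'r, 'z) ringed_space_scheme \<Rightarrow> 'p set \<Rightarrow> ('p, 'r) ringed_space" where
  "open_sub S U = \<lparr>topo = subtopology (topo S) U, sect = sect S, rst = rst S\<rparr>"

record ('p, 'r, 'q, 's) rs_map =
  pmap :: "'p \<Rightarrow> 'q"
  pull :: "'q set \<Rightarrow> 's \<Rightarrow> 'r"

definition preim :: "('p, 'r, 'z) ringed_space_scheme \<Rightarrow> ('p, 'r, 'q, 's) rs_map \<Rightarrow> 'q set \<Rightarrow> 'p set"
  where "preim S \<phi> V = {x \<in> pts S. pmap \<phi> x \<in> V}"

definition rs_morphism :: "('p, 'r, 'z) ringed_space_scheme \<Rightarrow> ('q, 's, 'y) ringed_space_scheme \<Rightarrow>
    ('p, 'r, 'q, 's) rs_map \<Rightarrow> bool" where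
  "rs_morphism S T \<phi> \<longleftrightarrow> continuous_map (topo S) (topo T) (pmap \<phi>) \<and>
     (\<forall>V. openin (topo T) V \<longrightarrow> pull \<phi> V \<in> Ring.ring_hom (sect T V) (sect S (preim S \<phi> V))) \<and>
     (\<forall>V W. openin (topo T) V \<and> openin (topo T) W \<and> W \<subseteq> V \<longrightarrow> (\<forall>s\<in>carrier (sect T V).
        pull \<phi> W (rst T V W s) = rst S (preim S \<phi> V) (preim S \<phi> W) (pull \<phi> V s)))"

definition rs_isomorphic ::
    "('p, 'r, 'z) ringed_space_scheme \<Rightarrow> ('q, 's, 'y) ringed_space_scheme \<Rightarrow> bool" where
  "rs_isomorphic S T \<longleftrightarrow> (\<exists>\<phi> :: ('p, 'r, 'q, 's) rs_map. rs_morphism S T \<phi> \<and>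
     homeomorphic_map (topo S) (topo T) (pmap \<phi>) \<and>
     (\<forall>V. openin (topo T) V \<longrightarrow> pull \<phi> V \<in> ring_iso (sect T V) (sect S (preim S \<phi> V))))"

definition stalk_map :: "('p, 'r, 'z) ringed_space_scheme \<Rightarrow> ('p, 'r, 'q, 's) rs_map \<Rightarrow> 'p \<Rightarrow>
    ('q set \<times> 's) set \<Rightarrow> ('p set \<times> 'r) set" where
  "stalk_map S \<phi> x a = \<Union>{fgerm S x (preim S \<phi> V) (pull \<phi> V s) | V s. (V, s) \<in> a}"

definition residue_map :: "('p, 'r, 'z) ringed_space_scheme \<Rightarrow> ('p, 'r, 'q, 's) rs_map \<Rightarrow> 'p \<Rightarrow>
    ('q set \<times> 's) set set \<Rightarrow> ('p set \<times> 'r) set set" where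
  "residue_map S \<phi> x C = (\<Union>a\<in>C. max_ideal (stalk S x) +>\<^bsub>stalk S x\<^esub> stalk_map S \<phi> x a)"

definition lrs_morphism :: "('p, 'r, 'z) ringed_space_scheme \<Rightarrow> ('q, 's, 'y) ringed_space_scheme \<Rightarrow>
    ('p, 'r, 'q, 's) rs_map \<Rightarrow> bool" where
  "lrs_morphism S T \<phi> \<longleftrightarrow> rs_morphism S T \<phi> \<and>
     (\<forall>x\<in>pts S. stalk_map S \<phi> x ` max_ideal (stalk T (pmap \<phi> x)) \<subseteq> max_ideal (stalk S x))"

subsection \<open>Spectra and schemes\<close>

definition spec_points :: "('a, 'b) ring_scheme \<Rightarrow> 'a set set" where
  "spec_points R = {P. primeideal P R}"

definition spec_topology :: "('a, 'b) ring_scheme \<Rightarrow> 'a set topology" where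
  "spec_topology R = topology (\<lambda>U. \<exists>A\<subseteq>carrier R. U = {P \<in> spec_points R. \<not> A \<subseteq> P})"

lemma openin_spec_topology:
  "openin (spec_topology R) U \<longleftrightarrow> (\<exists>A\<subseteq>carrier R. U = {P \<in> spec_points R. \<not> A \<subseteq> P})"
proof -
  define D where "D A = {P \<in> spec_points R. \<not> A \<subseteq> P}" for A
  have Int: "\<exists>C\<subseteq>carrier R. D A \<inter> D B = D C" if A: "A \<subseteq> carrier R" and B: "B \<subseteq> carrier R" for A B
  proof (intro exI conjI)
    let ?C = "{a \<otimes>\<^bsub>R\<^esub> b | a b. a \<in> A \<and> b \<in> B} \<inter> carrier R"
    show "?C \<subseteq> carrier R" by auto
    show "D A \<inter> D B = D ?C"
    proof (rule Set.set_eqI)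
      fix P
      show "P \<in> D A \<inter> D B \<longleftrightarrow> P \<in> D ?C"
      proof (cases "primeideal P R")
        case True
        then interpret primeideal P R .
        have closed: "a \<otimes>\<^bsub>R\<^esub> b \<in> carrier R" if "a \<in> A" "b \<in> B" for a b
          using that A B by auto
        have mem: "a \<in> P \<or> b \<in> P \<longleftrightarrow> a \<otimes>\<^bsub>R\<^esub> b \<in> P" if "a \<in> A" "b \<in> B" for a b
        proof -
          have "a \<in> carrier R" "b \<in> carrier R" using that A B by auto
          then show ?thesis using I_prime I_l_closed I_r_closed by metis
        qed
        have "?C \<subseteq> P \<longleftrightarrow> A \<subseteq> P \<or> B \<subseteq> P"
        proof
          assume AB: "A \<subseteq> P \<or> B \<subseteq> P"
          show "?C \<subseteq> P"
          proof
            fix c assume "c \<in> ?C"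
            then obtain a b where "a \<in> A" "b \<in> B" "c = a \<otimes>\<^bsub>R\<^esub> b" by auto
            then show "c \<in> P" using mem AB by auto
          qed
        next
          assume C: "?C \<subseteq> P"
          show "A \<subseteq> P \<or> B \<subseteq> P"
          proof (rule ccontr)
            assume "\<not> (A \<subseteq> P \<or> B \<subseteq> P)"
            then obtain a b where ab: "a \<in> A" "a \<notin> P" "b \<in> B" "b \<notin> P" by auto
            then have "a \<otimes>\<^bsub>R\<^esub> b \<in> ?C" using closed by auto
            then show False using C mem ab by auto
          qed
        qed
        then show ?thesis
          using True by (simp only: D_def spec_points_def mem_Collect_eq Int_iff de_Morgan_disj simp_thms)
      qed (simp add: D_def spec_points_def)
    qed
  qed
  have Un: "\<exists>C\<subseteq>carrier R. \<Union>\<U> = D C" if "\<forall>U\<in>\<U>. \<exists>A\<subseteq>carrier R. U = D A" for \<U>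
  proof (intro exI conjI)
    let ?C = "\<Union>{A. A \<subseteq> carrier R \<and> D A \<in> \<U>}"
    show "?C \<subseteq> carrier R" by auto
    show "\<Union>\<U> = D ?C"
    proof
      show "\<Union>\<U> \<subseteq> D ?C"
      proof
        fix P assume "P \<in> \<Union>\<U>"
        then obtain U where U: "U \<in> \<U>" "P \<in> U" by auto
        with that obtain A where "A \<subseteq> carrier R" "U = D A" by auto
        with U show "P \<in> D ?C" by (auto simp: D_def)
      qed
      show "D ?C \<subseteq> \<Union>\<U>"
      proof
        fix P assume P: "P \<in> D ?C"
        then obtain A where "A \<subseteq> carrier R" "D A \<in> \<U>" "\<not> A \<subseteq> P" by (auto simp: D_def)
        moreover from P this have "P \<in> D A" by (simp add: D_def)
        ultimately show "P \<in> \<Union>\<U>" by auto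
      qed
    qed
  qed
  have "istopology (\<lambda>U. \<exists>A\<subseteq>carrier R. U = D A)"
    unfolding istopology_def
  proof (intro conjI allI impI)
    fix U W assume "\<exists>A\<subseteq>carrier R. U = D A" "\<exists>A\<subseteq>carrier R. W = D A"
    then obtain A B where "A \<subseteq> carrier R" "U = D A" "B \<subseteq> carrier R" "W = D B" by auto
    then show "\<exists>C\<subseteq>carrier R. U \<inter> W = D C" using Int[of A B] by simp
  next
    fix \<U> assume "\<forall>U\<in>\<U>. \<exists>A\<subseteq>carrier R. U = D A"
    then show "\<exists>A\<subseteq>carrier R. \<Union>\<U> = D A" by (rule Un)
  qed
  then show ?thesis
    by (simp add: spec_topology_def D_def)
qed

text \<open>Sections over \<open>U\<close> are the functions \<open>s\<close> with \<open>s P\<close> in the localization at \<open>P\<close> that are locally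
  given by one fraction.\<close>

definition spec_sections ::
    "('a, 'b) ring_scheme \<Rightarrow> 'a set set \<Rightarrow> ('a set \<Rightarrow> ('a \<times> 'a) set) set" where
  "spec_sections R U = {s \<in> (\<Pi>\<^sub>E P\<in>U. carrier (localize_at R P)).
     \<forall>P\<in>U. \<exists>W a g. openin (spec_topology R) W \<and> P \<in> W \<and> W \<subseteq> U \<and> a \<in> carrier R \<and> g \<in> carrier R \<and>
       (\<forall>Q\<in>W. g \<notin> Q \<and> s Q = fraction R (carrier R - Q) a g)}"

definition Spec :: "('a, 'b) ring_scheme \<Rightarrow> ('a set, 'a set \<Rightarrow> ('a \<times> 'a) set) ringed_space" where
  "Spec R =
    \<lparr>topo = spec_topology R,
     sect = (\<lambda>U.
       \<lparr>carrier = spec_sections R U,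
        monoid.mult = (\<lambda>s t. \<lambda>P\<in>U. s P \<otimes>\<^bsub>localize_at R P\<^esub> t P),
        one = (\<lambda>P\<in>U. \<one>\<^bsub>localize_at R P\<^esub>),
        ring.zero = (\<lambda>P\<in>U. \<zero>\<^bsub>localize_at R P\<^esub>),
        ring.add = (\<lambda>s t. \<lambda>P\<in>U. s P \<oplus>\<^bsub>localize_at R P\<^esub> t P)\<rparr>),
     rst = (\<lambda>U W s. restrict s W)\<rparr>"

definition spec_fun :: "('a, 'b) ring_scheme \<Rightarrow> 'a \<Rightarrow> 'a set \<Rightarrow> ('a \<times> 'a) set" where
  "spec_fun R a = (\<lambda>P\<in>spec_points R. fraction R (carrier R - P) a \<one>\<^bsub>R\<^esub>)"

text \<open>An affine scheme is the spectrum of its ring of global functions, so no ring of another type is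
  needed here.\<close>

definition affine_open :: "('p, 'r, 'z) ringed_space_scheme \<Rightarrow> 'p set \<Rightarrow> bool" where
  "affine_open S U \<longleftrightarrow> openin (topo S) U \<and> rs_isomorphic (open_sub S U) (Spec (sect S U))"

definition is_scheme :: "('p, 'r, 'z) ringed_space_scheme \<Rightarrow> bool" where
  "is_scheme S \<longleftrightarrow> locally_ringed S \<and> (\<forall>x\<in>pts S. \<exists>U. x \<in> U \<and> affine_open S U)"

text \<open>A morphism to the spectrum of the field \<open>'k\<close> amounts to a ring homomorphism \<open>scal\<close> from \<open>'k\<close> to
  the global functions.\<close>

record ('k, 'p, 'r) k_space = "('p, 'r) ringed_space" +
  scal :: "'k \<Rightarrow> 'r"

definition k_scheme :: "('k::field, 'p, 'r) k_space \<Rightarrow> bool" where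
  "k_scheme S \<longleftrightarrow> is_scheme S \<and> scal S \<in> Ring.ring_hom field_ring (sect S (pts S))"

definition k_open_sub :: "('k, 'p, 'r) k_space \<Rightarrow> 'p set \<Rightarrow> ('k, 'p, 'r) k_space" where
  "k_open_sub S U = \<lparr>topo = subtopology (topo S) U, sect = sect S, rst = rst S,
     scal = (\<lambda>c. rst S (pts S) U (scal S c))\<rparr>"

definition k_morphism :: "('k, 'p, 'r) k_space \<Rightarrow> ('k, 'q, 's) k_space \<Rightarrow>
    ('p, 'r, 'q, 's) rs_map \<Rightarrow> bool" where
  "k_morphism S T \<phi> \<longleftrightarrow> lrs_morphism S T \<phi> \<and> (\<forall>c. pull \<phi> (pts T) (scal T c) = scal S c)"

definition scal_at :: "('k, 'p, 'r) k_space \<Rightarrow> 'p \<Rightarrow> 'k \<Rightarrow> ('p set \<times> 'r) set set" where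
  "scal_at S x c = value_at S x (pts S) (scal S c)"

definition affine_space ::
    "nat \<Rightarrow> ('k::field, 'k mpoly set, 'k mpoly set \<Rightarrow> ('k mpoly \<times> 'k mpoly) set) k_space" where
  "affine_space n = \<lparr>topo = topo (Spec (mpoly_ring n)), sect = sect (Spec (mpoly_ring n)),
     rst = rst (Spec (mpoly_ring n)), scal = (\<lambda>c. spec_fun (mpoly_ring n) (mconst c))\<rparr>"

definition irreducible_closed :: "'p topology \<Rightarrow> 'p set \<Rightarrow> bool" where
  "irreducible_closed T Z \<longleftrightarrow> closedin T Z \<and> Z \<noteq> {} \<and>
     (\<forall>A B. closedin T A \<and> closedin T B \<and> Z = A \<union> B \<longrightarrow> Z = A \<or> Z = B)"

definition irreducible_chain :: "'p topology \<Rightarrow> nat \<Rightarrow> (nat \<Rightarrow> 'p set) \<Rightarrow> bool" where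
  "irreducible_chain T d Z \<longleftrightarrow>
     (\<forall>i\<le>d. irreducible_closed T (Z i)) \<and> (\<forall>i<d. Z i \<subset> Z (Suc i))"

definition has_krull_dim :: "'p topology \<Rightarrow> nat \<Rightarrow> bool" where
  "has_krull_dim T n \<longleftrightarrow>
     (\<exists>Z. irreducible_chain T n Z) \<and> (\<nexists>Z. irreducible_chain T (Suc n) Z)"

text \<open>Etale means flat, unramified and locally of finite presentation. The latter is expressed as
  locally of finite type, which is the same when \<open>T\<close> is locally noetherian.\<close>

definition etale_to_noetherian ::
    "('p, 'r, 'z) ringed_space_scheme \<Rightarrow> ('q, 's, 'y) ringed_space_scheme \<Rightarrow>
     ('p, 'r, 'q, 's) rs_map \<Rightarrow> bool" where
  "etale_to_noetherian S T \<phi> \<longleftrightarrow> (\<forall>x\<in>pts S.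
     (let A = stalk T (pmap \<phi> x); B = stalk S x; h = stalk_map S \<phi> x in
        flat_hom A B h \<and>
        genideal B (h ` max_ideal A) = max_ideal B \<and>
        finite_ext (residue_field T (pmap \<phi> x)) (residue_field S x) (residue_map S \<phi> x) \<and>
        separable_ext (residue_field T (pmap \<phi> x)) (residue_field S x) (residue_map S \<phi> x)) \<and>
     (\<exists>V W. affine_open T V \<and> affine_open S W \<and> x \<in> W \<and> W \<subseteq> preim S \<phi> V \<and>
        finite_type_hom (sect T V) (sect S W) (\<lambda>s. rst S (preim S \<phi> V) W (pull \<phi> V s))))"

section \<open>Sheaves of modules\<close>

record ('p, 'r, 'm) mod_sheaf =
  msec :: "'p set \<Rightarrow> ('r, 'm) module"
  mrst :: "'p set \<Rightarrow> 'p set \<Rightarrow> 'm \<Rightarrow> 'm"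

definition module_sheaf ::
    "('p, 'r, 'z) ringed_space_scheme \<Rightarrow> ('p, 'r, 'm) mod_sheaf \<Rightarrow> bool" where
  "module_sheaf S M \<longleftrightarrow> sheaf_on (topo S) (\<lambda>U. carrier (msec M U)) (mrst M) \<and>
     (\<forall>U. openin (topo S) U \<longrightarrow> Module.module (sect S U) (msec M U)) \<and>
     (\<forall>U W. openin (topo S) U \<and> openin (topo S) W \<and> W \<subseteq> U \<longrightarrow>
        (\<forall>v\<in>carrier (msec M U). \<forall>w\<in>carrier (msec M U).
           mrst M U W (v \<oplus>\<^bsub>msec M U\<^esub> w) = mrst M U W v \<oplus>\<^bsub>msec M W\<^esub> mrst M U W w) \<and>
        (\<forall>a\<in>carrier (sect S U). \<forall>v\<in>carrier (msec M U).
           mrst M U W (a \<odot>\<^bsub>msec M U\<^esub> v) = rst S U W a \<odot>\<^bsub>msec M W\<^esub> mrst M U W v))"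

definition sheaf_iso :: "('p, 'r, 'z) ringed_space_scheme \<Rightarrow> ('p, 'r, 'm) mod_sheaf \<Rightarrow>
    ('p, 'r, 'n) mod_sheaf \<Rightarrow> ('p set \<Rightarrow> 'm \<Rightarrow> 'n) \<Rightarrow> bool" where
  "sheaf_iso S M N \<rho> \<longleftrightarrow>
     (\<forall>U. openin (topo S) U \<longrightarrow>
        bij_betw (\<rho> U) (carrier (msec M U)) (carrier (msec N U)) \<and>
        (\<forall>v\<in>carrier (msec M U). \<forall>w\<in>carrier (msec M U).
           \<rho> U (v \<oplus>\<^bsub>msec M U\<^esub> w) = \<rho> U v \<oplus>\<^bsub>msec N U\<^esub> \<rho> U w) \<and>
        (\<forall>a\<in>carrier (sect S U). \<forall>v\<in>carrier (msec M U).
           \<rho> U (a \<odot>\<^bsub>msec M U\<^esub> v) = a \<odot>\<^bsub>msec N U\<^esub> \<rho> U v)) \<and>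
     (\<forall>U W. openin (topo S) U \<and> openin (topo S) W \<and> W \<subseteq> U \<longrightarrow>
        (\<forall>v\<in>carrier (msec M U). \<rho> W (mrst M U W v) = mrst N U W (\<rho> U v)))"

text \<open>A trivialization of a rank \<open>n\<close> bundle over \<open>U\<close> is given by the frame \<open>e\<close> that it sends to the
  standard basis.\<close>

definition local_frame :: "('p, 'r, 'z) ringed_space_scheme \<Rightarrow> ('p, 'r, 'm) mod_sheaf \<Rightarrow> nat \<Rightarrow>
    'p set \<Rightarrow> (nat \<Rightarrow> 'm) \<Rightarrow> bool" where
  "local_frame S M n U e \<longleftrightarrow> openin (topo S) U \<and> e \<in> {..<n} \<rightarrow> carrier (msec M U) \<and>
     (\<forall>W. openin (topo S) W \<and> W \<subseteq> U \<longrightarrow>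
        is_basis (sect S W) (msec M W) n (\<lambda>i. mrst M U W (e i)))"

definition vector_bundle ::
    "('p, 'r, 'z) ringed_space_scheme \<Rightarrow> nat \<Rightarrow> ('p, 'r, 'm) mod_sheaf \<Rightarrow> bool" where
  "vector_bundle S n M \<longleftrightarrow> module_sheaf S M \<and>
     (\<forall>x\<in>pts S. \<exists>U e. x \<in> U \<and> local_frame S M n U e)"

subsection \<open>Sheafification\<close>

definition mgerm :: "('p, 'r, 'z) ringed_space_scheme \<Rightarrow> ('p, 'r, 'm) mod_sheaf \<Rightarrow> 'p \<Rightarrow> 'p set \<Rightarrow>
    'm \<Rightarrow> ('p set \<times> 'm) set" where
  "mgerm S P = germ (topo S) (\<lambda>U. carrier (msec P U)) (mrst P)"

definition sheafify :: "('p, 'r, 'z) ringed_space_scheme \<Rightarrow> ('p, 'r, 'm) mod_sheaf \<Rightarrow>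
    ('p, 'r, 'p \<Rightarrow> ('p set \<times> 'm) set) mod_sheaf" where
  "sheafify S P =
    \<lparr>msec = (\<lambda>U.
       \<lparr>carrier = {s \<in> extensional U. \<forall>x\<in>U. \<exists>W t. openin (topo S) W \<and> x \<in> W \<and> W \<subseteq> U \<and>
          t \<in> carrier (msec P W) \<and> (\<forall>y\<in>W. s y = mgerm S P y W t)},
        monoid.mult = (\<lambda>_ _. undefined), one = undefined,
        ring.zero = (\<lambda>x\<in>U. mgerm S P x U \<zero>\<^bsub>msec P U\<^esub>),
        ring.add = (\<lambda>s t. \<lambda>x\<in>U. germ_op (topo S) (\<lambda>W. carrier (msec P W)) (mrst P) x
                              (\<lambda>W. ring.add (msec P W)) (s x) (t x)),
        module.smult = (\<lambda>a s. \<lambda>x\<in>U. \<Union>{mgerm S P x W (rst S U W a \<odot>\<^bsub>msec P W\<^esub> t) | W t.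
                               (W, t) \<in> s x \<and> W \<subseteq> U})\<rparr>),
     mrst = (\<lambda>U W s. restrict s W)\<rparr>"

definition to_sheafify :: "('p, 'r, 'z) ringed_space_scheme \<Rightarrow> ('p, 'r, 'm) mod_sheaf \<Rightarrow> 'p set \<Rightarrow>
    'm \<Rightarrow> 'p \<Rightarrow> ('p set \<times> 'm) set" where
  "to_sheafify S P U t = (\<lambda>x\<in>U. mgerm S P x U t)"

subsection \<open>Tensor products, exterior powers, differentials\<close>

definition tensor_presheaf :: "('p, 'r, 'z) ringed_space_scheme \<Rightarrow> ('p, 'r, 'm) mod_sheaf \<Rightarrow>
    ('p, 'r, 'n) mod_sheaf \<Rightarrow> ('p, 'r, ('m \<times> 'n \<Rightarrow> 'r) set) mod_sheaf" where
  "tensor_presheaf S M N =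
    \<lparr>msec = (\<lambda>U. pres_module (sect S U) (tensor_gens (msec M U) (msec N U))
                    (tensor_rels (sect S U) (msec M U) (msec N U))),
     mrst = (\<lambda>U W. pres_map (sect S W) (tensor_gens (msec M W) (msec N W))
                    (tensor_rels (sect S W) (msec M W) (msec N W))
                    (rst S U W) (map_prod (mrst M U W) (mrst N U W)))\<rparr>"

definition tensor_sheaf :: "('p, 'r, 'z) ringed_space_scheme \<Rightarrow> ('p, 'r, 'm) mod_sheaf \<Rightarrow>
    ('p, 'r, 'n) mod_sheaf \<Rightarrow> ('p, 'r, 'p \<Rightarrow> ('p set \<times> ('m \<times> 'n \<Rightarrow> 'r) set) set) mod_sheaf" where
  "tensor_sheaf S M N = sheafify S (tensor_presheaf S M N)"

definition tens :: "('p, 'r, 'z) ringed_space_scheme \<Rightarrow> ('p, 'r, 'm) mod_sheaf \<Rightarrow>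
    ('p, 'r, 'n) mod_sheaf \<Rightarrow> 'p set \<Rightarrow> 'm \<Rightarrow> 'n \<Rightarrow> 'p \<Rightarrow> ('p set \<times> ('m \<times> 'n \<Rightarrow> 'r) set) set" where
  "tens S M N U v w = to_sheafify S (tensor_presheaf S M N) U
     (pres_class (sect S U) (tensor_gens (msec M U) (msec N U))
        (tensor_rels (sect S U) (msec M U) (msec N U)) (gen (sect S U) (v, w)))"

definition ext_presheaf :: "('p, 'r, 'z) ringed_space_scheme \<Rightarrow> nat \<Rightarrow> ('p, 'r, 'm) mod_sheaf \<Rightarrow>
    ('p, 'r, ((nat \<Rightarrow> 'm) \<Rightarrow> 'r) set) mod_sheaf" where
  "ext_presheaf S n M =
    \<lparr>msec = (\<lambda>U. pres_module (sect S U) (ext_gens n (msec M U)) (ext_rels (sect S U) n (msec M U))),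
     mrst = (\<lambda>U W. pres_map (sect S W) (ext_gens n (msec M W)) (ext_rels (sect S W) n (msec M W))
                    (rst S U W) (\<lambda>v. \<lambda>i\<in>{..<n}. mrst M U W (v i)))\<rparr>"

definition ext_sheaf :: "('p, 'r, 'z) ringed_space_scheme \<Rightarrow> nat \<Rightarrow> ('p, 'r, 'm) mod_sheaf \<Rightarrow>
    ('p, 'r, 'p \<Rightarrow> ('p set \<times> ((nat \<Rightarrow> 'm) \<Rightarrow> 'r) set) set) mod_sheaf" where
  "ext_sheaf S n M = sheafify S (ext_presheaf S n M)"

definition wedge :: "('p, 'r, 'z) ringed_space_scheme \<Rightarrow> nat \<Rightarrow> ('p, 'r, 'm) mod_sheaf \<Rightarrow> 'p set \<Rightarrow>
    (nat \<Rightarrow> 'm) \<Rightarrow> 'p \<Rightarrow> ('p set \<times> ((nat \<Rightarrow> 'm) \<Rightarrow> 'r) set) set" where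
  "wedge S n M U v = to_sheafify S (ext_presheaf S n M) U
     (pres_class (sect S U) (ext_gens n (msec M U)) (ext_rels (sect S U) n (msec M U))
        (gen (sect S U) (restrict v {..<n})))"

abbreviation local_scal :: "('k, 'p, 'r) k_space \<Rightarrow> 'p set \<Rightarrow> 'k \<Rightarrow> 'r" where
  "local_scal S U c \<equiv> rst S (pts S) U (scal S c)"

definition kaehler_presheaf :: "('k, 'p, 'r) k_space \<Rightarrow> ('p, 'r, ('r \<Rightarrow> 'r) set) mod_sheaf" where
  "kaehler_presheaf S =
    \<lparr>msec = (\<lambda>U. pres_module (sect S U) (carrier (sect S U))
                    (kaehler_rels (local_scal S U) (sect S U))),
     mrst = (\<lambda>U W. pres_map (sect S W) (carrier (sect S W))
                    (kaehler_rels (local_scal S W) (sect S W)) (rst S U W) (rst S U W))\<rparr>"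

definition cotangent_sheaf ::
    "('k, 'p, 'r) k_space \<Rightarrow> ('p, 'r, 'p \<Rightarrow> ('p set \<times> ('r \<Rightarrow> 'r) set) set) mod_sheaf" where
  "cotangent_sheaf S = sheafify S (kaehler_presheaf S)"

definition differential ::
    "('k, 'p, 'r) k_space \<Rightarrow> 'p set \<Rightarrow> 'r \<Rightarrow> 'p \<Rightarrow> ('p set \<times> ('r \<Rightarrow> 'r) set) set" where
  "differential S U s = to_sheafify S (kaehler_presheaf S) U
     (pres_class (sect S U) (carrier (sect S U)) (kaehler_rels (local_scal S U) (sect S U))
        (gen (sect S U) s))"

definition canonical_sheaf where
  "canonical_sheaf S n = ext_sheaf S n (cotangent_sheaf S)"

definition relative_orientation where
  "relative_orientation S n V L \<rho> \<longleftrightarrow> vector_bundle S 1 L \<and>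
     sheaf_iso S (tensor_sheaf S (ext_sheaf S n V) (canonical_sheaf S n)) (tensor_sheaf S L L) \<rho>"

section \<open>Zeros of sections\<close>

text \<open>The stalk at \<open>x\<close> of the ideal sheaf generated by the components of \<open>\<sigma>\<close> in local
  trivializations.\<close>

definition zero_ideal :: "('p, 'r, 'z) ringed_space_scheme \<Rightarrow> nat \<Rightarrow> ('p, 'r, 'm) mod_sheaf \<Rightarrow> 'm \<Rightarrow>
    'p \<Rightarrow> ('p set \<times> 'r) set set" where
  "zero_ideal S n V \<sigma> x = genideal (stalk S x)
     {fgerm S x U (coords (sect S U) (msec V U) n e (mrst V (pts S) U \<sigma>) i) | U e i.
        x \<in> U \<and> local_frame S V n U e \<and> i < n}"

definition zero_locus :: "('p, 'r, 'z) ringed_space_scheme \<Rightarrow> nat \<Rightarrow> ('p, 'r, 'm) mod_sheaf \<Rightarrow> 'm \<Rightarrow>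
    'p set" where
  "zero_locus S n V \<sigma> = {x \<in> pts S. zero_ideal S n V \<sigma> x \<noteq> carrier (stalk S x)}"

text \<open>The closed subscheme with stalks \<open>stalk S x Quot zero_ideal S n V \<sigma> x\<close>: its functions are the
  families of elements of these stalks that are locally induced by functions on \<open>S\<close>.\<close>

definition zero_scheme :: "('p, 'r, 'z) ringed_space_scheme \<Rightarrow> nat \<Rightarrow> ('p, 'r, 'm) mod_sheaf \<Rightarrow> 'm \<Rightarrow>
    ('p, 'p \<Rightarrow> ('p set \<times> 'r) set set) ringed_space" where
  "zero_scheme S n V \<sigma> = (let Z = zero_locus S n V \<sigma>; Q = (\<lambda>x. stalk S x Quot zero_ideal S n V \<sigma> x) in
    \<lparr>topo = subtopology (topo S) Z,
     sect = (\<lambda>U.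
       \<lparr>carrier = {s \<in> (\<Pi>\<^sub>E x\<in>U. carrier (Q x)). \<forall>x\<in>U. \<exists>W t.
          openin (topo S) W \<and> x \<in> W \<and> W \<inter> Z \<subseteq> U \<and> t \<in> carrier (sect S W) \<and>
          (\<forall>y\<in>W \<inter> Z. s y = zero_ideal S n V \<sigma> y +>\<^bsub>stalk S y\<^esub> fgerm S y W t)},
        monoid.mult = (\<lambda>s t. \<lambda>x\<in>U. s x \<otimes>\<^bsub>Q x\<^esub> t x),
        one = (\<lambda>x\<in>U. \<one>\<^bsub>Q x\<^esub>),
        ring.zero = (\<lambda>x\<in>U. \<zero>\<^bsub>Q x\<^esub>),
        ring.add = (\<lambda>s t. \<lambda>x\<in>U. s x \<oplus>\<^bsub>Q x\<^esub> t x)\<rparr>),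
     rst = (\<lambda>U W s. restrict s W)\<rparr>)"

definition simple_zero :: "('p, 'r, 'z) ringed_space_scheme \<Rightarrow> nat \<Rightarrow> ('p, 'r, 'm) mod_sheaf \<Rightarrow> 'm \<Rightarrow>
    'p \<Rightarrow> bool" where
  "simple_zero S n V \<sigma> p \<longleftrightarrow> p \<in> zero_locus S n V \<sigma> \<and>
     (\<exists>W. openin (topo (zero_scheme S n V \<sigma>)) W \<and> p \<in> W \<and>
        rs_isomorphic (open_sub (zero_scheme S n V \<sigma>) W) (Spec (residue_field S p)))"

section \<open>Local index and intersection volume\<close>

definition nisnevich_coordinates where
  "nisnevich_coordinates S n p U \<phi> \<longleftrightarrow>
     openin (topo S) U \<and> p \<in> U \<and> closedin (topo S) {p} \<and>
     k_morphism (k_open_sub S U) (affine_space n) \<phi> \<and>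
     etale_to_noetherian (k_open_sub S U) (affine_space n) \<phi> \<and>
     residue_map (k_open_sub S U) \<phi> p \<in>
       ring_iso (residue_field (affine_space n) (pmap \<phi> p)) (residue_field (k_open_sub S U) p)"

definition pull_poly where
  "pull_poly n \<phi> g = pull \<phi> (pts (affine_space n)) (spec_fun (mpoly_ring n) g)"

text \<open>The trivialization given by the frame \<open>e\<close>, whose distinguished element of the determinant is
  \<open>e\<^sub>0 \<and> \<dots> \<and> e\<^sub>n\<^sub>-\<^sub>1\<close>, is compatible with the coordinates \<open>\<phi>\<close> and the orientation \<open>(L, \<rho>)\<close>.\<close>

definition compatible_frame where
  "compatible_frame S n V L \<rho> U \<phi> e \<longleftrightarrow> local_frame S V n U e \<and>
     (\<exists>l\<in>carrier (msec L U).
        \<rho> U (tens S (ext_sheaf S n V) (canonical_sheaf S n) U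
               (wedge S n V U e)
               (wedge S n (cotangent_sheaf S) U (\<lambda>i. differential S U (pull_poly n \<phi> (mvar i)))))
        = tens S L L U l l)"

text \<open>The polynomials \<open>f\<close> represent the components of \<open>\<sigma>\<close> in the frame \<open>e\<close>. ``A sufficiently high power'' of the maximal ideal \<open>m\<close> means \<open>m\<^sup>2\<^sup>N\<close> for some \<open>N\<close> such that \<open>m\<^sup>N\<close>
  vanishes on the zero scheme; beyond that bound the Scheja--Storch form no longer changes.\<close>

definition expresses_section where
  "expresses_section S n V \<sigma> p U \<phi> e f \<longleftrightarrow> (\<forall>i<n. f i \<in> carrier (mpoly_ring n)) \<and>
     (\<exists>N. ideal_pow (stalk S p) (max_ideal (stalk S p)) N \<subseteq> zero_ideal S n V \<sigma> p \<and>
        (\<forall>i<n. fgerm S p U (coords (sect S U) (msec V U) n e (mrst V (pts S) U \<sigma>) i)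
                 \<ominus>\<^bsub>stalk S p\<^esub> fgerm S p U (pull_poly n \<phi> (f i))
               \<in> ideal_pow (stalk S p) (max_ideal (stalk S p)) (2 * N)))"

text \<open>The data through which the local index and the intersection volume are computed.\<close>

definition index_data where
  "index_data S n V L \<rho> \<sigma> p U \<phi> e f \<longleftrightarrow>
     nisnevich_coordinates S n p U \<phi> \<and>
     compatible_frame S n V L \<rho> U \<phi> e \<and>
     expresses_section S n V \<sigma> p U \<phi> e f"

definition local_index where
  "local_index n p \<phi> f = local_A1_degree n (pmap \<phi> p) f"

text \<open>The Jacobian determinant at \<open>\<phi>(p)\<close>, as an element of the residue field of \<open>p\<close>.\<close>

definition intersection_volume where
  "intersection_volume S n p U \<phi> f = value_at S p U (pull_poly n \<phi> (jacobian n f))"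

end

theory Submission imports Defs begin

text \<open>At a simple zero the zero ideal of \<open>\<sigma>\<close> is the maximal ideal of the stalk. Since the coordinates \<open>\<phi>\<close> are
  flat and unramified with trivial residue extension, this descends to \<open>q = \<phi>(p)\<close>: by Nakayama's lemma the
  polynomials \<open>f\<close> generate \<open>q\<close> in the local ring, so that the algebra of the Scheja--Storch form is the residue
  field \<open>E\<close>. Separability makes the Jacobian \<open>J\<close> invertible in \<open>E\<close> and the trace form nondegenerate. If
  \<open>D \<in> E \<otimes> E\<close> is the image of \<open>det \<Delta>\<close>, then \<open>D\<close> is annihilated by all \<open>x \<otimes> 1 - 1 \<otimes> x\<close>, and \<open>\<Delta>\<close> becomes the
  Jacobian matrix on the diagonal; contracting \<open>D\<close> with \<open>\<eta>\<close> and with the trace in both orders gives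
  \<open>\<eta>(J x) = Tr x\<close>. Hence the Scheja--Storch form is \<open>(x, y) \<mapsto> Tr (x y / J)\<close>, which is isometric to
  \<open>(x, y) \<mapsto> Tr (J x y)\<close> by multiplication with \<open>J\<close>.\<close>

section \<open>Polynomials\<close>

text \<open>\<open>local_A1_degree\<close> and \<open>alg_trace\<close> are definite descriptions
  over all choices of \<open>\<Delta>\<close> and \<eta>, respectively of a basis, and
  \<open>gw_trace\<close> is a union over all representatives. Each of them therefore needs
  existence together with independence of the choice. No tensor product over k is formed: a
  polynomial in X and Y stands for a tensor, and functionals are applied to one set of variables at
  a time, modulo q.

  The obstacle is the descent of \<open>f\<close> through the coordinates. Flatness is given as
  injectivity of I \<otimes> B \<rightarrow> B for ideals I. For the maximal ideal it yields an
  additive map on the maximal ideal upstairs that sends the pullback of x to x modulo an ideal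
  containing all products. This suffices, because Nakayama's lemma asks for generation modulo
  squares only. The exponent 2N serves the same end: N is positive at a simple zero, so
  \<open>f\<close> and the section agree modulo the square of the maximal ideal.

  Finiteness of E over k and finite generation of q both come from the algebraicity of the variables
  modulo q, through an explicit finite set of monomials.\<close>

abbreviation mpolys :: "nat \<Rightarrow> 'k::field mpoly set" where
  "mpolys n \<equiv> carrier (mpoly_ring n)"

lemma mpolys_iff: "f \<in> mpolys n \<longleftrightarrow> (\<forall>m\<in>Poly_Mapping.keys f. Poly_Mapping.keys m \<subseteq> {..<n})"
  by (simp add: mpoly_ring_def)

lemma mpoly_ring_simps [simp]:
  "monoid.mult (mpoly_ring n) = (*)" "ring.add (mpoly_ring n) = (+)"
  "one (mpoly_ring n) = 1" "ring.zero (mpoly_ring n) = 0"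
  by (simp_all add: mpoly_ring_def)

lemma keys_add_nat: "Poly_Mapping.keys (m + m' :: nat \<Rightarrow>\<^sub>0 nat) = Poly_Mapping.keys m \<union> Poly_Mapping.keys m'"
  by (auto simp: in_keys_iff lookup_add)

lemma single_in_mpolys: "Poly_Mapping.keys m \<subseteq> {..<n} \<Longrightarrow> Poly_Mapping.single m c \<in> mpolys n"
  by (auto simp: mpolys_iff)

lemma mpolys_zero [simp]: "0 \<in> mpolys n" by (simp add: mpolys_iff)
lemma mpolys_one [simp]: "1 \<in> mpolys n" by (simp add: mpolys_iff)
lemma mpolys_mconst [simp]: "mconst c \<in> mpolys n" by (auto simp: mpolys_iff mconst_def)
lemma mpolys_mvar [simp]: "i < n \<Longrightarrow> mvar i \<in> mpolys n" by (auto simp: mpolys_iff mvar_def)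

lemma mpolys_add [simp]: "f \<in> mpolys n \<Longrightarrow> g \<in> mpolys n \<Longrightarrow> f + g \<in> mpolys n"
  using keys_add[of f g] by (auto simp: mpolys_iff)

lemma mpolys_mult [simp]: "f \<in> mpolys n \<Longrightarrow> g \<in> mpolys n \<Longrightarrow> f * g \<in> mpolys n"
  using keys_mult[of f g] by (fastforce simp: mpolys_iff keys_add_nat)

lemma mpolys_uminus [simp]: "f \<in> mpolys n \<Longrightarrow> - f \<in> mpolys n"
  by (simp add: mpolys_iff in_keys_iff)

lemma mpolys_diff [simp]: "f \<in> mpolys n \<Longrightarrow> g \<in> mpolys n \<Longrightarrow> f - g \<in> mpolys n"
  using mpolys_add[of f n "- g"] by simp

lemma mpolys_sum [simp]: "(\<And>i. i \<in> I \<Longrightarrow> f i \<in> mpolys n) \<Longrightarrow> (\<Sum>i\<in>I. f i) \<in> mpolys n"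
  by (induction I rule: infinite_finite_induct) auto

lemma mpolys_prod [simp]: "(\<And>i. i \<in> I \<Longrightarrow> f i \<in> mpolys n) \<Longrightarrow> (\<Prod>i\<in>I. f i) \<in> mpolys n"
  by (induction I rule: infinite_finite_induct) auto

lemma mpolys_power [simp]: "f \<in> mpolys n \<Longrightarrow> f ^ j \<in> mpolys n"
  by (induction j) auto

lemma mpolys_mono: "n \<le> n' \<Longrightarrow> f \<in> mpolys n \<Longrightarrow> f \<in> mpolys n'"
  by (fastforce simp: mpolys_iff)

lemma mpolys_det:
  assumes "\<And>i j. i < d \<Longrightarrow> j < d \<Longrightarrow> M i j \<in> mpolys n"
  shows "Determinant.det (mat d d (\<lambda>(i, j). M i j)) \<in> mpolys n"
proof -
  have "signof p * x \<in> mpolys n" if "x \<in> mpolys n" for p and x :: "'a mpoly"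
    using that by (simp add: sign_def)
  moreover have "(\<Prod>i = 0..<d. mat d d (\<lambda>(i, j). M i j) $$ (i, p i)) \<in> mpolys n"
    if "p permutes {0..<d}" for p
    using that permutes_in_image[OF that] by (intro mpolys_prod) (auto intro!: assms)
  ultimately show ?thesis by (auto simp: Determinant.det_def intro!: mpolys_sum)
qed

lemma poly_mapping_sum_monomials:
  "f = (\<Sum>m\<in>Poly_Mapping.keys f. Poly_Mapping.single m (Poly_Mapping.lookup f m))"
  by (rule poly_mapping_eqI) (auto simp: lookup_sum lookup_single when_def in_keys_iff sum.delta)

lemma mpolys_induct_monomial [consumes 1, case_names single add]:
  assumes f: "f \<in> mpolys n"
    and single: "\<And>m c. Poly_Mapping.keys m \<subseteq> {..<n} \<Longrightarrow> P (Poly_Mapping.single m c)"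
    and add: "\<And>f g. f \<in> mpolys n \<Longrightarrow> g \<in> mpolys n \<Longrightarrow> P f \<Longrightarrow> P g \<Longrightarrow> P (f + g)"
  shows "P f"
proof -
  let ?s = "\<lambda>m. Poly_Mapping.single m (Poly_Mapping.lookup f m)"
  have "P (sum ?s M) \<and> sum ?s M \<in> mpolys n"
    if "finite M" "\<forall>m\<in>M. Poly_Mapping.keys m \<subseteq> {..<n}" for M
    using that
  proof (induction M rule: finite_induct)
    case empty
    then show ?case using single[of 0 0] by simp
  next
    case (insert m M)
    then show ?case by (simp add: add single single_in_mpolys)
  qed
  from this[of "Poly_Mapping.keys f"] show ?thesis
    using f poly_mapping_sum_monomials[of f] by (simp add: mpolys_iff)
qed

lemma poly_mapping_induct_monomial [case_names single add]:
  fixes f :: "'a \<Rightarrow>\<^sub>0 'b::comm_monoid_add"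
  assumes single: "\<And>m c. P (Poly_Mapping.single m c)"
    and add: "\<And>f g. P f \<Longrightarrow> P g \<Longrightarrow> P (f + g)"
  shows "P f"
proof -
  have "P (\<Sum>m\<in>M. Poly_Mapping.single m (Poly_Mapping.lookup f m))" if "finite M" for M
    using that
  proof (induction M rule: finite_induct)
    case empty
    \<comment> \<open>The empty sum is the monomial with coefficient 0 at an arbitrary
      exponent.\<close>
    then show ?case using single[of undefined 0] by simp
  qed (simp add: add single)
  from this[of "Poly_Mapping.keys f"] show ?thesis
    using poly_mapping_sum_monomials[of f] by simp
qed

text \<open>A monomial is a product of powers of variables, so induction over monomials reduces to
  constants, variables, sums and products. This form suits claims that are stable under products,
  such as those on the action of a polynomial on a tensor.\<close>

lemma mpolys_induct [consumes 1, case_names mconst mvar add mult]: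
  assumes f: "f \<in> mpolys n"
    and const: "\<And>c. P (mconst c)" and var: "\<And>i. i < n \<Longrightarrow> P (mvar i)"
    and add: "\<And>f g. f \<in> mpolys n \<Longrightarrow> g \<in> mpolys n \<Longrightarrow> P f \<Longrightarrow> P g \<Longrightarrow> P (f + g)"
    and mult: "\<And>f g. f \<in> mpolys n \<Longrightarrow> g \<in> mpolys n \<Longrightarrow> P f \<Longrightarrow> P g \<Longrightarrow> P (f * g)"
  shows "P f"
  using f
proof (induction f rule: mpolys_induct_monomial)
  case (single m c)
  have one: "P 1" using const[of 1] by (simp add: mconst_def)
  have power: "P (Poly_Mapping.single (Poly_Mapping.single i k) 1)" if "i < n" for i k
  proof (induction k)
    case (Suc k)
    have "Poly_Mapping.single (Poly_Mapping.single i (Suc k)) (1::'a)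
        = mvar i * Poly_Mapping.single (Poly_Mapping.single i k) 1"
      by (simp add: mvar_def mult_single single_add[symmetric])
    with Suc var mult that show ?case by (simp add: single_in_mpolys)
  qed (simp add: one)
  have "P (Poly_Mapping.single (\<Sum>i\<in>A. Poly_Mapping.single i (k i)) 1) \<and>
      Poly_Mapping.single (\<Sum>i\<in>A. Poly_Mapping.single i (k i)) (1::'a) \<in> mpolys n"
    if "finite A" "A \<subseteq> {..<n}" for A and k :: "nat \<Rightarrow> nat"
    using that
  proof (induction A rule: finite_induct)
    case (insert i A)
    have "Poly_Mapping.single (\<Sum>i\<in>insert i A. Poly_Mapping.single i (k i)) (1::'a)
        = Poly_Mapping.single (Poly_Mapping.single i (k i)) 1
          * Poly_Mapping.single (\<Sum>i\<in>A. Poly_Mapping.single i (k i)) 1"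
      using insert by (simp add: mult_single)
    with insert power mult show ?case by (simp add: single_in_mpolys)
  qed (simp add: one)
  from this[of "Poly_Mapping.keys m" "Poly_Mapping.lookup m"] single
  have "P (Poly_Mapping.single m 1)"
    using poly_mapping_sum_monomials[of m] by simp
  moreover have "Poly_Mapping.single m c = mconst c * Poly_Mapping.single m 1"
    by (simp add: mconst_def mult_single)
  ultimately show ?case using const mult single by (simp add: single_in_mpolys)
qed (simp add: add)

lemma cring_mpoly_ring: "cring (mpoly_ring n :: 'k::field mpoly ring)"
proof (rule cringI)
  show "abelian_group (mpoly_ring n :: 'k mpoly ring)"
  proof (rule abelian_groupI)
    fix x :: "'k mpoly" assume "x \<in> mpolys n"
    then show "\<exists>y\<in>mpolys n. y \<oplus>\<^bsub>mpoly_ring n\<^esub> x = \<zero>\<^bsub>mpoly_ring n\<^esub>"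
      by (intro bexI[of _ "- x"]) auto
  qed (auto simp: algebra_simps)
  show "Group.comm_monoid (mpoly_ring n :: 'k mpoly ring)"
    by (rule comm_monoidI) (auto simp: algebra_simps)
qed (auto simp: algebra_simps)

subsection \<open>Substitutions of monomials\<close>

definition exponent_hom :: "((nat \<Rightarrow>\<^sub>0 nat) \<Rightarrow> (nat \<Rightarrow>\<^sub>0 nat)) \<Rightarrow> bool" where
  "exponent_hom \<xi> \<longleftrightarrow> \<xi> 0 = 0 \<and> (\<forall>m m'. \<xi> (m + m') = \<xi> m + \<xi> m')"

text \<open>For a monoid homomorphism \<xi> of exponents this is the algebra endomorphism that
  replaces x^m by x^(\<xi> m). The passage from X to Y and the restriction to the diagonal are both
  of this kind, which gives their multiplicativity at once.\<close>

definition monomial_subst :: "((nat \<Rightarrow>\<^sub>0 nat) \<Rightarrow> (nat \<Rightarrow>\<^sub>0 nat)) \<Rightarrow> 'k::field mpoly \<Rightarrow> 'k mpoly" where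
  "monomial_subst \<xi> f = (\<Sum>m\<in>Poly_Mapping.keys f. Poly_Mapping.single (\<xi> m) (Poly_Mapping.lookup f m))"

lemma monomial_subst_single [simp]:
  "monomial_subst \<xi> (Poly_Mapping.single m c) = Poly_Mapping.single (\<xi> m) c"
  by (simp add: monomial_subst_def)

lemma monomial_subst_add [simp]: "monomial_subst \<xi> (f + g) = monomial_subst \<xi> f + monomial_subst \<xi> g"
  unfolding monomial_subst_def by (rule setsum_keys_plus_distrib) (auto simp: single_add)

lemma monomial_subst_mult:
  assumes "exponent_hom \<xi>"
  shows "monomial_subst \<xi> (f * g) = monomial_subst \<xi> f * monomial_subst \<xi> g"
proof (induction f rule: poly_mapping_induct_monomial)
  case (single m c)
  show ?case
  proof (induction g rule: poly_mapping_induct_monomial)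
    case (single m' c')
    then show ?case using assms by (simp add: mult_single exponent_hom_def)
  qed (simp add: algebra_simps)
qed (simp add: algebra_simps)

lemma comm_ring_hom_monomial_subst:
  "exponent_hom \<xi> \<Longrightarrow> comm_ring_hom (monomial_subst \<xi> :: 'k::field mpoly \<Rightarrow> 'k mpoly)"
  by unfold_locales
    (simp_all add: monomial_subst_mult exponent_hom_def flip: single_one, simp add: monomial_subst_def)

definition shift_exp :: "nat \<Rightarrow> (nat \<Rightarrow>\<^sub>0 nat) \<Rightarrow> (nat \<Rightarrow>\<^sub>0 nat)" where
  "shift_exp n m = (\<Sum>i\<in>Poly_Mapping.keys m. Poly_Mapping.single (n + i) (Poly_Mapping.lookup m i))"

text \<open>Adding the X- and Y-exponents is the substitution Y = X, that is, the multiplication A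
  \<otimes> A \<rightarrow> A on representing polynomials.\<close>

definition diag_exp :: "nat \<Rightarrow> (nat \<Rightarrow>\<^sub>0 nat) \<Rightarrow> (nat \<Rightarrow>\<^sub>0 nat)" where
  "diag_exp n m = X_part n m + Y_part n m"

lemma lookup_X_part: "Poly_Mapping.lookup (X_part n m) i = (if i < n then Poly_Mapping.lookup m i else 0)"
  by (auto simp: X_part_def lookup_sum lookup_single when_def)

lemma lookup_Y_part: "Poly_Mapping.lookup (Y_part n m) i = (if i < n then Poly_Mapping.lookup m (n + i) else 0)"
  by (auto simp: Y_part_def lookup_sum lookup_single when_def)

lemma lookup_shift_exp:
  "Poly_Mapping.lookup (shift_exp n m) i = (if i < n then 0 else Poly_Mapping.lookup m (i - n))"
proof -
  have "Poly_Mapping.lookup (shift_exp n m) i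
      = (\<Sum>j\<in>Poly_Mapping.keys m. if j = i - n \<and> n \<le> i then Poly_Mapping.lookup m j else 0)"
    by (auto simp: shift_exp_def lookup_sum lookup_single when_def intro!: sum.cong)
  then show ?thesis by (auto simp: in_keys_iff sum.delta)
qed

lemma exponent_homs:
  "exponent_hom (X_part n)" "exponent_hom (Y_part n)" "exponent_hom (shift_exp n)" "exponent_hom (diag_exp n)"
  by (auto simp: exponent_hom_def diag_exp_def lookup_X_part lookup_Y_part lookup_shift_exp lookup_add
      intro!: poly_mapping_eqI)

lemma shift_vars_eq: "shift_vars n = monomial_subst (shift_exp n)"
  by (simp add: fun_eq_iff shift_vars_def monomial_subst_def shift_exp_def)

lemma X_part_ident: "Poly_Mapping.keys m \<subseteq> {..<n} \<Longrightarrow> X_part n m = m"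
  by (rule poly_mapping_eqI) (auto simp: lookup_X_part in_keys_iff subset_iff)

lemma Y_part_ident: "Poly_Mapping.keys m \<subseteq> {..<n} \<Longrightarrow> Y_part n m = 0"
  by (rule poly_mapping_eqI) (auto simp: lookup_Y_part in_keys_iff subset_iff)

lemma X_part_shift: "X_part n (shift_exp n m) = 0"
  by (rule poly_mapping_eqI) (auto simp: lookup_X_part lookup_shift_exp)

lemma Y_part_shift: "Poly_Mapping.keys m \<subseteq> {..<n} \<Longrightarrow> Y_part n (shift_exp n m) = m"
  by (rule poly_mapping_eqI) (auto simp: lookup_Y_part lookup_shift_exp in_keys_iff subset_iff)

lemma keys_X_part: "Poly_Mapping.keys (X_part n m) \<subseteq> {..<n}"
  by (auto simp: in_keys_iff lookup_X_part split: if_splits)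

lemma keys_Y_part: "Poly_Mapping.keys (Y_part n m) \<subseteq> {..<n}"
  by (auto simp: in_keys_iff lookup_Y_part split: if_splits)

lemma diag_ident: "f \<in> mpolys n \<Longrightarrow> monomial_subst (diag_exp n) f = f"
  by (induction f rule: mpolys_induct_monomial) (simp_all add: diag_exp_def X_part_ident Y_part_ident)

lemma diag_shift: "f \<in> mpolys n \<Longrightarrow> monomial_subst (diag_exp n) (shift_vars n f) = f"
  by (induction f rule: mpolys_induct_monomial)
    (simp_all add: shift_vars_eq diag_exp_def X_part_shift Y_part_shift)

lemma shift_vars_mpolys: "f \<in> mpolys n \<Longrightarrow> shift_vars n f \<in> mpolys (2 * n)"
proof (induction f rule: mpolys_induct_monomial)
  case (single m c)
  have "Poly_Mapping.keys (shift_exp n m) \<subseteq> {..<2 * n}"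
  proof
    fix i assume "i \<in> Poly_Mapping.keys (shift_exp n m)"
    then have "n \<le> i" "i - n \<in> Poly_Mapping.keys m"
      by (auto simp: in_keys_iff lookup_shift_exp split: if_splits)
    then show "i \<in> {..<2 * n}" using single by auto
  qed
  then show ?case by (simp add: shift_vars_eq single_in_mpolys)
qed (simp add: shift_vars_eq)

lemma diag_mpolys: "monomial_subst (diag_exp n) f \<in> mpolys n"
proof (induction f rule: poly_mapping_induct_monomial)
  case (single m c)
  have "Poly_Mapping.keys (diag_exp n m) \<subseteq> {..<n}"
    using keys_X_part[of n m] keys_Y_part[of n m] by (simp add: diag_exp_def keys_add_nat)
  then show ?case by (simp add: single_in_mpolys)
qed simp

lemma shift_vars_mult: "shift_vars n (f * g) = shift_vars n f * shift_vars n g"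
  by (simp add: shift_vars_eq monomial_subst_mult exponent_homs)

lemma shift_vars_mconst: "shift_vars n (mconst c) = mconst c"
  using exponent_homs(3)[of n] by (simp add: shift_vars_eq mconst_def exponent_hom_def)

lemma shift_exp_single: "shift_exp n (Poly_Mapping.single i 1) = Poly_Mapping.single (n + i) 1"
  by (simp add: shift_exp_def)

lemma shift_vars_mvar: "shift_vars n (mvar i) = mvar (n + i)"
  using shift_exp_single[of n i] by (simp add: shift_vars_eq mvar_def)

lemma diag_exp_vars:
  assumes "i < n"
  shows "monomial_subst (diag_exp n) (mvar i - mvar (n + i) :: 'k::field mpoly) = 0"
proof -
  let ?t = "monomial_subst (diag_exp n) :: 'k mpoly \<Rightarrow> 'k mpoly"
  have "?t (mvar i) = ?t (mvar i - mvar (n + i)) + ?t (mvar (n + i))"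
    by (simp flip: monomial_subst_add)
  moreover have "?t (mvar i) = mvar i" "?t (mvar (n + i)) = mvar i"
    using diag_ident[of "mvar i" n] diag_shift[of "mvar i" n] assms by (simp_all add: shift_vars_mvar)
  ultimately show ?thesis by simp
qed

subsection \<open>Partial derivatives\<close>

lemma partial_deriv_single:
  "partial_deriv j (Poly_Mapping.single m c)
    = Poly_Mapping.single (m - Poly_Mapping.single j 1) (of_nat (Poly_Mapping.lookup m j) * c)"
  by (simp add: partial_deriv_def)

lemma partial_deriv_add: "partial_deriv j (f + g) = partial_deriv j f + partial_deriv j g"
  unfolding partial_deriv_def
  by (rule setsum_keys_plus_distrib) (auto simp: single_add algebra_simps)

lemma partial_deriv_zero [simp]: "partial_deriv j 0 = 0"
  by (simp add: partial_deriv_def)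

lemma partial_deriv_uminus: "partial_deriv j (- f) = - partial_deriv j f"
  using partial_deriv_add[of j f "- f"] by (simp add: eq_neg_iff_add_eq_0 add.commute)

lemma partial_deriv_diff: "partial_deriv j (f - g) = partial_deriv j f - partial_deriv j g"
  using partial_deriv_add[of j f "- g"] by (simp add: partial_deriv_uminus)

lemma partial_deriv_sum: "partial_deriv j (\<Sum>i\<in>I. f i) = (\<Sum>i\<in>I. partial_deriv j (f i))"
  by (induction I rule: infinite_finite_induct) (simp_all add: partial_deriv_add)

lemma partial_deriv_mult: "partial_deriv j (f * g) = partial_deriv j f * g + f * partial_deriv j g"
proof (induction f rule: poly_mapping_induct_monomial)
  case (single m c)
  show ?case
  proof (induction g rule: poly_mapping_induct_monomial)
    case (single m' c')
    let ?e = "Poly_Mapping.single j (1::nat)"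
    \<comment> \<open>Subtraction of exponents is truncated, so the two exponents can differ, but
      only when m does not involve the variable j; the coefficient is then 0.\<close>
    have *: "Poly_Mapping.single (m + m' - ?e) (of_nat (Poly_Mapping.lookup m j) * a)
        = Poly_Mapping.single ((m - ?e) + m') (of_nat (Poly_Mapping.lookup m j) * a)"
      for m m' :: "nat \<Rightarrow>\<^sub>0 nat" and a :: 'a
    proof (cases "Poly_Mapping.lookup m j = 0")
      case False
      then have "m + m' - ?e = (m - ?e) + m'"
        by (intro poly_mapping_eqI) (auto simp: lookup_add lookup_minus lookup_single when_def)
      then show ?thesis by simp
    qed simp
    have "Poly_Mapping.single (m + m' - ?e) (of_nat (Poly_Mapping.lookup m j) * (c * c'))
        = Poly_Mapping.single ((m - ?e) + m') (of_nat (Poly_Mapping.lookup m j) * (c * c'))"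
      "Poly_Mapping.single (m + m' - ?e) (of_nat (Poly_Mapping.lookup m' j) * (c * c'))
        = Poly_Mapping.single (m + (m' - ?e)) (of_nat (Poly_Mapping.lookup m' j) * (c * c'))"
      using *[of m m'] *[of m' m] by (simp_all add: add.commute)
    then show ?case
      by (simp add: mult_single partial_deriv_single lookup_add distrib_left distrib_right single_add ac_simps)
  qed (simp add: partial_deriv_add algebra_simps)
qed (simp add: partial_deriv_add algebra_simps)

lemma partial_deriv_mconst [simp]: "partial_deriv j (mconst c) = 0"
  by (simp add: mconst_def partial_deriv_single)

lemma partial_deriv_one [simp]: "partial_deriv j 1 = 0"
  using partial_deriv_mconst[of j 1] by (simp add: mconst_def)

lemma partial_deriv_mvar: "partial_deriv j (mvar i) = (if i = j then 1 else 0)"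
  by (simp add: mvar_def partial_deriv_single lookup_single when_def)

lemma partial_deriv_power: "partial_deriv j (f ^ k) = of_nat k * f ^ (k - 1) * partial_deriv j f"
proof (induction k)
  case (Suc k)
  then show ?case by (cases k) (simp_all add: partial_deriv_mult algebra_simps)
qed simp

lemma partial_deriv_shift: "f \<in> mpolys n \<Longrightarrow> j < n \<Longrightarrow> partial_deriv j (shift_vars n f) = 0"
  by (induct f rule: mpolys_induct_monomial)
    (simp_all add: shift_vars_eq partial_deriv_single partial_deriv_add lookup_shift_exp)

lemma partial_deriv_mpolys: "f \<in> mpolys n \<Longrightarrow> partial_deriv j f \<in> mpolys n"
  by (induction f rule: mpolys_induct_monomial)
    (auto simp: partial_deriv_single partial_deriv_add in_keys_iff lookup_minus subset_iff
      intro!: single_in_mpolys)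

lemma jacobian_mpolys: "(\<And>i. i < n \<Longrightarrow> f i \<in> mpolys n) \<Longrightarrow> jacobian n f \<in> mpolys n"
  unfolding jacobian_def by (rule mpolys_det) (rule partial_deriv_mpolys)

subsection \<open>Difference matrices\<close>

text \<open>Constants and variables have such an expansion, and sums inherit it. For products, fg -
  f'g' = g(f - f') + f'(g - g'), where the prime denotes the shift from X to Y.\<close>

lemma difference_vector_exists:
  assumes "f \<in> mpolys n"
  shows "\<exists>\<delta>. (\<forall>i<n. \<delta> i \<in> mpolys (2 * n)) \<and>
    f - shift_vars n f = (\<Sum>i<n. \<delta> i * (mvar i - mvar (n + i)))"
  using assms
proof (induction f rule: mpolys_induct)
  case (mconst c)
  show ?case by (intro exI[of _ "\<lambda>_. 0"]) (simp add: shift_vars_mconst)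
next
  case (mvar i)
  show ?case
    using mvar
    by (intro exI[of _ "\<lambda>l. if l = i then 1 else 0"])
      (simp add: shift_vars_mvar if_distrib[of "\<lambda>x. x * _"] sum.delta' cong: if_cong)
next
  case (add f g)
  then obtain \<delta> \<epsilon> where "\<forall>i<n. \<delta> i \<in> mpolys (2 * n)" "\<forall>i<n. \<epsilon> i \<in> mpolys (2 * n)"
    "f - shift_vars n f = (\<Sum>i<n. \<delta> i * (mvar i - mvar (n + i)))"
    "g - shift_vars n g = (\<Sum>i<n. \<epsilon> i * (mvar i - mvar (n + i)))" by auto
  moreover have "f + g - shift_vars n (f + g) = (f - shift_vars n f) + (g - shift_vars n g)"
    by (simp add: shift_vars_eq)
  ultimately show ?case
    by (intro exI[of _ "\<lambda>i. \<delta> i + \<epsilon> i"]) (simp add: distrib_right sum.distrib)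
next
  case (mult f g)
  then obtain \<delta> \<epsilon> where de: "\<forall>i<n. \<delta> i \<in> mpolys (2 * n)" "\<forall>i<n. \<epsilon> i \<in> mpolys (2 * n)"
    "f - shift_vars n f = (\<Sum>i<n. \<delta> i * (mvar i - mvar (n + i)))"
    "g - shift_vars n g = (\<Sum>i<n. \<epsilon> i * (mvar i - mvar (n + i)))" by auto
  have "f * g - shift_vars n (f * g)
      = g * (f - shift_vars n f) + shift_vars n f * (g - shift_vars n g)"
    by (simp add: shift_vars_mult algebra_simps)
  also have "\<dots> = (\<Sum>i<n. (g * \<delta> i + shift_vars n f * \<epsilon> i) * (mvar i - mvar (n + i)))"
    unfolding de(3,4) by (simp add: sum_distrib_left sum.distrib[symmetric] distrib_right mult.assoc)
  finally have "f * g - shift_vars n (f * g)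
      = (\<Sum>i<n. (g * \<delta> i + shift_vars n f * \<epsilon> i) * (mvar i - mvar (n + i)))" .
  moreover have "g * \<delta> i + shift_vars n f * \<epsilon> i \<in> mpolys (2 * n)" if "i < n" for i
  proof -
    have "g \<in> mpolys (2 * n)" "shift_vars n f \<in> mpolys (2 * n)"
      using mult.hyps shift_vars_mpolys by (auto intro: mpolys_mono[of n])
    then show ?thesis using de(1,2) that by (intro mpolys_add mpolys_mult) auto
  qed
  ultimately show ?case by (intro exI[of _ "\<lambda>i. g * \<delta> i + shift_vars n f * \<epsilon> i"] conjI) auto
qed

lemma difference_matrix_exists:
  assumes "\<And>j. j < n \<Longrightarrow> f j \<in> mpolys n"
  shows "\<exists>\<Delta>. difference_matrix n f \<Delta>"
proof -
  have *: "\<forall>j. \<exists>\<delta>. j < n \<longrightarrow> (\<forall>i<n. \<delta> i \<in> mpolys (2 * n)) \<and>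
    f j - shift_vars n (f j) = (\<Sum>i<n. \<delta> i * (mvar i - mvar (n + i)))"
    using difference_vector_exists assms by blast
  obtain \<delta> where "\<forall>j. j < n \<longrightarrow> (\<forall>i<n. \<delta> j i \<in> mpolys (2 * n)) \<and>
    f j - shift_vars n (f j) = (\<Sum>i<n. \<delta> j i * (mvar i - mvar (n + i)))"
    using choice[OF *] by blast
  then show ?thesis
    by (intro exI[of _ "\<lambda>i j. \<delta> j i"]) (auto simp: difference_matrix_def)
qed

text \<open>Differentiating \<open>f\<^sub>j(X) - f\<^sub>j(Y) = \<Sum>\<^sub>i \<Delta>\<^sub>i\<^sub>j (X\<^sub>i - Y\<^sub>i)\<close> with respect to \<open>X\<^sub>l\<close> and putting \<open>Y = X\<close>
  leaves only \<open>\<Delta>\<^sub>l\<^sub>j\<close> on the right.\<close>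

lemma diag_difference_matrix:
  assumes f: "\<And>j. j < n \<Longrightarrow> f j \<in> mpolys n" and \<Delta>: "difference_matrix n f \<Delta>"
    and l: "l < n" and j: "j < n"
  shows "monomial_subst (diag_exp n) (\<Delta> l j) = partial_deriv l (f j)"
proof -
  interpret \<tau>: comm_ring_hom "monomial_subst (diag_exp n)"
    by (rule comm_ring_hom_monomial_subst[OF exponent_homs(4)])
  let ?t = "monomial_subst (diag_exp n)"
  have "partial_deriv l (f j) = ?t (partial_deriv l (f j - shift_vars n (f j)))"
    using l j f by (simp add: partial_deriv_diff partial_deriv_shift diag_ident partial_deriv_mpolys)
  also have "\<dots> = (\<Sum>i<n. ?t (partial_deriv l (\<Delta> i j)) * ?t (mvar i - mvar (n + i))
      + ?t (\<Delta> i j) * ?t (partial_deriv l (mvar i - mvar (n + i))))"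
    using \<Delta> j by (simp add: difference_matrix_def partial_deriv_sum partial_deriv_mult
        \<tau>.hom_sum \<tau>.hom_add \<tau>.hom_mult)
  also have "\<dots> = (\<Sum>i<n. ?t (\<Delta> i j) * (if i = l then 1 else 0))"
    using l by (intro sum.cong refl) (simp_all add: diag_exp_vars partial_deriv_diff partial_deriv_mvar)
  also have "\<dots> = ?t (\<Delta> l j)"
    using l by (simp add: if_distrib[of "\<lambda>x. _ * x"] sum.delta' cong: if_cong)
  finally show ?thesis by simp
qed

lemma diag_det_difference_matrix:
  assumes f: "\<And>j. j < n \<Longrightarrow> f j \<in> mpolys n" and \<Delta>: "difference_matrix n f \<Delta>"
  shows "monomial_subst (diag_exp n) (Determinant.det (mat n n (\<lambda>(i, j). \<Delta> i j))) = jacobian n f"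
proof -
  interpret \<tau>: comm_ring_hom "monomial_subst (diag_exp n)"
    by (rule comm_ring_hom_monomial_subst[OF exponent_homs(4)])
  \<comment> \<open>\<open>\<Delta>\<close> is indexed by variable and equation,
    \<open>jacobian\<close> by equation and variable, hence the transposition.\<close>
  have "map_mat (monomial_subst (diag_exp n)) (mat n n (\<lambda>(i, j). \<Delta> i j))
      = transpose_mat (mat n n (\<lambda>(i, j). partial_deriv j (f i)))"
    using diag_difference_matrix[OF f \<Delta>] by (intro eq_matI) auto
  then show ?thesis
    by (simp add: jacobian_def Determinant.det_transpose[of _ n] flip: \<tau>.hom_det)
qed

text \<open>Cramer's rule: the transpose of \<open>\<Delta>\<close> sends the vector of all X_i -
  Y_i to the vector of all f_j(X) - f_j(Y), and the adjugate recovers det \<open>\<Delta>\<close>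
  times X_i - Y_i. Modulo all f_j(X) and f_j(Y) the determinant is thus annihilated by X_i -
  Y_i.\<close>

lemma det_difference_matrix_annihilates:
  assumes \<Delta>: "difference_matrix n f \<Delta>" and i: "i < n"
  shows "\<exists>g. Determinant.det (mat n n (\<lambda>(i, j). \<Delta> i j)) * (mvar i - mvar (n + i))
    = (\<Sum>j<n. g j * (f j - shift_vars n (f j)))"
proof -
  define M where "M = mat n n (\<lambda>(i, j). \<Delta> i j)"
  define z where "z = vec n (\<lambda>i. mvar i - mvar (n + i) :: 'a mpoly)"
  have M: "M \<in> carrier_mat n n" "transpose_mat M \<in> carrier_mat n n" by (auto simp: M_def)
  note adj = adj_mat[OF M(2)]
  have z: "z \<in> carrier_vec n" by (simp add: z_def)
  have "(transpose_mat M *\<^sub>v z) $ j = f j - shift_vars n (f j)" if "j < n" for j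
    using that \<Delta>
    by (simp add: difference_matrix_def M_def z_def scalar_prod_def atLeast0LessThan)
  then have "(adj_mat (transpose_mat M) *\<^sub>v (transpose_mat M *\<^sub>v z)) $ i
      = (\<Sum>j<n. adj_mat (transpose_mat M) $$ (i, j) * (f j - shift_vars n (f j)))"
    using adj(1) M i by (simp add: scalar_prod_def atLeast0LessThan)
  moreover have "adj_mat (transpose_mat M) *\<^sub>v (transpose_mat M *\<^sub>v z)
      = (adj_mat (transpose_mat M) * transpose_mat M) *\<^sub>v z"
    using adj(1) M(2) z by (simp add: assoc_mult_mat_vec)
  moreover have "((adj_mat (transpose_mat M) * transpose_mat M) *\<^sub>v z) $ i
      = Determinant.det M * (mvar i - mvar (n + i))"
    unfolding adj(3) using i z
    by (simp add: Determinant.det_transpose[OF M(1)] smult_scalar_prod_distrib[of _ n]) (simp add: z_def)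
  ultimately have "Determinant.det M * (mvar i - mvar (n + i))
      = (\<Sum>j<n. adj_mat (transpose_mat M) $$ (i, j) * (f j - shift_vars n (f j)))"
    by simp
  then show ?thesis
    unfolding M_def by (intro exI[of _ "\<lambda>j. adj_mat (transpose_mat (mat n n (\<lambda>(i, j). \<Delta> i j))) $$ (i, j)"])
qed

section \<open>The Scheja--Storch functional\<close>

lemma poly_mapping_single_sum:
  "Poly_Mapping.single m (\<Sum>i\<in>I. c i) = (\<Sum>i\<in>I. Poly_Mapping.single m (c i))"
  by (induction I rule: infinite_finite_induct) (simp_all add: single_add)

text \<open>\<open>q\<close> is an ideal of finite codimension: the classes of \<open>E 0, \<dots>, E (d - 1)\<close> are a basis of the
  quotient, with dual basis \<open>C 0, \<dots>, C (d - 1)\<close>. All functionals on the quotient are represented by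
  functions of polynomials.\<close>

locale finite_quotient =
  fixes n :: nat and q :: "'k::field mpoly set" and d :: nat
    and E :: "nat \<Rightarrow> 'k mpoly" and C :: "nat \<Rightarrow> 'k mpoly \<Rightarrow> 'k"
  assumes q_sub: "q \<subseteq> mpolys n" and q_zero: "0 \<in> q"
    and q_add: "a \<in> q \<Longrightarrow> b \<in> q \<Longrightarrow> a + b \<in> q"
    and q_mult: "a \<in> mpolys n \<Longrightarrow> b \<in> q \<Longrightarrow> a * b \<in> q"
    and E_in: "i < d \<Longrightarrow> E i \<in> mpolys n"
    and C_add: "i < d \<Longrightarrow> a \<in> mpolys n \<Longrightarrow> b \<in> mpolys n \<Longrightarrow> C i (a + b) = C i a + C i b"
    and C_mconst: "i < d \<Longrightarrow> a \<in> mpolys n \<Longrightarrow> C i (mconst c * a) = c * C i a"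
    and C_q: "i < d \<Longrightarrow> a \<in> q \<Longrightarrow> C i a = 0"
    and C_expand: "a \<in> mpolys n \<Longrightarrow> a - (\<Sum>i<d. mconst (C i a) * E i) \<in> q"
begin

lemma q_uminus: "a \<in> q \<Longrightarrow> - a \<in> q"
  using q_mult[of "- 1" a] by simp

lemma q_diff: "a \<in> q \<Longrightarrow> b \<in> q \<Longrightarrow> a - b \<in> q"
  using q_add[of a "- b"] q_uminus by simp

lemma q_sum: "(\<And>i. i \<in> I \<Longrightarrow> g i \<in> q) \<Longrightarrow> (\<Sum>i\<in>I. g i) \<in> q"
  by (induction I rule: infinite_finite_induct) (auto simp: q_zero q_add)

lemma q_trans: "a - b \<in> q \<Longrightarrow> b - c \<in> q \<Longrightarrow> a - c \<in> q"
  using q_add[of "a - b" "b - c"] by simp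

lemma q_mult_diff: "c \<in> mpolys n \<Longrightarrow> a - b \<in> q \<Longrightarrow> c * a - c * b \<in> q"
  using q_mult[of c "a - b"] by (simp add: algebra_simps)

definition functional :: "('k mpoly \<Rightarrow> 'k) \<Rightarrow> bool" where
  "functional l \<longleftrightarrow> (\<forall>a\<in>mpolys n. \<forall>b\<in>mpolys n. l (a + b) = l a + l b) \<and>
     (\<forall>c. \<forall>a\<in>mpolys n. l (mconst c * a) = c * l a) \<and> (\<forall>a\<in>q. l a = 0)"

lemma functional_add: "functional l \<Longrightarrow> a \<in> mpolys n \<Longrightarrow> b \<in> mpolys n \<Longrightarrow> l (a + b) = l a + l b"
  by (simp add: functional_def)

lemma functional_mconst: "functional l \<Longrightarrow> a \<in> mpolys n \<Longrightarrow> l (mconst c * a) = c * l a"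
  by (simp add: functional_def)

lemma functional_q: "functional l \<Longrightarrow> a \<in> q \<Longrightarrow> l a = 0"
  by (simp add: functional_def)

lemma functional_zero: "functional l \<Longrightarrow> l 0 = 0"
  using q_zero by (simp add: functional_def)

lemma functional_cong:
  assumes l: "functional l" and "a \<in> mpolys n" "b \<in> mpolys n" "a - b \<in> q"
  shows "l a = l b"
  using functional_add[OF l, of "a - b" b] functional_q[OF l, of "a - b"] assms by simp

lemma functional_single:
  assumes "functional l" "Poly_Mapping.keys m \<subseteq> {..<n}"
  shows "l (Poly_Mapping.single m c) = c * l (Poly_Mapping.single m 1)"
  using functional_mconst[of l "Poly_Mapping.single m 1" c] assms
  by (simp add: single_in_mpolys mconst_def mult_single)

lemma functional_C: "i < d \<Longrightarrow> functional (C i)"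
  by (simp add: functional_def C_add C_mconst C_q)

lemma functional_translate: "functional l \<Longrightarrow> a \<in> mpolys n \<Longrightarrow> functional (\<lambda>x. l (a * x))"
  using q_mult by (auto simp: functional_def distrib_left mult.left_commute[of a "mconst _"])

lemma functional_sum: "(\<And>i. i \<in> I \<Longrightarrow> functional (l i)) \<Longrightarrow> functional (\<lambda>x. \<Sum>i\<in>I. l i x)"
  by (simp add: functional_def sum.distrib sum_distrib_left)

lemma keys_parts: "Poly_Mapping.keys (X_part n m) \<subseteq> {..<n}" "Poly_Mapping.keys (Y_part n m) \<subseteq> {..<n}"
  by (rule keys_X_part keys_Y_part)+

text \<open>A functional applied to one tensor factor of (the image of) a polynomial in \<open>X\<close> and \<open>Y\<close>.\<close>

definition contract_X :: "('k mpoly \<Rightarrow> 'k) \<Rightarrow> 'k mpoly \<Rightarrow> 'k mpoly" where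
  "contract_X l g = (\<Sum>m\<in>Poly_Mapping.keys g.
     Poly_Mapping.single (Y_part n m) (l (Poly_Mapping.single (X_part n m) (Poly_Mapping.lookup g m))))"

definition contract_Y :: "('k mpoly \<Rightarrow> 'k) \<Rightarrow> 'k mpoly \<Rightarrow> 'k mpoly" where
  "contract_Y l g = (\<Sum>m\<in>Poly_Mapping.keys g.
     Poly_Mapping.single (X_part n m) (l (Poly_Mapping.single (Y_part n m) (Poly_Mapping.lookup g m))))"

lemma contract_X_single: "functional l \<Longrightarrow> contract_X l (Poly_Mapping.single m c)
    = Poly_Mapping.single (Y_part n m) (l (Poly_Mapping.single (X_part n m) c))"
  by (simp add: contract_X_def functional_zero)

lemma contract_Y_single: "functional l \<Longrightarrow> contract_Y l (Poly_Mapping.single m c)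
    = Poly_Mapping.single (X_part n m) (l (Poly_Mapping.single (Y_part n m) c))"
  by (simp add: contract_Y_def functional_zero)

lemma contract_X_add: "functional l \<Longrightarrow> contract_X l (f + g) = contract_X l f + contract_X l g"
  unfolding contract_X_def
  by (rule setsum_keys_plus_distrib)
    (auto simp: single_add functional_zero functional_add single_in_mpolys keys_parts)

lemma contract_Y_add: "functional l \<Longrightarrow> contract_Y l (f + g) = contract_Y l f + contract_Y l g"
  unfolding contract_Y_def
  by (rule setsum_keys_plus_distrib)
    (auto simp: single_add functional_zero functional_add single_in_mpolys keys_parts)

lemma contract_in: "contract_X l g \<in> mpolys n" "contract_Y l g \<in> mpolys n"
  unfolding contract_X_def contract_Y_def by (intro mpolys_sum single_in_mpolys keys_parts)+

lemma contract_X_diff: "functional l \<Longrightarrow> contract_X l (f - g) = contract_X l f - contract_X l g"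
  using contract_X_add[of l "f - g" g] by simp

lemma contract_Y_diff: "functional l \<Longrightarrow> contract_Y l (f - g) = contract_Y l f - contract_Y l g"
  using contract_Y_add[of l "f - g" g] by simp

lemma contract_X_zero: "contract_X l 0 = 0" and contract_Y_zero: "contract_Y l 0 = 0"
  by (simp_all add: contract_X_def contract_Y_def)

lemma contract_X_sum: "functional l \<Longrightarrow> contract_X l (\<Sum>i\<in>I. g i) = (\<Sum>i\<in>I. contract_X l (g i))"
  by (induction I rule: infinite_finite_induct) (simp_all add: contract_X_zero contract_X_add)

lemma contract_Y_sum: "functional l \<Longrightarrow> contract_Y l (\<Sum>i\<in>I. g i) = (\<Sum>i\<in>I. contract_Y l (g i))"
  by (induction I rule: infinite_finite_induct) (simp_all add: contract_Y_zero contract_Y_add)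

lemma part_add: "X_part n (m + m') = X_part n m + X_part n m'" "Y_part n (m + m') = Y_part n m + Y_part n m'"
  using exponent_homs(1,2)[of n] by (simp_all add: exponent_hom_def)

text \<open>Contracting the first tensor factor is linear over the second one; on monomials the two
  groups of exponents do not interact.\<close>

lemma contract_X_mult_shift:
  assumes l: "functional l" and a: "a \<in> mpolys n"
  shows "contract_X l (g * shift_vars n a) = contract_X l g * a"
proof (induction g rule: poly_mapping_induct_monomial)
  case (single m c)
  show ?case
    using a
  proof (induction a rule: mpolys_induct_monomial)
    case (single m' c')
    then show ?case
      using functional_single[OF l keys_parts(1), of m "c * c'"] functional_single[OF l keys_parts(1), of m c]
      by (simp add: shift_vars_eq mult_single contract_X_single l part_add X_part_shift Y_part_shift ac_simps)
  next
    case (add f g)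
    then show ?case by (simp add: shift_vars_eq distrib_left contract_X_add l)
  qed
next
  case (add f g)
  then show ?case by (simp add: distrib_right contract_X_add l)
qed

lemma contract_Y_mult:
  assumes l: "functional l" and a: "a \<in> mpolys n"
  shows "contract_Y l (g * a) = contract_Y l g * a"
proof (induction g rule: poly_mapping_induct_monomial)
  case (single m c)
  show ?case
    using a
  proof (induction a rule: mpolys_induct_monomial)
    case (single m' c')
    then show ?case
      using functional_single[OF l keys_parts(2), of m "c * c'"] functional_single[OF l keys_parts(2), of m c]
      by (simp add: mult_single contract_Y_single l part_add X_part_ident Y_part_ident ac_simps)
  next
    case (add f g)
    then show ?case by (simp add: distrib_left contract_Y_add l)
  qed
next
  case (add f g)
  then show ?case by (simp add: distrib_right contract_Y_add l)
qed

text \<open>A factor in the contracted variables is absorbed by the functional, which becomes x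
  \<mapsto> l(ax).\<close>

lemma contract_X_mult:
  assumes l: "functional l" and a: "a \<in> mpolys n"
  shows "contract_X l (g * a) = contract_X (\<lambda>x. l (a * x)) g"
proof (induction g rule: poly_mapping_induct_monomial)
  case (single m c)
  have "contract_X l (Poly_Mapping.single m c * a)
      = Poly_Mapping.single (Y_part n m) (l (a * Poly_Mapping.single (X_part n m) c))"
    using a
  proof (induction a rule: mpolys_induct_monomial)
    case (single m' c')
    then show ?case
      by (simp add: mult_single contract_X_single l part_add X_part_ident Y_part_ident ac_simps)
  next
    case (add f g)
    then show ?case
      by (simp add: distrib_left distrib_right contract_X_add l functional_add[OF l]
          single_in_mpolys keys_parts single_add)
  qed
  then show ?case by (simp add: contract_X_single functional_translate[OF l a])
next
  case (add f g)
  then show ?case by (simp add: distrib_right contract_X_add l functional_translate[OF l a])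
qed

lemma contract_Y_mult_shift:
  assumes l: "functional l" and a: "a \<in> mpolys n"
  shows "contract_Y l (g * shift_vars n a) = contract_Y (\<lambda>x. l (a * x)) g"
proof (induction g rule: poly_mapping_induct_monomial)
  case (single m c)
  have "contract_Y l (Poly_Mapping.single m c * shift_vars n a)
      = Poly_Mapping.single (X_part n m) (l (a * Poly_Mapping.single (Y_part n m) c))"
    using a
  proof (induction a rule: mpolys_induct_monomial)
    case (single m' c')
    then show ?case
      by (simp add: shift_vars_eq mult_single contract_Y_single l part_add X_part_shift Y_part_shift ac_simps)
  next
    case (add f g)
    then show ?case
      by (simp add: shift_vars_eq distrib_left distrib_right contract_Y_add l functional_add[OF l]
          single_in_mpolys keys_parts single_add)
  qed
  then show ?case by (simp add: contract_Y_single functional_translate[OF l a])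
next
  case (add f g)
  then show ?case by (simp add: distrib_right contract_Y_add l functional_translate[OF l a])
qed

text \<open>Both sides apply \<open>h\<close> to the X-factor and \<open>l\<close> to the Y-factor
  of \<open>g\<close>.\<close>

lemma contract_duality:
  assumes l: "functional l" and h: "functional h"
  shows "h (contract_Y l g) = l (contract_X h g)"
proof (induction g rule: poly_mapping_induct_monomial)
  case (single m c)
  show ?case
    by (subst contract_X_single contract_Y_single, fact)+
      (simp add: functional_single[OF l keys_parts(2), of m c] functional_single[OF h keys_parts(1), of m c]
        functional_single[OF l keys_parts(2), of m "_ * _"] functional_single[OF h keys_parts(1), of m "_ * _"])
next
  case (add f g)
  then show ?case by (simp add: contract_X_add contract_Y_add l h functional_add contract_in)
qed

text \<open>By \<open>C_expand\<close> the sum of the E_i C_i is the identity modulo q. Replacing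
  the X-factor x of every tensor by the sum of the E_i C_i(x) therefore turns x \<otimes> y into
  xy.\<close>

lemma sum_E_contract_X: "(\<Sum>i<d. E i * contract_X (C i) g) - monomial_subst (diag_exp n) g \<in> q"
proof (induction g rule: poly_mapping_induct_monomial)
  case (single m c)
  let ?X = "Poly_Mapping.single (X_part n m) c" and ?Y = "Poly_Mapping.single (Y_part n m) 1"
  have "?Y * (\<Sum>i<d. mconst (C i ?X) * E i) - ?Y * ?X \<in> q"
    using q_uminus[OF C_expand[of ?X]] by (intro q_mult_diff) (simp_all add: single_in_mpolys keys_parts)
  moreover have "?Y * (\<Sum>i<d. mconst (C i ?X) * E i) = (\<Sum>i<d. E i * contract_X (C i) (Poly_Mapping.single m c))"
    unfolding sum_distrib_left
    by (intro sum.cong refl)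
      (simp add: contract_X_single functional_C mconst_def mult_single mult.commute[of "E _"] flip: mult.assoc)
  moreover have "?Y * ?X = monomial_subst (diag_exp n) (Poly_Mapping.single m c)"
    by (simp add: mult_single diag_exp_def add.commute)
  ultimately show ?case by simp
next
  case (add f g)
  have "(\<Sum>i<d. E i * contract_X (C i) (f + g))
      = (\<Sum>i<d. E i * contract_X (C i) f) + (\<Sum>i<d. E i * contract_X (C i) g)"
    by (simp add: contract_X_add functional_C distrib_left sum.distrib)
  then show ?case using q_add[OF add] by (simp add: algebra_simps)
qed

lemma sum_E_contract_Y: "(\<Sum>i<d. E i * contract_Y (C i) g) - monomial_subst (diag_exp n) g \<in> q"
proof (induction g rule: poly_mapping_induct_monomial)
  case (single m c)
  let ?X = "Poly_Mapping.single (X_part n m) 1" and ?Y = "Poly_Mapping.single (Y_part n m) c"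
  have "?X * (\<Sum>i<d. mconst (C i ?Y) * E i) - ?X * ?Y \<in> q"
    using q_uminus[OF C_expand[of ?Y]] by (intro q_mult_diff) (simp_all add: single_in_mpolys keys_parts)
  moreover have "?X * (\<Sum>i<d. mconst (C i ?Y) * E i) = (\<Sum>i<d. E i * contract_Y (C i) (Poly_Mapping.single m c))"
    unfolding sum_distrib_left
    by (intro sum.cong refl)
      (simp add: contract_Y_single functional_C mconst_def mult_single mult.commute[of "E _"] flip: mult.assoc)
  moreover have "?X * ?Y = monomial_subst (diag_exp n) (Poly_Mapping.single m c)"
    by (simp add: mult_single diag_exp_def)
  ultimately show ?case by simp
next
  case (add f g)
  have "(\<Sum>i<d. E i * contract_Y (C i) (f + g))
      = (\<Sum>i<d. E i * contract_Y (C i) f) + (\<Sum>i<d. E i * contract_Y (C i) g)"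
    by (simp add: contract_Y_add functional_C distrib_left sum.distrib)
  then show ?case using q_add[OF add] by (simp add: algebra_simps)
qed

text \<open>The trace of multiplication by \<open>a\<close>. The axioms of
  \<open>finite_quotient\<close> say that the sum of the E_i \<otimes> C_i represents the identity
  of the quotient, and composing with the multiplication and contracting this sum gives the
  trace.\<close>

definition trace_functional :: "'k mpoly \<Rightarrow> 'k" where
  "trace_functional a = (\<Sum>i<d. C i (E i * a))"

lemma functional_trace: "functional trace_functional"
  unfolding trace_functional_def
  by (intro functional_sum functional_translate functional_C E_in) auto

end

text \<open>\<open>D\<close> stands for the determinant of a difference matrix.
  \<open>D_vars\<close> expresses that its image in the tensor square of the quotient is killed by
  x_i \<otimes> 1 - 1 \<otimes> x_i, since each f_j lies in q.\<close>

locale annihilating_difference = finite_quotient +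
  fixes f :: "nat \<Rightarrow> 'a mpoly" and D :: "'a mpoly"
  assumes f_q: "j < n \<Longrightarrow> f j \<in> q"
    and D_vars: "i < n \<Longrightarrow> \<exists>g. D * (mvar i - mvar (n + i)) = (\<Sum>j<n. g j * (f j - shift_vars n (f j)))"
begin

lemma contract_X_f: "functional l \<Longrightarrow> j < n \<Longrightarrow> contract_X l (g * f j) = 0"
  using f_q[of j] q_sub
  by (subst contract_X_mult)
    (auto simp: contract_X_def mult.commute[of "f j"] functional_q q_mult single_in_mpolys keys_parts)

lemma contract_Y_f: "functional l \<Longrightarrow> j < n \<Longrightarrow> contract_Y l (g * shift_vars n (f j)) = 0"
  using f_q[of j] q_sub
  by (subst contract_Y_mult_shift)
    (auto simp: contract_Y_def mult.commute[of "f j"] functional_q q_mult single_in_mpolys keys_parts)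

text \<open>In the tensor square D(a \<otimes> 1) = D(1 \<otimes> a), and contraction is linear over
  the second factor. The induction keeps \<open>l\<close> arbitrary because the product case uses
  the hypothesis for x \<mapsto> l(bx).\<close>

lemma contract_X_D:
  assumes "a \<in> mpolys n" "functional l"
  shows "contract_X l (D * a) - a * contract_X l D \<in> q"
  using assms
proof (induction a arbitrary: l rule: mpolys_induct)
  case (mconst c)
  then show ?case
    using contract_X_mult_shift[of l "mconst c" D] by (simp add: shift_vars_mconst q_zero mult.commute)
next
  case (mvar i)
  note l = mvar(2)
  obtain g where g: "D * (mvar i - mvar (n + i)) = (\<Sum>j<n. g j * (f j - shift_vars n (f j)))"
    using D_vars mvar by blast
  have "contract_X l (D * mvar i) - mvar i * contract_X l D
      = contract_X l (D * (mvar i - mvar (n + i)))"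
    using contract_X_mult_shift[OF l, of "mvar i" D] mvar
    by (simp add: right_diff_distrib contract_X_diff l shift_vars_mvar mult.commute)
  also have "\<dots> = - (\<Sum>j<n. contract_X l (g j) * f j)"
    using f_q q_sub unfolding g
    by (simp add: contract_X_sum l right_diff_distrib contract_X_diff contract_X_f
        contract_X_mult_shift sum_negf subset_iff)
  also have "\<dots> \<in> q"
    by (intro q_uminus q_sum q_mult contract_in f_q) auto
  finally show ?case .
next
  case (add a b)
  have "contract_X l (D * a) - a * contract_X l D + (contract_X l (D * b) - b * contract_X l D) \<in> q"
    using add by (intro q_add) auto
  then show ?case by (simp add: algebra_simps contract_X_add add.prems)
next
  case (mult a b)
  have "contract_X (\<lambda>x. l (b * x)) (D * a) - a * contract_X (\<lambda>x. l (b * x)) D \<in> q"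
    using mult functional_translate by blast
  then have "contract_X l (D * (a * b)) - a * contract_X l (D * b) \<in> q"
    using mult by (simp add: contract_X_mult[symmetric] mult.assoc)
  moreover have "a * contract_X l (D * b) - a * (b * contract_X l D) \<in> q"
    using mult by (intro q_mult_diff) auto
  ultimately show ?case using q_trans by (auto simp: mult.assoc)
qed

text \<open>Mirror image of \<open>contract_X_D\<close>. Now \<open>a\<close> multiplies the
  Y-factor, whence the opposite sign in the case of a variable.\<close>

lemma contract_Y_D:
  assumes "a \<in> mpolys n" "functional l"
  shows "contract_Y l (D * shift_vars n a) - a * contract_Y l D \<in> q"
  using assms
proof (induction a arbitrary: l rule: mpolys_induct)
  case (mconst c)
  then show ?case
    using contract_Y_mult[of l "mconst c" D] by (simp add: shift_vars_mconst q_zero mult.commute)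
next
  case (mvar i)
  note l = mvar(2)
  obtain g where g: "D * (mvar i - mvar (n + i)) = (\<Sum>j<n. g j * (f j - shift_vars n (f j)))"
    using D_vars mvar by blast
  have "contract_Y l (D * shift_vars n (mvar i)) - mvar i * contract_Y l D
      = - contract_Y l (D * (mvar i - mvar (n + i)))"
    using contract_Y_mult[OF l, of "mvar i" D] mvar
    by (simp add: right_diff_distrib contract_Y_diff l shift_vars_mvar mult.commute)
  also have "\<dots> = - (\<Sum>j<n. contract_Y l (g j) * f j)"
    using f_q q_sub unfolding g
    by (simp add: contract_Y_sum l right_diff_distrib contract_Y_diff contract_Y_f
        contract_Y_mult subset_iff)
  also have "\<dots> \<in> q"
    by (intro q_uminus q_sum q_mult contract_in f_q) auto
  finally show ?case .
next
  case (add a b)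
  have "contract_Y l (D * shift_vars n a) - a * contract_Y l D
      + (contract_Y l (D * shift_vars n b) - b * contract_Y l D) \<in> q"
    using add by (intro q_add) auto
  then show ?case by (simp add: algebra_simps contract_Y_add add.prems shift_vars_eq)
next
  case (mult a b)
  have "contract_Y (\<lambda>x. l (b * x)) (D * shift_vars n a) - a * contract_Y (\<lambda>x. l (b * x)) D \<in> q"
    using mult functional_translate by blast
  then have "contract_Y l (D * shift_vars n (a * b)) - a * contract_Y l (D * shift_vars n b) \<in> q"
    using mult by (simp add: contract_Y_mult_shift[symmetric] mult.assoc shift_vars_mult)
  moreover have "a * contract_Y l (D * shift_vars n b) - a * (b * contract_Y l D) \<in> q"
    using mult by (intro q_mult_diff) auto
  ultimately show ?case using q_trans by (auto simp: mult.assoc)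
qed

abbreviation "J \<equiv> monomial_subst (diag_exp n) D"

lemma J_in: "J \<in> mpolys n" by (rule diag_mpolys)

text \<open>The trace is the sum of the functionals C_i(E_i x). Contracting D by it gives the sum of
  the contractions of D(E_i \<otimes> 1) by C_i. By \<open>contract_X_D\<close> these are E_i times
  the contractions of D by C_i, which add up to the restriction of D to the diagonal.\<close>

lemma contract_X_trace: "contract_X trace_functional D - J \<in> q"
proof -
  have "contract_X trace_functional D = (\<Sum>i<d. contract_X (\<lambda>x. C i (E i * x)) D)"
    unfolding contract_X_def trace_functional_def
    by (subst sum.swap) (simp add: poly_mapping_single_sum)
  also have "\<dots> = (\<Sum>i<d. contract_X (C i) (D * E i))"
    by (simp add: contract_X_mult functional_C E_in)
  finally have "contract_X trace_functional D - (\<Sum>i<d. E i * contract_X (C i) D)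
      = (\<Sum>i<d. contract_X (C i) (D * E i) - E i * contract_X (C i) D)"
    by (simp add: sum_subtractf)
  also have "\<dots> \<in> q" by (intro q_sum contract_X_D E_in functional_C) auto
  finally show ?thesis using sum_E_contract_X q_trans by blast
qed

lemma contract_Y_trace: "contract_Y trace_functional D - J \<in> q"
proof -
  have "contract_Y trace_functional D = (\<Sum>i<d. contract_Y (\<lambda>x. C i (E i * x)) D)"
    unfolding contract_Y_def trace_functional_def
    by (subst sum.swap) (simp add: poly_mapping_single_sum)
  also have "\<dots> = (\<Sum>i<d. contract_Y (C i) (D * shift_vars n (E i)))"
    by (simp add: contract_Y_mult_shift functional_C E_in)
  finally have "contract_Y trace_functional D - (\<Sum>i<d. E i * contract_Y (C i) D)
      = (\<Sum>i<d. contract_Y (C i) (D * shift_vars n (E i)) - E i * contract_Y (C i) D)"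
    by (simp add: sum_subtractf)
  also have "\<dots> \<in> q" by (intro q_sum contract_Y_D E_in functional_C) auto
  finally show ?thesis using sum_E_contract_Y q_trans by blast
qed

text \<open>Contracting \<open>D\<close> with \<open>\<eta>\<close> and \<open>c \<cdot> Tr\<close> in the two possible orders gives \<open>\<eta> (c J)\<close> and \<open>Tr c\<close>.\<close>

lemma functional_unique:
  assumes \<eta>: "functional \<eta>" and one: "contract_X \<eta> D - 1 \<in> q" and c: "c \<in> mpolys n"
  shows "\<eta> (c * J) = trace_functional c"
proof -
  define l where "l = (\<lambda>x. trace_functional (c * x))"
  have l: "functional l" unfolding l_def by (rule functional_translate[OF functional_trace c])
  have "contract_Y l D = contract_Y trace_functional (D * shift_vars n c)"
    by (simp add: l_def contract_Y_mult_shift functional_trace c)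
  then have "contract_Y l D - c * contract_Y trace_functional D \<in> q"
    using contract_Y_D[OF c functional_trace] by simp
  then have "contract_Y l D - c * J \<in> q"
    using q_trans q_mult_diff[OF c contract_Y_trace] by blast
  then have "\<eta> (c * J) = \<eta> (contract_Y l D)"
    using functional_cong[OF \<eta>] contract_in J_in c by (metis mpolys_mult)
  also have "\<dots> = l (contract_X \<eta> D)" by (rule contract_duality[OF l \<eta>])
  also have "\<dots> = l 1" by (rule functional_cong[OF l contract_in(1) _ one]) simp
  finally show ?thesis by (simp add: l_def)
qed

text \<open>The contraction by the trace is J. Replacing the trace by x \<mapsto> Tr(ux) multiplies
  the contraction by u, and uJ is 1 modulo q.\<close>

lemma functional_exists:
  assumes u: "u \<in> mpolys n" and uJ: "u * J - 1 \<in> q"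
  shows "functional (\<lambda>x. trace_functional (u * x))"
    and "contract_X (\<lambda>x. trace_functional (u * x)) D - 1 \<in> q"
proof -
  show "functional (\<lambda>x. trace_functional (u * x))" by (rule functional_translate[OF functional_trace u])
  have "contract_X (\<lambda>x. trace_functional (u * x)) D = contract_X trace_functional (D * u)"
    by (simp add: contract_X_mult functional_trace u)
  then have "contract_X (\<lambda>x. trace_functional (u * x)) D - u * contract_X trace_functional D \<in> q"
    using contract_X_D[OF u functional_trace] by simp
  then show "contract_X (\<lambda>x. trace_functional (u * x)) D - 1 \<in> q"
    using q_trans q_mult_diff[OF u contract_X_trace] uJ by blast
qed

text \<open>If the trace vanished, the contraction in \<open>functional_exists\<close> would be 0,
  yet it is 1 modulo q. Nondegeneracy of the trace form is thus obtained from the invertibility of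
  J.\<close>

lemma trace_functional_nonzero:
  assumes u: "u \<in> mpolys n" and uJ: "u * J - 1 \<in> q" and "1 \<notin> q"
  shows "\<exists>c\<in>mpolys n. trace_functional c \<noteq> 0"
proof (rule ccontr)
  assume "\<not> ?thesis"
  then have "trace_functional (u * Poly_Mapping.single (X_part n m) c) = 0" for m c
    using u by (meson keys_parts(1) mpolys_mult single_in_mpolys)
  then have "contract_X (\<lambda>x. trace_functional (u * x)) D = 0" by (simp add: contract_X_def)
  then show False using functional_exists(2)[OF u uJ] q_uminus assms(3) by fastforce
qed

end

section \<open>Points with separable residue field\<close>

text \<open>Ideals are written with the operations of the type, so that ordinary sums and rewriting
  apply; \<open>poly_ideal_ideal\<close> passes to the ring record.\<close>

definition poly_ideal :: "nat \<Rightarrow> 'k::field mpoly set \<Rightarrow> bool" where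
  "poly_ideal n I \<longleftrightarrow> I \<subseteq> mpolys n \<and> 0 \<in> I \<and> (\<forall>a\<in>I. \<forall>b\<in>I. a + b \<in> I) \<and> (\<forall>a\<in>mpolys n. \<forall>b\<in>I. a * b \<in> I)"

lemma poly_idealD:
  assumes "poly_ideal n I"
  shows "I \<subseteq> mpolys n" "a \<in> I \<Longrightarrow> a \<in> mpolys n" "0 \<in> I" "a \<in> I \<Longrightarrow> b \<in> I \<Longrightarrow> a + b \<in> I"
    "c \<in> mpolys n \<Longrightarrow> a \<in> I \<Longrightarrow> c * a \<in> I" "a \<in> I \<Longrightarrow> b \<in> I \<Longrightarrow> a - b \<in> I"
proof -
  show "I \<subseteq> mpolys n" "a \<in> I \<Longrightarrow> a \<in> mpolys n" "0 \<in> I" "a \<in> I \<Longrightarrow> b \<in> I \<Longrightarrow> a + b \<in> I"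
    "c \<in> mpolys n \<Longrightarrow> a \<in> I \<Longrightarrow> c * a \<in> I" using assms by (auto simp: poly_ideal_def)
  assume "a \<in> I" "b \<in> I"
  moreover have "- 1 * b \<in> I" using assms \<open>b \<in> I\<close> unfolding poly_ideal_def by (metis mpolys_one mpolys_uminus)
  ultimately have "a + - 1 * b \<in> I" using assms by (auto simp: poly_ideal_def)
  then show "a - b \<in> I" by simp
qed

lemma poly_ideal_sum:
  fixes I :: "'k::field mpoly set"
  assumes "poly_ideal n I" "\<And>i. i \<in> Z \<Longrightarrow> g i \<in> I"
  shows "(\<Sum>i\<in>Z. g i) \<in> I"
  using assms(2) by (induction Z rule: infinite_finite_induct) (auto simp: poly_idealD[OF assms(1)])

text \<open>\<open>separable\<close> asks for a polynomial over k that annihilates \<open>a\<close>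
  modulo q and whose derivative at \<open>a\<close> is nonzero modulo q. In the derivative the
  factor \<open>of_nat t\<close> removes the term t = 0, where t - 1 is truncated.\<close>

locale separable_point =
  fixes n :: nat and q :: "'k::field mpoly set"
  assumes q: "poly_ideal n q" and one_notin_q: "1 \<notin> q"
    and q_prime: "a \<in> mpolys n \<Longrightarrow> b \<in> mpolys n \<Longrightarrow> a * b \<in> q \<Longrightarrow> a \<in> q \<or> b \<in> q"
    and separable: "a \<in> mpolys n \<Longrightarrow> \<exists>r c. (\<Sum>t<r. mconst (c t) * a ^ t) \<in> q \<and>
      (\<Sum>t<r. of_nat t * mconst (c t) * a ^ (t - 1)) \<notin> q"
begin

lemmas q_in = poly_idealD(2)[OF q] and q_zero = poly_idealD(3)[OF q] and q_add = poly_idealD(4)[OF q]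
  and q_mult = poly_idealD(5)[OF q] and q_diff = poly_idealD(6)[OF q] and q_sum = poly_ideal_sum[OF q]

lemma q_uminus: "a \<in> q \<Longrightarrow> - a \<in> q"
  using q_diff[OF q_zero] by simp

lemma q_trans: "a - b \<in> q \<Longrightarrow> b - c \<in> q \<Longrightarrow> a - c \<in> q"
  using q_add[of "a - b" "b - c"] by simp

lemma mconst_mult: "mconst (a * b) = mconst a * mconst b"
  by (simp add: mconst_def mult_single)

lemma mconst_add: "mconst (a + b) = mconst a + mconst b"
  by (simp add: mconst_def single_add)

lemma mconst_zero [simp]: "mconst 0 = 0" and mconst_one [simp]: "mconst 1 = 1"
  by (simp_all add: mconst_def)

lemma mconst_diff: "mconst (a - b) = mconst a - mconst b"
  by (simp add: mconst_def single_diff)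

text \<open>A relation with all coefficients 0 would have derivative 0, which lies in q.\<close>

lemma algebraic:
  assumes "a \<in> mpolys n"
  shows "\<exists>r c. (\<Sum>t<r. mconst (c t) * a ^ t) \<in> q \<and> (\<exists>t<r. c t \<noteq> 0)"
proof -
  obtain r c where rc: "(\<Sum>t<r. mconst (c t) * a ^ t) \<in> q"
    "(\<Sum>t<r. of_nat t * mconst (c t) * a ^ (t - 1)) \<notin> q" using separable[OF assms] by blast
  have "\<exists>t<r. c t \<noteq> 0"
  proof (rule ccontr)
    assume "\<not> (\<exists>t<r. c t \<noteq> 0)"
    then have "(\<Sum>t<r. of_nat t * mconst (c t) * a ^ (t - 1)) = 0" by (intro sum.neutral) auto
    then show False using rc(2) q_zero by simp
  qed
  then show ?thesis using rc(1) by blast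
qed

text \<open>Let c_s a^s be the lowest nonzero term of an algebraic relation of a. Since q is prime
  and a is outside q, the factor a^s can be cancelled. The remaining relation c_s + aw in q exhibits
  -w/c_s as an inverse.\<close>

lemma inverse_mod_q:
  assumes a: "a \<in> mpolys n" "a \<notin> q"
  shows "\<exists>u\<in>mpolys n. u * a - 1 \<in> q"
proof -
  obtain r c where rc: "(\<Sum>t<r. mconst (c t) * a ^ t) \<in> q" "\<exists>t<r. c t \<noteq> 0"
    using algebraic[OF a(1)] by blast
  define s where "s = (LEAST t. t < r \<and> c t \<noteq> 0)"
  have s: "s < r" "c s \<noteq> 0" using LeastI_ex[OF rc(2)] by (auto simp: s_def)
  have small: "c t = 0" if "t < s" for t
    using not_less_Least[of t "\<lambda>t. t < r \<and> c t \<noteq> 0"] that s(1) by (auto simp: s_def)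
  define w where "w = (\<Sum>t\<in>{Suc s..<r}. mconst (c t) * a ^ (t - Suc s))"
  have w: "w \<in> mpolys n" using a by (auto simp: w_def)
  have "(\<Sum>t<r. mconst (c t) * a ^ t) = (\<Sum>t\<in>{s..<r}. mconst (c t) * a ^ t)"
    using small s by (intro sum.mono_neutral_right) auto
  also have "\<dots> = mconst (c s) * a ^ s + (\<Sum>t\<in>{Suc s..<r}. mconst (c t) * a ^ t)"
    using s by (simp add: sum.atLeast_Suc_lessThan)
  also have "(\<Sum>t\<in>{Suc s..<r}. mconst (c t) * a ^ t) = a ^ s * (a * w)"
    unfolding w_def sum_distrib_left
  proof (intro sum.cong refl)
    fix t assume "t \<in> {Suc s..<r}"
    then have "a ^ t = a ^ (s + (Suc (t - Suc s)))" by (intro arg_cong2[of _ _ _ _ "(^)"]) auto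
    also have "\<dots> = a ^ s * (a * a ^ (t - Suc s))" by (simp only: power_add power_Suc)
    finally show "mconst (c t) * a ^ t = a ^ s * (a * (mconst (c t) * a ^ (t - Suc s)))"
      by (simp add: mult_ac)
  qed
  finally have "a ^ s * (mconst (c s) + a * w) \<in> q"
    using rc(1) by (simp add: algebra_simps)
  moreover have "a ^ k \<notin> q" for k
    using a one_notin_q q_prime[OF a(1) mpolys_power[OF a(1)]] by (induction k) auto
  ultimately have "mconst (c s) + a * w \<in> q" using q_prime a w by (meson mpolys_add mpolys_mconst mpolys_mult mpolys_power)
  then have "mconst (inverse (c s)) * (mconst (c s) + a * w) \<in> q" by (rule q_mult[rotated]) simp
  then have "- (mconst (inverse (c s)) * (mconst (c s) + a * w)) \<in> q" by (rule q_uminus)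
  moreover have "mconst (inverse (c s)) * mconst (c s) = 1" using s by (simp flip: mconst_mult)
  then have "- (mconst (inverse (c s)) * (mconst (c s) + a * w)) = (- mconst (inverse (c s)) * w) * a - 1"
    unfolding distrib_left by (simp add: mult_ac)
  ultimately have "(- mconst (inverse (c s)) * w) * a - 1 \<in> q" by simp
  then show ?thesis using w by (intro bexI[of _ "- mconst (inverse (c s)) * w"]) auto
qed

subsection \<open>Bases of the residue field\<close>

definition span_mod :: "'k mpoly set \<Rightarrow> 'k mpoly set" where
  "span_mod M = {a \<in> mpolys n. \<exists>c. a - (\<Sum>e\<in>M. mconst (c e) * e) \<in> q}"

lemma span_mod_add: "a \<in> span_mod M \<Longrightarrow> b \<in> span_mod M \<Longrightarrow> a + b \<in> span_mod M"
proof -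
  assume "a \<in> span_mod M" "b \<in> span_mod M"
  then obtain c c' where ab: "a \<in> mpolys n" "b \<in> mpolys n"
    "a - (\<Sum>e\<in>M. mconst (c e) * e) \<in> q" "b - (\<Sum>e\<in>M. mconst (c' e) * e) \<in> q"
    by (auto simp: span_mod_def)
  from q_add[OF ab(3,4)] have "a + b - (\<Sum>e\<in>M. mconst (c e + c' e) * e) \<in> q"
    by (simp add: mconst_add distrib_right sum.distrib algebra_simps)
  then show ?thesis using ab
    by (auto simp: span_mod_def intro!: exI[of _ "\<lambda>e. c e + c' e"])
qed

lemma span_mod_mconst: "a \<in> span_mod M \<Longrightarrow> mconst k * a \<in> span_mod M"
proof -
  assume "a \<in> span_mod M"
  then obtain c where a: "a \<in> mpolys n" "a - (\<Sum>e\<in>M. mconst (c e) * e) \<in> q"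
    by (auto simp: span_mod_def)
  have "mconst k * (a - (\<Sum>e\<in>M. mconst (c e) * e)) \<in> q" using a by (intro q_mult) auto
  then have "mconst k * a - (\<Sum>e\<in>M. mconst (k * c e) * e) \<in> q"
    by (simp add: mconst_mult right_diff_distrib sum_distrib_left mult.assoc)
  then show ?thesis using a
    by (auto simp: span_mod_def intro!: exI[of _ "\<lambda>e. k * c e"])
qed

lemma span_mod_cong: "a \<in> mpolys n \<Longrightarrow> a - b \<in> q \<Longrightarrow> b \<in> span_mod M \<Longrightarrow> a \<in> span_mod M"
  using q_trans by (fastforce simp: span_mod_def)

lemma span_mod_base:
  assumes "finite M" "e \<in> M" "M \<subseteq> mpolys n"
  shows "e \<in> span_mod M"
proof -
  have "(\<Sum>x\<in>M. mconst (if x = e then 1 else 0) * x) = (\<Sum>x\<in>M. if x = e then x else 0)"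
    by (intro sum.cong) auto
  also have "\<dots> = e" using assms by simp
  finally show ?thesis using assms q_zero
    by (auto simp: span_mod_def intro!: exI[of _ "\<lambda>x. if x = e then 1 else 0"])
qed

lemma span_mod_zero: "0 \<in> span_mod M"
  using q_zero by (auto simp: span_mod_def intro!: exI[of _ "\<lambda>_. 0"])

lemma span_mod_sum: "(\<And>i. i \<in> I \<Longrightarrow> g i \<in> span_mod M) \<Longrightarrow> (\<Sum>i\<in>I. g i) \<in> span_mod M"
  by (induction I rule: infinite_finite_induct) (auto simp: span_mod_zero span_mod_add)

text \<open>The polynomials that map \<open>span_mod M\<close> into itself include constants and
  variables and are closed under sums and products, so they are all polynomials; each of them is
  then applied to 1.\<close>

lemma span_mod_all:
  assumes M: "finite M" "M \<subseteq> mpolys n" and one: "1 \<in> span_mod M"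
    and mvar: "\<And>i e. i < n \<Longrightarrow> e \<in> M \<Longrightarrow> mvar i * e \<in> span_mod M"
  shows "mpolys n \<subseteq> span_mod M"
proof
  fix a :: "'k mpoly" assume "a \<in> mpolys n"
  then have "\<forall>v\<in>span_mod M. a * v \<in> span_mod M"
  proof (induction a rule: mpolys_induct)
    case (mvar i)
    show ?case
    proof
      fix v assume "v \<in> span_mod M"
      then obtain c where v: "v \<in> mpolys n" "v - (\<Sum>e\<in>M. mconst (c e) * e) \<in> q"
        by (auto simp: span_mod_def)
      have "mvar i * (v - (\<Sum>e\<in>M. mconst (c e) * e)) \<in> q" using mvar v by (intro q_mult) auto
      then have "mvar i * v - (\<Sum>e\<in>M. mconst (c e) * (mvar i * e)) \<in> q"
        by (simp add: right_diff_distrib sum_distrib_left mult.left_commute)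
      moreover have "mvar i * v \<in> mpolys n" using mvar v by simp
      moreover have "(\<Sum>e\<in>M. mconst (c e) * (mvar i * e)) \<in> span_mod M"
        by (intro span_mod_sum span_mod_mconst assms(4) mvar)
      ultimately show "mvar i * v \<in> span_mod M" using span_mod_cong by blast
    qed
  qed (auto simp: span_mod_mconst span_mod_add distrib_right mult.assoc)
  then show "a \<in> span_mod M" using one by force
qed

text \<open>Each variable satisfies a monic relation of some degree r_i modulo q, so the monomials
  with all exponents e_i < r_i span.\<close>

lemma finite_spanning_set: "\<exists>M. finite M \<and> M \<subseteq> mpolys n \<and> mpolys n \<subseteq> span_mod M"
proof -
  have "\<exists>r c. mvar i ^ r - (\<Sum>t<r. mconst (c t) * mvar i ^ t) \<in> q" if i: "i < n" for i
  proof -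
    obtain r c where rc: "(\<Sum>t<r. mconst (c t) * mvar i ^ t) \<in> q" "\<exists>t<r. c t \<noteq> 0"
      using algebraic[of "mvar i"] i by auto
    \<comment> \<open>The highest index with a nonzero coefficient; inverting that coefficient makes
      the relation monic.\<close>
    define s where "s = Max {t. t < r \<and> c t \<noteq> 0}"
    have "s \<in> {t. t < r \<and> c t \<noteq> 0}" unfolding s_def using rc(2) by (intro Max_in) auto
    then have s: "s < r" "c s \<noteq> 0" by auto
    have big: "c t = 0" if "s < t" "t < r" for t
    proof (rule ccontr)
      assume "c t \<noteq> 0"
      then have "t \<le> s" unfolding s_def using that by (intro Max_ge) auto
      then show False using that by simp
    qed
    have "(\<Sum>t<r. mconst (c t) * mvar i ^ t) = (\<Sum>t<Suc s. mconst (c t) * mvar i ^ t)"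
      using big s by (intro sum.mono_neutral_right) (auto simp: less_Suc_eq not_less_eq)
    then have "mconst (inverse (c s)) * (mconst (c s) * mvar i ^ s + (\<Sum>t<s. mconst (c t) * mvar i ^ t)) \<in> q"
      using rc(1) by (intro q_mult) (auto simp: add.commute)
    then have "mvar i ^ s - (\<Sum>t<s. mconst (- (inverse (c s) * c t)) * mvar i ^ t) \<in> q"
      using s by (simp add: distrib_left sum_distrib_left mult.assoc[symmetric] mconst_mult[symmetric]
          mconst_diff[of 0, simplified] sum_negf)
    then show ?thesis by (intro exI[of _ s] exI[of _ "\<lambda>t. - (inverse (c s) * c t)"])
  qed
  then obtain r c where rc: "\<And>i. i < n \<Longrightarrow> mvar i ^ r i - (\<Sum>t<r i. mconst (c i t) * mvar i ^ t) \<in> q"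
    by metis
  \<comment> \<open>A monic relation of degree 0 would put 1 into q. Positivity makes the zero
    exponent vector admissible, so that 1 is one of the monomials.\<close>
  have r_pos: "0 < r i" if "i < n" for i
    using rc[OF that] one_notin_q by (cases "r i = 0") auto
  define mon where "mon e = (\<Prod>i<n. mvar i ^ e i :: 'k mpoly)" for e
  define A where "A = PiE {..<n} (\<lambda>i. {..<r i})"
  define M where "M = mon ` A"
  have M: "finite M" "M \<subseteq> mpolys n"
  proof -
    show "finite M" unfolding M_def A_def by (intro finite_imageI finite_PiE) auto
    have "mon e \<in> mpolys n" for e
      unfolding mon_def by (intro mpolys_prod mpolys_power mpolys_mvar) auto
    then show "M \<subseteq> mpolys n" by (auto simp: M_def)
  qed
  have mon: "mon e = mvar i ^ e i * (\<Prod>j\<in>{..<n} - {i}. mvar j ^ e j)" if "i < n" for i e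
    using that by (simp add: mon_def prod.remove)
  have upd: "mon (e(i := t)) = mvar i ^ t * (\<Prod>j\<in>{..<n} - {i}. mvar j ^ e j)" if "i < n" for i e t
    unfolding mon[OF that] by simp
  have in_span: "mon (e(i := t)) \<in> span_mod M" if "i < n" "e \<in> A" "t < r i" for e i t
    using that M unfolding M_def by (intro span_mod_base) (auto simp: A_def PiE_iff extensional_def)
  have "mpolys n \<subseteq> span_mod M"
  proof (rule span_mod_all[OF M])
    have "mon (\<lambda>i\<in>{..<n}. 0) = 1" by (simp add: mon_def)
    moreover have "(\<lambda>i\<in>{..<n}. 0) \<in> A" using r_pos by (auto simp: A_def)
    ultimately show "1 \<in> span_mod M" using span_mod_base[OF M(1) _ M(2), of 1] by (metis M_def imageI)
  next
    fix i x assume i: "i < n" and "x \<in> M"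
    then obtain e where e: "e \<in> A" "x = mon e" by (auto simp: M_def)
    let ?p = "\<Prod>j\<in>{..<n} - {i}. mvar j ^ e j :: 'k mpoly"
    have p: "?p \<in> mpolys n" by (intro mpolys_prod mpolys_power mpolys_mvar) auto
    have x: "mvar i * x = mvar i ^ Suc (e i) * ?p" unfolding e mon[OF i] by (simp add: mult.assoc)
    show "mvar i * x \<in> span_mod M"
    proof (cases "Suc (e i) < r i")
      case True
      from in_span[OF i e(1) True] show ?thesis unfolding x upd[OF i] .
    next
      \<comment> \<open>The exponent reaches r_i. The relation rewrites this power into lower ones,
        which stay among the chosen monomials.\<close>
      case False
      moreover have "e i < r i" using i e by (auto simp: A_def PiE_iff)
      ultimately have "Suc (e i) = r i" by simp
      moreover have "?p * (mvar i ^ r i - (\<Sum>t<r i. mconst (c i t) * mvar i ^ t)) \<in> q"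
        using p rc[OF i] by (rule q_mult)
      ultimately have "mvar i * x - (\<Sum>t<r i. mconst (c i t) * mon (e(i := t))) \<in> q"
        unfolding x upd[OF i] by (simp add: right_diff_distrib sum_distrib_left mult_ac)
      moreover have "mvar i * x \<in> mpolys n" using i M \<open>x \<in> M\<close> by auto
      moreover have "(\<Sum>t<r i. mconst (c i t) * mon (e(i := t))) \<in> span_mod M"
        using in_span[OF i e(1)] by (intro span_mod_sum span_mod_mconst) auto
      ultimately show ?thesis using span_mod_cong by blast
    qed
  qed
  then show ?thesis using M by blast
qed

text \<open>In a spanning set of least cardinality a nontrivial relation would allow one member to
  be dropped.\<close>

lemma independent_spanning_set:
  "\<exists>M. finite M \<and> M \<subseteq> mpolys n \<and> mpolys n \<subseteq> span_mod M \<and>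
    (\<forall>c. (\<Sum>e\<in>M. mconst (c e) * e) \<in> q \<longrightarrow> (\<forall>e\<in>M. c e = 0))"
proof -
  define P where "P d \<longleftrightarrow> (\<exists>M. finite M \<and> M \<subseteq> mpolys n \<and> mpolys n \<subseteq> span_mod M \<and> card M = d)" for d
  have "\<exists>d. P d" using finite_spanning_set by (auto simp: P_def)
  then have "P (LEAST d. P d)" by (rule LeastI_ex)
  then obtain M where M: "finite M" "M \<subseteq> mpolys n" "mpolys n \<subseteq> span_mod M" "card M = (LEAST d. P d)"
    by (auto simp: P_def)
  have "c x = 0" if c: "(\<Sum>e\<in>M. mconst (c e) * e) \<in> q" and x: "x \<in> M" for c x
  proof (rule ccontr)
    assume nz: "c x \<noteq> 0"
    have "mpolys n \<subseteq> span_mod (M - {x})"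
    proof
      fix a :: "'k mpoly" assume a: "a \<in> mpolys n"
      then obtain b where b: "a - (\<Sum>e\<in>M. mconst (b e) * e) \<in> q" using M by (auto simp: span_mod_def)
      \<comment> \<open>Subtracting k times the relation kills the coefficient at x.\<close>
      define k where "k = b x / c x"
      have "mconst k * (\<Sum>e\<in>M. mconst (c e) * e) \<in> q" by (rule q_mult[OF _ c]) simp
      from q_add[OF b this] have "a - (\<Sum>e\<in>M. mconst (b e - k * c e) * e) \<in> q"
        by (simp add: mconst_diff mconst_mult left_diff_distrib sum_subtractf sum_distrib_left mult.assoc algebra_simps)
      moreover have "(\<Sum>e\<in>M. mconst (b e - k * c e) * e) = (\<Sum>e\<in>M - {x}. mconst (b e - k * c e) * e)"
        using M x nz by (simp add: sum.remove k_def)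
      ultimately show "a \<in> span_mod (M - {x})" using a
        by (auto simp: span_mod_def intro!: exI[of _ "\<lambda>e. b e - k * c e"])
    qed
    then have "P (card (M - {x}))" using M by (auto simp: P_def)
    then have "(LEAST d. P d) \<le> card (M - {x})" by (rule Least_le)
    then show False using M(4) card_Diff1_less[OF M(1) x] by simp
  qed
  then show ?thesis using M by blast
qed

text \<open>Independence makes the coefficients of an expansion unique, hence linear in the expanded
  polynomial; they are the functionals \<open>C\<close>.\<close>

lemma basis_exists:
  "\<exists>d E C. finite_quotient n q d E C \<and> (\<forall>i<d. \<forall>j<d. C i (E j) = (if i = j then 1 else 0))"
proof -
  obtain M where M: "finite M" "M \<subseteq> mpolys n" "mpolys n \<subseteq> span_mod M"
    and indep: "\<And>c e. (\<Sum>e\<in>M. mconst (c e) * e) \<in> q \<Longrightarrow> e \<in> M \<Longrightarrow> c e = 0"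
    using independent_spanning_set by blast
  obtain E where E: "bij_betw E {..<card M} M"
    using ex_bij_betw_nat_finite[OF M(1)] by (auto simp: atLeast0LessThan)
  have "\<forall>a. \<exists>c. a \<in> mpolys n \<longrightarrow> a - (\<Sum>e\<in>M. mconst (c e) * e) \<in> q"
    using M by (auto simp: span_mod_def)
  from choice[OF this] obtain c where c: "\<And>a. a \<in> mpolys n \<Longrightarrow> a - (\<Sum>e\<in>M. mconst (c a e) * e) \<in> q"
    by auto
  have unique: "c a e = b e" if a: "a \<in> mpolys n" "a - (\<Sum>e\<in>M. mconst (b e) * e) \<in> q" "e \<in> M" for a b e
  proof -
    have "(a - (\<Sum>e\<in>M. mconst (b e) * e)) - (a - (\<Sum>e\<in>M. mconst (c a e) * e)) \<in> q"
      by (rule q_diff[OF a(2) c[OF a(1)]])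
    then have "(\<Sum>e\<in>M. mconst (c a e - b e) * e) \<in> q"
      by (simp add: mconst_diff left_diff_distrib sum_subtractf)
    from indep[OF this a(3)] show ?thesis by simp
  qed
  have E_M: "E i \<in> M" if "i < card M" for i using E that by (auto simp: bij_betw_def)
  define C where "C i a = c a (E i)" for i a
  have sumE: "(\<Sum>i<card M. mconst (b (E i)) * E i) = (\<Sum>e\<in>M. mconst (b e) * e)" for b
    using sum.reindex_bij_betw[OF E, of "\<lambda>e. mconst (b e) * e"] by simp
  have "finite_quotient n q (card M) E C"
  proof
    show "q \<subseteq> mpolys n" "0 \<in> q" by (auto simp: q_in q_zero)
    show "a + b \<in> q" if "a \<in> q" "b \<in> q" for a b using that by (rule q_add)
    show "a * b \<in> q" if "a \<in> mpolys n" "b \<in> q" for a b using that by (rule q_mult)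
    show "E i \<in> mpolys n" if "i < card M" for i using E_M that M by auto
    show "C i (a + b) = C i a + C i b" if "i < card M" "a \<in> mpolys n" "b \<in> mpolys n" for i a b
      unfolding C_def
    proof (rule unique)
      show "a + b - (\<Sum>e\<in>M. mconst (c a e + c b e) * e) \<in> q"
        using q_add[OF c c, OF that(2,3)]
        by (simp add: mconst_add distrib_right sum.distrib algebra_simps)
    qed (use that E_M in auto)
    show "C i (mconst k * a) = k * C i a" if "i < card M" "a \<in> mpolys n" for i a k
      unfolding C_def
    proof (rule unique)
      have "mconst k * (a - (\<Sum>e\<in>M. mconst (c a e) * e)) \<in> q" using c that by (intro q_mult) auto
      then show "mconst k * a - (\<Sum>e\<in>M. mconst (k * c a e) * e) \<in> q"
        by (simp add: mconst_mult right_diff_distrib sum_distrib_left mult.assoc)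
    qed (use that E_M in auto)
    show "C i a = 0" if "i < card M" "a \<in> q" for i a
      unfolding C_def using that q_in E_M by (intro unique) auto
    show "a - (\<Sum>i<card M. mconst (C i a) * E i) \<in> q" if "a \<in> mpolys n" for a
      unfolding C_def sumE using c[OF that] .
  qed
  moreover have "C i (E j) = (if i = j then 1 else 0)" if "i < card M" "j < card M" for i j
  proof -
    have "(\<Sum>e\<in>M. mconst (if e = E j then 1 else 0) * e) = (\<Sum>e\<in>M. if e = E j then e else 0)"
      by (intro sum.cong) auto
    also have "\<dots> = E j" using M E_M that by simp
    finally have "c (E j) (E i) = (if E i = E j then 1 else 0)"
      using E_M that M q_zero by (intro unique) auto
    moreover have "E i = E j \<longleftrightarrow> i = j" using E that by (auto simp: bij_betw_def inj_on_def)
    ultimately show ?thesis by (simp add: C_def)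
  qed
  ultimately show ?thesis by blast
qed

text \<open>The generators are the reduction errors of 1 and of all x_i E_l. Modulo any ideal
  containing them every polynomial is a combination of the E_t. For a polynomial in q this
  combination lies in q as well, so its coefficients are 0.\<close>

lemma finitely_generated:
  "\<exists>G. finite G \<and> G \<subseteq> q \<and> (\<forall>I. poly_ideal n I \<and> G \<subseteq> I \<longrightarrow> q \<subseteq> I)"
proof -
  obtain d E C where fq: "finite_quotient n q d E C"
    and C_E: "\<And>i j. i < d \<Longrightarrow> j < d \<Longrightarrow> C i (E j) = (if i = j then 1 else 0)"
    using basis_exists by blast
  interpret fq: finite_quotient n q d E C by (rule fq)
  define \<rho> where "\<rho> a = a - (\<Sum>t<d. mconst (C t a) * E t)" for a
  define G where "G = insert (\<rho> 1) ((\<lambda>(i, l). \<rho> (mvar i * E l)) ` ({..<n} \<times> {..<d}))"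
  have "finite G" by (simp add: G_def)
  moreover have "G \<subseteq> q" by (auto simp: G_def \<rho>_def intro!: fq.C_expand mpolys_mult fq.E_in)
  moreover have "q \<subseteq> I" if I: "poly_ideal n I" and GI: "G \<subseteq> I" for I
  proof -
    \<comment> \<open>Reduction is taken modulo I \<inter> q instead of I: the combination of the
      E_t then stays in q along with the polynomial, as linear independence requires.\<close>
    define V where "V = {a \<in> mpolys n. \<exists>c. a - (\<Sum>t<d. mconst (c t) * E t) \<in> I \<inter> q}"
    note Iq = IntI[OF poly_idealD(3)[OF I] q_zero]
    have \<rho>: "\<rho> 1 \<in> I \<inter> q" "\<And>i l. i < n \<Longrightarrow> l < d \<Longrightarrow> \<rho> (mvar i * E l) \<in> I \<inter> q"
      using GI \<open>G \<subseteq> q\<close> by (auto simp: G_def)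
    have Ip: "poly_ideal n (I \<inter> q)" using I q by (auto simp: poly_ideal_def)
    have "\<forall>v\<in>V. a * v \<in> V" if "a \<in> mpolys n" for a
      using that
    proof (induction a rule: mpolys_induct)
      case (mconst k)
      show ?case
      proof
        fix v assume "v \<in> V"
        then obtain c where v: "v \<in> mpolys n" "v - (\<Sum>t<d. mconst (c t) * E t) \<in> I \<inter> q" by (auto simp: V_def)
        then have "mconst k * (v - (\<Sum>t<d. mconst (c t) * E t)) \<in> I \<inter> q"
          by (intro poly_idealD(5)[OF Ip]) auto
        then have "mconst k * v - (\<Sum>t<d. mconst (k * c t) * E t) \<in> I \<inter> q"
          by (simp add: mconst_mult right_diff_distrib sum_distrib_left mult.assoc)
        then show "mconst k * v \<in> V" using v unfolding V_def by auto
      qed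
    next
      case (mvar i)
      show ?case
      proof
        fix v assume "v \<in> V"
        then obtain c where v: "v \<in> mpolys n" "v - (\<Sum>t<d. mconst (c t) * E t) \<in> I \<inter> q" by (auto simp: V_def)
        then have "mvar i * (v - (\<Sum>t<d. mconst (c t) * E t)) \<in> I \<inter> q"
          using mvar by (intro poly_idealD(5)[OF Ip]) auto
        moreover have "(\<Sum>l<d. mconst (c l) * \<rho> (mvar i * E l)) \<in> I \<inter> q"
          using \<rho> mvar by (intro poly_ideal_sum[OF Ip] poly_idealD(5)[OF Ip]) auto
        ultimately have "mvar i * (v - (\<Sum>t<d. mconst (c t) * E t))
            + (\<Sum>l<d. mconst (c l) * \<rho> (mvar i * E l)) \<in> I \<inter> q" by (rule poly_idealD(4)[OF Ip])
        moreover have "(\<Sum>l<d. mconst (c l) * \<rho> (mvar i * E l))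
            = mvar i * (\<Sum>t<d. mconst (c t) * E t)
              - (\<Sum>t<d. mconst (\<Sum>l<d. c l * C t (mvar i * E l)) * E t)"
        proof -
          have mconst_sum: "mconst (\<Sum>l<d. g l) = (\<Sum>l<d. mconst (g l))" for g :: "nat \<Rightarrow> 'k"
            by (simp add: mconst_def poly_mapping_single_sum)
          have "(\<Sum>t<d. mconst (\<Sum>l<d. c l * C t (mvar i * E l)) * E t)
              = (\<Sum>l<d. mconst (c l) * (\<Sum>t<d. mconst (C t (mvar i * E l)) * E t))"
            unfolding mconst_sum sum_distrib_right sum_distrib_left
            by (subst sum.swap) (simp add: mconst_mult mult.assoc)
          then show ?thesis
            by (simp add: \<rho>_def right_diff_distrib sum_subtractf sum_distrib_left mult.left_commute)
        qed
        ultimately have "mvar i * v - (\<Sum>t<d. mconst (\<Sum>l<d. c l * C t (mvar i * E l)) * E t) \<in> I \<inter> q"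
          by (simp add: right_diff_distrib)
        then show "mvar i * v \<in> V" using v mvar unfolding V_def by auto
      qed
    next
      case (add a b)
      have "x + y \<in> V" if xy: "x \<in> V" "y \<in> V" for x y
      proof -
        from xy obtain c c' where xy': "x \<in> mpolys n" "y \<in> mpolys n"
          "x - (\<Sum>t<d. mconst (c t) * E t) \<in> I \<inter> q" "y - (\<Sum>t<d. mconst (c' t) * E t) \<in> I \<inter> q"
          by (auto simp: V_def)
        from poly_idealD(4)[OF Ip xy'(3,4)]
        have "x + y - (\<Sum>t<d. mconst (c t + c' t) * E t) \<in> I \<inter> q"
          by (simp add: mconst_add distrib_right sum.distrib algebra_simps)
        then show ?thesis using xy' unfolding V_def by auto
      qed
      then show ?case using add by (auto simp: distrib_right)
    qed (auto simp: mult.assoc)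
    moreover have "1 \<in> V" using \<rho>(1) by (auto simp: V_def \<rho>_def)
    ultimately have all: "a \<in> V" if "a \<in> mpolys n" for a using that by force
    show "q \<subseteq> I"
    proof
      fix a assume a: "a \<in> q"
      obtain c where c: "a - (\<Sum>t<d. mconst (c t) * E t) \<in> I \<inter> q" using all[OF q_in[OF a]] by (auto simp: V_def)
      then have "a - (a - (\<Sum>t<d. mconst (c t) * E t)) \<in> q" using q_diff[OF a] by blast
      then have s: "(\<Sum>t<d. mconst (c t) * E t) \<in> q" by simp
      have "c i = 0" if i: "i < d" for i
      proof -
        have "C i (\<Sum>t\<in>T. mconst (c t) * E t) = (\<Sum>t\<in>T. c t * C i (E t))" if "finite T" "T \<subseteq> {..<d}" for T
          using that
          by (induction T rule: finite_induct)
            (use i fq.functional_zero[OF fq.functional_C] in \<open>auto simp: fq.C_add fq.C_mconst fq.E_in subset_iff\<close>)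
        from this[of "{..<d}"] have "C i (\<Sum>t<d. mconst (c t) * E t) = (\<Sum>t<d. c t * C i (E t))" by simp
        also have "\<dots> = (\<Sum>t<d. if t = i then c t else 0)"
          using i C_E by (intro sum.cong refl) auto
        also have "\<dots> = c i" using i by simp
        finally show ?thesis using fq.C_q[OF i s] by simp
      qed
      then show "a \<in> I" using c by simp
    qed
  qed
  ultimately show ?thesis by blast
qed

end

context separable_point
begin

subsection \<open>Nakayama's lemma\<close>

text \<open>These are the contractions of ideals of the local ring k[x]_q. They allow arguments in
  the local ring to be carried out without fractions.\<close>

definition saturated_ideal :: "'k mpoly set \<Rightarrow> bool" where
  "saturated_ideal I \<longleftrightarrow> poly_ideal n I \<and> (\<forall>s\<in>mpolys n - q. \<forall>a\<in>mpolys n. s * a \<in> I \<longrightarrow> a \<in> I)"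

lemma not_q_mult: "s \<in> mpolys n - q \<Longrightarrow> t \<in> mpolys n - q \<Longrightarrow> s * t \<in> mpolys n - q"
  using q_prime by auto

text \<open>Generators are eliminated one at a time. In the relation for g the coefficient s - c_g
  is again outside q, so g is expressed through the other generators up to a unit of the local ring
  and can be substituted into their relations.\<close>

lemma nakayama_finite:
  assumes I: "saturated_ideal I" and "finite G" "G \<subseteq> mpolys n"
    and "\<And>g. g \<in> G \<Longrightarrow> \<exists>s\<in>mpolys n - q. \<exists>c\<in>G \<rightarrow> q. s * g - (\<Sum>h\<in>G. c h * h) \<in> I"
  shows "G \<subseteq> I"
  using assms(2-)
proof (induction G rule: finite_induct)
  case empty
  then show ?case by simp
next
  case (insert g G)
  have pI: "poly_ideal n I" and sat: "\<And>s a. s \<in> mpolys n - q \<Longrightarrow> a \<in> mpolys n \<Longrightarrow> s * a \<in> I \<Longrightarrow> a \<in> I"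
    using I by (auto simp: saturated_ideal_def)
  obtain s c where s: "s \<in> mpolys n - q" and c: "c \<in> insert g G \<rightarrow> q"
    and sg: "s * g - (\<Sum>h\<in>insert g G. c h * h) \<in> I" using insert.prems(2)[of g] by blast
  define t where "t = s - c g"
  have t: "t \<in> mpolys n - q"
  proof
    show "t \<in> mpolys n" using s c q_in by (auto simp: t_def)
    show "t \<notin> q"
    proof
      assume "t \<in> q"
      then have "t + c g \<in> q" using c by (intro q_add) auto
      then show False using s by (simp add: t_def)
    qed
  qed
  have tg: "t * g - (\<Sum>h\<in>G. c h * h) \<in> I"
    using sg insert.hyps by (simp add: t_def algebra_simps)
  have "G \<subseteq> I"
  proof (rule insert.IH)
    show "G \<subseteq> mpolys n" using insert.prems by auto
    fix x assume "x \<in> G"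
    then obtain s' c' where s': "s' \<in> mpolys n - q" and c': "c' \<in> insert g G \<rightarrow> q"
      and sx: "s' * x - (\<Sum>h\<in>insert g G. c' h * h) \<in> I" using insert.prems(2)[of x] by blast
    \<comment> \<open>The relation of x is multiplied by t, and c'(g) times the relation of g is
      added; this cancels the term in g.\<close>
    define b where "b h = c' g * c h + t * c' h" for h
    have "t * (s' * x - (\<Sum>h\<in>insert g G. c' h * h)) + c' g * (t * g - (\<Sum>h\<in>G. c h * h)) \<in> I"
      using t sx tg c' q_in by (intro poly_idealD(4,5)[OF pI]) auto
    moreover have "t * (s' * x - (\<Sum>h\<in>insert g G. c' h * h)) + c' g * (t * g - (\<Sum>h\<in>G. c h * h))
        = (t * s') * x - (\<Sum>h\<in>G. b h * h)"
      using insert.hyps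
      by (simp add: b_def distrib_right sum.distrib sum_distrib_left right_diff_distrib distrib_left mult_ac)
    moreover have "b \<in> G \<rightarrow> q" using c c' t q_in by (auto simp: b_def intro!: q_add q_mult)
    ultimately show "\<exists>s\<in>mpolys n - q. \<exists>c\<in>G \<rightarrow> q. s * x - (\<Sum>h\<in>G. c h * h) \<in> I"
      using not_q_mult[OF t s'] by (intro bexI[of _ "t * s'"] bexI[of _ b]) auto
  qed
  then have "(\<Sum>h\<in>G. c h * h) \<in> I"
    using c q_in by (intro poly_ideal_sum[OF pI] poly_idealD(5)[OF pI]) auto
  from poly_idealD(4)[OF pI tg this] have "t * g \<in> I" by simp
  then show ?case using \<open>G \<subseteq> I\<close> sat[OF t] insert.prems by auto
qed

text \<open>The hypothesis \<open>gen\<close> is applied to the saturation \<open>K\<close> of I +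
  q^2. That q lies in \<open>K\<close> is exactly what \<open>nakayama_finite\<close> asks of a
  finite set of generators of q.\<close>

lemma nakayama:
  assumes I: "saturated_ideal I"
    and gen: "\<And>K. saturated_ideal K \<Longrightarrow> I \<subseteq> K \<Longrightarrow> (\<And>a b. a \<in> q \<Longrightarrow> b \<in> q \<Longrightarrow> a * b \<in> K) \<Longrightarrow> q \<subseteq> K"
  shows "q \<subseteq> I"
proof -
  from finitely_generated obtain G
    where G: "finite G \<and> G \<subseteq> q \<and> (\<forall>I. poly_ideal n I \<and> G \<subseteq> I \<longrightarrow> q \<subseteq> I)" ..
  then have G_gen: "q \<subseteq> K" if "poly_ideal n K" "G \<subseteq> K" for K using that by blast
  from G have G: "finite G" "G \<subseteq> q" by auto
  have pI: "poly_ideal n I" and sat: "\<And>s a. s \<in> mpolys n - q \<Longrightarrow> a \<in> mpolys n \<Longrightarrow> s * a \<in> I \<Longrightarrow> a \<in> I"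
    using I by (auto simp: saturated_ideal_def)
  \<comment> \<open>The square of q is written as the combinations of the generators
    \<open>G\<close> with coefficients in q; the factor s saturates.\<close>
  define K where "K = {a \<in> mpolys n. \<exists>s\<in>mpolys n - q. \<exists>c\<in>G \<rightarrow> q. s * a - (\<Sum>h\<in>G. c h * h) \<in> I}"
  have one: "1 \<in> mpolys n - q" using one_notin_q by simp
  have KI: "a \<in> K" if "a \<in> mpolys n" "s \<in> mpolys n - q" "c \<in> G \<rightarrow> q" "s * a - (\<Sum>h\<in>G. c h * h) \<in> I" for a s c
    using that unfolding K_def by blast
  have I_K: "I \<subseteq> K"
  proof
    fix a assume "a \<in> I"
    then show "a \<in> K" using poly_idealD(2)[OF pI] q_zero by (intro KI[OF _ one, of a "\<lambda>_. 0"]) auto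
  qed
  have K: "poly_ideal n K"
    unfolding poly_ideal_def
  proof (intro conjI ballI)
    show "K \<subseteq> mpolys n" by (auto simp: K_def)
    show "0 \<in> K" using I_K poly_idealD(3)[OF pI] by blast
    fix a b :: "'k mpoly" assume "b \<in> K"
    then obtain t c' where b: "b \<in> mpolys n" "t \<in> mpolys n - q" "c' \<in> G \<rightarrow> q"
      "t * b - (\<Sum>h\<in>G. c' h * h) \<in> I" by (auto simp: K_def)
    {
      assume "a \<in> K"
      then obtain s c where a: "a \<in> mpolys n" "s \<in> mpolys n - q" "c \<in> G \<rightarrow> q"
        "s * a - (\<Sum>h\<in>G. c h * h) \<in> I" by (auto simp: K_def)
      define e where "e h = t * c h + s * c' h" for h
      have "t * (s * a - (\<Sum>h\<in>G. c h * h)) + s * (t * b - (\<Sum>h\<in>G. c' h * h)) \<in> I"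
        using a b by (intro poly_idealD(4,5)[OF pI]) auto
      moreover have "t * (s * a - (\<Sum>h\<in>G. c h * h)) + s * (t * b - (\<Sum>h\<in>G. c' h * h))
          = (s * t) * (a + b) - (\<Sum>h\<in>G. e h * h)"
        by (simp add: e_def distrib_right sum.distrib sum_distrib_left right_diff_distrib distrib_left mult_ac)
      moreover have "e \<in> G \<rightarrow> q" using a b by (auto simp: e_def intro!: q_add q_mult)
      ultimately show "a + b \<in> K" using a(1) b(1) by (intro KI[OF _ not_q_mult[OF a(2) b(2)], of _ e]) auto
    next
      assume a: "a \<in> mpolys n"
      have "a * (t * b - (\<Sum>h\<in>G. c' h * h)) \<in> I" using a b by (intro poly_idealD(5)[OF pI]) auto
      then have "t * (a * b) - (\<Sum>h\<in>G. (a * c' h) * h) \<in> I"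
        by (simp add: right_diff_distrib sum_distrib_left mult_ac)
      then show "a * b \<in> K" using a b(1,3) q_mult by (intro KI[OF _ b(2), of _ "\<lambda>h. a * c' h"]) auto
    }
  qed
  have "saturated_ideal K"
    unfolding saturated_ideal_def
  proof (intro conjI ballI impI K)
    fix s a :: "'k mpoly" assume s: "s \<in> mpolys n - q" and a: "a \<in> mpolys n" and "s * a \<in> K"
    then obtain t c where t: "t \<in> mpolys n - q" "c \<in> G \<rightarrow> q" "t * (s * a) - (\<Sum>h\<in>G. c h * h) \<in> I"
      by (auto simp: K_def)
    then show "a \<in> K" by (intro KI[OF a not_q_mult[OF t(1) s] t(2)]) (simp add: mult.assoc)
  qed
  moreover have "a * b \<in> K" if a: "a \<in> q" and b: "b \<in> q" for a b
  proof -
    \<comment> \<open>With a fixed, the b such that ab lies in \<open>K\<close> form an ideal, so it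
      suffices to test the generators.\<close>
    have "q \<subseteq> {b \<in> mpolys n. a * b \<in> K}"
    proof (rule G_gen)
      show "poly_ideal n {b \<in> mpolys n. a * b \<in> K}"
        using poly_idealD[OF K] by (auto simp: poly_ideal_def distrib_left mult.left_commute[of a])
      show "G \<subseteq> {b \<in> mpolys n. a * b \<in> K}"
      proof
        fix g assume g: "g \<in> G"
        have "(\<Sum>h\<in>G. (if h = g then a else 0) * h) = (\<Sum>h\<in>G. if h = g then a * h else 0)"
          by (intro sum.cong) auto
        also have "\<dots> = a * g" using G g by simp
        finally have "1 * (a * g) - (\<Sum>h\<in>G. (if h = g then a else 0) * h) \<in> I"
          using poly_idealD(3)[OF pI] by simp
        moreover have "(\<lambda>h. if h = g then a else 0) \<in> G \<rightarrow> q" using a q_zero by auto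
        moreover have "g \<in> mpolys n" "a * g \<in> mpolys n" using g G a q_in by auto
        ultimately show "g \<in> {b \<in> mpolys n. a * b \<in> K}" using KI[OF _ one] by blast
      qed
    qed
    then show ?thesis using b by auto
  qed
  ultimately have "q \<subseteq> K" using I_K by (intro gen)
  have "G \<subseteq> I"
    by (rule nakayama_finite[OF I G(1)]) (use G q_in \<open>q \<subseteq> K\<close> in \<open>auto simp: K_def subset_iff\<close>)
  then show ?thesis by (rule G_gen[OF pI])
qed

subsection \<open>The Jacobian criterion\<close>

lemma prod_cong_mod_q:
  assumes "finite Z" "\<And>i. i \<in> Z \<Longrightarrow> g i \<in> mpolys n" "\<And>i. i \<in> Z \<Longrightarrow> h i \<in> mpolys n"
    "\<And>i. i \<in> Z \<Longrightarrow> g i - h i \<in> q"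
  shows "(\<Prod>i\<in>Z. g i) - (\<Prod>i\<in>Z. h i) \<in> q"
  using assms
proof (induction Z rule: finite_induct)
  case empty
  then show ?case by (simp add: q_zero)
next
  case (insert x Z)
  have "g x * ((\<Prod>i\<in>Z. g i) - (\<Prod>i\<in>Z. h i)) + (\<Prod>i\<in>Z. h i) * (g x - h x) \<in> q"
    using insert by (intro q_add q_mult) auto
  then show ?case using insert by (simp add: algebra_simps)
qed

lemma det_cong_mod_q:
  assumes "\<And>i j. i < d \<Longrightarrow> j < d \<Longrightarrow> A i j \<in> mpolys n" "\<And>i j. i < d \<Longrightarrow> j < d \<Longrightarrow> B i j \<in> mpolys n"
    "\<And>i j. i < d \<Longrightarrow> j < d \<Longrightarrow> A i j - B i j \<in> q"
  shows "Determinant.det (mat d d (\<lambda>(i, j). A i j)) - Determinant.det (mat d d (\<lambda>(i, j). B i j)) \<in> q"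
proof -
  let ?p = "\<lambda>M \<pi>. \<Prod>i = 0..<d. mat d d (\<lambda>(i, j). M i j) $$ (i, \<pi> i) :: 'k mpoly"
  have "signof \<pi> * ?p A \<pi> - signof \<pi> * ?p B \<pi> \<in> q" if "\<pi> permutes {0..<d}" for \<pi>
  proof -
    have "?p A \<pi> - ?p B \<pi> \<in> q"
      using permutes_in_image[OF that] assms by (intro prod_cong_mod_q) auto
    then show ?thesis using q_uminus[of "?p A \<pi> - ?p B \<pi>"] by (auto simp: sign_def)
  qed
  then show ?thesis
    by (simp add: Determinant.det_def sum_subtractf[symmetric] del: index_mat) (intro q_sum, auto)
qed

lemma det_diag_mat: "Determinant.det (mat d d (\<lambda>(i, j). if i = j then a i else 0)) = (\<Prod>i<d. a i :: 'k mpoly)"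
proof -
  have "Determinant.det (mat d d (\<lambda>(i, j). if i = j then a i else 0))
      = prod_list (diag_mat (mat d d (\<lambda>(i, j). if i = j then a i else 0)))"
    by (rule det_upper_triangular) auto
  then show ?thesis
    by (simp add: diag_mat_def prod.list_conv_set_nth atLeast0LessThan)
qed

text \<open>If \<open>s\<^sub>i P\<^sub>i(x\<^sub>i) = \<Sum>\<^sub>j b\<^sub>i\<^sub>j f\<^sub>j\<close> with \<open>P\<^sub>i\<close> a separable polynomial that annihilates \<open>x\<^sub>i\<close> modulo \<open>q\<close>,
  then differentiation shows that the matrix \<open>b\<close> inverts the Jacobian matrix modulo \<open>q\<close> up to units.\<close>

lemma jacobian_notin_q:
  assumes f: "\<And>j. j < n \<Longrightarrow> f j \<in> q"
    and gen: "\<And>I. saturated_ideal I \<Longrightarrow> (\<And>j. j < n \<Longrightarrow> f j \<in> I) \<Longrightarrow> q \<subseteq> I"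
  shows "jacobian n f \<notin> q"
proof
  assume jac: "jacobian n f \<in> q"
  \<comment> \<open>The contraction of the ideal that the f_j generate in the local ring at q. Once
    it is known to be saturated, \<open>gen\<close> puts q inside it.\<close>
  define I where "I = {a \<in> mpolys n. \<exists>s\<in>mpolys n - q. \<exists>b. (\<forall>j<n. b j \<in> mpolys n) \<and> s * a = (\<Sum>j<n. b j * f j)}"
  have f_in: "\<And>j. j < n \<Longrightarrow> f j \<in> mpolys n" using f q_in by blast
  have one: "1 \<in> mpolys n - q" using one_notin_q by simp
  have II: "a \<in> I" if "a \<in> mpolys n" "s \<in> mpolys n - q" "\<forall>j<n. b j \<in> mpolys n" "s * a = (\<Sum>j<n. b j * f j)" for a s b
    using that unfolding I_def by blast
  have "saturated_ideal I"
    unfolding saturated_ideal_def poly_ideal_def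
  proof (intro conjI ballI impI)
    show "I \<subseteq> mpolys n" by (auto simp: I_def)
    show "0 \<in> I" by (rule II[OF _ one, of _ "\<lambda>_. 0"]) auto
  next
    fix a b :: "'k mpoly" assume "a \<in> I" "b \<in> I"
    then obtain s t x y where a: "a \<in> mpolys n" "s \<in> mpolys n - q" "\<forall>j<n. x j \<in> mpolys n" "s * a = (\<Sum>j<n. x j * f j)"
      and b: "b \<in> mpolys n" "t \<in> mpolys n - q" "\<forall>j<n. y j \<in> mpolys n" "t * b = (\<Sum>j<n. y j * f j)"
      by (auto simp: I_def)
    have "(s * t) * (a + b) = t * (s * a) + s * (t * b)" by (simp add: algebra_simps)
    also have "\<dots> = (\<Sum>j<n. (t * x j + s * y j) * f j)"
      unfolding a b by (simp add: sum_distrib_left sum.distrib distrib_right mult.assoc)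
    finally show "a + b \<in> I" using a(1-3) b(1-3)
      by (intro II[OF _ not_q_mult[OF a(2) b(2)], of _ "\<lambda>j. t * x j + s * y j"]) auto
  next
    fix a b :: "'k mpoly" assume a: "a \<in> mpolys n" and "b \<in> I"
    then obtain t y where b: "b \<in> mpolys n" "t \<in> mpolys n - q" "\<forall>j<n. y j \<in> mpolys n" "t * b = (\<Sum>j<n. y j * f j)"
      by (auto simp: I_def)
    have "t * (a * b) = a * (t * b)" by (simp add: mult_ac)
    also have "\<dots> = (\<Sum>j<n. (a * y j) * f j)" unfolding b by (simp add: sum_distrib_left mult.assoc)
    finally show "a * b \<in> I" using a b(1,3) by (intro II[OF _ b(2), of _ "\<lambda>j. a * y j"]) auto
  next
    fix s a :: "'k mpoly" assume s: "s \<in> mpolys n - q" and a: "a \<in> mpolys n" and "s * a \<in> I"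
    then obtain t x where t: "t \<in> mpolys n - q" "\<forall>j<n. x j \<in> mpolys n" "t * (s * a) = (\<Sum>j<n. x j * f j)"
      by (auto simp: I_def)
    then show "a \<in> I" by (intro II[OF a not_q_mult[OF t(1) s] t(2)]) (simp add: mult.assoc)
  qed
  moreover have "f j \<in> I" if "j < n" for j
  proof -
    have "(\<Sum>i<n. (if i = j then 1 else 0) * f i) = (\<Sum>i<n. if i = j then f i else 0)" by (intro sum.cong) auto
    also have "\<dots> = 1 * f j" using that by simp
    finally show ?thesis by (intro II[OF f_in[OF that] one, of "\<lambda>i. if i = j then 1 else 0"]) auto
  qed
  ultimately have qI: "q \<subseteq> I" by (rule gen)
  \<comment> \<open>\<open>P\<close> will be a separable polynomial in the single variable x_i,
    which \<open>s\<close> multiplies into the ideal of the f_j; only its i-th partial derivative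
    survives.\<close>
  define Q where "Q i P s b \<longleftrightarrow> P \<in> q \<and> s \<in> mpolys n - q \<and> (\<forall>j<n. b j \<in> mpolys n) \<and>
      s * P = (\<Sum>j<n. b j * f j) \<and> partial_deriv i P \<notin> q \<and> (\<forall>k. k \<noteq> i \<longrightarrow> partial_deriv k P = 0)"
    for i P s and b :: "nat \<Rightarrow> 'k mpoly"
  have "\<exists>P s b. Q i P s b" if i: "i < n" for i
  proof -
    obtain r c where rc: "(\<Sum>t<r. mconst (c t) * mvar i ^ t) \<in> q"
      "(\<Sum>t<r. of_nat t * mconst (c t) * mvar i ^ (t - 1)) \<notin> q" using separable[of "mvar i"] i by auto
    have "partial_deriv k (\<Sum>t<r. mconst (c t) * mvar i ^ t)
        = (if k = i then (\<Sum>t<r. of_nat t * mconst (c t) * mvar i ^ (t - 1)) else 0)" for k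
      by (simp add: partial_deriv_sum partial_deriv_mult partial_deriv_power partial_deriv_mvar mult_ac)
    note dP = this
    have "(\<Sum>t<r. mconst (c t) * mvar i ^ t) \<in> I" using rc(1) qI by blast
    then obtain s b where "s \<in> mpolys n - q" "\<forall>j<n. b j \<in> mpolys n"
      "s * (\<Sum>t<r. mconst (c t) * mvar i ^ t) = (\<Sum>j<n. b j * f j)" by (auto simp: I_def)
    then have "Q i (\<Sum>t<r. mconst (c t) * mvar i ^ t) s b"
      using rc by (simp add: Q_def dP)
    then show ?thesis by blast
  qed
  then obtain P s b where Q: "\<And>i. i < n \<Longrightarrow> Q i (P i) (s i) (b i)" by metis
  have P: "P i \<in> q" and s: "s i \<in> mpolys n - q" and b: "\<And>j. j < n \<Longrightarrow> b i j \<in> mpolys n"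
    and eq: "s i * P i = (\<Sum>j<n. b i j * f j)" and dP: "partial_deriv i (P i) \<notin> q"
      "\<And>k. k \<noteq> i \<Longrightarrow> partial_deriv k (P i) = 0" if "i < n" for i
    using Q[OF that] by (auto simp: Q_def)
  \<comment> \<open>The diagonal entries, modulo q, of the product of \<open>b\<close> with the
    Jacobian matrix; the other entries lie in q.\<close>
  define D where "D i = s i * partial_deriv i (P i)" for i
  have D: "D i \<in> mpolys n" "D i \<notin> q" if "i < n" for i
  proof -
    have "partial_deriv i (P i) \<in> mpolys n - q" "s i \<in> mpolys n - q"
      using s[OF that] dP(1)[OF that] partial_deriv_mpolys[OF q_in[OF P[OF that]]] by auto
    from not_q_mult[OF this(2,1)] show "D i \<in> mpolys n" "D i \<notin> q" by (auto simp: D_def)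
  qed
  let ?B = "mat n n (\<lambda>(i, j). b i j)" and ?J = "mat n n (\<lambda>(i, j). partial_deriv j (f i))"
  have BJ: "?B * ?J = mat n n (\<lambda>(i, k). \<Sum>j<n. b i j * partial_deriv k (f j))"
    by (intro eq_matI) (auto simp: scalar_prod_def atLeast0LessThan)
  have "(\<Sum>j<n. b i j * partial_deriv k (f j)) - (if i = k then D i else 0) \<in> q" if "i < n" "k < n" for i k
  proof -
    \<comment> \<open>Both sides of \<open>eq\<close> are differentiated. The terms in which P_i or
      f_j remains undifferentiated lie in q.\<close>
    have "partial_deriv k (s i) * P i + s i * partial_deriv k (P i)
        = (\<Sum>j<n. partial_deriv k (b i j) * f j) + (\<Sum>j<n. b i j * partial_deriv k (f j))"
      using arg_cong[OF eq[OF that(1)], of "partial_deriv k"]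
      by (simp add: partial_deriv_sum partial_deriv_mult sum.distrib)
    moreover have "s i * partial_deriv k (P i) = (if i = k then D i else 0)"
      using dP(2)[OF that(1)] by (auto simp: D_def)
    ultimately have "(\<Sum>j<n. b i j * partial_deriv k (f j)) - (if i = k then D i else 0)
        = partial_deriv k (s i) * P i - (\<Sum>j<n. partial_deriv k (b i j) * f j)"
      by (simp add: algebra_simps)
    also have "\<dots> \<in> q"
    proof (intro q_diff q_mult q_sum partial_deriv_mpolys)
      show "s i \<in> mpolys n" "P i \<in> q" using s P that by auto
      show "b i j \<in> mpolys n" "f j \<in> q" if "j \<in> {..<n}" for j using b f that \<open>i < n\<close> by auto
    qed
    finally show ?thesis .
  qed
  then have "Determinant.det (?B * ?J) - Determinant.det (mat n n (\<lambda>(i, j). if i = j then D i else 0)) \<in> q"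
    unfolding BJ
    by (intro det_cong_mod_q mpolys_sum mpolys_mult b partial_deriv_mpolys f_in) (auto simp: D(1))
  moreover have "Determinant.det (?B * ?J) = Determinant.det ?B * jacobian n f"
    unfolding jacobian_def by (intro Determinant.det_mult) auto
  moreover have "Determinant.det ?B * jacobian n f \<in> q"
    by (intro q_mult mpolys_det jac b)
  ultimately have "Determinant.det ?B * jacobian n f - (\<Prod>i<n. D i) \<in> q"
    "Determinant.det ?B * jacobian n f \<in> q" by (simp_all add: det_diag_mat)
  from q_diff[OF this(2,1)] have "(\<Prod>i<n. D i) \<in> q" by simp
  \<comment> \<open>A product of elements outside a prime ideal stays outside, against the
    membership just derived.\<close>
  moreover have "(\<Prod>i\<in>Z. D i) \<notin> q" if "Z \<subseteq> {..<n}" for Z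
    using finite_subset[OF that finite_lessThan] that
  proof (induction Z rule: finite_induct)
    case (insert i Z)
    have "D i \<in> mpolys n" "D i \<notin> q" using insert.prems D by auto
    moreover have "(\<Prod>i\<in>Z. D i) \<in> mpolys n" using insert.prems D(1) by (intro mpolys_prod) auto
    ultimately have "D i * (\<Prod>i\<in>Z. D i) \<notin> q" using q_prime insert by blast
    then show ?case using insert.hyps by simp
  qed (simp add: one_notin_q)
  ultimately show False by blast
qed

end

section \<open>Bilinear forms\<close>

subsection \<open>Linear isomorphisms\<close>

definition lin_iso :: "('a, 'c) ring_scheme \<Rightarrow> ('a, 'm) module \<Rightarrow> ('a, 'n) module \<Rightarrow> ('m \<Rightarrow> 'n) \<Rightarrow> bool" where
  "lin_iso F M N g \<longleftrightarrow> bij_betw g (carrier M) (carrier N) \<and>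
     (\<forall>x\<in>carrier M. \<forall>y\<in>carrier M. g (x \<oplus>\<^bsub>M\<^esub> y) = g x \<oplus>\<^bsub>N\<^esub> g y) \<and>
     (\<forall>a\<in>carrier F. \<forall>x\<in>carrier M. g (a \<odot>\<^bsub>M\<^esub> x) = a \<odot>\<^bsub>N\<^esub> g x)"

lemma lin_isoD:
  assumes "lin_iso F M N g"
  shows "bij_betw g (carrier M) (carrier N)" "x \<in> carrier M \<Longrightarrow> g x \<in> carrier N"
    "x \<in> carrier M \<Longrightarrow> y \<in> carrier M \<Longrightarrow> g (x \<oplus>\<^bsub>M\<^esub> y) = g x \<oplus>\<^bsub>N\<^esub> g y"
    "a \<in> carrier F \<Longrightarrow> x \<in> carrier M \<Longrightarrow> g (a \<odot>\<^bsub>M\<^esub> x) = a \<odot>\<^bsub>N\<^esub> g x"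
  using assms by (auto simp: lin_iso_def bij_betw_def)

lemma lin_iso_surj: "lin_iso F M N g \<Longrightarrow> y \<in> carrier N \<Longrightarrow> \<exists>x\<in>carrier M. y = g x"
  by (auto simp: lin_iso_def bij_betw_def)

lemma isometric_iff:
  "isometric F (M, b) (N, c) \<longleftrightarrow>
    (\<exists>g. lin_iso F M N g \<and> (\<forall>x\<in>carrier M. \<forall>y\<in>carrier M. c (g x) (g y) = b x y))"
  by (auto simp: isometric_def lin_iso_def)

lemma lin_iso_comp: "lin_iso F M N g \<Longrightarrow> lin_iso F N P h \<Longrightarrow> lin_iso F M P (h \<circ> g)"
  using bij_betw_trans[of g "carrier M" "carrier N" h "carrier P"] lin_isoD(2)[of F M N g]
  by (simp add: lin_iso_def)

lemma lin_iso_inv: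
  assumes M: "Module.module F M" and g: "lin_iso F M N g"
  shows "lin_iso F N M (inv_into (carrier M) g)"
proof -
  interpret Module.module F M by fact
  let ?h = "inv_into (carrier M) g"
  have bij: "bij_betw ?h (carrier N) (carrier M)" using lin_isoD(1)[OF g] by (rule bij_betw_inv_into)
  have gh: "g (?h y) = y" if "y \<in> carrier N" for y
    using lin_isoD(1)[OF g] that by (rule bij_betw_inv_into_right)
  have hg: "?h (g x) = x" if "x \<in> carrier M" for x
    using lin_isoD(1)[OF g] that by (rule bij_betw_inv_into_left)
  have h: "?h y \<in> carrier M" if "y \<in> carrier N" for y using bij that by (rule bij_betw_apply)
  have "?h (y \<oplus>\<^bsub>N\<^esub> y') = ?h y \<oplus>\<^bsub>M\<^esub> ?h y'" if "y \<in> carrier N" "y' \<in> carrier N" for y y'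
    using hg[of "?h y \<oplus>\<^bsub>M\<^esub> ?h y'"] lin_isoD(3)[OF g h h, OF that] gh that h by simp
  moreover have "?h (a \<odot>\<^bsub>N\<^esub> y) = a \<odot>\<^bsub>M\<^esub> ?h y" if "a \<in> carrier F" "y \<in> carrier N" for a y
    using hg[of "a \<odot>\<^bsub>M\<^esub> ?h y"] lin_isoD(4)[OF g that(1) h, OF that(2)] gh that h by simp
  ultimately show ?thesis using bij by (simp add: lin_iso_def)
qed

lemma std_space_simps [simp]:
  "carrier (std_space F n) = {..<n} \<rightarrow>\<^sub>E carrier F" "\<zero>\<^bsub>std_space F n\<^esub> = (\<lambda>i\<in>{..<n}. \<zero>\<^bsub>F\<^esub>)"
  "x \<oplus>\<^bsub>std_space F n\<^esub> y = (\<lambda>i\<in>{..<n}. x i \<oplus>\<^bsub>F\<^esub> y i)"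
  "a \<odot>\<^bsub>std_space F n\<^esub> x = (\<lambda>i\<in>{..<n}. a \<otimes>\<^bsub>F\<^esub> x i)"
  by (simp_all add: std_space_def)

lemma module_std_space:
  assumes "cring F"
  shows "Module.module F (std_space F n)"
proof -
  interpret cring F by fact
  have mem: "x i \<in> carrier F" if "x \<in> {..<n} \<rightarrow>\<^sub>E carrier F" "i < n" for x i
    using that by (auto simp: PiE_iff)
  have restr: "(\<lambda>i\<in>{..<n}. u i) = x" if "x \<in> {..<n} \<rightarrow>\<^sub>E carrier F" "\<And>i. i < n \<Longrightarrow> u i = x i" for x u
  proof -
    have "restrict u {..<n} = restrict x {..<n}" by (rule restrict_ext) (simp add: that)
    then show ?thesis by (simp add: PiE_restrict[OF that(1)])
  qed
  show ?thesis
  proof (rule moduleI)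
    show "abelian_group (std_space F n)"
    proof (rule abelian_groupI)
      fix x assume x: "x \<in> carrier (std_space F n)"
      have "(\<lambda>i\<in>{..<n}. (\<lambda>i\<in>{..<n}. \<ominus>\<^bsub>F\<^esub> x i) i \<oplus>\<^bsub>F\<^esub> x i) = (\<lambda>i\<in>{..<n}. \<zero>\<^bsub>F\<^esub>)"
        by (rule restrict_ext) (use x in \<open>simp add: mem l_neg\<close>)
      moreover have "(\<lambda>i\<in>{..<n}. \<ominus>\<^bsub>F\<^esub> x i) \<in> {..<n} \<rightarrow>\<^sub>E carrier F" using x mem by simp
      ultimately show "\<exists>y\<in>carrier (std_space F n). y \<oplus>\<^bsub>std_space F n\<^esub> x = \<zero>\<^bsub>std_space F n\<^esub>"
        unfolding std_space_simps by blast
      show "\<zero>\<^bsub>std_space F n\<^esub> \<oplus>\<^bsub>std_space F n\<^esub> x = x"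
        unfolding std_space_simps by (rule restr) (use x in \<open>simp_all add: mem\<close>)
      fix y assume y: "y \<in> carrier (std_space F n)"
      show "x \<oplus>\<^bsub>std_space F n\<^esub> y = y \<oplus>\<^bsub>std_space F n\<^esub> x"
        unfolding std_space_simps by (rule restrict_ext) (use x y in \<open>simp add: mem a_comm\<close>)
      fix z assume z: "z \<in> carrier (std_space F n)"
      show "x \<oplus>\<^bsub>std_space F n\<^esub> y \<oplus>\<^bsub>std_space F n\<^esub> z = x \<oplus>\<^bsub>std_space F n\<^esub> (y \<oplus>\<^bsub>std_space F n\<^esub> z)"
        unfolding std_space_simps by (rule restrict_ext) (use x y z in \<open>simp add: mem a_assoc\<close>)
    qed (simp_all add: mem)
    fix x assume x: "x \<in> carrier (std_space F n)"
    show "\<one>\<^bsub>F\<^esub> \<odot>\<^bsub>std_space F n\<^esub> x = x"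
      unfolding std_space_simps by (rule restr) (use x in \<open>simp_all add: mem\<close>)
  qed (unfold std_space_simps, simp_all add: mem l_distr r_distr m_assoc assms cong: restrict_cong)
qed

lemma lincomb_linear:
  assumes "Module.module F M" "e \<in> {..<n} \<rightarrow> carrier M"
  shows "a \<in> carrier (std_space F n) \<Longrightarrow> lincomb M n a e \<in> carrier M"
    "a \<in> carrier (std_space F n) \<Longrightarrow> b \<in> carrier (std_space F n) \<Longrightarrow>
      lincomb M n (a \<oplus>\<^bsub>std_space F n\<^esub> b) e = lincomb M n a e \<oplus>\<^bsub>M\<^esub> lincomb M n b e"
    "c \<in> carrier F \<Longrightarrow> a \<in> carrier (std_space F n) \<Longrightarrow>
      lincomb M n (c \<odot>\<^bsub>std_space F n\<^esub> a) e = c \<odot>\<^bsub>M\<^esub> lincomb M n a e"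
proof -
  interpret Module.module F M by fact
  have e: "e i \<in> carrier M" if "i < n" for i using assms(2) that by auto
  have mem: "x i \<in> carrier F" if "x \<in> {..<n} \<rightarrow>\<^sub>E carrier F" "i < n" for x i
    using that by (auto simp: PiE_iff)
  show "a \<in> carrier (std_space F n) \<Longrightarrow> lincomb M n a e \<in> carrier M"
    unfolding lincomb_def by (intro M.finsum_closed) (auto simp: e mem)
  show "lincomb M n (a \<oplus>\<^bsub>std_space F n\<^esub> b) e = lincomb M n a e \<oplus>\<^bsub>M\<^esub> lincomb M n b e"
    if "a \<in> carrier (std_space F n)" "b \<in> carrier (std_space F n)"
  proof -
    have "lincomb M n (a \<oplus>\<^bsub>std_space F n\<^esub> b) e
        = (\<Oplus>\<^bsub>M\<^esub>i\<in>{..<n}. a i \<odot>\<^bsub>M\<^esub> e i \<oplus>\<^bsub>M\<^esub> b i \<odot>\<^bsub>M\<^esub> e i)"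
      unfolding lincomb_def using that by (intro M.finsum_cong') (auto simp: e mem smult_l_distr)
    also have "\<dots> = lincomb M n a e \<oplus>\<^bsub>M\<^esub> lincomb M n b e"
      unfolding lincomb_def using that by (intro M.finsum_addf) (auto simp: e mem)
    finally show ?thesis .
  qed
  show "lincomb M n (c \<odot>\<^bsub>std_space F n\<^esub> a) e = c \<odot>\<^bsub>M\<^esub> lincomb M n a e"
    if "c \<in> carrier F" "a \<in> carrier (std_space F n)"
  proof -
    have "lincomb M n (c \<odot>\<^bsub>std_space F n\<^esub> a) e = (\<Oplus>\<^bsub>M\<^esub>i\<in>{..<n}. c \<odot>\<^bsub>M\<^esub> (a i \<odot>\<^bsub>M\<^esub> e i))"
      unfolding lincomb_def using that by (intro M.finsum_cong') (auto simp: e mem smult_assoc1)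
    also have "\<dots> = c \<odot>\<^bsub>M\<^esub> lincomb M n a e"
      unfolding lincomb_def using that by (intro finsum_smult_ldistr[symmetric]) (auto simp: e mem)
    finally show ?thesis .
  qed
qed

lemma basis_lin_iso:
  assumes "Module.module F M" "is_basis F M n e"
  shows "lin_iso F (std_space F n) M (\<lambda>a. lincomb M n a e)"
proof -
  have e: "e \<in> {..<n} \<rightarrow> carrier M"
    and ex: "\<And>v. v \<in> carrier M \<Longrightarrow> \<exists>!a. a \<in> {..<n} \<rightarrow>\<^sub>E carrier F \<and> v = lincomb M n a e"
    using assms(2) by (auto simp: is_basis_def)
  note l = lincomb_linear[OF assms(1) e]
  have "inj_on (\<lambda>a. lincomb M n a e) ({..<n} \<rightarrow>\<^sub>E carrier F)"
    using ex l(1) by (intro inj_onI) (metis std_space_simps(1))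
  moreover have "(\<lambda>a. lincomb M n a e) ` ({..<n} \<rightarrow>\<^sub>E carrier F) = carrier M"
  proof (intro subset_antisym subsetI)
    fix v assume "v \<in> carrier M"
    from ex1_implies_ex[OF ex[OF this]]
    show "v \<in> (\<lambda>a. lincomb M n a e) ` ({..<n} \<rightarrow>\<^sub>E carrier F)" by blast
  qed (use l(1) in auto)
  ultimately show ?thesis unfolding lin_iso_def bij_betw_def using l(2,3) by simp
qed

definition unit_vector :: "('a, 'c) ring_scheme \<Rightarrow> nat \<Rightarrow> nat \<Rightarrow> nat \<Rightarrow> 'a" where
  "unit_vector F n i = (\<lambda>j\<in>{..<n}. if j = i then \<one>\<^bsub>F\<^esub> else \<zero>\<^bsub>F\<^esub>)"

lemma lin_iso_lincomb:
  assumes M: "Module.module F M" and g: "lin_iso F (std_space F n) M g" and a: "a \<in> {..<n} \<rightarrow>\<^sub>E carrier F"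
  shows "lincomb M n a (\<lambda>i. g (unit_vector F n i)) = g a"
proof -
  interpret Module.module F M by fact
  interpret S: Module.module F "std_space F n" by (rule module_std_space) (rule R.is_cring)
  have u: "unit_vector F n i \<in> {..<n} \<rightarrow>\<^sub>E carrier F" for i by (auto simp: unit_vector_def)
  have gu: "g (unit_vector F n i) \<in> carrier M" for i using lin_isoD(2)[OF g] u by auto
  have mem: "a i \<in> carrier F" if "i < n" for i using that a by (auto simp: PiE_iff)
  have g0: "g (\<lambda>i\<in>{..<n}. \<zero>\<^bsub>F\<^esub>) = \<zero>\<^bsub>M\<^esub>"
  proof -
    have "\<zero>\<^bsub>F\<^esub> \<odot>\<^bsub>std_space F n\<^esub> a = (\<lambda>i\<in>{..<n}. \<zero>\<^bsub>F\<^esub>)"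
      unfolding std_space_simps by (rule restrict_ext) (simp add: mem)
    moreover have "a \<in> carrier (std_space F n)" using a by simp
    ultimately show ?thesis
      using lin_isoD(4)[OF g R.zero_closed, of a] smult_l_null[OF lin_isoD(2)[OF g, of a]] by metis
  qed
  \<comment> \<open>\<open>p k\<close> keeps the first k coordinates of \<open>a\<close> and
    replaces the others by zero, so that \<open>a\<close> is built up by one unit vector at a
    time.\<close>
  define p where "p k = (\<lambda>i\<in>{..<n}. if i < k then a i else \<zero>\<^bsub>F\<^esub>)" for k :: nat
  have p: "p k \<in> carrier (std_space F n)" for k unfolding p_def std_space_simps using mem by simp
  have p0: "p 0 = (\<lambda>i\<in>{..<n}. \<zero>\<^bsub>F\<^esub>)" unfolding p_def by (rule restrict_ext) simp
  have pn: "p n = a"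
  proof -
    have "p n = restrict a {..<n}" unfolding p_def by (rule restrict_ext) simp
    then show ?thesis by (simp add: PiE_restrict[OF a])
  qed
  have p_Suc: "a k \<odot>\<^bsub>std_space F n\<^esub> unit_vector F n k \<oplus>\<^bsub>std_space F n\<^esub> p k = p (Suc k)" if "k < n" for k
    unfolding std_space_simps p_def
    by (rule restrict_ext) (use that mem in \<open>simp add: unit_vector_def less_Suc_eq\<close>)
  have "(\<Oplus>\<^bsub>M\<^esub>i\<in>{..<k}. a i \<odot>\<^bsub>M\<^esub> g (unit_vector F n i)) = g (p k)" if "k \<le> n" for k
    using that
  proof (induction k)
    case 0
    show ?case by (simp only: p0 g0 lessThan_0 M.finsum_empty)
  next
    case (Suc k)
    have ak: "a k \<in> carrier F" and uk: "unit_vector F n k \<in> carrier (std_space F n)"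
      using Suc.prems mem u by simp_all
    have "(\<Oplus>\<^bsub>M\<^esub>i\<in>{..<Suc k}. a i \<odot>\<^bsub>M\<^esub> g (unit_vector F n i))
        = a k \<odot>\<^bsub>M\<^esub> g (unit_vector F n k) \<oplus>\<^bsub>M\<^esub> g (p k)"
      using Suc mem gu by (simp add: lessThan_Suc Pi_def)
    also have "\<dots> = g (a k \<odot>\<^bsub>std_space F n\<^esub> unit_vector F n k \<oplus>\<^bsub>std_space F n\<^esub> p k)"
      using lin_isoD(4)[OF g ak uk] lin_isoD(3)[OF g S.smult_closed[OF ak uk] p] by simp
    finally show ?case using p_Suc Suc.prems by simp
  qed
  from this[of n] show ?thesis unfolding lincomb_def by (simp add: pn)
qed

lemma lin_iso_basis:
  assumes M: "Module.module F M" and g: "lin_iso F (std_space F n) M g"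
  shows "is_basis F M n (\<lambda>i. g (unit_vector F n i))"
  unfolding is_basis_def
proof (intro conjI ballI)
  interpret Module.module F M by fact
  show "(\<lambda>i. g (unit_vector F n i)) \<in> {..<n} \<rightarrow> carrier M"
    using lin_isoD(2)[OF g] by (auto simp: unit_vector_def)
  fix v assume "v \<in> carrier M"
  then obtain a where a: "a \<in> {..<n} \<rightarrow>\<^sub>E carrier F" "v = g a" using lin_iso_surj[OF g] by auto
  show "\<exists>!a. a \<in> {..<n} \<rightarrow>\<^sub>E carrier F \<and> v = lincomb M n a (\<lambda>i. g (unit_vector F n i))"
  proof (rule ex1I[of _ a])
    fix b assume "b \<in> {..<n} \<rightarrow>\<^sub>E carrier F \<and> v = lincomb M n b (\<lambda>i. g (unit_vector F n i))"
    then show "b = a" using a lin_iso_lincomb[OF M g, of b] lin_isoD(1)[OF g]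
      by (auto simp: bij_betw_def inj_on_def)
  qed (use a lin_iso_lincomb[OF M g] in auto)
qed

text \<open>Bases are replaced by isomorphisms from a standard space, which are transported by
  composition.\<close>

lemma has_basis_iff:
  assumes "Module.module F M"
  shows "(\<exists>n e. is_basis F M n e) \<longleftrightarrow> (\<exists>n g. lin_iso F (std_space F n) M g)"
  using basis_lin_iso[OF assms] lin_iso_basis[OF assms] by blast

subsection \<open>Isometry classes\<close>

lemma nondeg_symm_formD:
  assumes "nondeg_symm_form F (M, b)"
  shows "Module.module F M" "\<exists>n g. lin_iso F (std_space F n) M g"
    "x \<in> carrier M \<Longrightarrow> y \<in> carrier M \<Longrightarrow> b x y \<in> carrier F"
    "x \<in> carrier M \<Longrightarrow> y \<in> carrier M \<Longrightarrow> b x y = b y x"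
    "x \<in> carrier M \<Longrightarrow> y \<in> carrier M \<Longrightarrow> z \<in> carrier M \<Longrightarrow> b (x \<oplus>\<^bsub>M\<^esub> y) z = b x z \<oplus>\<^bsub>F\<^esub> b y z"
    "a \<in> carrier F \<Longrightarrow> x \<in> carrier M \<Longrightarrow> y \<in> carrier M \<Longrightarrow> b (a \<odot>\<^bsub>M\<^esub> x) y = a \<otimes>\<^bsub>F\<^esub> b x y"
    "x \<in> carrier M \<Longrightarrow> (\<And>y. y \<in> carrier M \<Longrightarrow> b x y = \<zero>\<^bsub>F\<^esub>) \<Longrightarrow> x = \<zero>\<^bsub>M\<^esub>"
  using assms has_basis_iff[of F M] by (simp_all add: nondeg_symm_form_def)

lemma nondeg_symm_formI:
  assumes "Module.module F M" "lin_iso F (std_space F n) M g"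
    "\<And>x y. x \<in> carrier M \<Longrightarrow> y \<in> carrier M \<Longrightarrow> b x y \<in> carrier F"
    "\<And>x y. x \<in> carrier M \<Longrightarrow> y \<in> carrier M \<Longrightarrow> b x y = b y x"
    "\<And>x y z. x \<in> carrier M \<Longrightarrow> y \<in> carrier M \<Longrightarrow> z \<in> carrier M \<Longrightarrow> b (x \<oplus>\<^bsub>M\<^esub> y) z = b x z \<oplus>\<^bsub>F\<^esub> b y z"
    "\<And>a x y. a \<in> carrier F \<Longrightarrow> x \<in> carrier M \<Longrightarrow> y \<in> carrier M \<Longrightarrow> b (a \<odot>\<^bsub>M\<^esub> x) y = a \<otimes>\<^bsub>F\<^esub> b x y"
    "\<And>x. x \<in> carrier M \<Longrightarrow> (\<And>y. y \<in> carrier M \<Longrightarrow> b x y = \<zero>\<^bsub>F\<^esub>) \<Longrightarrow> x = \<zero>\<^bsub>M\<^esub>"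
  shows "nondeg_symm_form F (M, b)"
  using assms has_basis_iff[of F M] by (auto simp: nondeg_symm_form_def)

lemma isometric_refl: "isometric F A A"
proof (cases A)
  case (Pair M b)
  have "lin_iso F M M id" by (simp add: lin_iso_def)
  then show ?thesis unfolding Pair isometric_iff by (intro exI[of _ id]) simp
qed

lemma isometric_trans: "isometric F A B \<Longrightarrow> isometric F B C \<Longrightarrow> isometric F A C"
proof (cases A; cases B; cases C)
  fix M b N c P d
  assume eqs: "A = (M, b)" "B = (N, c)" "C = (P, d)" and "isometric F A B" "isometric F B C"
  then obtain g h where g: "lin_iso F M N g" "\<forall>x\<in>carrier M. \<forall>y\<in>carrier M. c (g x) (g y) = b x y"
    and h: "lin_iso F N P h" "\<forall>x\<in>carrier N. \<forall>y\<in>carrier N. d (h x) (h y) = c x y"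
    by (auto simp: isometric_iff)
  then show ?thesis unfolding eqs isometric_iff
    using lin_iso_comp[OF g(1) h(1)] lin_isoD(2)[OF g(1)] by (intro exI[of _ "h \<circ> g"]) simp
qed

lemma isometric_sym:
  assumes "nondeg_symm_form F A" "isometric F A B"
  shows "isometric F B A"
proof (cases A; cases B)
  fix M b N c assume eqs: "A = (M, b)" "B = (N, c)"
  with assms obtain g where g: "lin_iso F M N g" "\<forall>x\<in>carrier M. \<forall>y\<in>carrier M. c (g x) (g y) = b x y"
    by (auto simp: isometric_iff)
  have M: "Module.module F M" using assms eqs nondeg_symm_formD by blast
  let ?h = "inv_into (carrier M) g"
  have "b (?h x) (?h y) = c x y" if "x \<in> carrier N" "y \<in> carrier N" for x y
    using g(2) bij_betw_inv_into_right[OF lin_isoD(1)[OF g(1)]] lin_isoD(2)[OF lin_iso_inv[OF M g(1)]] that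
    by metis
  then show ?thesis unfolding eqs isometric_iff using lin_iso_inv[OF M g(1)] by blast
qed

lemma isometric_nondeg:
  assumes "nondeg_symm_form F A" "isometric F A (N, c)" "Module.module F N"
  shows "nondeg_symm_form F (N, c)"
proof (cases A)
  fix M b assume A: "A = (M, b)"
  with assms obtain g where g: "lin_iso F M N g" "\<And>x y. x \<in> carrier M \<Longrightarrow> y \<in> carrier M \<Longrightarrow> c (g x) (g y) = b x y"
    by (auto simp: isometric_iff)
  note M = nondeg_symm_formD[OF assms(1)[unfolded A]]
  interpret M: Module.module F M by (rule M)
  interpret N: Module.module F N by fact
  have surj: "\<exists>x\<in>carrier M. y = g x" if "y \<in> carrier N" for y using lin_iso_surj[OF g(1) that] .
  obtain n h where h: "lin_iso F (std_space F n) M h" using M(2) by blast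
  show ?thesis
  proof (rule nondeg_symm_formI[OF assms(3) lin_iso_comp[OF h g(1)]])
    fix x y assume "x \<in> carrier N" "y \<in> carrier N"
    then obtain x' y' where xy: "x' \<in> carrier M" "x = g x'" "y' \<in> carrier M" "y = g y'" using surj by meson
    then show "c x y \<in> carrier F" "c x y = c y x" using M(3,4) g(2) by auto
    {
      fix z assume "z \<in> carrier N"
      then obtain z' where z: "z' \<in> carrier M" "z = g z'" using surj by meson
      have "c (g (x' \<oplus>\<^bsub>M\<^esub> y')) (g z') = c (g x') (g z') \<oplus>\<^bsub>F\<^esub> c (g y') (g z')"
        using xy z M(5) by (simp add: g(2))
      then show "c (x \<oplus>\<^bsub>N\<^esub> y) z = c x z \<oplus>\<^bsub>F\<^esub> c y z"
        using xy z lin_isoD(3)[OF g(1)] by simp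
    }
    {
      fix a assume a: "a \<in> carrier F"
      have "c (g (a \<odot>\<^bsub>M\<^esub> x')) (g y') = a \<otimes>\<^bsub>F\<^esub> c (g x') (g y')"
        using xy a M(6) by (simp add: g(2))
      then show "c (a \<odot>\<^bsub>N\<^esub> x) y = a \<otimes>\<^bsub>F\<^esub> c x y" using xy a lin_isoD(4)[OF g(1)] by simp
    }
  next
    fix x assume "x \<in> carrier N" and z: "\<And>y. y \<in> carrier N \<Longrightarrow> c x y = \<zero>\<^bsub>F\<^esub>"
    then obtain x' where x: "x' \<in> carrier M" "x = g x'" using surj by meson
    have "b x' y = \<zero>\<^bsub>F\<^esub>" if "y \<in> carrier M" for y using z[of "g y"] g that x lin_isoD(2)[OF g(1)] by auto
    then have "x' = \<zero>\<^bsub>M\<^esub>" using M(7) x by blast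
    moreover have "g \<zero>\<^bsub>M\<^esub> = \<zero>\<^bsub>N\<^esub>"
      using lin_isoD(4)[OF g(1) M.R.zero_closed M.M.zero_closed] lin_isoD(2)[OF g(1) M.M.zero_closed] by simp
    ultimately show "x = \<zero>\<^bsub>N\<^esub>" using x by simp
  qed
qed

lemma isometric_std_form:
  assumes "nondeg_symm_form F A"
  shows "\<exists>P\<in>std_forms F. isometric F P A"
proof (cases A)
  fix M b assume A: "A = (M, b)"
  note M = nondeg_symm_formD[OF assms[unfolded A]]
  interpret Module.module F M by (rule M)
  obtain n g where g: "lin_iso F (std_space F n) M g" using M(2) by blast
  let ?P = "(std_space F n, \<lambda>x y. b (g x) (g y))"
  have iso: "isometric F ?P A" unfolding A isometric_iff using g by blast
  have S: "Module.module F (std_space F n)" by (rule module_std_space[OF R.is_cring])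
  let ?h = "inv_into (carrier (std_space F n)) g"
  have "isometric F A ?P"
    unfolding A isometric_iff
    using lin_iso_inv[OF S g] bij_betw_inv_into_right[OF lin_isoD(1)[OF g]]
    by (intro exI[of _ ?h]) simp
  then have "nondeg_symm_form F ?P" using isometric_nondeg assms S by blast
  then show ?thesis using iso unfolding std_forms_def by blast
qed

lemma orth_sum_pair: "orth_sum F (M, b) (N, c) =
   (\<lparr>carrier = carrier M \<times> carrier N, monoid.mult = (\<lambda>_ _. undefined), one = undefined,
       ring.zero = (\<zero>\<^bsub>M\<^esub>, \<zero>\<^bsub>N\<^esub>), ring.add = (\<lambda>(x, y) (x', y'). (x \<oplus>\<^bsub>M\<^esub> x', y \<oplus>\<^bsub>N\<^esub> y')),
       module.smult = (\<lambda>a (x, y). (a \<odot>\<^bsub>M\<^esub> x, a \<odot>\<^bsub>N\<^esub> y))\<rparr>,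
      \<lambda>(x, y) (x', y'). b x x' \<oplus>\<^bsub>F\<^esub> c y y')"
  by (simp add: orth_sum_def)

lemma isometric_orth_sum:
  assumes "isometric F A A'" "isometric F B B'"
  shows "isometric F (orth_sum F A B) (orth_sum F A' B')"
proof (cases A; cases B; cases A'; cases B')
  fix M b N c M' b' N' c'
  assume eqs: "A = (M, b)" "B = (N, c)" "A' = (M', b')" "B' = (N', c')"
  with assms obtain g h where g: "lin_iso F M M' g" "\<forall>x\<in>carrier M. \<forall>y\<in>carrier M. b' (g x) (g y) = b x y"
    and h: "lin_iso F N N' h" "\<forall>x\<in>carrier N. \<forall>y\<in>carrier N. c' (h x) (h y) = c x y"
    by (auto simp: isometric_iff)
  have "bij_betw (map_prod g h) (carrier M \<times> carrier N) (carrier M' \<times> carrier N')"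
    using lin_isoD(1)[OF g(1)] lin_isoD(1)[OF h(1)] by (simp add: bij_betw_def map_prod_inj_on map_prod_surj_on)
  then show ?thesis unfolding eqs orth_sum_pair isometric_iff
    using g h by (intro exI[of _ "map_prod g h"]) (auto simp: lin_iso_def)
qed

lemma isometric_orth_sum_commute:
  assumes "nondeg_symm_form F A" "nondeg_symm_form F B"
  shows "isometric F (orth_sum F A B) (orth_sum F B A)"
proof (cases A; cases B)
  fix M b N c assume eqs: "A = (M, b)" "B = (N, c)"
  note M = nondeg_symm_formD[OF assms(1)[unfolded eqs]] and N = nondeg_symm_formD[OF assms(2)[unfolded eqs]]
  interpret Module.module F M by (rule M)
  have "bij_betw prod.swap (carrier M \<times> carrier N) (carrier N \<times> carrier M)"
    by (intro bij_betwI[of _ _ _ prod.swap]) auto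
  then show ?thesis unfolding eqs orth_sum_pair isometric_iff
    by (intro exI[of _ prod.swap]) (auto simp: lin_iso_def R.a_comm M(3) N(3))
qed

lemma isometric_orth_sum_assoc:
  assumes "nondeg_symm_form F A" "nondeg_symm_form F B" "nondeg_symm_form F C"
  shows "isometric F (orth_sum F (orth_sum F A B) C) (orth_sum F A (orth_sum F B C))"
proof (cases A; cases B; cases C)
  fix M b N c P d assume eqs: "A = (M, b)" "B = (N, c)" "C = (P, d)"
  note M = nondeg_symm_formD[OF assms(1)[unfolded eqs]] and N = nondeg_symm_formD[OF assms(2)[unfolded eqs]]
    and P = nondeg_symm_formD[OF assms(3)[unfolded eqs]]
  interpret Module.module F M by (rule M)
  let ?g = "\<lambda>((x, y), z). (x, y, z)"
  have "bij_betw ?g ((carrier M \<times> carrier N) \<times> carrier P) (carrier M \<times> carrier N \<times> carrier P)"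
    by (intro bij_betwI[of _ _ _ "\<lambda>(x, y, z). ((x, y), z)"]) auto
  then show ?thesis unfolding eqs orth_sum_pair isometric_iff
    by (intro exI[of _ ?g]) (auto simp: lin_iso_def R.a_assoc M(3) N(3) P(3))
qed

lemma lin_iso_concat:
  assumes "cring F"
  shows "\<exists>g. lin_iso F (std_space F (m + n)) (fst (orth_sum F (std_space F m, b) (std_space F n, c))) g"
proof -
  interpret cring F by fact
  define g where "g x = (restrict x {..<m}, \<lambda>i\<in>{..<n}. x (m + i))" for x :: "nat \<Rightarrow> 'a"
  define h where "h z = (\<lambda>i\<in>{..<m + n}. if i < m then fst z i else snd z (i - m))"
    for z :: "(nat \<Rightarrow> 'a) \<times> (nat \<Rightarrow> 'a)"
  have "bij_betw g ({..<m + n} \<rightarrow>\<^sub>E carrier F) (({..<m} \<rightarrow>\<^sub>E carrier F) \<times> ({..<n} \<rightarrow>\<^sub>E carrier F))"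
  proof (rule bij_betwI[where g = h])
    show "g \<in> ({..<m + n} \<rightarrow>\<^sub>E carrier F) \<rightarrow> ({..<m} \<rightarrow>\<^sub>E carrier F) \<times> ({..<n} \<rightarrow>\<^sub>E carrier F)"
      by (auto simp: g_def PiE_iff)
    show "h \<in> ({..<m} \<rightarrow>\<^sub>E carrier F) \<times> ({..<n} \<rightarrow>\<^sub>E carrier F) \<rightarrow> {..<m + n} \<rightarrow>\<^sub>E carrier F"
      by (auto simp: h_def PiE_iff)
    show "h (g x) = x" if "x \<in> {..<m + n} \<rightarrow>\<^sub>E carrier F" for x
      using that by (auto simp: g_def h_def PiE_iff extensional_def fun_eq_iff restrict_def)
    show "g (h y) = y" if "y \<in> ({..<m} \<rightarrow>\<^sub>E carrier F) \<times> ({..<n} \<rightarrow>\<^sub>E carrier F)" for y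
      using that by (auto simp: g_def h_def PiE_iff extensional_def fun_eq_iff restrict_def)
  qed
  moreover have "g (x \<oplus>\<^bsub>std_space F (m + n)\<^esub> y)
      = (\<lambda>i\<in>{..<m}. fst (g x) i \<oplus>\<^bsub>F\<^esub> fst (g y) i, \<lambda>i\<in>{..<n}. snd (g x) i \<oplus>\<^bsub>F\<^esub> snd (g y) i)" for x y
    by (auto simp: g_def fun_eq_iff restrict_def)
  moreover have "g (a \<odot>\<^bsub>std_space F (m + n)\<^esub> x)
      = (\<lambda>i\<in>{..<m}. a \<otimes>\<^bsub>F\<^esub> fst (g x) i, \<lambda>i\<in>{..<n}. a \<otimes>\<^bsub>F\<^esub> snd (g x) i)" for a x
    by (auto simp: g_def fun_eq_iff restrict_def)
  ultimately show ?thesis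
    unfolding lin_iso_def orth_sum_pair by (intro exI[of _ g]) (simp add: case_prod_unfold)
qed

lemma nondeg_orth_sum:
  assumes "nondeg_symm_form F A" "nondeg_symm_form F B"
  shows "nondeg_symm_form F (orth_sum F A B)"
proof (cases A; cases B)
  fix M b N c assume eqs: "A = (M, b)" "B = (N, c)"
  note M = nondeg_symm_formD[OF assms(1)[unfolded eqs]] and N = nondeg_symm_formD[OF assms(2)[unfolded eqs]]
  interpret M: Module.module F M by (rule M)
  interpret N: Module.module F N by (rule N)
  let ?S = "fst (orth_sum F A B)" and ?b = "snd (orth_sum F A B)"
  have S: "Module.module F ?S"
    unfolding eqs orth_sum_pair fst_conv
  proof (rule moduleI)
    show "cring F" by (rule M.R.is_cring)
    show "abelian_group \<lparr>carrier = carrier M \<times> carrier N, monoid.mult = (\<lambda>_ _. undefined), one = undefined,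
       ring.zero = (\<zero>\<^bsub>M\<^esub>, \<zero>\<^bsub>N\<^esub>), ring.add = (\<lambda>(x, y) (x', y'). (x \<oplus>\<^bsub>M\<^esub> x', y \<oplus>\<^bsub>N\<^esub> y')),
       module.smult = (\<lambda>a (x, y). (a \<odot>\<^bsub>M\<^esub> x, a \<odot>\<^bsub>N\<^esub> y))\<rparr>"
    proof (rule abelian_groupI, goal_cases)
      case (6 x)
      then show ?case by (intro bexI[of _ "(\<ominus>\<^bsub>M\<^esub> fst x, \<ominus>\<^bsub>N\<^esub> snd x)"]) (auto simp: M.M.l_neg N.M.l_neg)
    qed (auto simp: M.M.a_ac N.M.a_ac)
  qed (auto simp: M.smult_l_distr N.smult_l_distr M.smult_r_distr N.smult_r_distr M.smult_assoc1 N.smult_assoc1)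
  obtain m g n h where g: "lin_iso F (std_space F m) M g" and h: "lin_iso F (std_space F n) N h"
    using M(2) N(2) by blast
  obtain i where i: "lin_iso F (std_space F (m + n))
      (fst (orth_sum F (std_space F m, \<lambda>x y. b (g x) (g y)) (std_space F n, \<lambda>x y. c (h x) (h y)))) i"
    using lin_iso_concat[OF M.R.is_cring] by blast
  have "isometric F (orth_sum F (std_space F m, \<lambda>x y. b (g x) (g y)) (std_space F n, \<lambda>x y. c (h x) (h y))) (orth_sum F A B)"
    unfolding eqs using g h by (intro isometric_orth_sum) (auto simp: isometric_iff)
  then obtain j where j: "lin_iso F (fst (orth_sum F (std_space F m, \<lambda>x y. b (g x) (g y)) (std_space F n, \<lambda>x y. c (h x) (h y)))) ?S j"
    by (metis isometric_iff prod.collapse)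
  have "nondeg_symm_form F (?S, ?b)"
  proof (rule nondeg_symm_formI[OF S lin_iso_comp[OF i j]])
    fix x assume x: "x \<in> carrier ?S" and z: "\<And>y. y \<in> carrier ?S \<Longrightarrow> ?b x y = \<zero>\<^bsub>F\<^esub>"
    from x obtain u v where uv: "x = (u, v)" "u \<in> carrier M" "v \<in> carrier N" by (auto simp: eqs orth_sum_pair)
    have "b u \<zero>\<^bsub>M\<^esub> = \<zero>\<^bsub>F\<^esub>" "c v \<zero>\<^bsub>N\<^esub> = \<zero>\<^bsub>F\<^esub>"
      using M(6)[OF M.R.zero_closed M.M.zero_closed uv(2)] M(4)[OF uv(2) M.M.zero_closed] M(3)[OF M.M.zero_closed uv(2)]
        N(6)[OF M.R.zero_closed N.M.zero_closed uv(3)] N(4)[OF uv(3) N.M.zero_closed] N(3)[OF N.M.zero_closed uv(3)]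
      by simp_all
    then have "b u u' = \<zero>\<^bsub>F\<^esub>" if "u' \<in> carrier M" for u'
      using z[of "(u', \<zero>\<^bsub>N\<^esub>)"] that uv M(3) by (auto simp: eqs orth_sum_pair)
    moreover have "c v v' = \<zero>\<^bsub>F\<^esub>" if "v' \<in> carrier N" for v'
      using z[of "(\<zero>\<^bsub>M\<^esub>, v')"] that uv N(3) \<open>b u \<zero>\<^bsub>M\<^esub> = \<zero>\<^bsub>F\<^esub>\<close> by (auto simp: eqs orth_sum_pair)
    ultimately show "x = \<zero>\<^bsub>?S\<^esub>" using M(7) N(7) uv by (simp add: eqs orth_sum_pair)
  next
    fix x y assume "x \<in> carrier ?S" "y \<in> carrier ?S"
    then show "?b x y = ?b y x" using M(4) N(4) by (auto simp: eqs orth_sum_pair)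
  qed (auto simp: eqs orth_sum_pair M(3,5,6) N(3,5,6) M.R.a_ac M.R.r_distr)
  then show ?thesis by simp
qed

section \<open>The commutative monoid of isometry classes\<close>

lemma nondeg_std_forms: "P \<in> std_forms F \<Longrightarrow> nondeg_symm_form F P"
  by (auto simp: std_forms_def)

text \<open>An invariant of \<open>A\<close> in one fixed type, whatever the type of its module. For
  nondegenerate forms equality of these sets is isometry, so stable isometries become equations that
  can be rewritten.\<close>

definition form_class :: "('a, 'c) ring_scheme \<Rightarrow> ('a, 'm) bform \<Rightarrow> ('a, nat \<Rightarrow> 'a) bform set" where
  "form_class F A = {P \<in> std_forms F. isometric F P A}"

text \<open>Intersecting with \<open>std_forms\<close> makes commutativity and associativity hold
  for arbitrary sets, as unconditional rewriting with \<open>class_add_ac\<close> requires.\<close>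

definition class_add ::
    "('a, 'c) ring_scheme \<Rightarrow> ('a, nat \<Rightarrow> 'a) bform set \<Rightarrow> ('a, nat \<Rightarrow> 'a) bform set \<Rightarrow> ('a, nat \<Rightarrow> 'a) bform set" where
  "class_add F c d = {P \<in> std_forms F. \<exists>Q\<in>c \<inter> std_forms F. \<exists>R\<in>d \<inter> std_forms F. isometric F P (orth_sum F Q R)}"

lemma form_class_eq_iff:
  assumes A: "nondeg_symm_form F A" and B: "nondeg_symm_form F B"
  shows "form_class F A = form_class F B \<longleftrightarrow> isometric F A B"
proof
  assume eq: "form_class F A = form_class F B"
  obtain P where P: "P \<in> std_forms F" "isometric F P A" using isometric_std_form[OF A] by blast
  then have "isometric F P B" using eq by (auto simp: form_class_def)
  then show "isometric F A B"
    using isometric_trans[OF isometric_sym[OF nondeg_std_forms[OF P(1)] P(2)]] by blast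
next
  assume AB: "isometric F A B"
  have "isometric F P A \<longleftrightarrow> isometric F P B" for P :: "('a, nat \<Rightarrow> 'a) bform"
    using isometric_trans[OF _ AB, of P] isometric_trans[OF _ isometric_sym[OF A AB], of P] by blast
  then show "form_class F A = form_class F B" by (simp add: form_class_def)
qed

lemma form_class_orth_sum:
  assumes A: "nondeg_symm_form F A" and B: "nondeg_symm_form F B"
  shows "form_class F (orth_sum F A B) = class_add F (form_class F A) (form_class F B)"
proof (intro subset_antisym subsetI)
  fix P assume P: "P \<in> form_class F (orth_sum F A B)"
  obtain Q R where QR: "Q \<in> std_forms F" "isometric F Q A" "R \<in> std_forms F" "isometric F R B"
    using isometric_std_form[OF A] isometric_std_form[OF B] by blast
  have AB: "isometric F (orth_sum F A B) (orth_sum F Q R)"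
    using QR by (intro isometric_orth_sum isometric_sym[OF nondeg_std_forms])
  have "P \<in> std_forms F" "isometric F P (orth_sum F A B)" using P by (auto simp: form_class_def)
  note this(1) isometric_trans[OF this(2) AB]
  then show "P \<in> class_add F (form_class F A) (form_class F B)"
    using QR by (auto simp: form_class_def class_add_def)
next
  fix P assume "P \<in> class_add F (form_class F A) (form_class F B)"
  then obtain Q R where P: "P \<in> std_forms F" "isometric F P (orth_sum F Q R)"
    and "Q \<in> std_forms F" "R \<in> std_forms F" and QR: "isometric F Q A" "isometric F R B" unfolding form_class_def class_add_def by blast
  have "isometric F P (orth_sum F A B)" by (rule isometric_trans[OF P(2) isometric_orth_sum[OF QR]])
  then show "P \<in> form_class F (orth_sum F A B)" using P(1) by (simp add: form_class_def)
qed

lemma class_add_commute: "class_add F c d = class_add F d c"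
proof -
  have "class_add F c d \<subseteq> class_add F d c" for c d :: "('a, nat \<Rightarrow> 'a) bform set"
  proof
    fix P assume "P \<in> class_add F c d"
    then obtain Q R where P: "P \<in> std_forms F" "isometric F P (orth_sum F Q R)"
      and QR: "Q \<in> c \<inter> std_forms F" "R \<in> d \<inter> std_forms F" unfolding class_add_def by blast
    have "isometric F P (orth_sum F R Q)"
      using QR by (intro isometric_trans[OF P(2) isometric_orth_sum_commute] nondeg_std_forms) auto
    then show "P \<in> class_add F d c" unfolding class_add_def using P(1) QR by blast
  qed
  then show ?thesis by blast
qed

lemma class_add_assoc: "class_add F (class_add F c d) e = class_add F c (class_add F d e)"
proof (intro subset_antisym subsetI)
  fix P assume "P \<in> class_add F (class_add F c d) e"
  then obtain S T Q R where P: "P \<in> std_forms F" "isometric F P (orth_sum F S T)"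
    and S: "S \<in> std_forms F" "isometric F S (orth_sum F Q R)"
    and QRT: "Q \<in> c" "Q \<in> std_forms F" "R \<in> d" "R \<in> std_forms F" "T \<in> e" "T \<in> std_forms F"
    unfolding class_add_def by blast
  have QRT': "nondeg_symm_form F Q" "nondeg_symm_form F R" "nondeg_symm_form F T"
    by (rule nondeg_std_forms, fact)+
  obtain U where U: "U \<in> std_forms F" "isometric F U (orth_sum F R T)"
    using isometric_std_form[OF nondeg_orth_sum[OF QRT'(2,3)]] by blast
  have "isometric F P (orth_sum F (orth_sum F Q R) T)"
    by (rule isometric_trans[OF P(2) isometric_orth_sum[OF S(2) isometric_refl]])
  from isometric_trans[OF this isometric_orth_sum_assoc[OF QRT']]
  have "isometric F P (orth_sum F Q (orth_sum F R T))" .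
  from isometric_trans[OF this isometric_orth_sum[OF isometric_refl isometric_sym[OF nondeg_std_forms[OF U(1)] U(2)]]]
  have "isometric F P (orth_sum F Q U)" .
  then show "P \<in> class_add F c (class_add F d e)"
    unfolding class_add_def using P U QRT by blast
next
  fix P assume "P \<in> class_add F c (class_add F d e)"
  then obtain Q U R T where P: "P \<in> std_forms F" "isometric F P (orth_sum F Q U)"
    and U: "U \<in> std_forms F" "isometric F U (orth_sum F R T)"
    and QRT: "Q \<in> c" "Q \<in> std_forms F" "R \<in> d" "R \<in> std_forms F" "T \<in> e" "T \<in> std_forms F"
    unfolding class_add_def by blast
  have QRT': "nondeg_symm_form F Q" "nondeg_symm_form F R" "nondeg_symm_form F T"
    by (rule nondeg_std_forms, fact)+
  obtain S where S: "S \<in> std_forms F" "isometric F S (orth_sum F Q R)"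
    using isometric_std_form[OF nondeg_orth_sum[OF QRT'(1,2)]] by blast
  have "isometric F P (orth_sum F Q (orth_sum F R T))"
    by (rule isometric_trans[OF P(2) isometric_orth_sum[OF isometric_refl U(2)]])
  moreover have "isometric F (orth_sum F Q (orth_sum F R T)) (orth_sum F (orth_sum F Q R) T)"
    by (rule isometric_sym[OF _ isometric_orth_sum_assoc[OF QRT']]) (intro nondeg_orth_sum QRT')
  ultimately have "isometric F P (orth_sum F (orth_sum F Q R) T)" by (rule isometric_trans)
  from isometric_trans[OF this isometric_orth_sum[OF isometric_sym[OF nondeg_std_forms[OF S(1)] S(2)] isometric_refl]]
  have "isometric F P (orth_sum F S T)" .
  then show "P \<in> class_add F (class_add F c d) e"
    unfolding class_add_def using P S QRT by blast
qed

lemma class_add_left_commute: "class_add F c (class_add F d e) = class_add F d (class_add F c e)"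
  by (simp only: class_add_commute[of F c "class_add F d e"] class_add_assoc class_add_commute[of F e c])

lemmas class_add_ac = class_add_assoc class_add_commute class_add_left_commute

lemma gw_diff_eq:
  assumes A: "nondeg_symm_form F A" and B: "nondeg_symm_form F B"
  shows "gw_diff F A B = {(P, Q). P \<in> std_forms F \<and> Q \<in> std_forms F \<and> (\<exists>R\<in>std_forms F.
    class_add F (class_add F (form_class F P) (form_class F B)) (form_class F R) =
    class_add F (class_add F (form_class F Q) (form_class F A)) (form_class F R))}"
proof -
  have *: "isometric F (orth_sum F (orth_sum F P B) R) (orth_sum F (orth_sum F Q A) R) \<longleftrightarrow>
    class_add F (class_add F (form_class F P) (form_class F B)) (form_class F R) =
    class_add F (class_add F (form_class F Q) (form_class F A)) (form_class F R)"
    if "P \<in> std_forms F" "Q \<in> std_forms F" "R \<in> std_forms F" for P Q R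
    using that by (simp add: nondeg_std_forms nondeg_orth_sum A B
        flip: form_class_eq_iff form_class_orth_sum)
  show ?thesis
    unfolding gw_diff_def case_prod_unfold by (intro Collect_cong conj_cong refl bex_cong *)
qed

lemma gw_diff_cong:
  assumes "nondeg_symm_form F A" "nondeg_symm_form F B" "nondeg_symm_form F A'" "nondeg_symm_form F B'"
    and "isometric F A A'" "isometric F B B'"
  shows "gw_diff F A B = gw_diff F A' B'"
  using assms form_class_eq_iff[of F A A'] form_class_eq_iff[of F B B'] by (simp add: gw_diff_eq)

text \<open>The class of \<open>[T] - [T']\<close> is that of \<open>[A] - [B]\<close> if \<open>T + B + C\<close> and \<open>T' + A + C\<close> are isometric.\<close>

lemma gw_diff_eqI:
  assumes nondeg: "nondeg_symm_form F A" "nondeg_symm_form F B" "nondeg_symm_form F C"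
      "nondeg_symm_form F T" "nondeg_symm_form F T'"
    and iso: "isometric F (orth_sum F (orth_sum F T B) C) (orth_sum F (orth_sum F T' A) C)"
  shows "gw_diff F T T' = gw_diff F A B"
proof -
  let ?c = "form_class F" and ?p = "class_add F"
  have eq: "?p (?p (form_class F T) (form_class F B)) (form_class F C)
      = ?p (?p (form_class F T') (form_class F A)) (form_class F C)"
    using iso nondeg by (simp add: nondeg_orth_sum flip: form_class_eq_iff form_class_orth_sum)
  have rep: "\<exists>S\<in>std_forms F. form_class F S = form_class F (orth_sum F (orth_sum F R X1) (orth_sum F X2 X3))"
    if nd: "R \<in> std_forms F" "nondeg_symm_form F X1" "nondeg_symm_form F X2" "nondeg_symm_form F X3" for R X1 X2 X3
  proof -
    have nd': "nondeg_symm_form F (orth_sum F (orth_sum F R X1) (orth_sum F X2 X3))"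
      using nd by (intro nondeg_orth_sum nondeg_std_forms)
    obtain S where "S \<in> std_forms F" "isometric F S (orth_sum F (orth_sum F R X1) (orth_sum F X2 X3))"
      using isometric_std_form[OF nd'] by blast
    then show ?thesis using form_class_eq_iff[OF nondeg_std_forms nd'] by blast
  qed
  note [simp] = nondeg nondeg_orth_sum nondeg_std_forms
  show ?thesis
    unfolding gw_diff_eq[OF nondeg(4,5)] gw_diff_eq[OF nondeg(1,2)]
  proof (intro Collect_cong, clarify, intro conj_cong refl iffI)
    fix P Q
    assume PQ: "P \<in> std_forms F" "Q \<in> std_forms F"
    {
      assume "\<exists>R\<in>std_forms F. ?p (?p (?c P) (form_class F T')) (?c R) = ?p (?p (?c Q) (form_class F T)) (?c R)"
      then obtain R where R: "R \<in> std_forms F"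
        and h: "?p (?p (?c P) (form_class F T')) (?c R) = ?p (?p (?c Q) (form_class F T)) (?c R)" by blast
      \<comment> \<open>The stabilizing form is S = R + C + T + T'. Then P + B + S regroups as (P +
        T' + R) + (T + B + C), to which \<open>h\<close> and \<open>eq\<close> apply.\<close>
      obtain S where S: "S \<in> std_forms F" "?c S = form_class F (orth_sum F (orth_sum F R C) (orth_sum F T T'))"
        using rep[OF R nondeg(3,4,5)] by blast
      have S': "?c S = ?p (?p (?c R) (form_class F C)) (?p (form_class F T) (form_class F T'))"
        using R unfolding S(2) by (simp add: form_class_orth_sum)
      have "?p (?p (?c P) (form_class F B)) (?c S)
          = ?p (?p (?p (?c P) (form_class F T')) (?c R)) (?p (?p (form_class F T) (form_class F B)) (form_class F C))"
        unfolding S' by (simp only: class_add_ac)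
      also have "\<dots> = ?p (?p (?c Q) (form_class F A)) (?c S)"
        unfolding h eq S' by (simp only: class_add_ac)
      finally show "\<exists>R\<in>std_forms F. ?p (?p (?c P) (form_class F B)) (?c R) = ?p (?p (?c Q) (form_class F A)) (?c R)"
        using S(1) by blast
    next
      assume "\<exists>R\<in>std_forms F. ?p (?p (?c P) (form_class F B)) (?c R) = ?p (?p (?c Q) (form_class F A)) (?c R)"
      then obtain R where R: "R \<in> std_forms F"
        and h: "?p (?p (?c P) (form_class F B)) (?c R) = ?p (?p (?c Q) (form_class F A)) (?c R)" by blast
      \<comment> \<open>With S = R + C + A + B, the sum P + T' + S regroups as (P + B + R) + (T' + A
        + C).\<close>
      obtain S where S: "S \<in> std_forms F" "?c S = form_class F (orth_sum F (orth_sum F R C) (orth_sum F A B))"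
        using rep[OF R nondeg(3,1,2)] by blast
      have S': "?c S = ?p (?p (?c R) (form_class F C)) (?p (form_class F A) (form_class F B))"
        using R unfolding S(2) by (simp add: form_class_orth_sum)
      have "?p (?p (?c P) (form_class F T')) (?c S)
          = ?p (?p (?p (?c P) (form_class F B)) (?c R)) (?p (?p (form_class F T') (form_class F A)) (form_class F C))"
        unfolding S' by (simp only: class_add_ac)
      also have "\<dots> = ?p (?p (?c Q) (form_class F T)) (?c S)"
        unfolding h eq[symmetric] S' by (simp only: class_add_ac)
      finally show "\<exists>R\<in>std_forms F. ?p (?p (?c P) (form_class F T')) (?c R) = ?p (?p (?c Q) (form_class F T)) (?c R)"
        using S(1) by blast
    }
  qed
qed

subsection \<open>Transfer of forms\<close>

lemma alg_module_simps [simp]: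
  "carrier (alg_module h B) = carrier B" "\<zero>\<^bsub>alg_module h B\<^esub> = \<zero>\<^bsub>B\<^esub>"
  "x \<oplus>\<^bsub>alg_module h B\<^esub> y = x \<oplus>\<^bsub>B\<^esub> y" "a \<odot>\<^bsub>alg_module h B\<^esub> x = h a \<otimes>\<^bsub>B\<^esub> x"
  by (simp_all add: alg_module_def)

lemma restrict_scalars_simps [simp]:
  "carrier (restrict_scalars h M) = carrier M" "\<zero>\<^bsub>restrict_scalars h M\<^esub> = \<zero>\<^bsub>M\<^esub>"
  "x \<oplus>\<^bsub>restrict_scalars h M\<^esub> y = x \<oplus>\<^bsub>M\<^esub> y" "a \<odot>\<^bsub>restrict_scalars h M\<^esub> x = h a \<odot>\<^bsub>M\<^esub> x"
  by (simp_all add: restrict_scalars_def)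

lemma module_restrict_scalars:
  assumes F: "cring F" and h: "h \<in> Ring.ring_hom F E" and M: "Module.module E M"
  shows "Module.module F (restrict_scalars h M)"
proof -
  interpret M: Module.module E M by fact
  show ?thesis
  proof (rule moduleI[OF F])
    show "abelian_group (restrict_scalars h M)"
      by (rule abelian_groupI) (auto simp: M.M.a_ac intro: M.M.l_neg bexI[of _ "\<ominus>\<^bsub>M\<^esub> _"])
  qed (auto simp: ring_hom_closed[OF h] ring_hom_add[OF h] ring_hom_mult[OF h] ring_hom_one[OF h]
      M.smult_l_distr M.smult_r_distr M.smult_assoc1)
qed

lemma module_alg_module:
  assumes F: "cring F" and E: "cring E" and h: "h \<in> Ring.ring_hom F E"
  shows "Module.module F (alg_module h E)"
proof -
  interpret E: cring E by fact
  show ?thesis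
  proof (rule moduleI[OF F])
    show "abelian_group (alg_module h E)"
      by (rule abelian_groupI) (auto simp: E.a_ac intro: E.l_neg bexI[of _ "\<ominus>\<^bsub>E\<^esub> _"])
  qed (auto simp: ring_hom_closed[OF h] ring_hom_add[OF h] ring_hom_mult[OF h] ring_hom_one[OF h]
      E.l_distr E.r_distr E.m_assoc)
qed

text \<open>Linearity of the trace and an element of nonzero trace are all that the transfer
  requires. These properties are supplied where the degree is computed, from the coordinates of the
  residue field.\<close>

locale finite_extension_trace =
  fixes F :: "('a, 'c) ring_scheme" and E :: "('b, 'd) ring_scheme" and h :: "'a \<Rightarrow> 'b"
    and d :: nat and u :: "(nat \<Rightarrow> 'a) \<Rightarrow> 'b"
  assumes F: "field F" and E: "field E" and h: "h \<in> Ring.ring_hom F E"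
    and u: "lin_iso F (std_space F d) (alg_module h E) u"
    and trace_closed: "x \<in> carrier E \<Longrightarrow> alg_trace F E h x \<in> carrier F"
    and trace_add: "x \<in> carrier E \<Longrightarrow> y \<in> carrier E \<Longrightarrow>
      alg_trace F E h (x \<oplus>\<^bsub>E\<^esub> y) = alg_trace F E h x \<oplus>\<^bsub>F\<^esub> alg_trace F E h y"
    and trace_smult: "a \<in> carrier F \<Longrightarrow> x \<in> carrier E \<Longrightarrow>
      alg_trace F E h (h a \<otimes>\<^bsub>E\<^esub> x) = a \<otimes>\<^bsub>F\<^esub> alg_trace F E h x"
    and trace_nonzero: "\<exists>c\<in>carrier E. alg_trace F E h c \<noteq> \<zero>\<^bsub>F\<^esub>"
begin

sublocale F: field F by (rule F)
sublocale E: field E by (rule E)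

abbreviation "T \<equiv> trace_form F E h"

lemma h_closed: "a \<in> carrier F \<Longrightarrow> h a \<in> carrier E"
  using h by (rule ring_hom_closed)

lemma u_closed: "v \<in> {..<d} \<rightarrow>\<^sub>E carrier F \<Longrightarrow> u v \<in> carrier E"
  using lin_isoD(2)[OF u] by simp

text \<open>Coordinate j d + i over F is the i-th coordinate of the j-th entry over E.\<close>

lemma lin_iso_restrict_std_space:
  "\<exists>g. lin_iso F (std_space F (m * d)) (restrict_scalars h (std_space E m)) g"
proof -
  define r where "r v j = (\<lambda>i\<in>{..<d}. v (j * d + i))" for v :: "nat \<Rightarrow> 'a" and j
  define g where "g v = (\<lambda>j\<in>{..<m}. u (r v j))" for v
  let ?w = "inv_into ({..<d} \<rightarrow>\<^sub>E carrier F) u"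
  define k where "k w = (\<lambda>t\<in>{..<m * d}. ?w (w (t div d)) (t mod d))" for w :: "nat \<Rightarrow> 'b"
  have bij: "bij_betw u ({..<d} \<rightarrow>\<^sub>E carrier F) (carrier E)" using lin_isoD(1)[OF u] by simp
  have ind: "j * d + i < m * d" if "j < m" "i < d" for i j
  proof -
    have "j * d + i < Suc j * d" using that by simp
    also have "\<dots> \<le> m * d" using that by (intro mult_le_mono1) simp
    finally show ?thesis .
  qed
  have ind': "t div d < m" "t mod d < d" if "t < m * d" for t
    using that by (auto simp: less_mult_imp_div_less) (metis mod_less_divisor gr0I mult_0_right not_less0)
  have r: "r v j \<in> {..<d} \<rightarrow>\<^sub>E carrier F" if "v \<in> {..<m * d} \<rightarrow>\<^sub>E carrier F" "j < m" for v j
    using that ind by (auto simp: r_def PiE_iff)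
  have w: "?w x \<in> {..<d} \<rightarrow>\<^sub>E carrier F" "u (?w x) = x" if "x \<in> carrier E" for x
    using bij that by (auto simp: bij_betw_def inv_into_into f_inv_into_f)
  have "bij_betw g ({..<m * d} \<rightarrow>\<^sub>E carrier F) ({..<m} \<rightarrow>\<^sub>E carrier E)"
  proof (rule bij_betwI[where g = k])
    show "g \<in> ({..<m * d} \<rightarrow>\<^sub>E carrier F) \<rightarrow> ({..<m} \<rightarrow>\<^sub>E carrier E)"
      using r u_closed by (auto simp: g_def)
    show "k \<in> ({..<m} \<rightarrow>\<^sub>E carrier E) \<rightarrow> ({..<m * d} \<rightarrow>\<^sub>E carrier F)"
    proof
      fix x assume x: "x \<in> {..<m} \<rightarrow>\<^sub>E carrier E"
      have "?w (x (t div d)) (t mod d) \<in> carrier F" if "t < m * d" for t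
        using w(1)[of "x (t div d)"] ind'[OF that] x by (auto simp: PiE_iff)
      then show "k x \<in> {..<m * d} \<rightarrow>\<^sub>E carrier F" by (auto simp: k_def)
    qed
    show "k (g v) = v" if v: "v \<in> {..<m * d} \<rightarrow>\<^sub>E carrier F" for v
    proof
      fix t
      show "k (g v) t = v t"
      proof (cases "t < m * d")
        case True
        have "?w (u (r v (t div d))) = r v (t div d)"
          using bij r[OF v ind'(1)[OF True]] by (rule bij_betw_inv_into_left)
        then show ?thesis using ind'[OF True] True by (simp add: k_def g_def r_def)
      next
        case False
        then show ?thesis using v by (simp add: k_def PiE_iff extensional_def)
      qed
    qed
    show "g (k x) = x" if x: "x \<in> {..<m} \<rightarrow>\<^sub>E carrier E" for x
    proof
      fix j
      show "g (k x) j = x j"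
      proof (cases "j < m")
        case True
        have xj: "x j \<in> carrier E" using x True by (auto simp: PiE_iff)
        have "r (k x) j i = ?w (x j) i" for i
          using ind[OF True, of i] w(1)[OF xj] by (cases "i < d") (auto simp: r_def k_def PiE_iff extensional_def)
        then have "r (k x) j = ?w (x j)" by auto
        then show ?thesis using True w(2)[OF xj] by (simp add: g_def)
      next
        case False
        then show ?thesis using x by (simp add: g_def PiE_iff extensional_def)
      qed
    qed
  qed
  moreover have "g (x \<oplus>\<^bsub>std_space F (m * d)\<^esub> y) = g x \<oplus>\<^bsub>std_space E m\<^esub> g y"
    if "x \<in> {..<m * d} \<rightarrow>\<^sub>E carrier F" "y \<in> {..<m * d} \<rightarrow>\<^sub>E carrier F" for x y
    unfolding g_def std_space_simps
  proof (rule restrict_ext)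
    fix j assume "j \<in> {..<m}"
    then have j: "j < m" by simp
    have "r (\<lambda>i\<in>{..<m * d}. x i \<oplus>\<^bsub>F\<^esub> y i) j = r x j \<oplus>\<^bsub>std_space F d\<^esub> r y j"
      unfolding r_def std_space_simps by (rule restrict_ext) (use ind[OF j] in simp)
    then show "u (r (\<lambda>i\<in>{..<m * d}. x i \<oplus>\<^bsub>F\<^esub> y i) j)
        = (\<lambda>j\<in>{..<m}. u (r x j)) j \<oplus>\<^bsub>E\<^esub> (\<lambda>j\<in>{..<m}. u (r y j)) j"
      using lin_isoD(3)[OF u, of "r x j" "r y j"] r that j by simp
  qed
  moreover have "g (a \<odot>\<^bsub>std_space F (m * d)\<^esub> x) = h a \<odot>\<^bsub>std_space E m\<^esub> g x"
    if "a \<in> carrier F" "x \<in> {..<m * d} \<rightarrow>\<^sub>E carrier F" for a x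
    unfolding g_def std_space_simps
  proof (rule restrict_ext)
    fix j assume "j \<in> {..<m}"
    then have j: "j < m" by simp
    have "r (\<lambda>i\<in>{..<m * d}. a \<otimes>\<^bsub>F\<^esub> x i) j = a \<odot>\<^bsub>std_space F d\<^esub> r x j"
      unfolding r_def std_space_simps by (rule restrict_ext) (use ind[OF j] in simp)
    then show "u (r (\<lambda>i\<in>{..<m * d}. a \<otimes>\<^bsub>F\<^esub> x i) j) = h a \<otimes>\<^bsub>E\<^esub> (\<lambda>j\<in>{..<m}. u (r x j)) j"
      using lin_isoD(4)[OF u that(1), of "r x j"] r[OF that(2) j] j by simp
  qed
  ultimately have "lin_iso F (std_space F (m * d)) (restrict_scalars h (std_space E m)) g"
    unfolding lin_iso_def by (simp del: std_space_simps(3,4))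
  then show ?thesis by blast
qed

lemma lin_iso_restrict_scalars:
  "lin_iso E M N k \<Longrightarrow> lin_iso F (restrict_scalars h M) (restrict_scalars h N) k"
  by (simp add: lin_iso_def h_closed)

lemma nondeg_trace_form:
  assumes "nondeg_symm_form E P"
  shows "nondeg_symm_form F (T P)"
proof (cases P)
  case (Pair M b)
  note M = nondeg_symm_formD[OF assms[unfolded Pair]]
  interpret M: Module.module E M by (rule M)
  obtain m k where k: "lin_iso E (std_space E m) M k" using M(2) by blast
  obtain g where g: "lin_iso F (std_space F (m * d)) (restrict_scalars h (std_space E m)) g"
    using lin_iso_restrict_std_space by blast
  have "nondeg_symm_form F (restrict_scalars h M, \<lambda>x y. alg_trace F E h (b x y))"
  proof (rule nondeg_symm_formI[OF _ lin_iso_comp[OF g lin_iso_restrict_scalars[OF k]]])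
    show "Module.module F (restrict_scalars h M)"
      by (rule module_restrict_scalars[OF F.is_cring h M(1)])
    fix x assume x: "x \<in> carrier (restrict_scalars h M)"
      and z: "\<And>y. y \<in> carrier (restrict_scalars h M) \<Longrightarrow> alg_trace F E h (b x y) = \<zero>\<^bsub>F\<^esub>"
    have "b x y = \<zero>\<^bsub>E\<^esub>" if y: "y \<in> carrier M" for y
    proof (rule ccontr)
      assume nz: "b x y \<noteq> \<zero>\<^bsub>E\<^esub>"
      have bxy: "b x y \<in> carrier E" using x y M(3) by simp
      with nz have unit: "b x y \<in> Units E" by (simp add: E.field_Units)
      obtain c where c: "c \<in> carrier E" "alg_trace F E h c \<noteq> \<zero>\<^bsub>F\<^esub>" using trace_nonzero by blast
      \<comment> \<open>Scaling \<open>y\<close> by c / b(x, y) turns the value of the form into the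
        element c of nonzero trace.\<close>
      let ?s = "c \<otimes>\<^bsub>E\<^esub> inv\<^bsub>E\<^esub> b x y"
      have s: "?s \<in> carrier E" using c unit by simp
      have "b x (?s \<odot>\<^bsub>M\<^esub> y) = ?s \<otimes>\<^bsub>E\<^esub> b x y"
        using M(4)[of x "?s \<odot>\<^bsub>M\<^esub> y"] M(6)[OF s y, of x] M(4)[of x y] x y s by simp
      also have "\<dots> = c" using c unit bxy by (simp add: E.m_assoc)
      finally show False using z[of "?s \<odot>\<^bsub>M\<^esub> y"] c y s by simp
    qed
    then show "x = \<zero>\<^bsub>restrict_scalars h M\<^esub>" using M(7) x by simp
  qed (simp_all add: M(3,5,6) h_closed trace_closed trace_add trace_smult, simp add: M(4))
  then show ?thesis by (simp add: Pair trace_form_def)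
qed

lemma isometric_trace_form:
  assumes "isometric E P Q"
  shows "isometric F (T P) (T Q)"
proof (cases P; cases Q)
  fix M b N c assume eqs: "P = (M, b)" "Q = (N, c)"
  with assms obtain g where "lin_iso E M N g" "\<forall>x\<in>carrier M. \<forall>y\<in>carrier M. c (g x) (g y) = b x y"
    by (auto simp: isometric_iff)
  then show ?thesis
    unfolding eqs trace_form_def prod.case isometric_iff
    by (intro exI[of _ g] conjI lin_iso_restrict_scalars) auto
qed

lemma isometric_trace_orth_sum:
  assumes "nondeg_symm_form E P" "nondeg_symm_form E Q"
  shows "isometric F (T (orth_sum E P Q)) (orth_sum F (T P) (T Q))"
proof (cases P; cases Q)
  fix M b N c assume eqs: "P = (M, b)" "Q = (N, c)"
  note M = nondeg_symm_formD[OF assms(1)[unfolded eqs]] and N = nondeg_symm_formD[OF assms(2)[unfolded eqs]]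
  show ?thesis
    unfolding eqs orth_sum_pair trace_form_def prod.case isometric_iff
    by (intro exI[of _ id]) (auto simp: lin_iso_def trace_add M(3) N(3))
qed

lemma zero_form_std: "field K \<Longrightarrow> zero_form K \<in> std_forms K"
proof -
  assume "field K"
  then interpret K: field K .
  have "nondeg_symm_form K (std_space K 0, \<lambda>_ _. \<zero>\<^bsub>K\<^esub>)"
  proof (rule nondeg_symm_formI)
    show "Module.module K (std_space K 0)" by (rule module_std_space[OF K.is_cring])
    show "lin_iso K (std_space K 0) (std_space K 0) id" by (simp add: lin_iso_def)
  qed auto
  then show ?thesis by (auto simp: zero_form_def std_forms_def)
qed

lemma trace_zero: "alg_trace F E h \<zero>\<^bsub>E\<^esub> = \<zero>\<^bsub>F\<^esub>"
  using trace_smult[of "\<zero>\<^bsub>F\<^esub>" "\<zero>\<^bsub>E\<^esub>"] h_closed[of "\<zero>\<^bsub>F\<^esub>"] trace_closed[of "\<zero>\<^bsub>E\<^esub>"] by simp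

lemma isometric_trace_zero_form: "isometric F (zero_form F) (T (zero_form E))"
  unfolding zero_form_def trace_form_def prod.case isometric_iff
  \<comment> \<open>The zero space consists of the single function that is \<open>undefined\<close>
    everywhere, so the constant map to it is the isomorphism.\<close>
  by (intro exI[of _ "\<lambda>_ _. undefined"]) (auto simp: lin_iso_def trace_zero bij_betw_def)

lemma isometric_trace_triple:
  assumes "nondeg_symm_form E P" "nondeg_symm_form E Q" "nondeg_symm_form E R"
  shows "isometric F (T (orth_sum E (orth_sum E P Q) R)) (orth_sum F (orth_sum F (T P) (T Q)) (T R))"
  by (rule isometric_trans[OF isometric_trace_orth_sum isometric_orth_sum[OF isometric_trace_orth_sum isometric_refl]])
    (intro assms nondeg_orth_sum)+

text \<open>\<open>gw_trace\<close> is a union over all pairs that represent the class. Each pair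
  contributes the same set, because a stable isometry over E transfers to one over F, and at least
  one pair exists.\<close>

lemma gw_trace_gw_class:
  assumes A: "nondeg_symm_form E A"
  shows "gw_trace F E h (gw_class E A) = gw_class F (T A)"
proof -
  have z: "zero_form E \<in> std_forms E" "nondeg_symm_form E (zero_form E)" "nondeg_symm_form F (zero_form F)"
    using zero_form_std nondeg_std_forms E F by blast+
  have eq: "gw_diff F (T P) (T Q) = gw_diff F (T A) (zero_form F)" if "(P, Q) \<in> gw_class E A" for P Q
  proof -
    from that obtain R where R: "R \<in> std_forms E" and PQ: "P \<in> std_forms E" "Q \<in> std_forms E"
      and iso: "isometric E (orth_sum E (orth_sum E P (zero_form E)) R) (orth_sum E (orth_sum E Q A) R)"
      by (auto simp: gw_class_def gw_diff_def)
    note nd = nondeg_std_forms[OF PQ(1)] nondeg_std_forms[OF PQ(2)] nondeg_std_forms[OF R]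
    have "isometric F (orth_sum F (orth_sum F (T P) (zero_form F)) (T R))
        (orth_sum F (orth_sum F (T P) (T (zero_form E))) (T R))"
      by (intro isometric_orth_sum isometric_refl isometric_trace_zero_form)
    moreover have "isometric F (orth_sum F (orth_sum F (T P) (T (zero_form E))) (T R))
        (T (orth_sum E (orth_sum E P (zero_form E)) R))"
      by (rule isometric_sym[OF _ isometric_trace_triple]) (intro nondeg_trace_form nondeg_orth_sum nd z)+
    moreover note isometric_trace_form[OF iso]
    moreover have "isometric F (T (orth_sum E (orth_sum E Q A) R)) (orth_sum F (orth_sum F (T Q) (T A)) (T R))"
      by (intro isometric_trace_triple nd A)
    ultimately have "isometric F (orth_sum F (orth_sum F (T P) (zero_form F)) (T R))
        (orth_sum F (orth_sum F (T Q) (T A)) (T R))"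
      using isometric_trans by meson
    then show ?thesis by (intro gw_diff_eqI[of _ _ _ "T R"] nondeg_trace_form nd z A)
  qed
  \<comment> \<open>The witness is the pair of a standard copy of \<open>A\<close> and the zero
    form.\<close>
  obtain P where P: "P \<in> std_forms E" "isometric E P A" using isometric_std_form[OF A] by blast
  have "isometric E (orth_sum E P (zero_form E)) (orth_sum E (zero_form E) P)"
    by (intro isometric_orth_sum_commute nondeg_std_forms P z)
  from isometric_trans[OF this isometric_orth_sum[OF isometric_refl P(2)]]
  have "isometric E (orth_sum E (orth_sum E P (zero_form E)) (zero_form E))
      (orth_sum E (orth_sum E (zero_form E) A) (zero_form E))"
    by (rule isometric_orth_sum[OF _ isometric_refl])
  then have "(P, zero_form E) \<in> gw_class E A"
    unfolding gw_class_def gw_diff_def using P z by blast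
  then show ?thesis
    unfolding gw_trace_def gw_class_def[of F] using eq by blast
qed

lemma gw_trace_rank_one:
  assumes a: "a \<in> carrier E" "a \<noteq> \<zero>\<^bsub>E\<^esub>"
  shows "nondeg_symm_form F (alg_module h E, \<lambda>x y. alg_trace F E h (a \<otimes>\<^bsub>E\<^esub> (x \<otimes>\<^bsub>E\<^esub> y)))"
    and "gw_trace F E h (gw_rank_one E a)
      = gw_class F (alg_module h E, \<lambda>x y. alg_trace F E h (a \<otimes>\<^bsub>E\<^esub> (x \<otimes>\<^bsub>E\<^esub> y)))"
proof -
  let ?A = "(alg_module id E, \<lambda>x y. a \<otimes>\<^bsub>E\<^esub> (x \<otimes>\<^bsub>E\<^esub> y))"
  have "nondeg_symm_form E ?A"
  proof (rule nondeg_symm_formI)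
    show "Module.module E (alg_module id E)"
      by (rule module_alg_module[OF E.is_cring E.is_cring]) (auto intro: ring_hom_memI)
    show "lin_iso E (std_space E 1) (alg_module id E) (\<lambda>v. v 0)"
    proof -
      have "bij_betw (\<lambda>v. v 0) ({..<1::nat} \<rightarrow>\<^sub>E carrier E) (carrier E)"
      proof (rule bij_betwI[where g = "\<lambda>x. \<lambda>i\<in>{..<1}. x"])
        show "(\<lambda>i\<in>{..<1}. v 0) = v" if "v \<in> {..<1::nat} \<rightarrow>\<^sub>E carrier E" for v
          using that by (auto simp: PiE_iff extensional_def fun_eq_iff)
      qed auto
      then show ?thesis by (simp add: lin_iso_def)
    qed
    fix x assume x: "x \<in> carrier (alg_module id E)"
      and z: "\<And>y. y \<in> carrier (alg_module id E) \<Longrightarrow> a \<otimes>\<^bsub>E\<^esub> (x \<otimes>\<^bsub>E\<^esub> y) = \<zero>\<^bsub>E\<^esub>"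
    show "x = \<zero>\<^bsub>alg_module id E\<^esub>" using z[of "\<one>\<^bsub>E\<^esub>"] x a E.integral by auto
  qed (use a in \<open>auto simp: E.m_ac E.l_distr E.r_distr\<close>)
  moreover have "T ?A = (alg_module h E, \<lambda>x y. alg_trace F E h (a \<otimes>\<^bsub>E\<^esub> (x \<otimes>\<^bsub>E\<^esub> y)))"
    by (simp add: trace_form_def restrict_scalars_def alg_module_def)
  ultimately show "nondeg_symm_form F (alg_module h E, \<lambda>x y. alg_trace F E h (a \<otimes>\<^bsub>E\<^esub> (x \<otimes>\<^bsub>E\<^esub> y)))"
    "gw_trace F E h (gw_rank_one E a)
      = gw_class F (alg_module h E, \<lambda>x y. alg_trace F E h (a \<otimes>\<^bsub>E\<^esub> (x \<otimes>\<^bsub>E\<^esub> y)))"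
    using nondeg_trace_form gw_trace_gw_class unfolding gw_rank_one_def by metis+
qed

end

section \<open>Localization\<close>

locale multiplicative_subset = cring R for R (structure) +
  fixes S :: "'a set"
  assumes S_sub: "S \<subseteq> carrier R" and S_one: "\<one> \<in> S" and S_mult: "s \<in> S \<Longrightarrow> t \<in> S \<Longrightarrow> s \<otimes> t \<in> S"
begin

abbreviation "fra \<equiv> fraction R S"
abbreviation "Loc \<equiv> localization R S"

lemma S_in [simp]: "s \<in> S \<Longrightarrow> s \<in> carrier R"
  using S_sub by auto

lemma mem_fraction: "(b, t) \<in> fra a s \<longleftrightarrow> b \<in> carrier R \<and> t \<in> S \<and> (\<exists>u\<in>S. u \<otimes> (a \<otimes> t) = u \<otimes> (b \<otimes> s))"
  by (simp add: fraction_def)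

lemma fraction_self: "a \<in> carrier R \<Longrightarrow> s \<in> S \<Longrightarrow> (a, s) \<in> fra a s"
  unfolding mem_fraction using S_one by blast

text \<open>The chain of equalities passes through the denominator t of the middle fraction, hence
  the extra factor t in the witness.\<close>

lemma fraction_rel_trans:
  assumes abc: "a \<in> carrier R" "b \<in> carrier R" "c \<in> carrier R" "s \<in> S" "t \<in> S" "r \<in> S"
    and u: "u \<in> S" "u \<otimes> (a \<otimes> t) = u \<otimes> (b \<otimes> s)" and v: "v \<in> S" "v \<otimes> (b \<otimes> r) = v \<otimes> (c \<otimes> t)"
  shows "\<exists>w\<in>S. w \<otimes> (a \<otimes> r) = w \<otimes> (c \<otimes> s)"
proof (intro bexI)
  have "(u \<otimes> v \<otimes> t) \<otimes> (a \<otimes> r) = v \<otimes> r \<otimes> (u \<otimes> (a \<otimes> t))" using abc u(1) v(1) by (simp add: m_ac)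
  also have "\<dots> = u \<otimes> s \<otimes> (v \<otimes> (b \<otimes> r))" unfolding u(2) using abc u(1) v(1) by (simp add: m_ac)
  also have "\<dots> = (u \<otimes> v \<otimes> t) \<otimes> (c \<otimes> s)" unfolding v(2) using abc u(1) v(1) by (simp add: m_ac)
  finally show "(u \<otimes> v \<otimes> t) \<otimes> (a \<otimes> r) = (u \<otimes> v \<otimes> t) \<otimes> (c \<otimes> s)" .
  show "u \<otimes> v \<otimes> t \<in> S" using abc u v by (simp add: S_mult)
qed

lemma fraction_eq_iff:
  assumes "a \<in> carrier R" "b \<in> carrier R" "s \<in> S" "t \<in> S"
  shows "fra a s = fra b t \<longleftrightarrow> (\<exists>u\<in>S. u \<otimes> (a \<otimes> t) = u \<otimes> (b \<otimes> s))"
proof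
  assume "fra a s = fra b t"
  then have "(b, t) \<in> fra a s" using fraction_self assms by auto
  then show "\<exists>u\<in>S. u \<otimes> (a \<otimes> t) = u \<otimes> (b \<otimes> s)" by (simp add: mem_fraction)
next
  assume "\<exists>u\<in>S. u \<otimes> (a \<otimes> t) = u \<otimes> (b \<otimes> s)"
  then obtain u where u: "u \<in> S" "u \<otimes> (a \<otimes> t) = u \<otimes> (b \<otimes> s)" by blast
  have "fra b t \<subseteq> fra a s"
  proof
    fix z assume "z \<in> fra b t"
    then obtain c r v where z: "z = (c, r)" "c \<in> carrier R" "r \<in> S" "v \<in> S" "v \<otimes> (b \<otimes> r) = v \<otimes> (c \<otimes> t)"
      by (cases z) (auto simp: mem_fraction)
    show "z \<in> fra a s"
      using fraction_rel_trans[OF assms(1,2) z(2) assms(3,4) z(3) u z(4,5)] z by (simp add: mem_fraction)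
  qed
  moreover have "fra a s \<subseteq> fra b t"
  proof
    fix z assume "z \<in> fra a s"
    then obtain c r v where z: "z = (c, r)" "c \<in> carrier R" "r \<in> S" "v \<in> S" "v \<otimes> (a \<otimes> r) = v \<otimes> (c \<otimes> s)"
      by (cases z) (auto simp: mem_fraction)
    show "z \<in> fra b t"
      using fraction_rel_trans[OF assms(2,1) z(2) assms(4,3) z(3) u(1) u(2)[symmetric] z(4,5)] z
      by (simp add: mem_fraction)
  qed
  ultimately show "fra a s = fra b t" by blast
qed

lemma fraction_eqI:
  "a \<in> carrier R \<Longrightarrow> b \<in> carrier R \<Longrightarrow> s \<in> S \<Longrightarrow> t \<in> S \<Longrightarrow> a \<otimes> t = b \<otimes> s \<Longrightarrow> fra a s = fra b t"
  using S_one by (subst fraction_eq_iff) auto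

lemma Loc_simps:
  "carrier Loc = {fra a s | a s. a \<in> carrier R \<and> s \<in> S}"
  "\<one>\<^bsub>Loc\<^esub> = fra \<one> \<one>" "\<zero>\<^bsub>Loc\<^esub> = fra \<zero> \<one>"
  by (simp_all add: localization_def)

lemma fraction_in [simp]: "a \<in> carrier R \<Longrightarrow> s \<in> S \<Longrightarrow> fra a s \<in> carrier Loc"
  by (auto simp: Loc_simps)

lemma Loc_cases:
  assumes "z \<in> carrier Loc"
  obtains a s where "a \<in> carrier R" "s \<in> S" "z = fra a s"
  using assms by (auto simp: Loc_simps)

text \<open>The definition takes a union over all representatives of both factors; they all produce
  the same fraction, so the union is over a single set.\<close>

lemma Loc_mult:
  assumes "a \<in> carrier R" "b \<in> carrier R" "s \<in> S" "t \<in> S"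
  shows "fra a s \<otimes>\<^bsub>Loc\<^esub> fra b t = fra (a \<otimes> b) (s \<otimes> t)"
proof -
  have eq: "fra (a' \<otimes> b') (s' \<otimes> t') = fra (a \<otimes> b) (s \<otimes> t)"
    if h: "(a', s') \<in> fra a s" "(b', t') \<in> fra b t" for a' s' b' t'
  proof -
    from h obtain u v where u: "u \<in> S" "u \<otimes> (a \<otimes> s') = u \<otimes> (a' \<otimes> s)" and v: "v \<in> S" "v \<otimes> (b \<otimes> t') = v \<otimes> (b' \<otimes> t)"
      and in': "a' \<in> carrier R" "s' \<in> S" "b' \<in> carrier R" "t' \<in> S" by (auto simp: mem_fraction)
    have "(u \<otimes> v) \<otimes> ((a' \<otimes> b') \<otimes> (s \<otimes> t)) = (u \<otimes> (a' \<otimes> s)) \<otimes> (v \<otimes> (b' \<otimes> t))"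
      using assms in' u(1) v(1) by (simp add: m_ac)
    also have "\<dots> = (u \<otimes> v) \<otimes> ((a \<otimes> b) \<otimes> (s' \<otimes> t'))"
      unfolding u(2)[symmetric] v(2)[symmetric] using assms in' u(1) v(1) by (simp add: m_ac)
    finally show ?thesis using assms in' u(1) v(1) S_mult by (subst fraction_eq_iff) auto
  qed
  have "fra a s \<otimes>\<^bsub>Loc\<^esub> fra b t
      = \<Union>{fra (a' \<otimes> b') (s' \<otimes> t') | a' s' b' t'. (a', s') \<in> fra a s \<and> (b', t') \<in> fra b t}"
    by (simp add: localization_def)
  also have "{fra (a' \<otimes> b') (s' \<otimes> t') | a' s' b' t'. (a', s') \<in> fra a s \<and> (b', t') \<in> fra b t}
      = {fra (a \<otimes> b) (s \<otimes> t)}"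
    using eq fraction_self assms by blast
  finally show ?thesis by simp
qed

lemma Loc_add:
  assumes "a \<in> carrier R" "b \<in> carrier R" "s \<in> S" "t \<in> S"
  shows "fra a s \<oplus>\<^bsub>Loc\<^esub> fra b t = fra (a \<otimes> t \<oplus> b \<otimes> s) (s \<otimes> t)"
proof -
  have eq: "fra (a' \<otimes> t' \<oplus> b' \<otimes> s') (s' \<otimes> t') = fra (a \<otimes> t \<oplus> b \<otimes> s) (s \<otimes> t)"
    if h: "(a', s') \<in> fra a s" "(b', t') \<in> fra b t" for a' s' b' t'
  proof -
    from h obtain u v where u: "u \<in> S" "u \<otimes> (a \<otimes> s') = u \<otimes> (a' \<otimes> s)" and v: "v \<in> S" "v \<otimes> (b \<otimes> t') = v \<otimes> (b' \<otimes> t)"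
      and in': "a' \<in> carrier R" "s' \<in> S" "b' \<in> carrier R" "t' \<in> S" by (auto simp: mem_fraction)
    have "(u \<otimes> v) \<otimes> ((a' \<otimes> t' \<oplus> b' \<otimes> s') \<otimes> (s \<otimes> t))
        = (v \<otimes> t \<otimes> t') \<otimes> (u \<otimes> (a' \<otimes> s)) \<oplus> (u \<otimes> s \<otimes> s') \<otimes> (v \<otimes> (b' \<otimes> t))"
      using assms in' u(1) v(1) by (simp add: m_ac l_distr r_distr)
    also have "\<dots> = (u \<otimes> v) \<otimes> ((a \<otimes> t \<oplus> b \<otimes> s) \<otimes> (s' \<otimes> t'))"
      unfolding u(2)[symmetric] v(2)[symmetric] using assms in' u(1) v(1) by (simp add: m_ac l_distr r_distr)
    finally show ?thesis using assms in' u(1) v(1) S_mult by (subst fraction_eq_iff) auto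
  qed
  have "fra a s \<oplus>\<^bsub>Loc\<^esub> fra b t
      = \<Union>{fra (a' \<otimes> t' \<oplus> b' \<otimes> s') (s' \<otimes> t') | a' s' b' t'. (a', s') \<in> fra a s \<and> (b', t') \<in> fra b t}"
    by (simp add: localization_def)
  also have "{fra (a' \<otimes> t' \<oplus> b' \<otimes> s') (s' \<otimes> t') | a' s' b' t'. (a', s') \<in> fra a s \<and> (b', t') \<in> fra b t}
      = {fra (a \<otimes> t \<oplus> b \<otimes> s) (s \<otimes> t)}"
    using eq fraction_self assms by blast
  finally show ?thesis by simp
qed

lemma cring_Loc: "cring Loc"
proof (rule cringI)
  show "abelian_group Loc"
  proof (rule abelian_groupI)
    fix x assume "x \<in> carrier Loc"
    then obtain a s where x: "a \<in> carrier R" "s \<in> S" "x = fra a s" by (rule Loc_cases)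
    show "\<zero>\<^bsub>Loc\<^esub> \<oplus>\<^bsub>Loc\<^esub> x = x" using x S_one by (simp add: Loc_simps Loc_add)
    have "\<ominus> a \<otimes> s \<oplus> a \<otimes> s = \<zero>" using x by (simp add: l_distr[symmetric] l_neg)
    then have "fra (\<ominus> a) s \<oplus>\<^bsub>Loc\<^esub> x = fra \<zero> (s \<otimes> s)" using x by (simp add: Loc_add)
    also have "\<dots> = \<zero>\<^bsub>Loc\<^esub>"
      unfolding Loc_simps by (rule fraction_eqI) (use x S_one S_mult in auto)
    finally have "fra (\<ominus> a) s \<oplus>\<^bsub>Loc\<^esub> x = \<zero>\<^bsub>Loc\<^esub>" .
    then show "\<exists>y\<in>carrier Loc. y \<oplus>\<^bsub>Loc\<^esub> x = \<zero>\<^bsub>Loc\<^esub>" using x by (intro bexI[of _ "fra (\<ominus> a) s"]) auto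
    fix y assume "y \<in> carrier Loc"
    then obtain b t where y: "b \<in> carrier R" "t \<in> S" "y = fra b t" by (rule Loc_cases)
    show "x \<oplus>\<^bsub>Loc\<^esub> y \<in> carrier Loc" using x y S_mult by (simp add: Loc_add)
    show "x \<oplus>\<^bsub>Loc\<^esub> y = y \<oplus>\<^bsub>Loc\<^esub> x" using x y by (simp add: Loc_add m_comm a_comm)
    fix z assume "z \<in> carrier Loc"
    then obtain c r where z: "c \<in> carrier R" "r \<in> S" "z = fra c r" by (rule Loc_cases)
    show "x \<oplus>\<^bsub>Loc\<^esub> y \<oplus>\<^bsub>Loc\<^esub> z = x \<oplus>\<^bsub>Loc\<^esub> (y \<oplus>\<^bsub>Loc\<^esub> z)"
      using x y z S_mult by (simp add: Loc_add m_ac l_distr r_distr a_ac)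
  qed (use S_one in \<open>simp add: Loc_simps(3)\<close>)
  show "Group.comm_monoid Loc"
  proof (rule comm_monoidI)
    fix x y assume "x \<in> carrier Loc" "y \<in> carrier Loc"
    then obtain a s b t where xy: "a \<in> carrier R" "s \<in> S" "x = fra a s" "b \<in> carrier R" "t \<in> S" "y = fra b t"
      by (meson Loc_cases)
    show "x \<otimes>\<^bsub>Loc\<^esub> y \<in> carrier Loc" using xy S_mult by (simp add: Loc_mult)
    show "x \<otimes>\<^bsub>Loc\<^esub> y = y \<otimes>\<^bsub>Loc\<^esub> x" using xy by (simp add: Loc_mult m_comm)
    show "\<one>\<^bsub>Loc\<^esub> \<otimes>\<^bsub>Loc\<^esub> x = x" using xy S_one by (simp add: Loc_mult Loc_simps)
    fix z assume "z \<in> carrier Loc"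
    then obtain c r where z: "c \<in> carrier R" "r \<in> S" "z = fra c r" by (rule Loc_cases)
    show "x \<otimes>\<^bsub>Loc\<^esub> y \<otimes>\<^bsub>Loc\<^esub> z = x \<otimes>\<^bsub>Loc\<^esub> (y \<otimes>\<^bsub>Loc\<^esub> z)"
      using xy z S_mult by (simp add: Loc_mult m_assoc)
  qed (use S_one in \<open>simp add: Loc_simps(2)\<close>)
  fix x y z assume "x \<in> carrier Loc" "y \<in> carrier Loc" "z \<in> carrier Loc"
  then obtain a s b t c r where xyz: "a \<in> carrier R" "s \<in> S" "x = fra a s" "b \<in> carrier R" "t \<in> S" "y = fra b t"
    "c \<in> carrier R" "r \<in> S" "z = fra c r"
    by (meson Loc_cases)
  show "(x \<oplus>\<^bsub>Loc\<^esub> y) \<otimes>\<^bsub>Loc\<^esub> z = x \<otimes>\<^bsub>Loc\<^esub> z \<oplus>\<^bsub>Loc\<^esub> y \<otimes>\<^bsub>Loc\<^esub> z"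
    using xyz S_mult
    by (simp add: Loc_mult Loc_add) (intro fraction_eqI, auto simp: m_ac l_distr r_distr)
qed

lemma fraction_hom: "(\<lambda>a. fra a \<one>) \<in> Ring.ring_hom R Loc"
  using S_one by (intro ring_hom_memI) (auto simp: Loc_mult Loc_add Loc_simps(2))

lemma fraction_split:
  "a \<in> carrier R \<Longrightarrow> s \<in> S \<Longrightarrow> fra a s = fra \<one> s \<otimes>\<^bsub>Loc\<^esub> fra a \<one>"
  "s \<in> S \<Longrightarrow> fra s \<one> \<otimes>\<^bsub>Loc\<^esub> fra \<one> s = \<one>\<^bsub>Loc\<^esub>"
proof -
  show "fra a s = fra \<one> s \<otimes>\<^bsub>Loc\<^esub> fra a \<one>" if "a \<in> carrier R" "s \<in> S"
    using that S_one by (simp add: Loc_mult)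
  have "fra s s = fra \<one> \<one>" if "s \<in> S" by (rule fraction_eqI) (use that S_one in auto)
  then show "s \<in> S \<Longrightarrow> fra s \<one> \<otimes>\<^bsub>Loc\<^esub> fra \<one> s = \<one>\<^bsub>Loc\<^esub>"
    using S_one by (simp add: Loc_mult Loc_simps(2))
qed

end

lemma (in cring) multiplicative_subset_prime:
  assumes "primeideal P R"
  shows "multiplicative_subset R (carrier R - P)"
proof -
  interpret P: primeideal P R by fact
  show ?thesis
  proof
    show "\<one> \<in> carrier R - P" using P.I_notcarr P.one_imp_carrier by blast
    show "s \<otimes> t \<in> carrier R - P" if "s \<in> carrier R - P" "t \<in> carrier R - P" for s t
      using that P.I_prime by auto
  qed auto
qed

text \<open>A homomorphism to a field that vanishes at no element of \<open>S\<close> extends to the localization.\<close>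

definition fraction_map ::
    "('a \<Rightarrow> 'b) \<Rightarrow> ('b, 'd) ring_scheme \<Rightarrow> ('a \<times> 'a) set \<Rightarrow> 'b" where
  "fraction_map g E z = (let (a, s) = (SOME p. p \<in> z) in g a \<otimes>\<^bsub>E\<^esub> inv\<^bsub>E\<^esub> g s)"

locale fraction_extension = multiplicative_subset R S + E: field E
  for R :: "('a, 'm) ring_scheme" (structure) and S and E :: "('b, 'n) ring_scheme" +
  fixes g :: "'a \<Rightarrow> 'b"
  assumes g: "g \<in> Ring.ring_hom R E" and g_unit: "s \<in> S \<Longrightarrow> g s \<noteq> \<zero>\<^bsub>E\<^esub>"
begin

lemma g_closed [simp]: "a \<in> carrier R \<Longrightarrow> g a \<in> carrier E"
  using g by (rule ring_hom_closed)

lemma g_Units [simp]: "s \<in> S \<Longrightarrow> g s \<in> Units E"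
  using g_unit E.field_Units by simp

lemma div_eq_iff:
  assumes "x \<in> carrier E" "y \<in> carrier E" "s \<in> Units E" "t \<in> Units E"
  shows "x \<otimes>\<^bsub>E\<^esub> inv\<^bsub>E\<^esub> s = y \<otimes>\<^bsub>E\<^esub> inv\<^bsub>E\<^esub> t \<longleftrightarrow> x \<otimes>\<^bsub>E\<^esub> t = y \<otimes>\<^bsub>E\<^esub> s"
proof -
  have st: "s \<in> carrier E" "t \<in> carrier E" "inv\<^bsub>E\<^esub> s \<in> carrier E" "inv\<^bsub>E\<^esub> t \<in> carrier E"
    using assms by auto
  have s: "z \<otimes>\<^bsub>E\<^esub> inv\<^bsub>E\<^esub> s \<otimes>\<^bsub>E\<^esub> s = z" and t: "z \<otimes>\<^bsub>E\<^esub> inv\<^bsub>E\<^esub> t \<otimes>\<^bsub>E\<^esub> t = z" if "z \<in> carrier E" for z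
    using assms that st by (simp_all add: E.m_assoc)
  show ?thesis
  proof
    assume h: "x \<otimes>\<^bsub>E\<^esub> inv\<^bsub>E\<^esub> s = y \<otimes>\<^bsub>E\<^esub> inv\<^bsub>E\<^esub> t"
    have "x \<otimes>\<^bsub>E\<^esub> t = (x \<otimes>\<^bsub>E\<^esub> inv\<^bsub>E\<^esub> s) \<otimes>\<^bsub>E\<^esub> s \<otimes>\<^bsub>E\<^esub> t" using s assms by simp
    also have "\<dots> = (y \<otimes>\<^bsub>E\<^esub> inv\<^bsub>E\<^esub> t) \<otimes>\<^bsub>E\<^esub> t \<otimes>\<^bsub>E\<^esub> s"
      unfolding h using st assms(2) by (simp only: E.m_assoc E.m_comm[of s t] E.m_closed)
    also have "\<dots> = y \<otimes>\<^bsub>E\<^esub> s" using t assms by simp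
    finally show "x \<otimes>\<^bsub>E\<^esub> t = y \<otimes>\<^bsub>E\<^esub> s" .
  next
    assume h: "x \<otimes>\<^bsub>E\<^esub> t = y \<otimes>\<^bsub>E\<^esub> s"
    have "x \<otimes>\<^bsub>E\<^esub> inv\<^bsub>E\<^esub> s = (x \<otimes>\<^bsub>E\<^esub> inv\<^bsub>E\<^esub> s) \<otimes>\<^bsub>E\<^esub> inv\<^bsub>E\<^esub> t \<otimes>\<^bsub>E\<^esub> t" using t assms st by simp
    also have "\<dots> = (x \<otimes>\<^bsub>E\<^esub> t) \<otimes>\<^bsub>E\<^esub> (inv\<^bsub>E\<^esub> s \<otimes>\<^bsub>E\<^esub> inv\<^bsub>E\<^esub> t)"
      using st assms(1) by (simp add: E.m_ac del: E.Units_l_inv E.Units_r_inv)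
    also have "\<dots> = (y \<otimes>\<^bsub>E\<^esub> inv\<^bsub>E\<^esub> t) \<otimes>\<^bsub>E\<^esub> inv\<^bsub>E\<^esub> s \<otimes>\<^bsub>E\<^esub> s"
      unfolding h using st assms(2) by (simp add: E.m_ac del: E.Units_l_inv E.Units_r_inv)
    also have "\<dots> = y \<otimes>\<^bsub>E\<^esub> inv\<^bsub>E\<^esub> t" using s assms st by simp
    finally show "x \<otimes>\<^bsub>E\<^esub> inv\<^bsub>E\<^esub> s = y \<otimes>\<^bsub>E\<^esub> inv\<^bsub>E\<^esub> t" .
  qed
qed

lemma fraction_map_eq:
  assumes "a \<in> carrier R" "s \<in> S"
  shows "fraction_map g E (fra a s) = g a \<otimes>\<^bsub>E\<^esub> inv\<^bsub>E\<^esub> g s"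
proof -
  have "(SOME p. p \<in> fra a s) \<in> fra a s" using fraction_self[OF assms] by (rule someI)
  then obtain b t where bt: "(SOME p. p \<in> fra a s) = (b, t)" "(b, t) \<in> fra a s"
    by (cases "SOME p. p \<in> fra a s") auto
  then obtain u where u: "b \<in> carrier R" "t \<in> S" "u \<in> S" "u \<otimes> (a \<otimes> t) = u \<otimes> (b \<otimes> s)" by (auto simp: mem_fraction)
  have "g u \<otimes>\<^bsub>E\<^esub> (g a \<otimes>\<^bsub>E\<^esub> g t) = g u \<otimes>\<^bsub>E\<^esub> (g b \<otimes>\<^bsub>E\<^esub> g s)"
    using arg_cong[OF u(4), of g] u(1-3) assms by (simp add: ring_hom_mult[OF g])
  then have "g a \<otimes>\<^bsub>E\<^esub> g t = g b \<otimes>\<^bsub>E\<^esub> g s"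
    using g_unit[OF u(3)] u(1-3) assms by (simp add: E.m_lcancel)
  then show ?thesis unfolding fraction_map_def bt using u assms by (simp add: div_eq_iff)
qed

lemma fraction_map_hom: "fraction_map g E \<in> Ring.ring_hom Loc E"
proof (rule ring_hom_memI)
  fix x assume "x \<in> carrier Loc"
  then obtain a s where x: "a \<in> carrier R" "s \<in> S" "x = fra a s" by (rule Loc_cases)
  then show "fraction_map g E x \<in> carrier E" by (simp add: fraction_map_eq)
  fix y assume "y \<in> carrier Loc"
  then obtain b t where y: "b \<in> carrier R" "t \<in> S" "y = fra b t" by (rule Loc_cases)
  have st: "inv\<^bsub>E\<^esub> (g s \<otimes>\<^bsub>E\<^esub> g t) = inv\<^bsub>E\<^esub> g s \<otimes>\<^bsub>E\<^esub> inv\<^bsub>E\<^esub> g t"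
  proof (rule E.comm_inv_char)
    have gst: "g s \<in> carrier E" "g t \<in> carrier E" "inv\<^bsub>E\<^esub> g s \<in> carrier E" "inv\<^bsub>E\<^esub> g t \<in> carrier E"
      using x y by auto
    then have "g s \<otimes>\<^bsub>E\<^esub> g t \<otimes>\<^bsub>E\<^esub> (inv\<^bsub>E\<^esub> g s \<otimes>\<^bsub>E\<^esub> inv\<^bsub>E\<^esub> g t)
        = (g s \<otimes>\<^bsub>E\<^esub> inv\<^bsub>E\<^esub> g s) \<otimes>\<^bsub>E\<^esub> (g t \<otimes>\<^bsub>E\<^esub> inv\<^bsub>E\<^esub> g t)"
      by (simp add: E.m_ac del: E.Units_l_inv E.Units_r_inv)
    then show "g s \<otimes>\<^bsub>E\<^esub> g t \<otimes>\<^bsub>E\<^esub> (inv\<^bsub>E\<^esub> g s \<otimes>\<^bsub>E\<^esub> inv\<^bsub>E\<^esub> g t) = \<one>\<^bsub>E\<^esub>" using x y by simp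
  qed (use x y in auto)
  show "fraction_map g E (x \<otimes>\<^bsub>Loc\<^esub> y) = fraction_map g E x \<otimes>\<^bsub>E\<^esub> fraction_map g E y"
    using x y S_mult by (simp add: Loc_mult fraction_map_eq ring_hom_mult[OF g] st E.m_ac)
  have "(g a \<otimes>\<^bsub>E\<^esub> g t) \<otimes>\<^bsub>E\<^esub> (inv\<^bsub>E\<^esub> g s \<otimes>\<^bsub>E\<^esub> inv\<^bsub>E\<^esub> g t) = (g a \<otimes>\<^bsub>E\<^esub> inv\<^bsub>E\<^esub> g s) \<otimes>\<^bsub>E\<^esub> (g t \<otimes>\<^bsub>E\<^esub> inv\<^bsub>E\<^esub> g t)"
    "(g b \<otimes>\<^bsub>E\<^esub> g s) \<otimes>\<^bsub>E\<^esub> (inv\<^bsub>E\<^esub> g s \<otimes>\<^bsub>E\<^esub> inv\<^bsub>E\<^esub> g t) = (g b \<otimes>\<^bsub>E\<^esub> inv\<^bsub>E\<^esub> g t) \<otimes>\<^bsub>E\<^esub> (g s \<otimes>\<^bsub>E\<^esub> inv\<^bsub>E\<^esub> g s)"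
    using x y by (simp_all add: E.m_ac del: E.Units_l_inv E.Units_r_inv)
  then show "fraction_map g E (x \<oplus>\<^bsub>Loc\<^esub> y) = fraction_map g E x \<oplus>\<^bsub>E\<^esub> fraction_map g E y"
    using x y S_mult
    by (simp add: Loc_add fraction_map_eq ring_hom_mult[OF g] ring_hom_add[OF g] st E.l_distr)
next
  show "fraction_map g E \<one>\<^bsub>Loc\<^esub> = \<one>\<^bsub>E\<^esub>"
    using S_one by (simp add: Loc_simps fraction_map_eq ring_hom_one[OF g])
qed

end

section \<open>The local degree at a point with separable residue field\<close>

subsection \<open>The base field as a ring\<close>

lemma field_ring_simps [simp]:
  "carrier field_ring = UNIV" "monoid.mult field_ring = (*)" "one field_ring = 1"
  "ring.zero field_ring = 0" "ring.add field_ring = (+)"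
  by (simp_all add: field_ring_def)

lemma field_field_ring: "field (field_ring :: 'k::field ring)"
proof -
  have "cring (field_ring :: 'k ring)"
  proof (rule cringI)
    show "abelian_group (field_ring :: 'k ring)"
      by (rule abelian_groupI) (auto simp: algebra_simps intro: exI[of _ "- _"])
    show "Group.comm_monoid (field_ring :: 'k ring)"
      by (rule comm_monoidI) (auto simp: algebra_simps)
  qed (auto simp: algebra_simps)
  moreover have "Units (field_ring :: 'k ring) = carrier field_ring - {\<zero>\<^bsub>field_ring\<^esub>}"
  proof -
    have "\<exists>y. y * x = 1 \<and> x * y = 1" if "x \<noteq> 0" for x :: 'k
      using that by (intro exI[of _ "inverse x"]) auto
    then show ?thesis by (auto simp: Units_def)
  qed
  ultimately show ?thesis by (rule cring.cring_fieldI)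
qed

lemma cring_field_ring: "cring (field_ring :: 'k::field ring)"
proof -
  interpret field "field_ring :: 'k ring" by (rule field_field_ring)
  show ?thesis by (rule is_cring)
qed

lemma finsum_field_ring: "finsum (field_ring :: 'k::field ring) g A = sum g A"
proof -
  interpret field "field_ring :: 'k ring" by (rule field_field_ring)
  show ?thesis
    by (induction A rule: infinite_finite_induct) (simp_all add: finsum_infinite)
qed

lemma finsum_alg_module: "finsum (alg_module h B) = finsum B"
  by (simp add: fun_eq_iff finsum_def finprod_def alg_module_def)

text \<open>Expanding the B_i a in the second system, or the B'_j in the first, leads to the same
  double sum, as in the proof of tr(XY) = tr(YX).\<close>

lemma (in separable_point) trace_independent:
  assumes "finite_quotient n q d B C" "finite_quotient n q d' B' C'" and a: "a \<in> mpolys n"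
  shows "(\<Sum>i<d. C i (B i * a)) = (\<Sum>j<d'. C' j (B' j * a))"
proof -
  interpret l: finite_quotient n q d B C by fact
  interpret r: finite_quotient n q d' B' C' by fact
  have expand: "g z = (\<Sum>j\<in>A. c j * g (v j))"
    if g: "l.functional g" and z: "z \<in> mpolys n" and A: "finite A" "\<And>j. j \<in> A \<Longrightarrow> v j \<in> mpolys n"
      and zq: "z - (\<Sum>j\<in>A. mconst (c j) * v j) \<in> q"
    for g z c v and A :: "nat set"
  proof -
    have "g (\<Sum>j\<in>A. mconst (c j) * v j) = (\<Sum>j\<in>A. c j * g (v j))"
      using A
    proof (induction A rule: finite_induct)
      case empty
      then show ?case by (simp add: l.functional_zero[OF g])
    next
      case (insert j A)
      then have "(\<Sum>j\<in>A. mconst (c j) * v j) \<in> mpolys n" "v j \<in> mpolys n" by auto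
      then show ?case
        using insert by (simp add: l.functional_add[OF g] l.functional_mconst[OF g])
    qed
    moreover have "(\<Sum>j\<in>A. mconst (c j) * v j) \<in> mpolys n" using A by auto
    ultimately show ?thesis using l.functional_cong[OF g z _ zq] by simp
  qed
  have "(\<Sum>i<d. C i (B i * a)) = (\<Sum>i<d. \<Sum>j<d'. C' j (B i * a) * C i (B' j))"
  proof (intro sum.cong refl)
    fix i assume "i \<in> {..<d}"
    then have i: "i < d" by simp
    show "C i (B i * a) = (\<Sum>j<d'. C' j (B i * a) * C i (B' j))"
      by (rule expand[OF l.functional_C[OF i]]) (use a i l.E_in r.E_in r.C_expand in auto)
  qed
  also have "\<dots> = (\<Sum>j<d'. \<Sum>i<d. C i (B' j) * C' j (B i * a))"
    by (subst sum.swap) (simp add: mult.commute)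
  also have "\<dots> = (\<Sum>j<d'. C' j (B' j * a))"
  proof (intro sum.cong refl)
    fix j assume "j \<in> {..<d'}"
    then have j: "j < d'" by simp
    have f: "l.functional (C' j)"
      using r.functional_C[OF j] by (simp add: l.functional_def r.functional_def)
    have "a * (B' j - (\<Sum>i<d. mconst (C i (B' j)) * B i)) \<in> q"
      using a r.E_in[OF j] by (intro q_mult l.C_expand)
    then have "B' j * a - (\<Sum>i<d. mconst (C i (B' j)) * (B i * a)) \<in> q"
      by (simp add: right_diff_distrib sum_distrib_left mult_ac)
    then show "(\<Sum>i<d. C i (B' j) * C' j (B i * a)) = C' j (B' j * a)"
      using a r.E_in[OF j] l.E_in by (intro expand[OF f, symmetric]) auto
  qed
  finally show ?thesis .
qed

subsection \<open>The residue field\<close>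

text \<open>The residue field enters as an abstract field \<open>E\<close> with an evaluation
  \<open>ev\<close> of polynomials whose kernel is q, so that the degree can be computed without
  schemes. By \<open>fractions\<close> the elements of E are quotients of values of
  polynomials.\<close>

locale residue_point =
  fixes n :: nat and E :: "('b, 'e) ring_scheme" and \<kappa> :: "'k::field \<Rightarrow> 'b"
    and ev :: "'k mpoly \<Rightarrow> 'b" and q :: "'k mpoly set"
  assumes E: "field E" and \<kappa>: "\<kappa> \<in> Ring.ring_hom field_ring E"
    and ev: "ev \<in> Ring.ring_hom (mpoly_ring n) E" and ev_mconst: "ev (mconst c) = \<kappa> c"
    and separable_E: "separable_ext field_ring E \<kappa>"
    and fractions: "y \<in> carrier E \<Longrightarrow> \<exists>a\<in>mpolys n. \<exists>s\<in>mpolys n. ev s \<noteq> \<zero>\<^bsub>E\<^esub> \<and> y \<otimes>\<^bsub>E\<^esub> ev s = ev a"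
    and q_def: "q = {a \<in> mpolys n. ev a = \<zero>\<^bsub>E\<^esub>}"
begin

sublocale E: field E by (rule E)

lemma ev_closed [simp]: "a \<in> mpolys n \<Longrightarrow> ev a \<in> carrier E"
  using ring_hom_closed[OF ev] by simp

lemma ev_add: "a \<in> mpolys n \<Longrightarrow> b \<in> mpolys n \<Longrightarrow> ev (a + b) = ev a \<oplus>\<^bsub>E\<^esub> ev b"
  using ring_hom_add[OF ev] by simp

lemma ev_mult: "a \<in> mpolys n \<Longrightarrow> b \<in> mpolys n \<Longrightarrow> ev (a * b) = ev a \<otimes>\<^bsub>E\<^esub> ev b"
  using ring_hom_mult[OF ev] by simp

lemma ev_one: "ev 1 = \<one>\<^bsub>E\<^esub>"
  using ring_hom_one[OF ev] by simp

lemma ev_zero: "ev 0 = \<zero>\<^bsub>E\<^esub>"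
proof -
  interpret R: cring "mpoly_ring n :: 'k mpoly ring" by (rule cring_mpoly_ring)
  show ?thesis using ring_hom_zero[OF ev R.ring_axioms E.ring_axioms] by simp
qed

lemma ev_minus: "a \<in> mpolys n \<Longrightarrow> b \<in> mpolys n \<Longrightarrow> ev (a - b) = ev a \<ominus>\<^bsub>E\<^esub> ev b"
proof -
  assume ab: "a \<in> mpolys n" "b \<in> mpolys n"
  then have "ev (a - b) \<oplus>\<^bsub>E\<^esub> ev b = ev a" by (simp flip: ev_add)
  then have "ev a \<ominus>\<^bsub>E\<^esub> ev b = (ev (a - b) \<oplus>\<^bsub>E\<^esub> ev b) \<ominus>\<^bsub>E\<^esub> ev b" by simp
  also have "\<dots> = ev (a - b)" using ab by (simp add: E.minus_eq E.a_assoc E.r_neg)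
  finally show ?thesis by simp
qed

lemma ev_eq_iff: "a \<in> mpolys n \<Longrightarrow> b \<in> mpolys n \<Longrightarrow> ev a = ev b \<longleftrightarrow> a - b \<in> q"
  by (auto simp: q_def ev_minus E.r_right_minus_eq)

lemma ev_sum: "finite A \<Longrightarrow> (\<And>i. i \<in> A \<Longrightarrow> g i \<in> mpolys n) \<Longrightarrow> ev (\<Sum>i\<in>A. g i) = (\<Oplus>\<^bsub>E\<^esub>i\<in>A. ev (g i))"
proof (induction A rule: finite_induct)
  case (insert x A)
  then have "(\<Sum>i\<in>A. g i) \<in> mpolys n" by auto
  then show ?case using insert by (simp add: ev_add Pi_def)
qed (simp add: ev_zero)

lemma ev_power: "a \<in> mpolys n \<Longrightarrow> ev (a ^ k) = ev a [^]\<^bsub>E\<^esub> k"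
  by (induction k) (simp_all add: ev_one ev_mult E.m_comm)

lemma ev_of_nat: "a \<in> mpolys n \<Longrightarrow> ev (of_nat k * a) = [k] \<cdot>\<^bsub>E\<^esub> ev a"
proof (induction k)
  case (Suc k)
  have "(of_nat k :: 'k mpoly) \<in> mpolys n" by (induction k) auto
  then show ?case using Suc by (simp add: distrib_right ev_add E.add.nat_pow_Suc E.a_comm)
qed (simp add: ev_zero)

lemma \<kappa>_closed [simp]: "\<kappa> c \<in> carrier E"
  using ring_hom_closed[OF \<kappa>] by simp

lemma separable_mpolys:
  assumes a: "a \<in> mpolys n"
  shows "\<exists>r c. (\<Sum>t<r. mconst (c t) * a ^ t) \<in> q \<and>
      (\<Sum>t<r. of_nat t * mconst (c t) * a ^ (t - 1)) \<notin> q"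
proof -
  obtain p where
    p: "(\<Oplus>\<^bsub>E\<^esub>i\<in>{..<length p}. \<kappa> (ring.coeff field_ring p i) \<otimes>\<^bsub>E\<^esub> ev a [^]\<^bsub>E\<^esub> i) = \<zero>\<^bsub>E\<^esub>"
    "(\<Oplus>\<^bsub>E\<^esub>i\<in>{1..<length p}. [i] \<cdot>\<^bsub>E\<^esub> (\<kappa> (ring.coeff field_ring p i) \<otimes>\<^bsub>E\<^esub> ev a [^]\<^bsub>E\<^esub> (i - 1))) \<noteq> \<zero>\<^bsub>E\<^esub>"
    using separable_E a unfolding separable_ext_def by (meson ev_closed)
  define c where "c = ring.coeff field_ring p"
  let ?r = "length p"
  have nat: "(of_nat k :: 'k mpoly) \<in> mpolys n" for k by (induction k) auto
  have "ev (\<Sum>t<?r. mconst (c t) * a ^ t) = \<zero>\<^bsub>E\<^esub>"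
    using p(1) a by (simp add: ev_sum ev_mult ev_mconst ev_power c_def)
  moreover have "(\<Sum>t<?r. mconst (c t) * a ^ t) \<in> mpolys n"
    using a by (intro mpolys_sum) simp
  ultimately have "(\<Sum>t<?r. mconst (c t) * a ^ t) \<in> q" by (simp add: q_def)
  moreover have "(\<Sum>t<?r. of_nat t * mconst (c t) * a ^ (t - 1)) = (\<Sum>t\<in>{1..<?r}. of_nat t * (mconst (c t) * a ^ (t - 1)))"
    by (intro sum.mono_neutral_cong_right) (auto simp: mult.assoc Suc_le_eq)
  moreover have "ev (\<Sum>t\<in>{1..<?r}. of_nat t * (mconst (c t) * a ^ (t - 1))) \<noteq> \<zero>\<^bsub>E\<^esub>"
  proof -
    have "ev (\<Sum>t\<in>{1..<?r}. of_nat t * (mconst (c t) * a ^ (t - 1)))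
        = (\<Oplus>\<^bsub>E\<^esub>t\<in>{1..<?r}. ev (of_nat t * (mconst (c t) * a ^ (t - 1))))"
      using a nat by (intro ev_sum) auto
    also have "\<dots> = (\<Oplus>\<^bsub>E\<^esub>t\<in>{1..<?r}. [t] \<cdot>\<^bsub>E\<^esub> (\<kappa> (c t) \<otimes>\<^bsub>E\<^esub> ev a [^]\<^bsub>E\<^esub> (t - 1)))"
      using a by (intro E.finsum_cong') (auto simp: ev_of_nat ev_mult ev_mconst ev_power)
    finally show ?thesis using p(2) by (simp add: c_def)
  qed
  ultimately show ?thesis by (intro exI[of _ ?r] exI[of _ c]) (auto simp: q_def)
qed

sublocale separable_point n q
proof
  show "poly_ideal n q"
    by (auto simp: poly_ideal_def q_def ev_zero ev_add ev_mult)
  show "1 \<notin> q" by (simp add: q_def ev_one)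
  show "a \<in> q \<or> b \<in> q" if "a \<in> mpolys n" "b \<in> mpolys n" "a * b \<in> q" for a b
    using that E.integral[of "ev a" "ev b"] by (auto simp: q_def ev_mult)
qed (rule separable_mpolys)

text \<open>A denominator outside q has an inverse modulo q that is itself a polynomial, so
  quotients of values are values.\<close>

lemma ev_surj: "y \<in> carrier E \<Longrightarrow> \<exists>a\<in>mpolys n. y = ev a"
proof -
  assume y: "y \<in> carrier E"
  obtain a s where as: "a \<in> mpolys n" "s \<in> mpolys n" "ev s \<noteq> \<zero>\<^bsub>E\<^esub>" "y \<otimes>\<^bsub>E\<^esub> ev s = ev a"
    using fractions[OF y] by blast
  then have "s \<notin> q" by (simp add: q_def)
  then obtain v where v: "v \<in> mpolys n" "v * s - 1 \<in> q" using inverse_mod_q as by blast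
  then have "ev (v * s) = \<one>\<^bsub>E\<^esub>" using as by (simp add: ev_eq_iff flip: ev_one)
  then have vs: "ev s \<otimes>\<^bsub>E\<^esub> ev v = \<one>\<^bsub>E\<^esub>" using v as by (simp add: ev_mult E.m_comm)
  have "y = y \<otimes>\<^bsub>E\<^esub> (ev s \<otimes>\<^bsub>E\<^esub> ev v)" using y by (simp add: vs)
  also have "\<dots> = ev (a * v)" using y as v by (simp add: ev_mult E.m_assoc[symmetric])
  finally show ?thesis using as v by (intro bexI[of _ "a * v"]) auto
qed

lemma module_E: "Module.module field_ring (alg_module \<kappa> E)"
  by (intro module_alg_module \<kappa> E.is_cring cring_field_ring)

lemma lin_iso_quotient:
  assumes "finite_quotient n q d B C" and C_B: "\<And>i j. i < d \<Longrightarrow> j < d \<Longrightarrow> C i (B j) = (if i = j then 1 else 0)"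
  shows "lin_iso field_ring (std_space field_ring d) (alg_module \<kappa> E) (\<lambda>a. ev (\<Sum>i<d. mconst (a i) * B i))"
proof -
  interpret fq: finite_quotient n q d B C by fact
  let ?u = "\<lambda>a. \<Sum>i<d. mconst (a i) * B i"
  have u: "?u a \<in> mpolys n" for a using fq.E_in by (intro mpolys_sum) auto
  have C_u: "C i (?u a) = a i" if i: "i < d" for a i
  proof -
    have "C i (\<Sum>j\<in>A. mconst (a j) * B j) = (\<Sum>j\<in>A. a j * C i (B j))" if "A \<subseteq> {..<d}" for A
      using finite_subset[OF that finite_lessThan] that
    proof (induction A rule: finite_induct)
      case empty
      then show ?case by (simp add: fq.functional_zero fq.functional_C i)
    next
      case (insert j A)
      then have "(\<Sum>j\<in>A. mconst (a j) * B j) \<in> mpolys n" "B j \<in> mpolys n"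
        using fq.E_in by (auto intro!: mpolys_sum)
      then show ?case using insert by (simp add: fq.C_add fq.C_mconst i)
    qed
    from this[of "{..<d}"] have "C i (?u a) = (\<Sum>j<d. a j * C i (B j))" by simp
    also have "\<dots> = (\<Sum>j<d. if j = i then a j else 0)" using i C_B by (intro sum.cong refl) auto
    finally show ?thesis using i by simp
  qed
  have "bij_betw (\<lambda>a. ev (?u a)) ({..<d} \<rightarrow>\<^sub>E UNIV) (carrier E)"
  proof (rule bij_betwI')
    fix a b :: "nat \<Rightarrow> 'k" assume ab: "a \<in> {..<d} \<rightarrow>\<^sub>E UNIV" "b \<in> {..<d} \<rightarrow>\<^sub>E UNIV"
    show "ev (?u a) = ev (?u b) \<longleftrightarrow> a = b"
    proof
      assume "ev (?u a) = ev (?u b)"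
      then have "?u a - ?u b \<in> q" using u ev_eq_iff by blast
      then have "C i (?u a) = C i (?u b)" if "i < d" for i
        using fq.functional_cong[OF fq.functional_C[OF that] u u] by blast
      then show "a = b" using ab by (intro PiE_ext[OF ab]) (simp add: C_u)
    qed simp
    show "ev (?u a) \<in> carrier E" using u by simp
  next
    fix y assume "y \<in> carrier E"
    then obtain g where g: "g \<in> mpolys n" "y = ev g" using ev_surj by blast
    have "?u (\<lambda>i\<in>{..<d}. C i g) = ?u (\<lambda>i. C i g)" by (intro sum.cong) auto
    then have "y = ev (?u (\<lambda>i\<in>{..<d}. C i g))"
      using g fq.C_expand[OF g(1)] u ev_eq_iff[OF g(1) u] by simp
    moreover have "(\<lambda>i\<in>{..<d}. C i g) \<in> {..<d} \<rightarrow>\<^sub>E UNIV" by (simp add: PiE_iff)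
    ultimately show "\<exists>a\<in>{..<d} \<rightarrow>\<^sub>E UNIV. y = ev (?u a)" by blast
  qed
  moreover have "ev (?u (a \<oplus>\<^bsub>std_space field_ring d\<^esub> b)) = ev (?u a) \<oplus>\<^bsub>E\<^esub> ev (?u b)" for a b
  proof -
    have "?u (a \<oplus>\<^bsub>std_space field_ring d\<^esub> b) = ?u a + ?u b"
      by (simp add: mconst_add distrib_right sum.distrib)
    then show ?thesis using u by (simp add: ev_add)
  qed
  moreover have "ev (?u (c \<odot>\<^bsub>std_space field_ring d\<^esub> a)) = \<kappa> c \<otimes>\<^bsub>E\<^esub> ev (?u a)" for a c
  proof -
    have "?u (c \<odot>\<^bsub>std_space field_ring d\<^esub> a) = mconst c * ?u a"
      by (simp add: mconst_mult sum_distrib_left mult.assoc)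
    then show ?thesis using u by (simp add: ev_mult ev_mconst)
  qed
  ultimately show ?thesis unfolding lin_iso_def by (simp del: std_space_simps(3,4))
qed

lemma coords_eq:
  assumes e: "is_basis field_ring (alg_module \<kappa> E) m e" and y: "y \<in> carrier E"
  shows "coords field_ring (alg_module \<kappa> E) m e y
    = inv_into ({..<m} \<rightarrow>\<^sub>E UNIV) (\<lambda>a. lincomb (alg_module \<kappa> E) m a e) y"
proof -
  let ?L = "\<lambda>a. lincomb (alg_module \<kappa> E) m a e"
  have ex: "\<exists>!a. a \<in> {..<m} \<rightarrow>\<^sub>E UNIV \<and> y = ?L a" using e y by (simp add: is_basis_def)
  have bij: "bij_betw ?L ({..<m} \<rightarrow>\<^sub>E UNIV) (carrier E)"
    using lin_isoD(1)[OF basis_lin_iso[OF module_E e]] by simp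
  have "inv_into ({..<m} \<rightarrow>\<^sub>E UNIV) ?L y \<in> {..<m} \<rightarrow>\<^sub>E UNIV" "y = ?L (inv_into ({..<m} \<rightarrow>\<^sub>E UNIV) ?L y)"
    using bij_betw_apply[OF bij_betw_inv_into[OF bij] y] bij_betw_inv_into_right[OF bij y] by simp_all
  then show ?thesis unfolding coords_def using ex by (intro the1_equality) auto
qed

lemma basis_finite_quotient:
  assumes e: "is_basis field_ring (alg_module \<kappa> E) m e"
  shows "\<exists>B C. finite_quotient n q m B C \<and> (\<forall>i<m. B i \<in> mpolys n \<and> ev (B i) = e i) \<and>
    (\<forall>i. \<forall>a\<in>mpolys n. C i a = coords field_ring (alg_module \<kappa> E) m e (ev a) i)"
proof -
  let ?L = "\<lambda>a. lincomb (alg_module \<kappa> E) m a e"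
  define c where "c y = coords field_ring (alg_module \<kappa> E) m e y" for y
  note L = basis_lin_iso[OF module_E e]
  have S: "Module.module field_ring (std_space field_ring m)"
    by (rule module_std_space[OF cring_field_ring])
  note inv = lin_iso_inv[OF S L]
  have c_inv: "c y = inv_into (carrier (std_space field_ring m)) ?L y" if "y \<in> carrier E" for y
    using coords_eq[OF e that] by (simp add: c_def)
  have c_in: "c y \<in> {..<m} \<rightarrow>\<^sub>E UNIV" if "y \<in> carrier E" for y
    using lin_isoD(2)[OF inv] that by (simp add: c_inv)
  have c_add: "c (x \<oplus>\<^bsub>E\<^esub> y) i = c x i + c y i" if "x \<in> carrier E" "y \<in> carrier E" "i < m" for x y i
    using lin_isoD(3)[OF inv, of x y] that by (simp add: c_inv)
  have c_smult: "c (\<kappa> k \<otimes>\<^bsub>E\<^esub> x) i = k * c x i" if "x \<in> carrier E" "i < m" for k x i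
    using lin_isoD(4)[OF inv, of k x] that by (simp add: c_inv)
  have L_c: "?L (c y) = y" if "y \<in> carrier E" for y
    using bij_betw_inv_into_right[OF lin_isoD(1)[OF L]] that by (simp add: c_inv)
  have e_in: "e i \<in> carrier E" if "i < m" for i using e that by (auto simp: is_basis_def)
  have "\<forall>i. \<exists>b. i < m \<longrightarrow> b \<in> mpolys n \<and> ev b = e i"
    using ev_surj e_in by metis
  from choice[OF this] obtain B where B: "\<And>i. i < m \<Longrightarrow> B i \<in> mpolys n \<and> ev (B i) = e i" by auto
  define C where "C i a = c (ev a) i" for i a
  have "finite_quotient n q m B C"
  proof
    show "q \<subseteq> mpolys n" "0 \<in> q" by (auto simp: q_in q_zero)
    show "a + b \<in> q" if "a \<in> q" "b \<in> q" for a b using that by (rule q_add)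
    show "a * b \<in> q" if "a \<in> mpolys n" "b \<in> q" for a b using that by (rule q_mult)
    show "B i \<in> mpolys n" if "i < m" for i using B[OF that] by blast
    show "C i (a + b) = C i a + C i b" if "i < m" "a \<in> mpolys n" "b \<in> mpolys n" for i a b
      using that by (simp add: C_def ev_add c_add)
    show "C i (mconst k * a) = k * C i a" if "i < m" "a \<in> mpolys n" for i a k
      using that by (simp add: C_def ev_mult ev_mconst c_smult)
    show "C i a = 0" if "i < m" "a \<in> q" for i a
    proof -
      have "ev a = \<zero>\<^bsub>E\<^esub>" using that by (simp add: q_def)
      then show ?thesis using c_smult[OF E.zero_closed that(1), of 0] by (simp add: C_def)
    qed
    show "a - (\<Sum>i<m. mconst (C i a) * B i) \<in> q" if a: "a \<in> mpolys n" for a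
    proof -
      have "ev (\<Sum>i<m. mconst (C i a) * B i) = (\<Oplus>\<^bsub>E\<^esub>i\<in>{..<m}. ev (mconst (C i a) * B i))"
        using B by (intro ev_sum) auto
      also have "\<dots> = (\<Oplus>\<^bsub>E\<^esub>i\<in>{..<m}. \<kappa> (c (ev a) i) \<otimes>\<^bsub>E\<^esub> e i)"
        using B e_in by (intro E.finsum_cong') (auto simp: ev_mult ev_mconst C_def)
      also have "\<dots> = ?L (c (ev a))" by (simp add: lincomb_def finsum_alg_module)
      also have "\<dots> = ev a" using a by (simp add: L_c)
      finally have "ev a = ev (\<Sum>i<m. mconst (C i a) * B i)" by simp
      moreover have "(\<Sum>i<m. mconst (C i a) * B i) \<in> mpolys n" using B by (intro mpolys_sum) auto
      ultimately show ?thesis using ev_eq_iff[OF a] by blast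
    qed
  qed
  then show ?thesis using B unfolding C_def c_def by blast
qed

lemma alg_trace_eq:
  assumes fq: "finite_quotient n q d B C"
    and C_B: "\<And>i j. i < d \<Longrightarrow> j < d \<Longrightarrow> C i (B j) = (if i = j then 1 else 0)" and a: "a \<in> mpolys n"
  shows "alg_trace field_ring E \<kappa> (ev a) = (\<Sum>i<d. C i (B i * a))"
proof -
  have tr: "(\<Oplus>\<^bsub>field_ring\<^esub>i\<in>{..<m}. coords field_ring (alg_module \<kappa> E) m e (ev a \<otimes>\<^bsub>E\<^esub> e i) i)
      = (\<Sum>i<d. C i (B i * a))" if e: "is_basis field_ring (alg_module \<kappa> E) m e" for m e
  proof -
    obtain B' C' where fq': "finite_quotient n q m B' C'" and B': "\<And>i. i < m \<Longrightarrow> B' i \<in> mpolys n \<and> ev (B' i) = e i"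
      and C': "\<And>i a. a \<in> mpolys n \<Longrightarrow> C' i a = coords field_ring (alg_module \<kappa> E) m e (ev a) i"
      using basis_finite_quotient[OF e] by blast
    have "(\<Oplus>\<^bsub>field_ring\<^esub>i\<in>{..<m}. coords field_ring (alg_module \<kappa> E) m e (ev a \<otimes>\<^bsub>E\<^esub> e i) i)
        = (\<Sum>i<m. C' i (B' i * a))"
      unfolding finsum_field_ring
    proof (intro sum.cong refl)
      fix i assume "i \<in> {..<m}"
      then have i: "B' i \<in> mpolys n" "ev (B' i) = e i" using B' by auto
      have "ev (B' i * a) = ev a \<otimes>\<^bsub>E\<^esub> e i" using i a by (simp add: ev_mult E.m_comm flip: i(2))
      then show "coords field_ring (alg_module \<kappa> E) m e (ev a \<otimes>\<^bsub>E\<^esub> e i) i = C' i (B' i * a)"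
        using C' i a by simp
    qed
    also have "\<dots> = (\<Sum>i<d. C i (B i * a))" by (rule trace_independent[OF fq' fq a])
    finally show ?thesis .
  qed
  have "lin_iso field_ring (std_space field_ring d) (alg_module \<kappa> E) (\<lambda>a. ev (\<Sum>i<d. mconst (a i) * B i))"
    by (rule lin_iso_quotient[OF fq C_B])
  note e = lin_iso_basis[OF module_E this]
  show ?thesis
    unfolding alg_trace_def
  proof (rule the_equality)
    show "\<exists>m e. is_basis field_ring (alg_module \<kappa> E) m e \<and> (\<Sum>i<d. C i (B i * a))
      = (\<Oplus>\<^bsub>field_ring\<^esub>i\<in>{..<m}. coords field_ring (alg_module \<kappa> E) m e (ev a \<otimes>\<^bsub>E\<^esub> e i) i)"
      by (intro exI conjI, rule e, rule tr[OF e, symmetric])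
    fix t assume "\<exists>m e. is_basis field_ring (alg_module \<kappa> E) m e \<and>
      t = (\<Oplus>\<^bsub>field_ring\<^esub>i\<in>{..<m}. coords field_ring (alg_module \<kappa> E) m e (ev a \<otimes>\<^bsub>E\<^esub> e i) i)"
    then obtain m e where "is_basis field_ring (alg_module \<kappa> E) m e"
      "t = (\<Oplus>\<^bsub>field_ring\<^esub>i\<in>{..<m}. coords field_ring (alg_module \<kappa> E) m e (ev a \<otimes>\<^bsub>E\<^esub> e i) i)" by (elim exE conjE)
    then show "t = (\<Sum>i<d. C i (B i * a))" by (simp only: tr)
  qed
qed

end

context residue_point
begin

subsection \<open>The zero algebra\<close>

lemma q_iff: "a \<in> q \<longleftrightarrow> a \<in> mpolys n \<and> ev a = \<zero>\<^bsub>E\<^esub>"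
  by (subst q_def) simp

abbreviation "S \<equiv> mpolys n - q"
abbreviation "A \<equiv> localization (mpoly_ring n) S"

sublocale loc: fraction_extension "mpoly_ring n" S E ev
proof -
  interpret R: cring "mpoly_ring n :: 'k mpoly ring" by (rule cring_mpoly_ring)
  show "fraction_extension (mpoly_ring n) S E ev"
    by unfold_locales (use one_notin_q q_prime ev in \<open>auto simp: q_def\<close>)
qed

declare loc.S_in [simp del]

sublocale A: cring A by (rule loc.cring_Loc)

abbreviation "frac_one a \<equiv> fraction (mpoly_ring n) S a 1"

lemma frac_one_hom: "frac_one \<in> Ring.ring_hom (mpoly_ring n) A"
  using loc.fraction_hom by simp

lemma frac_one_in: "a \<in> mpolys n \<Longrightarrow> frac_one a \<in> carrier A"
  using ring_hom_closed[OF frac_one_hom] by simp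

lemma frac_one_add: "a \<in> mpolys n \<Longrightarrow> b \<in> mpolys n \<Longrightarrow> frac_one (a + b) = frac_one a \<oplus>\<^bsub>A\<^esub> frac_one b"
  using ring_hom_add[OF frac_one_hom] by simp

lemma frac_one_mult: "a \<in> mpolys n \<Longrightarrow> b \<in> mpolys n \<Longrightarrow> frac_one (a * b) = frac_one a \<otimes>\<^bsub>A\<^esub> frac_one b"
  using ring_hom_mult[OF frac_one_hom] by simp

lemma one_in_S: "1 \<in> S"
  using one_notin_q by simp

lemma frac_split: "a \<in> mpolys n \<Longrightarrow> s \<in> S \<Longrightarrow>
    fraction (mpoly_ring n) S a s = fraction (mpoly_ring n) S 1 s \<otimes>\<^bsub>A\<^esub> frac_one a"
  by (rule loc.fraction_split(1)[unfolded mpoly_ring_simps])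

text \<open>An element outside q becomes invertible in the local ring, so it can be cancelled in the
  contraction.\<close>

lemma saturated_ideal_vimage:
  assumes I: "ideal I A"
  shows "saturated_ideal {a \<in> mpolys n. frac_one a \<in> I}"
proof -
  interpret I: ideal I A by fact
  have sat: "frac_one a \<in> I" if s: "s \<in> S" and a: "a \<in> mpolys n" and sa: "frac_one (s * a) \<in> I" for s a
  proof -
    have inv: "fraction (mpoly_ring n) S 1 s \<in> carrier A" using s loc.fraction_in[of 1 s] by simp
    have s': "s \<in> mpolys n" using s by simp
    have "frac_one s \<otimes>\<^bsub>A\<^esub> fraction (mpoly_ring n) S 1 s = \<one>\<^bsub>A\<^esub>"
      by (rule loc.fraction_split(2)[unfolded mpoly_ring_simps, OF s])
    then have "frac_one a = fraction (mpoly_ring n) S 1 s \<otimes>\<^bsub>A\<^esub> frac_one (s * a)"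
      using inv frac_one_in s' a by (simp add: frac_one_mult A.m_assoc[symmetric] A.m_comm)
    then show ?thesis using I.I_l_closed[OF sa inv] by simp
  qed
  have "frac_one 0 = \<zero>\<^bsub>A\<^esub>" using loc.Loc_simps(3) by simp
  then have "frac_one 0 \<in> I" using I.zero_closed by simp
  then show ?thesis
    unfolding saturated_ideal_def poly_ideal_def using sat
    by (auto simp: frac_one_add frac_one_mult I.a_closed I.I_l_closed frac_one_in)
qed

lemma fraction_map_one:
  assumes a: "a \<in> mpolys n"
  shows "fraction_map ev E (frac_one a) = ev a"
  using loc.fraction_map_eq[OF a one_in_S] a by (simp add: ev_one)

end

text \<open>\<open>f_generate\<close> says that the f_j generate the maximal ideal of k[x]_q,
  phrased through contractions of its ideals.\<close>

locale residue_point_system = residue_point n E \<kappa> ev q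
  for n and E :: "('b, 'e) ring_scheme" and \<kappa> :: "'k::field \<Rightarrow> 'b" and ev and q +
  fixes f :: "nat \<Rightarrow> 'k mpoly"
  assumes f_q: "j < n \<Longrightarrow> f j \<in> q"
    and f_generate: "saturated_ideal I \<Longrightarrow> (\<And>j. j < n \<Longrightarrow> f j \<in> I) \<Longrightarrow> q \<subseteq> I"
begin

declare loc.S_in [simp del]

abbreviation "Z \<equiv> zero_algebra n q f"
abbreviation "\<pi> \<equiv> to_zero_algebra n q f"

definition f_ideal :: "('k mpoly \<times> 'k mpoly) set set" where
  "f_ideal = genideal A ((\<lambda>i. frac_one (f i)) ` {..<n})"

lemma zero_algebra_eq: "Z = A Quot f_ideal" "\<pi> g = f_ideal +>\<^bsub>A\<^esub> frac_one g"
  by (simp_all add: zero_algebra_def to_zero_algebra_def f_ideal_def Let_def)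

lemma ideal_f_ideal: "ideal f_ideal A"
  unfolding f_ideal_def using f_q q_in frac_one_in by (intro A.genideal_ideal) auto

text \<open>A fraction in the kernel has its numerator in q. The contraction of
  \<open>f_ideal\<close> is saturated and contains the f_j, hence it contains q by
  \<open>f_generate\<close>. Consequently the zero algebra is E itself.\<close>

lemma f_ideal_eq_kernel: "f_ideal = a_kernel A E (fraction_map ev E)"
proof -
  interpret h: ring_hom_ring A E "fraction_map ev E"
    by (rule ring_hom_ringI2[OF A.ring_axioms E.ring_axioms loc.fraction_map_hom])
  interpret I: ideal f_ideal A by (rule ideal_f_ideal)
  have inv_one: "inv\<^bsub>E\<^esub> \<one>\<^bsub>E\<^esub> = \<one>\<^bsub>E\<^esub>" by simp
  have f0: "ev (f i) = \<zero>\<^bsub>E\<^esub>" "f i \<in> mpolys n" if "i < n" for i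
    using f_q[OF that] unfolding q_iff by blast+
  show ?thesis
  proof
    show "f_ideal \<subseteq> a_kernel A E (fraction_map ev E)"
      unfolding f_ideal_def
    proof (rule A.genideal_minimal)
      show "ideal (a_kernel A E (fraction_map ev E)) A" by (rule h.kernel_is_ideal)
      show "(\<lambda>i. frac_one (f i)) ` {..<n} \<subseteq> a_kernel A E (fraction_map ev E)"
      proof
        fix z assume "z \<in> (\<lambda>i. frac_one (f i)) ` {..<n}"
        then obtain i where i: "i < n" "z = frac_one (f i)" by blast
        have "fraction_map ev E z = \<zero>\<^bsub>E\<^esub>" "z \<in> carrier A"
          unfolding i(2) by (simp_all only: fraction_map_one f0 i(1) frac_one_in)
        then show "z \<in> a_kernel A E (fraction_map ev E)" unfolding a_kernel_def' by blast
      qed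
    qed
    show "a_kernel A E (fraction_map ev E) \<subseteq> f_ideal"
    proof
      fix z assume z: "z \<in> a_kernel A E (fraction_map ev E)"
      then have zA: "z \<in> carrier A" and z0: "fraction_map ev E z = \<zero>\<^bsub>E\<^esub>"
        unfolding a_kernel_def' by blast+
      from zA obtain a s where as: "a \<in> mpolys n" "s \<in> S" "z = fraction (mpoly_ring n) S a s"
        by (rule loc.Loc_cases)
      have "ev a \<otimes>\<^bsub>E\<^esub> inv\<^bsub>E\<^esub> ev s = \<zero>\<^bsub>E\<^esub>" using z0 as by (simp add: loc.fraction_map_eq)
      moreover have "ev s \<in> Units E" using as loc.g_Units by blast
      ultimately have "ev a = \<zero>\<^bsub>E\<^esub>"
        using as E.integral[of "ev a" "inv\<^bsub>E\<^esub> ev s"] E.Units_inv_Units[of "ev s"] E.field_Units by auto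
      then have "a \<in> q" using as by (simp add: q_iff)
      moreover have "q \<subseteq> {a \<in> mpolys n. frac_one a \<in> f_ideal}"
      proof (rule f_generate[OF saturated_ideal_vimage[OF ideal_f_ideal]])
        fix j assume "j < n"
        moreover have "(\<lambda>i. frac_one (f i)) ` {..<n} \<subseteq> f_ideal"
          unfolding f_ideal_def using f0 frac_one_in by (intro A.genideal_self) auto
        ultimately show "f j \<in> {a \<in> mpolys n. frac_one a \<in> f_ideal}" using f0 by auto
      qed
      ultimately have "frac_one a \<in> f_ideal" by auto
      moreover have "fraction (mpoly_ring n) S 1 s \<in> carrier A" using as loc.fraction_in[of 1 s] by simp
      ultimately show "z \<in> f_ideal" using as frac_split[OF as(1,2)] I.I_l_closed by simp
    qed
  qed
qed

definition \<theta> :: "('k mpoly \<times> 'k mpoly) set set \<Rightarrow> 'b" where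
  "\<theta> z = the_elem (fraction_map ev E ` z)"

lemma \<theta>: "\<theta> \<in> ring_iso Z E" and \<theta>_\<pi>: "a \<in> mpolys n \<Longrightarrow> \<theta> (\<pi> a) = ev a"
  and \<pi>_hom: "\<pi> \<in> Ring.ring_hom (mpoly_ring n) Z"
proof -
  interpret h: ring_hom_ring A E "fraction_map ev E"
    by (rule ring_hom_ringI2[OF A.ring_axioms E.ring_axioms loc.fraction_map_hom])
  have "fraction_map ev E ` carrier A = carrier E"
  proof
    show "fraction_map ev E ` carrier A \<subseteq> carrier E" by auto
    show "carrier E \<subseteq> fraction_map ev E ` carrier A"
    proof
      fix y assume "y \<in> carrier E"
      then obtain a where "a \<in> mpolys n" "y = ev a" using ev_surj by blast
      then show "y \<in> fraction_map ev E ` carrier A" using fraction_map_one frac_one_in by (metis imageI)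
    qed
  qed
  from h.FactRing_iso_set[OF this] show "\<theta> \<in> ring_iso Z E"
    unfolding zero_algebra_eq f_ideal_eq_kernel \<theta>_def[abs_def] .
  show "\<theta> (\<pi> a) = ev a" if "a \<in> mpolys n"
    unfolding \<theta>_def zero_algebra_eq f_ideal_eq_kernel
    using h.the_elem_simp[OF frac_one_in[OF that]] fraction_map_one[OF that] by simp
  have "(+>\<^bsub>A\<^esub>) f_ideal \<in> Ring.ring_hom A Z"
    unfolding zero_algebra_eq by (rule ideal.rcos_ring_hom[OF ideal_f_ideal])
  from ring_hom_trans[OF frac_one_hom this] show "\<pi> \<in> Ring.ring_hom (mpoly_ring n) Z"
    by (simp add: comp_def zero_algebra_eq[abs_def] fun_eq_iff)
qed

lemma cring_Z: "cring Z"
  unfolding zero_algebra_eq by (rule ideal.quotient_is_cring[OF ideal_f_ideal A.is_cring])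

sublocale Z: cring Z by (rule cring_Z)

lemma \<pi>_in: "a \<in> mpolys n \<Longrightarrow> \<pi> a \<in> carrier Z"
  and \<pi>_add: "a \<in> mpolys n \<Longrightarrow> b \<in> mpolys n \<Longrightarrow> \<pi> (a + b) = \<pi> a \<oplus>\<^bsub>Z\<^esub> \<pi> b"
  and \<pi>_mult: "a \<in> mpolys n \<Longrightarrow> b \<in> mpolys n \<Longrightarrow> \<pi> (a * b) = \<pi> a \<otimes>\<^bsub>Z\<^esub> \<pi> b"
  and \<pi>_one: "\<pi> 1 = \<one>\<^bsub>Z\<^esub>"
  using ring_hom_closed[OF \<pi>_hom] ring_hom_add[OF \<pi>_hom] ring_hom_mult[OF \<pi>_hom] ring_hom_one[OF \<pi>_hom]
  by simp_all

lemma \<theta>_hom: "\<theta> \<in> Ring.ring_hom Z E" and \<theta>_bij: "bij_betw \<theta> (carrier Z) (carrier E)"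
  using \<theta> by (auto simp: ring_iso_def)

lemma \<theta>_inj: "x \<in> carrier Z \<Longrightarrow> y \<in> carrier Z \<Longrightarrow> \<theta> x = \<theta> y \<Longrightarrow> x = y"
  using \<theta>_bij by (auto simp: bij_betw_def inj_on_def)

lemma \<pi>_eq_iff: "a \<in> mpolys n \<Longrightarrow> b \<in> mpolys n \<Longrightarrow> \<pi> a = \<pi> b \<longleftrightarrow> a - b \<in> q"
proof -
  assume ab: "a \<in> mpolys n" "b \<in> mpolys n"
  have "\<pi> a = \<pi> b \<Longrightarrow> ev a = ev b" using \<theta>_\<pi>[OF ab(1)] \<theta>_\<pi>[OF ab(2)] by simp
  moreover have "ev a = ev b \<Longrightarrow> \<pi> a = \<pi> b"
    using \<theta>_inj[OF \<pi>_in[OF ab(1)] \<pi>_in[OF ab(2)]] by (simp add: \<theta>_\<pi> ab)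
  ultimately show ?thesis using ev_eq_iff[OF ab] by blast
qed

lemma \<pi>_surj:
  assumes "z \<in> carrier Z"
  obtains a where "a \<in> mpolys n" "z = \<pi> a"
proof -
  obtain a where "a \<in> mpolys n" "\<theta> z = ev a" using ev_surj ring_hom_closed[OF \<theta>_hom assms] by blast
  then have "z = \<pi> a" using \<theta>_inj[OF assms \<pi>_in] by (simp add: \<theta>_\<pi>)
  then show ?thesis using that \<open>a \<in> mpolys n\<close> by blast
qed

lemma \<pi>_zero: "\<pi> 0 = \<zero>\<^bsub>Z\<^esub>"
proof -
  have "\<pi> 0 \<oplus>\<^bsub>Z\<^esub> \<pi> 0 = \<pi> 0" by (simp flip: \<pi>_add)
  then show ?thesis using \<pi>_in[of 0] by (simp add: Z.add.r_cancel_one')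
qed

lemma \<pi>_sum: "finite M \<Longrightarrow> (\<And>i. i \<in> M \<Longrightarrow> g i \<in> mpolys n) \<Longrightarrow> \<pi> (\<Sum>i\<in>M. g i) = (\<Oplus>\<^bsub>Z\<^esub>i\<in>M. \<pi> (g i))"
proof (induction M rule: finite_induct)
  case (insert x M)
  then have "(\<Sum>i\<in>M. g i) \<in> mpolys n" by auto
  then show ?case using insert by (simp add: \<pi>_add \<pi>_in Pi_def)
qed (simp add: \<pi>_zero)

subsection \<open>The local degree\<close>

definition trace_jacobian_form :: "('k, 'b) bform" where
  "trace_jacobian_form = (alg_module \<kappa> E,
     \<lambda>x y. alg_trace field_ring E \<kappa> (ev (jacobian n f) \<otimes>\<^bsub>E\<^esub> (x \<otimes>\<^bsub>E\<^esub> y)))"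

lemma f_in: "j < n \<Longrightarrow> f j \<in> mpolys n"
  using f_q q_in by blast

lemma jacobian_in: "jacobian n f \<in> mpolys n"
  by (rule jacobian_mpolys) (rule f_in)

lemma jacobian_unit: "jacobian n f \<notin> q"
  by (rule jacobian_notin_q[OF f_q f_generate])

definition scheja_form :: "(('k mpoly \<times> 'k mpoly) set set \<Rightarrow> 'k) \<Rightarrow> ('k, ('k mpoly \<times> 'k mpoly) set set) bform" where
  "scheja_form \<eta> = (alg_module (\<lambda>t. \<pi> (mconst t)) Z, \<lambda>x y. \<eta> (x \<otimes>\<^bsub>Z\<^esub> y))"

text \<open>The sum in the definition is the image of the contraction of the determinant by the
  pullback of \<eta> to polynomials. This moves the condition on \<eta> into the calculus of
  contractions modulo q.\<close>

lemma scheja_storch_iff: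
  assumes fq: "finite_quotient n q d B C"
  shows "scheja_storch_functional n q f \<Delta> \<eta> \<longleftrightarrow>
    finite_quotient.functional n q (\<lambda>a. \<eta> (\<pi> a)) \<and>
    finite_quotient.contract_X n (\<lambda>a. \<eta> (\<pi> a)) (Determinant.det (mat n n (\<lambda>(i, j). \<Delta> i j))) - 1 \<in> q"
proof -
  interpret fq: finite_quotient n q d B C by fact
  define D where "D = Determinant.det (mat n n (\<lambda>(i, j). \<Delta> i j))"
  let ?l = "\<lambda>a. \<eta> (\<pi> a)"
  have lin: "(\<forall>x\<in>carrier Z. \<forall>y\<in>carrier Z. \<eta> (x \<oplus>\<^bsub>Z\<^esub> y) = \<eta> x + \<eta> y) \<and>
      (\<forall>c. \<forall>x\<in>carrier Z. \<eta> (\<pi> (mconst c) \<otimes>\<^bsub>Z\<^esub> x) = c * \<eta> x) \<longleftrightarrow> fq.functional ?l" (is "?a \<longleftrightarrow> _")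
  proof
    assume a: ?a
    have "\<eta> (\<pi> (mconst 0) \<otimes>\<^bsub>Z\<^esub> \<zero>\<^bsub>Z\<^esub>) = 0 * \<eta> \<zero>\<^bsub>Z\<^esub>" using a Z.zero_closed by blast
    then have zero: "\<eta> \<zero>\<^bsub>Z\<^esub> = 0" by (simp only: Z.r_null[OF \<pi>_in[OF mpolys_mconst]] mult_zero_left)
    have "\<pi> x = \<zero>\<^bsub>Z\<^esub>" if "x \<in> q" for x using \<pi>_eq_iff[of x 0] that q_in by (simp add: \<pi>_zero)
    then show "fq.functional ?l"
      unfolding fq.functional_def using a zero by (auto simp: \<pi>_add \<pi>_mult \<pi>_in)
  next
    assume l: "fq.functional ?l"
    show ?a
    proof (intro conjI ballI allI)
      fix x assume "x \<in> carrier Z"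
      then obtain a where a: "a \<in> mpolys n" "x = \<pi> a" by (rule \<pi>_surj)
      show "\<eta> (\<pi> (mconst c) \<otimes>\<^bsub>Z\<^esub> x) = c * \<eta> x" for c
        using fq.functional_mconst[OF l a(1), of c] a by (simp add: \<pi>_mult)
      fix y assume "y \<in> carrier Z"
      then obtain b where b: "b \<in> mpolys n" "y = \<pi> b" by (rule \<pi>_surj)
      show "\<eta> (x \<oplus>\<^bsub>Z\<^esub> y) = \<eta> x + \<eta> y"
        using fq.functional_add[OF l a(1) b(1)] a b by (simp add: \<pi>_add)
    qed
  qed
  have "\<pi> (fq.contract_X ?l D) = (\<Oplus>\<^bsub>Z\<^esub>m\<in>Poly_Mapping.keys D.
      \<pi> (Poly_Mapping.single (Y_part n m) (?l (Poly_Mapping.single (X_part n m) (Poly_Mapping.lookup D m)))))"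
    unfolding fq.contract_X_def by (intro \<pi>_sum single_in_mpolys fq.keys_parts) simp
  also have "\<dots> = (\<Oplus>\<^bsub>Z\<^esub>m\<in>Poly_Mapping.keys D.
         \<pi> (mconst (?l (Poly_Mapping.single (X_part n m) (Poly_Mapping.lookup D m)))) \<otimes>\<^bsub>Z\<^esub>
         \<pi> (Poly_Mapping.single (Y_part n m) 1))"
    by (intro Z.finsum_cong')
      (auto simp: single_in_mpolys fq.keys_parts \<pi>_in mconst_def mult_single
        simp flip: \<pi>_mult[OF mpolys_mconst single_in_mpolys, unfolded mconst_def])
  finally have eq: "\<pi> (fq.contract_X ?l D) = (\<Oplus>\<^bsub>Z\<^esub>m\<in>Poly_Mapping.keys D.
         \<pi> (mconst (?l (Poly_Mapping.single (X_part n m) (Poly_Mapping.lookup D m)))) \<otimes>\<^bsub>Z\<^esub>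
         \<pi> (Poly_Mapping.single (Y_part n m) 1))" .
  have "\<pi> (fq.contract_X ?l D) = \<one>\<^bsub>Z\<^esub> \<longleftrightarrow> fq.contract_X ?l D - 1 \<in> q"
    using \<pi>_eq_iff[OF fq.contract_in(1) mpolys_one] by (simp only: \<pi>_one)
  then show ?thesis
    unfolding scheja_storch_functional_def Let_def D_def[symmetric] eq[symmetric] using lin by blast
qed

text \<open>The degree is a definite description, so one admissible pair of \<open>\<Delta>\<close>
  and \<eta> has to be exhibited, and all admissible pairs have to give the same class.\<close>

theorem local_A1_degree_eq:
  "local_A1_degree n q f = gw_trace field_ring E \<kappa> (gw_rank_one E (ev (jacobian n f)))"
proof -
  obtain d B C where fq: "finite_quotient n q d B C"
    and C_B: "\<And>i j. i < d \<Longrightarrow> j < d \<Longrightarrow> C i (B j) = (if i = j then 1 else 0)"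
    using basis_exists by blast
  interpret fq: finite_quotient n q d B C by (rule fq)
  let ?J = "jacobian n f" and ?tr = "alg_trace field_ring E \<kappa>"
  have tr: "?tr (ev a) = fq.trace_functional a" if "a \<in> mpolys n" for a
    unfolding fq.trace_functional_def by (rule alg_trace_eq[OF fq C_B that])
  obtain u where u: "u \<in> mpolys n" "u * ?J - 1 \<in> q"
    using inverse_mod_q[OF jacobian_in jacobian_unit] by blast
  have ann: "annihilating_difference n q d B C f (Determinant.det (mat n n (\<lambda>(i, j). \<Delta> i j)))"
    if "difference_matrix n f \<Delta>" for \<Delta>
    using f_q det_difference_matrix_annihilates[OF that] fq
    by (simp add: annihilating_difference_def annihilating_difference_axioms_def)
  have diag: "monomial_subst (diag_exp n) (Determinant.det (mat n n (\<lambda>(i, j). \<Delta> i j))) = ?J"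
    if "difference_matrix n f \<Delta>" for \<Delta>
    by (rule diag_det_difference_matrix[OF f_in that])
  obtain \<Delta>0 where \<Delta>0: "difference_matrix n f \<Delta>0" using difference_matrix_exists[of n f] f_in by blast
  have ev_cases: "\<exists>a\<in>mpolys n. x = ev a" if "x \<in> carrier E" for x using ev_surj[OF that] .
  interpret fe: finite_extension_trace field_ring E \<kappa> d "\<lambda>a. ev (\<Sum>i<d. mconst (a i) * B i)"
  proof (rule finite_extension_trace.intro)
    show "lin_iso field_ring (std_space field_ring d) (alg_module \<kappa> E) (\<lambda>a. ev (\<Sum>i<d. mconst (a i) * B i))"
      by (rule lin_iso_quotient[OF fq C_B])
    show "?tr (x \<oplus>\<^bsub>E\<^esub> y) = ?tr x \<oplus>\<^bsub>field_ring\<^esub> ?tr y" if xy: "x \<in> carrier E" "y \<in> carrier E" for x y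
    proof -
      obtain a b where "a \<in> mpolys n" "x = ev a" "b \<in> mpolys n" "y = ev b" using xy ev_cases by meson
      then show ?thesis using fq.functional_add[OF fq.functional_trace, of a b] by (simp add: tr flip: ev_add)
    qed
    show "?tr (\<kappa> c \<otimes>\<^bsub>E\<^esub> x) = c \<otimes>\<^bsub>field_ring\<^esub> ?tr x" if x: "x \<in> carrier E" for c x
    proof -
      obtain a where "a \<in> mpolys n" "x = ev a" using x ev_cases by meson
      then show ?thesis using fq.functional_mconst[OF fq.functional_trace, of a c]
        by (simp add: tr flip: ev_mult ev_mconst)
    qed
    interpret annihilating_difference n q d B C f "Determinant.det (mat n n (\<lambda>(i, j). \<Delta>0 i j))"
      by (rule ann[OF \<Delta>0])
    obtain c where c: "c \<in> mpolys n" "fq.trace_functional c \<noteq> 0"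
      using trace_functional_nonzero[OF u(1), unfolded diag[OF \<Delta>0], OF u(2) one_notin_q] by blast
    show "\<exists>c\<in>carrier E. ?tr c \<noteq> \<zero>\<^bsub>field_ring\<^esub>"
    proof
      show "?tr (ev c) \<noteq> \<zero>\<^bsub>field_ring\<^esub>" using c by (simp add: tr)
    qed (simp add: c)
  qed (simp_all add: \<kappa> field_field_ring E)
  have J: "ev ?J \<in> carrier E" "ev ?J \<noteq> \<zero>\<^bsub>E\<^esub>" using jacobian_in jacobian_unit by (auto simp: q_iff)
  have nondeg: "nondeg_symm_form field_ring trace_jacobian_form"
    unfolding trace_jacobian_form_def by (rule fe.gw_trace_rank_one(1)[OF J])
  have rhs: "gw_trace field_ring E \<kappa> (gw_rank_one E (ev ?J)) = gw_class field_ring trace_jacobian_form"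
    unfolding trace_jacobian_form_def by (rule fe.gw_trace_rank_one(2)[OF J])
  have module_Z: "Module.module field_ring (alg_module (\<lambda>t. \<pi> (mconst t)) Z)"
  proof (rule module_alg_module[OF cring_field_ring cring_Z ring_hom_memI])
    show "\<pi> (mconst \<one>\<^bsub>field_ring\<^esub>) = \<one>\<^bsub>Z\<^esub>" by (simp add: \<pi>_one)
  qed (auto simp: \<pi>_in mconst_mult mconst_add simp flip: \<pi>_mult \<pi>_add)
  have zero_std: "nondeg_symm_form field_ring (zero_form (field_ring :: 'k ring))"
    using fe.zero_form_std[OF field_field_ring] nondeg_std_forms by blast
  have class_eq: "gw_class field_ring (scheja_form \<eta>) = gw_class field_ring trace_jacobian_form"
    if \<Delta>: "difference_matrix n f \<Delta>" and \<eta>: "scheja_storch_functional n q f \<Delta> \<eta>" for \<Delta> \<eta>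
  proof -
    interpret annihilating_difference n q d B C f "Determinant.det (mat n n (\<lambda>(i, j). \<Delta> i j))"
      by (rule ann[OF \<Delta>])
    have l: "fq.functional (\<lambda>a. \<eta> (\<pi> a))"
      and unique: "\<And>c. c \<in> mpolys n \<Longrightarrow> \<eta> (\<pi> (c * ?J)) = fq.trace_functional c"
      using \<eta> functional_unique unfolding scheja_storch_iff[OF fq] diag[OF \<Delta>] by blast+
    \<comment> \<open>Multiplication by J, on an arbitrary representative of y. It carries the form
      Tr(Jxy) on E to \<eta>(xy) on the zero algebra, because \<eta>(cJ) = Tr(c) with c =
      Jab.\<close>
    define g where "g y = \<pi> (?J * (SOME a. a \<in> mpolys n \<and> y = ev a))" for y
    have g: "g (ev a) = \<pi> (?J * a)" if a: "a \<in> mpolys n" for a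
    proof -
      define b where "b = (SOME b. b \<in> mpolys n \<and> ev a = ev b)"
      have b: "b \<in> mpolys n \<and> ev a = ev b" unfolding b_def by (rule someI[of _ a]) (simp add: a)
      then have "a - b \<in> q" using ev_eq_iff a by blast
      then have "?J * a - ?J * b \<in> q" using q_mult[OF jacobian_in] by (simp add: right_diff_distrib[symmetric])
      then have "\<pi> (?J * a) = \<pi> (?J * b)" using a b jacobian_in \<pi>_eq_iff[of "?J * a" "?J * b"] by simp
      then show ?thesis by (simp only: g_def b_def)
    qed
    have "lin_iso field_ring (alg_module \<kappa> E) (alg_module (\<lambda>t. \<pi> (mconst t)) Z) g"
      unfolding lin_iso_def
    proof (intro conjI ballI)
      show "bij_betw g (carrier (alg_module \<kappa> E)) (carrier (alg_module (\<lambda>t. \<pi> (mconst t)) Z))"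
        unfolding alg_module_simps
      proof (rule bij_betwI')
        fix x y assume "x \<in> carrier E" "y \<in> carrier E"
        then obtain a b where ab: "a \<in> mpolys n" "x = ev a" "b \<in> mpolys n" "y = ev b" using ev_cases by meson
        show "g x = g y \<longleftrightarrow> x = y"
        proof
          assume "g x = g y"
          then have "?J * (a - b) \<in> q"
            using ab jacobian_in \<pi>_eq_iff[of "?J * a" "?J * b"] by (simp add: g right_diff_distrib)
          then have "a - b \<in> q" using q_prime[OF jacobian_in, of "a - b"] jacobian_unit ab by simp
          then show "x = y" using ab ev_eq_iff by simp
        qed simp
        show "g x \<in> carrier Z" using ab jacobian_in by (simp add: g \<pi>_in)
      next
        fix z assume "z \<in> carrier Z"
        then obtain a where a: "a \<in> mpolys n" "z = \<pi> a" by (rule \<pi>_surj)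
        have "a * (u * ?J - 1) \<in> q" using a u by (intro q_mult)
        then have "?J * (u * a) - a \<in> q" by (simp add: algebra_simps)
        then have "z = g (ev (u * a))"
          using a u jacobian_in \<pi>_eq_iff[of "?J * (u * a)" a] by (simp add: g)
        then show "\<exists>x\<in>carrier E. z = g x" using a u by (intro bexI[of _ "ev (u * a)"]) auto
      qed
      fix x assume "x \<in> carrier (alg_module \<kappa> E)"
      then obtain a where a: "a \<in> mpolys n" "x = ev a" using ev_cases by auto
      show "g (c \<odot>\<^bsub>alg_module \<kappa> E\<^esub> x) = c \<odot>\<^bsub>alg_module (\<lambda>t. \<pi> (mconst t)) Z\<^esub> g x" for c
        using a jacobian_in by (simp add: g mult.left_commute flip: ev_mult ev_mconst \<pi>_mult)
      fix y assume "y \<in> carrier (alg_module \<kappa> E)"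
      then obtain b where b: "b \<in> mpolys n" "y = ev b" using ev_cases by auto
      show "g (x \<oplus>\<^bsub>alg_module \<kappa> E\<^esub> y) = g x \<oplus>\<^bsub>alg_module (\<lambda>t. \<pi> (mconst t)) Z\<^esub> g y"
        using a b jacobian_in by (simp add: g distrib_left flip: ev_add \<pi>_add)
    qed
    moreover have "\<eta> (g x \<otimes>\<^bsub>Z\<^esub> g y) = ?tr (ev ?J \<otimes>\<^bsub>E\<^esub> (x \<otimes>\<^bsub>E\<^esub> y))" if xy: "x \<in> carrier E" "y \<in> carrier E" for x y
    proof -
      obtain a b where ab: "a \<in> mpolys n" "x = ev a" "b \<in> mpolys n" "y = ev b" using ev_cases xy by meson
      have "\<eta> (g x \<otimes>\<^bsub>Z\<^esub> g y) = \<eta> (\<pi> ((?J * (a * b)) * ?J))"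
        using ab jacobian_in by (simp add: g mult_ac flip: \<pi>_mult)
      also have "\<dots> = ?tr (ev (?J * (a * b)))" using unique ab jacobian_in tr by simp
      finally show ?thesis using ab jacobian_in by (simp add: ev_mult)
    qed
    ultimately have iso: "isometric field_ring trace_jacobian_form (scheja_form \<eta>)"
      unfolding trace_jacobian_form_def scheja_form_def isometric_iff by auto
    have nondeg': "nondeg_symm_form field_ring (scheja_form \<eta>)"
      using isometric_nondeg[OF nondeg _ module_Z] iso unfolding scheja_form_def by blast
    show ?thesis
      unfolding gw_class_def
      by (rule gw_diff_cong[OF nondeg' zero_std nondeg zero_std isometric_sym[OF nondeg iso] isometric_refl])
  qed
  have ex: "\<exists>\<eta>. scheja_storch_functional n q f \<Delta>0 \<eta>"
  proof -
    interpret annihilating_difference n q d B C f "Determinant.det (mat n n (\<lambda>(i, j). \<Delta>0 i j))"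
      by (rule ann[OF \<Delta>0])
    \<comment> \<open>Since u inverts J, this is the functional x \<mapsto> Tr(x/J).\<close>
    define \<eta> where "\<eta> z = ?tr (ev u \<otimes>\<^bsub>E\<^esub> \<theta> z)" for z
    have \<eta>: "\<eta> (\<pi> a) = fq.trace_functional (u * a)" if "a \<in> mpolys n" for a
      using that u by (simp add: \<eta>_def \<theta>_\<pi> tr flip: ev_mult)
    note ex = functional_exists[OF u(1), unfolded diag[OF \<Delta>0], OF u(2)]
    have "fq.functional (\<lambda>a. \<eta> (\<pi> a))"
      using ex(1) \<eta> q_in unfolding fq.functional_def by simp
    moreover have "fq.contract_X (\<lambda>a. \<eta> (\<pi> a)) D = fq.contract_X (\<lambda>x. fq.trace_functional (u * x)) D" for D
      unfolding fq.contract_X_def by (intro sum.cong refl) (simp add: \<eta> single_in_mpolys fq.keys_parts)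
    ultimately show ?thesis unfolding scheja_storch_iff[OF fq] using ex(2) by (intro exI[of _ \<eta>]) simp
  qed
  show ?thesis
    unfolding local_A1_degree_def rhs
  proof (rule the_equality)
    obtain \<eta>0 where \<eta>0: "scheja_storch_functional n q f \<Delta>0 \<eta>0" using ex by blast
    show "\<exists>\<Delta> \<eta>. difference_matrix n f \<Delta> \<and> scheja_storch_functional n q f \<Delta> \<eta> \<and>
      gw_class field_ring trace_jacobian_form =
        gw_class field_ring (alg_module (\<lambda>t. \<pi> (mconst t)) Z, \<lambda>x y. \<eta> (x \<otimes>\<^bsub>Z\<^esub> y))"
      using class_eq[OF \<Delta>0 \<eta>0] \<Delta>0 \<eta>0 unfolding scheja_form_def by metis
  next
    fix c assume "\<exists>\<Delta> \<eta>. difference_matrix n f \<Delta> \<and> scheja_storch_functional n q f \<Delta> \<eta> \<and>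
      c = gw_class field_ring (alg_module (\<lambda>t. \<pi> (mconst t)) Z, \<lambda>x y. \<eta> (x \<otimes>\<^bsub>Z\<^esub> y))"
    then show "c = gw_class field_ring trace_jacobian_form"
      using class_eq unfolding scheja_form_def by metis
  qed
qed

end

section \<open>Stalks\<close>

text \<open>Stalks need only a presheaf of rings; for spectra and open subspaces this is all that is
  established.\<close>

locale ring_presheaf =
  fixes S :: "('p, 'r, 'z) ringed_space_scheme"
  assumes presheaf: "presheaf_on (topo S) (\<lambda>U. carrier (sect S U)) (rst S)"
    and sect_cring: "openin (topo S) U \<Longrightarrow> cring (sect S U)"
    and rst_hom: "openin (topo S) U \<Longrightarrow> openin (topo S) W \<Longrightarrow> W \<subseteq> U \<Longrightarrow>
      rst S U W \<in> Ring.ring_hom (sect S U) (sect S W)"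
begin

lemma rst_closed: "openin (topo S) U \<Longrightarrow> openin (topo S) W \<Longrightarrow> W \<subseteq> U \<Longrightarrow> s \<in> carrier (sect S U) \<Longrightarrow>
    rst S U W s \<in> carrier (sect S W)"
  using ring_hom_closed[OF rst_hom] by blast

lemma rst_rst: "openin (topo S) U \<Longrightarrow> openin (topo S) W \<Longrightarrow> openin (topo S) W' \<Longrightarrow> W \<subseteq> U \<Longrightarrow> W' \<subseteq> W \<Longrightarrow>
    s \<in> carrier (sect S U) \<Longrightarrow> rst S W W' (rst S U W s) = rst S U W' s"
  using presheaf unfolding presheaf_on_def by blast

lemma rst_id: "openin (topo S) U \<Longrightarrow> s \<in> carrier (sect S U) \<Longrightarrow> rst S U U s = s"
  using presheaf unfolding presheaf_on_def by blast

definition sec :: "'p \<Rightarrow> 'p set \<Rightarrow> 'r \<Rightarrow> bool" where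
  "sec x U s \<longleftrightarrow> openin (topo S) U \<and> x \<in> U \<and> s \<in> carrier (sect S U)"

lemma sec_rst: "sec x U s \<Longrightarrow> openin (topo S) W \<Longrightarrow> x \<in> W \<Longrightarrow> W \<subseteq> U \<Longrightarrow> sec x W (rst S U W s)"
  by (auto simp: sec_def rst_closed)

lemma mem_fgerm: "(W, t) \<in> fgerm S x U s \<longleftrightarrow> sec x W t \<and>
    (\<exists>N. openin (topo S) N \<and> x \<in> N \<and> N \<subseteq> U \<inter> W \<and> rst S U N s = rst S W N t)"
  by (auto simp: fgerm_def germ_def sec_def)

lemma fgerm_self: "sec x U s \<Longrightarrow> (U, s) \<in> fgerm S x U s"
  unfolding mem_fgerm by (auto simp: sec_def)

lemma fgerm_subset:
  assumes s: "sec x U s" and t: "sec x W t"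
    and N: "openin (topo S) N" "x \<in> N" "N \<subseteq> U \<inter> W" "rst S U N s = rst S W N t"
  shows "fgerm S x U s \<subseteq> fgerm S x W t"
proof
  fix z assume "z \<in> fgerm S x U s"
  then obtain V r M where z: "z = (V, r)" "sec x V r"
    and M: "openin (topo S) M" "x \<in> M" "M \<subseteq> U \<inter> V" "rst S U M s = rst S V M r"
    by (cases z) (auto simp: mem_fgerm)
  have NM: "openin (topo S) (N \<inter> M)" using N M by (simp add: openin_Int)
  have "rst S W (N \<inter> M) t = rst S N (N \<inter> M) (rst S W N t)"
    using N t NM by (subst rst_rst) (auto simp: sec_def)
  also have "\<dots> = rst S U (N \<inter> M) s"
    unfolding N(4)[symmetric] using N s NM by (subst rst_rst) (auto simp: sec_def)
  also have "\<dots> = rst S M (N \<inter> M) (rst S U M s)"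
    using M s NM by (subst rst_rst) (auto simp: sec_def)
  also have "\<dots> = rst S V (N \<inter> M) r"
    unfolding M(4) using M z NM by (subst rst_rst) (auto simp: sec_def)
  finally have "rst S W (N \<inter> M) t = rst S V (N \<inter> M) r" .
  moreover have "x \<in> N \<inter> M" "N \<inter> M \<subseteq> W \<inter> V" using N M by auto
  ultimately show "z \<in> fgerm S x W t" unfolding z(1) mem_fgerm using z(2) NM by blast
qed

lemma fgerm_eq_iff:
  assumes s: "sec x U s" and t: "sec x W t"
  shows "fgerm S x U s = fgerm S x W t \<longleftrightarrow>
    (\<exists>N. openin (topo S) N \<and> x \<in> N \<and> N \<subseteq> U \<inter> W \<and> rst S U N s = rst S W N t)"
proof
  assume "fgerm S x U s = fgerm S x W t"
  then have "(W, t) \<in> fgerm S x U s" using fgerm_self[OF t] by simp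
  then show "\<exists>N. openin (topo S) N \<and> x \<in> N \<and> N \<subseteq> U \<inter> W \<and> rst S U N s = rst S W N t"
    by (simp add: mem_fgerm)
next
  assume "\<exists>N. openin (topo S) N \<and> x \<in> N \<and> N \<subseteq> U \<inter> W \<and> rst S U N s = rst S W N t"
  then obtain N where N: "openin (topo S) N" "x \<in> N" "N \<subseteq> U \<inter> W" "rst S U N s = rst S W N t" by blast
  then have "N \<subseteq> W \<inter> U" by blast
  with N show "fgerm S x U s = fgerm S x W t"
    using fgerm_subset[OF s t N] fgerm_subset[OF t s N(1,2) _ N(4)[symmetric]] by blast
qed

lemma fgerm_rst:
  assumes "sec x U s" "openin (topo S) W" "x \<in> W" "W \<subseteq> U"
  shows "fgerm S x W (rst S U W s) = fgerm S x U s"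
proof -
  have "rst S W W (rst S U W s) = rst S U W s"
    using assms by (intro rst_id) (auto simp: sec_def rst_closed)
  then show ?thesis
    using assms by (subst fgerm_eq_iff[OF sec_rst[OF assms] assms(1)]) (intro exI[of _ W], auto)
qed

lemma stalk_carrier: "carrier (stalk S x) = {fgerm S x U s | U s. sec x U s}"
  by (auto simp: stalk_def Let_def germs_def fgerm_def sec_def)

lemma fgerm_in: "sec x U s \<Longrightarrow> fgerm S x U s \<in> carrier (stalk S x)"
  by (auto simp: stalk_carrier)

lemma stalk_cases:
  assumes "a \<in> carrier (stalk S x)"
  obtains U s where "sec x U s" "a = fgerm S x U s"
  using assms by (auto simp: stalk_carrier)

lemma stalk_cases2:
  assumes "a \<in> carrier (stalk S x)" "b \<in> carrier (stalk S x)"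
  obtains U s t where "sec x U s" "sec x U t" "a = fgerm S x U s" "b = fgerm S x U t"
proof -
  obtain U s where s: "sec x U s" "a = fgerm S x U s" using assms(1) by (rule stalk_cases)
  obtain W t where t: "sec x W t" "b = fgerm S x W t" using assms(2) by (rule stalk_cases)
  have UW: "openin (topo S) (U \<inter> W)" "x \<in> U \<inter> W" using s t by (auto simp: sec_def)
  show thesis
    using that[OF sec_rst[OF s(1) UW] sec_rst[OF t(1) UW]] fgerm_rst[OF s(1) UW] fgerm_rst[OF t(1) UW] s t
    by auto
qed

lemma stalk_cases3:
  assumes "a \<in> carrier (stalk S x)" "b \<in> carrier (stalk S x)" "c \<in> carrier (stalk S x)"
  obtains U s t r where "sec x U s" "sec x U t" "sec x U r"
    "a = fgerm S x U s" "b = fgerm S x U t" "c = fgerm S x U r"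
proof -
  obtain U s t where st: "sec x U s" "sec x U t" "a = fgerm S x U s" "b = fgerm S x U t"
    using assms(1,2) by (rule stalk_cases2)
  obtain W r where r: "sec x W r" "c = fgerm S x W r" using assms(3) by (rule stalk_cases)
  have UW: "openin (topo S) (U \<inter> W)" "x \<in> U \<inter> W" using st r by (auto simp: sec_def)
  show thesis
    using that[OF sec_rst[OF st(1) UW] sec_rst[OF st(2) UW] sec_rst[OF r(1) UW]]
      fgerm_rst[OF st(1) UW] fgerm_rst[OF st(2) UW] fgerm_rst[OF r(1) UW] st r by auto
qed

text \<open>On a common smaller neighborhood all representing sections agree, so the union in
  \<open>germ_op\<close> is over a single germ.\<close>

lemma germ_op_fgerm:
  assumes f_closed: "\<And>U s t. sec x U s \<Longrightarrow> sec x U t \<Longrightarrow> sec x U (f U s t)"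
    and f_rst: "\<And>U W s t. sec x U s \<Longrightarrow> sec x U t \<Longrightarrow> openin (topo S) W \<Longrightarrow> x \<in> W \<Longrightarrow> W \<subseteq> U \<Longrightarrow>
      rst S U W (f U s t) = f W (rst S U W s) (rst S U W t)"
    and s: "sec x U s" and t: "sec x U t"
  shows "germ_op (topo S) (\<lambda>U. carrier (sect S U)) (rst S) x f (fgerm S x U s) (fgerm S x U t)
    = fgerm S x U (f U s t)"
proof -
  have "fgerm S x W (f W s' t') = fgerm S x U (f U s t)"
    if s': "(W, s') \<in> fgerm S x U s" and t': "(W, t') \<in> fgerm S x U t" for W s' t'
  proof -
    from s' obtain M where s'': "sec x W s'" and M: "openin (topo S) M" "x \<in> M" "M \<subseteq> U \<inter> W" "rst S U M s = rst S W M s'"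
      by (auto simp: mem_fgerm)
    from t' obtain N where t'': "sec x W t'" and N: "openin (topo S) N" "x \<in> N" "N \<subseteq> U \<inter> W" "rst S U N t = rst S W N t'"
      by (auto simp: mem_fgerm)
    let ?P = "M \<inter> N"
    have P: "openin (topo S) ?P" "x \<in> ?P" "?P \<subseteq> U" "?P \<subseteq> W" "?P \<subseteq> M" "?P \<subseteq> N" using M N by auto
    have "rst S U ?P s = rst S W ?P s'"
      using rst_rst[of U M ?P s] rst_rst[of W M ?P s'] M P s s'' by (auto simp: sec_def)
    moreover have "rst S U ?P t = rst S W ?P t'"
      using rst_rst[of U N ?P t] rst_rst[of W N ?P t'] N P t t'' by (auto simp: sec_def)
    ultimately have "rst S W ?P (f W s' t') = rst S U ?P (f U s t)"
      using f_rst[OF s'' t'' P(1,2,4)] f_rst[OF s t P(1,2,3)] by simp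
    then show ?thesis
      unfolding fgerm_eq_iff[OF f_closed[OF s'' t''] f_closed[OF s t]] using P by blast
  qed
  then have "{fgerm S x W (f W s' t') | W s' t'. (W, s') \<in> fgerm S x U s \<and> (W, t') \<in> fgerm S x U t}
      = {fgerm S x U (f U s t)}"
    using fgerm_self[OF s] fgerm_self[OF t] by blast
  then show ?thesis unfolding germ_op_def fgerm_def[symmetric] by simp
qed

lemma sec_add: "sec x U s \<Longrightarrow> sec x U t \<Longrightarrow> sec x U (s \<oplus>\<^bsub>sect S U\<^esub> t)"
  and sec_mult: "sec x U s \<Longrightarrow> sec x U t \<Longrightarrow> sec x U (s \<otimes>\<^bsub>sect S U\<^esub> t)"
  using sect_cring[of U] by (auto simp: sec_def cring_def ring.ring_simprules)

lemma stalk_add: "sec x U s \<Longrightarrow> sec x U t \<Longrightarrow>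
    fgerm S x U s \<oplus>\<^bsub>stalk S x\<^esub> fgerm S x U t = fgerm S x U (s \<oplus>\<^bsub>sect S U\<^esub> t)"
  unfolding stalk_def Let_def
  by (simp, rule germ_op_fgerm) (auto simp: sec_add, auto simp: sec_def ring_hom_add[OF rst_hom])

lemma stalk_mult: "sec x U s \<Longrightarrow> sec x U t \<Longrightarrow>
    fgerm S x U s \<otimes>\<^bsub>stalk S x\<^esub> fgerm S x U t = fgerm S x U (s \<otimes>\<^bsub>sect S U\<^esub> t)"
  unfolding stalk_def Let_def
  by (simp, rule germ_op_fgerm) (auto simp: sec_mult, auto simp: sec_def ring_hom_mult[OF rst_hom])

lemma sec_one: "openin (topo S) U \<Longrightarrow> x \<in> U \<Longrightarrow> sec x U \<one>\<^bsub>sect S U\<^esub>"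
  and sec_zero: "openin (topo S) U \<Longrightarrow> x \<in> U \<Longrightarrow> sec x U \<zero>\<^bsub>sect S U\<^esub>"
  using sect_cring[of U] by (auto simp: sec_def cring_def ring.ring_simprules)

lemma rst_zero:
  assumes "openin (topo S) U" "openin (topo S) W" "W \<subseteq> U"
  shows "rst S U W \<zero>\<^bsub>sect S U\<^esub> = \<zero>\<^bsub>sect S W\<^esub>"
  using ring_hom_zero[OF rst_hom[OF assms]] sect_cring assms by (simp add: cring_def)

lemma stalk_one: "openin (topo S) U \<Longrightarrow> x \<in> U \<Longrightarrow> \<one>\<^bsub>stalk S x\<^esub> = fgerm S x U \<one>\<^bsub>sect S U\<^esub>"
proof -
  assume U: "openin (topo S) U" "x \<in> U"
  have sub: "U \<subseteq> pts S" using U openin_subset by blast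
  have "fgerm S x U (rst S (pts S) U \<one>\<^bsub>sect S (pts S)\<^esub>) = fgerm S x (pts S) \<one>\<^bsub>sect S (pts S)\<^esub>"
    using U sub by (intro fgerm_rst sec_one) auto
  then show ?thesis using ring_hom_one[OF rst_hom[OF _ U(1) sub]] by (simp add: stalk_def Let_def)
qed

lemma stalk_zero: "openin (topo S) U \<Longrightarrow> x \<in> U \<Longrightarrow> \<zero>\<^bsub>stalk S x\<^esub> = fgerm S x U \<zero>\<^bsub>sect S U\<^esub>"
proof -
  assume U: "openin (topo S) U" "x \<in> U"
  have sub: "U \<subseteq> pts S" using U openin_subset by blast
  have "fgerm S x U (rst S (pts S) U \<zero>\<^bsub>sect S (pts S)\<^esub>) = fgerm S x (pts S) \<zero>\<^bsub>sect S (pts S)\<^esub>"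
    using U sub by (intro fgerm_rst sec_zero) auto
  then show ?thesis using rst_zero[OF _ U(1) sub] by (simp add: stalk_def Let_def)
qed

lemma cring_stalk:
  assumes x: "x \<in> pts S"
  shows "cring (stalk S x)"
proof (rule cringI)
  have sect: "cring (sect S U)" if "sec x U s" for U s using that sect_cring by (simp add: sec_def)
  have op: "openin (topo S) U" "x \<in> U" if "sec x U s" for U s using that by (auto simp: sec_def)
  have mem: "s \<in> carrier (sect S U)" if "sec x U s" for U s using that by (simp add: sec_def)
  show "abelian_group (stalk S x)"
  proof (rule abelian_groupI)
    show "\<zero>\<^bsub>stalk S x\<^esub> \<in> carrier (stalk S x)"
      unfolding stalk_zero[OF openin_topspace x] by (intro fgerm_in sec_zero openin_topspace x)
  next
    fix a assume "a \<in> carrier (stalk S x)"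
    then obtain U s where s: "sec x U s" "a = fgerm S x U s" by (rule stalk_cases)
    interpret R: cring "sect S U" by (rule sect[OF s(1)])
    have z: "sec x U \<zero>\<^bsub>sect S U\<^esub>" and m: "sec x U (\<ominus>\<^bsub>sect S U\<^esub> s)" using s by (auto simp: sec_def)
    show "\<zero>\<^bsub>stalk S x\<^esub> \<oplus>\<^bsub>stalk S x\<^esub> a = a"
      unfolding stalk_zero[OF op[OF s(1)]] s(2) stalk_add[OF z s(1)] using mem[OF s(1)] by simp
    have "fgerm S x U (\<ominus>\<^bsub>sect S U\<^esub> s) \<oplus>\<^bsub>stalk S x\<^esub> a = \<zero>\<^bsub>stalk S x\<^esub>"
      unfolding stalk_zero[OF op[OF s(1)]] s(2) stalk_add[OF m s(1)] using mem[OF s(1)] by (simp add: R.l_neg)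
    then show "\<exists>b\<in>carrier (stalk S x). b \<oplus>\<^bsub>stalk S x\<^esub> a = \<zero>\<^bsub>stalk S x\<^esub>" using fgerm_in[OF m] by blast
  next
    fix a b assume "a \<in> carrier (stalk S x)" "b \<in> carrier (stalk S x)"
    then obtain U s t where st: "sec x U s" "sec x U t" "a = fgerm S x U s" "b = fgerm S x U t"
      by (rule stalk_cases2)
    interpret R: cring "sect S U" by (rule sect[OF st(1)])
    show "a \<oplus>\<^bsub>stalk S x\<^esub> b \<in> carrier (stalk S x)" using st by (simp add: stalk_add fgerm_in sec_add)
    show "a \<oplus>\<^bsub>stalk S x\<^esub> b = b \<oplus>\<^bsub>stalk S x\<^esub> a"
      using st mem by (simp add: stalk_add R.a_comm)
    fix c assume "c \<in> carrier (stalk S x)"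
    with \<open>a \<in> carrier (stalk S x)\<close> \<open>b \<in> carrier (stalk S x)\<close> obtain U s t r where
      str: "sec x U s" "sec x U t" "sec x U r" "a = fgerm S x U s" "b = fgerm S x U t" "c = fgerm S x U r"
      by (rule stalk_cases3)
    interpret Q: cring "sect S U" by (rule sect[OF str(1)])
    show "a \<oplus>\<^bsub>stalk S x\<^esub> b \<oplus>\<^bsub>stalk S x\<^esub> c = a \<oplus>\<^bsub>stalk S x\<^esub> (b \<oplus>\<^bsub>stalk S x\<^esub> c)"
      using str mem by (simp add: stalk_add sec_add Q.a_assoc)
  qed
  show "Group.comm_monoid (stalk S x)"
  proof (rule comm_monoidI)
    show "\<one>\<^bsub>stalk S x\<^esub> \<in> carrier (stalk S x)"
      unfolding stalk_one[OF openin_topspace x] by (intro fgerm_in sec_one openin_topspace x)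
  next
    fix a assume "a \<in> carrier (stalk S x)"
    then obtain U s where s: "sec x U s" "a = fgerm S x U s" by (rule stalk_cases)
    interpret R: cring "sect S U" by (rule sect[OF s(1)])
    have z: "sec x U \<one>\<^bsub>sect S U\<^esub>" using s by (auto simp: sec_def)
    show "\<one>\<^bsub>stalk S x\<^esub> \<otimes>\<^bsub>stalk S x\<^esub> a = a"
      unfolding stalk_one[OF op[OF s(1)]] s(2) stalk_mult[OF z s(1)] using mem[OF s(1)] by simp
  next
    fix a b assume "a \<in> carrier (stalk S x)" "b \<in> carrier (stalk S x)"
    then obtain U s t where st: "sec x U s" "sec x U t" "a = fgerm S x U s" "b = fgerm S x U t"
      by (rule stalk_cases2)
    interpret R: cring "sect S U" by (rule sect[OF st(1)])
    show "a \<otimes>\<^bsub>stalk S x\<^esub> b \<in> carrier (stalk S x)" using st by (simp add: stalk_mult fgerm_in sec_mult)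
    show "a \<otimes>\<^bsub>stalk S x\<^esub> b = b \<otimes>\<^bsub>stalk S x\<^esub> a"
      using st mem by (simp add: stalk_mult R.m_comm)
    fix c assume "c \<in> carrier (stalk S x)"
    with \<open>a \<in> carrier (stalk S x)\<close> \<open>b \<in> carrier (stalk S x)\<close> obtain U s t r where
      str: "sec x U s" "sec x U t" "sec x U r" "a = fgerm S x U s" "b = fgerm S x U t" "c = fgerm S x U r"
      by (rule stalk_cases3)
    interpret Q: cring "sect S U" by (rule sect[OF str(1)])
    show "a \<otimes>\<^bsub>stalk S x\<^esub> b \<otimes>\<^bsub>stalk S x\<^esub> c = a \<otimes>\<^bsub>stalk S x\<^esub> (b \<otimes>\<^bsub>stalk S x\<^esub> c)"
      using str mem by (simp add: stalk_mult sec_mult Q.m_assoc)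
  qed
  fix a b c assume "a \<in> carrier (stalk S x)" "b \<in> carrier (stalk S x)" "c \<in> carrier (stalk S x)"
  then obtain U s t r where
    str: "sec x U s" "sec x U t" "sec x U r" "a = fgerm S x U s" "b = fgerm S x U t" "c = fgerm S x U r"
    by (rule stalk_cases3)
  interpret R: cring "sect S U" by (rule sect[OF str(1)])
  show "(a \<oplus>\<^bsub>stalk S x\<^esub> b) \<otimes>\<^bsub>stalk S x\<^esub> c = a \<otimes>\<^bsub>stalk S x\<^esub> c \<oplus>\<^bsub>stalk S x\<^esub> b \<otimes>\<^bsub>stalk S x\<^esub> c"
    using str mem by (simp add: stalk_mult stalk_add sec_mult sec_add R.l_distr)
qed

lemma fgerm_hom:
  assumes "openin (topo S) U" "x \<in> U"
  shows "fgerm S x U \<in> Ring.ring_hom (sect S U) (stalk S x)"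
  using assms
  by (intro ring_hom_memI) (auto simp: sec_def stalk_one fgerm_in stalk_add stalk_mult)

text \<open>For maps out of a stalk that are defined as unions over representatives: if
  \<open>F\<close> is compatible with restriction, all representatives contribute the same
  value.\<close>

lemma germ_image:
  assumes F: "\<And>U N s. sec x U s \<Longrightarrow> openin (topo S) N \<Longrightarrow> x \<in> N \<Longrightarrow> N \<subseteq> U \<Longrightarrow> F N (rst S U N s) = F U s"
    and s: "sec x U s"
  shows "{F W t | W t. (W, t) \<in> fgerm S x U s} = {F U s}"
proof -
  have "F W t = F U s" if "(W, t) \<in> fgerm S x U s" for W t
  proof -
    from that obtain N where "sec x W t" "openin (topo S) N" "x \<in> N" "N \<subseteq> U \<inter> W" "rst S U N s = rst S W N t"
      by (auto simp: mem_fgerm)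
    then show ?thesis using F[of U s N] F[of W t N] s by auto
  qed
  then show ?thesis using fgerm_self[OF s] by blast
qed

end

lemma ring_presheaf_ringed: "ringed S \<Longrightarrow> ring_presheaf S"
  unfolding ringed_def sheaf_on_def by (rule ring_presheaf.intro) auto

lemma ring_presheaf_k_open_sub:
  assumes "ring_presheaf S" and U: "openin (topo S) U"
  shows "ring_presheaf (k_open_sub S U)"
proof -
  interpret ring_presheaf S by fact
  have op: "openin (topo (k_open_sub S U)) W \<longleftrightarrow> openin (topo S) W \<and> W \<subseteq> U" for W
    using U by (simp add: k_open_sub_def openin_open_subtopology)
  show ?thesis
  proof (rule ring_presheaf.intro)
    show "presheaf_on (topo (k_open_sub S U)) (\<lambda>W. carrier (sect (k_open_sub S U) W)) (rst (k_open_sub S U))"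
      using presheaf unfolding presheaf_on_def op by (simp add: k_open_sub_def)
  qed (auto simp: op, auto simp: k_open_sub_def sect_cring rst_hom)
qed

section \<open>Cotangent spaces under flat homomorphisms\<close>

lemma free_module_simps [simp]:
  "\<zero>\<^bsub>free_module A S\<^esub> = (\<lambda>_. \<zero>\<^bsub>A\<^esub>)" "v \<oplus>\<^bsub>free_module A S\<^esub> w = (\<lambda>s. v s \<oplus>\<^bsub>A\<^esub> w s)"
  "a \<odot>\<^bsub>free_module A S\<^esub> v = (\<lambda>s. a \<otimes>\<^bsub>A\<^esub> v s)"
  by (simp_all add: free_module_def)

lemma free_module_carrier: "v \<in> carrier (free_module A S) \<longleftrightarrow>
    (\<forall>s. v s \<in> carrier A) \<and> {s. v s \<noteq> \<zero>\<^bsub>A\<^esub>} \<subseteq> S \<and> finite {s. v s \<noteq> \<zero>\<^bsub>A\<^esub>}"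
  by (simp add: free_module_def)

text \<open>\<open>eval\<close> is the map from the free module on \<open>S\<close> to the \<open>A\<close>-algebra \<open>C\<close> that sends the
  generator \<open>z\<close> to \<open>w z\<close>.\<close>

locale free_eval = A: cring A + C: cring C for A :: "('a, 'x) ring_scheme" and C :: "('c, 'y) ring_scheme" +
  fixes k :: "'a \<Rightarrow> 'c" and S :: "'s set" and w :: "'s \<Rightarrow> 'c"
  assumes k: "k \<in> Ring.ring_hom A C" and w: "z \<in> S \<Longrightarrow> w z \<in> carrier C"
begin

abbreviation "FM \<equiv> free_module A S"

definition eval :: "('s \<Rightarrow> 'a) \<Rightarrow> 'c" where
  "eval v = (\<Oplus>\<^bsub>C\<^esub>z\<in>{z. v z \<noteq> \<zero>\<^bsub>A\<^esub>}. k (v z) \<otimes>\<^bsub>C\<^esub> w z)"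

lemma k_closed [simp]: "a \<in> carrier A \<Longrightarrow> k a \<in> carrier C"
  using k by (rule ring_hom_closed)

lemma k_zero: "k \<zero>\<^bsub>A\<^esub> = \<zero>\<^bsub>C\<^esub>"
  using k A.ring_axioms C.ring_axioms by (rule ring_hom_zero)

lemma FM_in: "v \<in> carrier FM \<Longrightarrow> v z \<in> carrier A"
  by (simp add: free_module_carrier)

lemma eval_superset:
  assumes v: "v \<in> carrier FM" and T: "finite T" "{z. v z \<noteq> \<zero>\<^bsub>A\<^esub>} \<subseteq> T" "T \<subseteq> S"
  shows "eval v = (\<Oplus>\<^bsub>C\<^esub>z\<in>T. k (v z) \<otimes>\<^bsub>C\<^esub> w z)"
  unfolding eval_def
proof (rule C.add.finprod_mono_neutral_cong_left[OF T(1,2)])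
  fix i assume "i \<in> T - {z. v z \<noteq> \<zero>\<^bsub>A\<^esub>}"
  then have "v i = \<zero>\<^bsub>A\<^esub>" "i \<in> S" using T by auto
  then show "k (v i) \<otimes>\<^bsub>C\<^esub> w i = \<zero>\<^bsub>C\<^esub>" by (simp add: k_zero w)
next
  show "(\<lambda>z. k (v z) \<otimes>\<^bsub>C\<^esub> w z) \<in> T \<rightarrow> carrier C" using T v w by (auto simp: FM_in)
qed simp

lemma eval_closed: "v \<in> carrier FM \<Longrightarrow> eval v \<in> carrier C"
  unfolding eval_def by (intro C.finsum_closed) (auto simp: free_module_carrier w)

lemma eval_minus:
  assumes v: "v \<in> carrier FM" and v': "v' \<in> carrier FM"
  shows "(\<lambda>z. v z \<ominus>\<^bsub>A\<^esub> v' z) \<in> carrier FM" "eval (\<lambda>z. v z \<ominus>\<^bsub>A\<^esub> v' z) = eval v \<ominus>\<^bsub>C\<^esub> eval v'"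
proof -
  let ?T = "{z. v z \<noteq> \<zero>\<^bsub>A\<^esub>} \<union> {z. v' z \<noteq> \<zero>\<^bsub>A\<^esub>}" and ?u = "\<lambda>z. v z \<ominus>\<^bsub>A\<^esub> v' z"
  have T: "finite ?T" "?T \<subseteq> S" using v v' by (auto simp: free_module_carrier)
  have "?u z = \<zero>\<^bsub>A\<^esub>" if "v z = \<zero>\<^bsub>A\<^esub>" "v' z = \<zero>\<^bsub>A\<^esub>" for z using that by (simp add: A.minus_eq)
  then have sup: "{z. ?u z \<noteq> \<zero>\<^bsub>A\<^esub>} \<subseteq> ?T" by auto
  then show u: "?u \<in> carrier FM"
    using T v v' finite_subset[OF sup T(1)] by (auto simp: free_module_carrier)
  have in': "(\<lambda>z. k (v z) \<otimes>\<^bsub>C\<^esub> w z) \<in> ?T \<rightarrow> carrier C" "(\<lambda>z. k (?u z) \<otimes>\<^bsub>C\<^esub> w z) \<in> ?T \<rightarrow> carrier C"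
    "(\<lambda>z. k (v' z) \<otimes>\<^bsub>C\<^esub> w z) \<in> ?T \<rightarrow> carrier C"
    using T v v' u w by (auto simp: FM_in)
  have "eval v = (\<Oplus>\<^bsub>C\<^esub>z\<in>?T. k (v z) \<otimes>\<^bsub>C\<^esub> w z)" by (rule eval_superset[OF v T(1) _ T(2)]) auto
  also have "\<dots> = (\<Oplus>\<^bsub>C\<^esub>z\<in>?T. k (?u z) \<otimes>\<^bsub>C\<^esub> w z \<oplus>\<^bsub>C\<^esub> k (v' z) \<otimes>\<^bsub>C\<^esub> w z)"
  proof (rule C.finsum_cong'[OF refl])
    fix z assume z: "z \<in> ?T"
    have "?u z \<oplus>\<^bsub>A\<^esub> v' z = v z" using FM_in[OF v] FM_in[OF v'] by (simp add: A.minus_eq A.a_assoc A.l_neg)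
    then have "k (v z) = k (?u z) \<oplus>\<^bsub>C\<^esub> k (v' z)"
      using ring_hom_add[OF k, of "?u z" "v' z"] FM_in[OF u] FM_in[OF v'] by simp
    moreover have "w z \<in> carrier C" using z T w by blast
    ultimately show "k (v z) \<otimes>\<^bsub>C\<^esub> w z = k (?u z) \<otimes>\<^bsub>C\<^esub> w z \<oplus>\<^bsub>C\<^esub> k (v' z) \<otimes>\<^bsub>C\<^esub> w z"
      using FM_in[OF u] FM_in[OF v'] by (simp add: C.l_distr)
  qed (use in' in \<open>auto simp: Pi_def\<close>)
  also have "\<dots> = (\<Oplus>\<^bsub>C\<^esub>z\<in>?T. k (?u z) \<otimes>\<^bsub>C\<^esub> w z) \<oplus>\<^bsub>C\<^esub> (\<Oplus>\<^bsub>C\<^esub>z\<in>?T. k (v' z) \<otimes>\<^bsub>C\<^esub> w z)"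
    by (rule C.finsum_addf[OF in'(2,3)])
  also have "(\<Oplus>\<^bsub>C\<^esub>z\<in>?T. k (?u z) \<otimes>\<^bsub>C\<^esub> w z) = eval ?u"
    using eval_superset[OF u T(1) sup T(2)] by simp
  also have "(\<Oplus>\<^bsub>C\<^esub>z\<in>?T. k (v' z) \<otimes>\<^bsub>C\<^esub> w z) = eval v'"
    by (rule eval_superset[OF v' T(1) _ T(2), symmetric]) auto
  finally have "eval v = eval ?u \<oplus>\<^bsub>C\<^esub> eval v'" .
  then show "eval ?u = eval v \<ominus>\<^bsub>C\<^esub> eval v'"
    using eval_closed[OF u] eval_closed[OF v'] by (simp add: C.minus_eq C.a_assoc C.r_neg)
qed

lemma eval_smult:
  assumes v: "v \<in> carrier FM" and a: "a \<in> carrier A"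
  shows "(\<lambda>z. a \<otimes>\<^bsub>A\<^esub> v z) \<in> carrier FM" "eval (\<lambda>z. a \<otimes>\<^bsub>A\<^esub> v z) = k a \<otimes>\<^bsub>C\<^esub> eval v"
proof -
  let ?T = "{z. v z \<noteq> \<zero>\<^bsub>A\<^esub>}" and ?u = "\<lambda>z. a \<otimes>\<^bsub>A\<^esub> v z"
  have T: "finite ?T" "?T \<subseteq> S" using v by (auto simp: free_module_carrier)
  have sup: "{z. ?u z \<noteq> \<zero>\<^bsub>A\<^esub>} \<subseteq> ?T" using a by auto
  then show u: "?u \<in> carrier FM"
    using T v a finite_subset[OF sup T(1)] by (auto simp: free_module_carrier)
  have "eval ?u = (\<Oplus>\<^bsub>C\<^esub>z\<in>?T. k (?u z) \<otimes>\<^bsub>C\<^esub> w z)" by (rule eval_superset[OF u T(1) sup T(2)])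
  also have "\<dots> = (\<Oplus>\<^bsub>C\<^esub>z\<in>?T. k a \<otimes>\<^bsub>C\<^esub> (k (v z) \<otimes>\<^bsub>C\<^esub> w z))"
    using T w a FM_in[OF v] by (intro C.finsum_cong') (auto simp: ring_hom_mult[OF k] C.m_assoc)
  also have "\<dots> = k a \<otimes>\<^bsub>C\<^esub> eval v"
    unfolding eval_def using T w a FM_in[OF v] by (intro C.finsum_rdistr[symmetric]) auto
  finally show "eval ?u = k a \<otimes>\<^bsub>C\<^esub> eval v" .
qed

lemma eval_gen:
  assumes z: "z \<in> S"
  shows "gen A z \<in> carrier FM" "eval (gen A z) = w z"
proof -
  have sup: "{s. gen A z s \<noteq> \<zero>\<^bsub>A\<^esub>} \<subseteq> {z}" by (auto simp: gen_def)
  show g: "gen A z \<in> carrier FM"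
    using z finite_subset[OF sup] sup by (auto simp: free_module_carrier gen_def)
  have "eval (gen A z) = (\<Oplus>\<^bsub>C\<^esub>s\<in>{z}. k (gen A z s) \<otimes>\<^bsub>C\<^esub> w s)"
    by (rule eval_superset[OF g _ sup]) (use z in auto)
  also have "\<dots> = w z" using z w[OF z] by (simp add: gen_def ring_hom_one[OF k])
  finally show "eval (gen A z) = w z" .
qed

lemma abelian_group_FM: "abelian_group FM"
proof (rule abelian_groupI)
  fix v assume v: "v \<in> carrier FM"
  have z: "(\<lambda>_. \<zero>\<^bsub>A\<^esub>) \<in> carrier FM" by (simp add: free_module_carrier)
  show "\<exists>u\<in>carrier FM. u \<oplus>\<^bsub>FM\<^esub> v = \<zero>\<^bsub>FM\<^esub>"
    using eval_minus(1)[OF z v] FM_in[OF v] by (intro bexI[of _ "\<lambda>z. \<zero>\<^bsub>A\<^esub> \<ominus>\<^bsub>A\<^esub> v z"]) (auto simp: A.minus_eq A.l_neg)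
  show "\<zero>\<^bsub>FM\<^esub> \<oplus>\<^bsub>FM\<^esub> v = v" using FM_in[OF v] by simp
  fix v' assume v': "v' \<in> carrier FM"
  show "v \<oplus>\<^bsub>FM\<^esub> v' = v' \<oplus>\<^bsub>FM\<^esub> v" using FM_in[OF v] FM_in[OF v'] by (simp add: A.a_comm)
  have "{z. v z \<oplus>\<^bsub>A\<^esub> v' z \<noteq> \<zero>\<^bsub>A\<^esub>} \<subseteq> {z. v z \<noteq> \<zero>\<^bsub>A\<^esub>} \<union> {z. v' z \<noteq> \<zero>\<^bsub>A\<^esub>}" by auto
  then show "v \<oplus>\<^bsub>FM\<^esub> v' \<in> carrier FM"
    using v v' by (auto simp: free_module_carrier intro: finite_subset)
  fix v'' assume "v'' \<in> carrier FM"
  then show "v \<oplus>\<^bsub>FM\<^esub> v' \<oplus>\<^bsub>FM\<^esub> v'' = v \<oplus>\<^bsub>FM\<^esub> (v' \<oplus>\<^bsub>FM\<^esub> v'')"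
    using FM_in[OF v] FM_in[OF v'] FM_in[of v''] by (simp add: A.a_assoc)
qed (simp add: free_module_carrier)

text \<open>Since \<open>mspan\<close> is the least submodule containing given relations, it is
  enough to check that \<open>eval\<close> sends the relations into \<open>K\<close>; their whole
  span then follows.\<close>

lemma submodule_vimage:
  assumes K: "ideal K C"
  shows "submodule {v \<in> carrier FM. eval v \<in> K} A FM"
proof -
  interpret K: ideal K C by fact
  interpret FM: abelian_group FM by (rule abelian_group_FM)
  have zero: "(\<lambda>_. \<zero>\<^bsub>A\<^esub>) \<in> carrier FM" "eval (\<lambda>_. \<zero>\<^bsub>A\<^esub>) = \<zero>\<^bsub>C\<^esub>"
    by (simp_all add: free_module_carrier eval_def)
  have minus: "(\<lambda>z. v z \<ominus>\<^bsub>A\<^esub> v' z) \<in> carrier FM \<and> eval (\<lambda>z. v z \<ominus>\<^bsub>A\<^esub> v' z) \<in> K"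
    if "v \<in> carrier FM" "v' \<in> carrier FM" "eval v \<in> K" "eval v' \<in> K" for v v'
    using eval_minus[OF that(1,2)] that K.a_closed[OF that(3) K.a_inv_closed[OF that(4)]]
    by (simp add: C.minus_eq)
  have inv: "inv\<^bsub>add_monoid FM\<^esub> v = (\<lambda>z. \<zero>\<^bsub>A\<^esub> \<ominus>\<^bsub>A\<^esub> v z)" if v: "v \<in> carrier FM" for v
    unfolding a_inv_def[symmetric]
    by (rule FM.minus_equality) (use v FM_in[OF v] eval_minus(1)[OF zero(1) v] in \<open>auto simp: A.minus_eq A.l_neg\<close>)
  show ?thesis
  proof (intro submodule.intro subgroup.intro submodule_axioms.intro)
    fix v assume v: "v \<in> {v \<in> carrier FM. eval v \<in> K}"
    have m: "(\<lambda>z. \<zero>\<^bsub>A\<^esub> \<ominus>\<^bsub>A\<^esub> v z) \<in> carrier FM \<and> eval (\<lambda>z. \<zero>\<^bsub>A\<^esub> \<ominus>\<^bsub>A\<^esub> v z) \<in> K"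
      if "v \<in> {v \<in> carrier FM. eval v \<in> K}" for v
      using minus[OF zero(1), of v] that zero(2) K.zero_closed by simp
    then show "inv\<^bsub>add_monoid FM\<^esub> v \<in> {v \<in> carrier FM. eval v \<in> K}" using inv v by simp
    fix v' assume v': "v' \<in> {v \<in> carrier FM. eval v \<in> K}"
    let ?n = "\<lambda>z. \<zero>\<^bsub>A\<^esub> \<ominus>\<^bsub>A\<^esub> v' z"
    have "(\<lambda>z. v z \<ominus>\<^bsub>A\<^esub> ?n z) = (\<lambda>z. v z \<oplus>\<^bsub>A\<^esub> v' z)"
      using v v' FM_in[of v] FM_in[of v'] by (auto simp: A.minus_eq)
    moreover have "(\<lambda>z. v z \<ominus>\<^bsub>A\<^esub> ?n z) \<in> carrier FM \<and> eval (\<lambda>z. v z \<ominus>\<^bsub>A\<^esub> ?n z) \<in> K"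
      using m[OF v'] v by (intro minus) auto
    ultimately show "v \<otimes>\<^bsub>add_monoid FM\<^esub> v' \<in> {v \<in> carrier FM. eval v \<in> K}" by simp
  next
    fix a v assume "a \<in> carrier A" "v \<in> {v \<in> carrier FM. eval v \<in> K}"
    then show "a \<odot>\<^bsub>FM\<^esub> v \<in> {v \<in> carrier FM. eval v \<in> K}"
      using eval_smult[of v a] K.I_l_closed by simp
  qed (use zero K.zero_closed in auto)
qed

end

text \<open>The elements all of whose multiples lie in \<open>Z\<close> form an ideal contained in
  \<open>Z\<close>. This serves for additive subgroups that are not known to be ideals.\<close>

lemma (in cring) genideal_subset_additive:
  assumes Z: "additive_subgroup Z R" and S: "S \<subseteq> carrier R"
    and mult: "\<And>s c. s \<in> S \<Longrightarrow> c \<in> carrier R \<Longrightarrow> s \<otimes> c \<in> Z"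
  shows "genideal R S \<subseteq> Z"
proof -
  interpret Z: additive_subgroup Z R by fact
  let ?J = "{x \<in> carrier R. \<forall>c\<in>carrier R. x \<otimes> c \<in> Z}"
  have "ideal ?J R"
  proof (rule idealI[OF ring_axioms])
    show "subgroup ?J (add_monoid R)"
    proof (rule add.subgroupI)
      have "\<zero> \<in> ?J" using Z.zero_closed by simp
      then show "?J \<noteq> {}" by blast
    next
      fix x assume x: "x \<in> ?J"
      have "\<ominus> x \<otimes> c \<in> Z" if "c \<in> carrier R" for c using x that Z.a_inv_closed[of "x \<otimes> c"] by (simp add: l_minus)
      then show "\<ominus> x \<in> ?J" using x by simp
    qed (auto simp: l_distr)
    fix a x assume "a \<in> ?J" "x \<in> carrier R"
    then show "x \<otimes> a \<in> ?J" "a \<otimes> x \<in> ?J" by (auto simp: m_assoc m_comm[of x a])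
  qed
  moreover have "S \<subseteq> ?J" using S mult by auto
  ultimately have "genideal R S \<subseteq> ?J" by (rule genideal_minimal)
  moreover have "?J \<subseteq> Z"
  proof
    fix x assume "x \<in> ?J"
    then have "x \<otimes> \<one> \<in> Z" "x \<in> carrier R" by blast+
    then show "x \<in> Z" by simp
  qed
  ultimately show ?thesis by blast
qed

text \<open>Each b in B agrees modulo mB with h(lam b) for some lam b in A. Modulo K, which contains
  all products of two elements of mA, the value x lam(y) is bilinear over A in x from mA and y from
  B. So it factors through mA \<otimes> B, which flatness embeds into B with image mB. The result is
  an additive map from mB to A/K that sends h(x) to x. Its kernel contains all h(f_i)B and all
  products of two elements of mB, so \<open>cotangent\<close> makes the map zero, and mA lies in
  K.\<close>

lemma flat_hom_cotangent:
  assumes A: "cring A" and B: "cring B" and h: "h \<in> Ring.ring_hom A B"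
    and mA: "maximalideal mA A" and mB: "maximalideal mB B" and local: "h ` mA \<subseteq> mB"
    and flat: "flat_hom A B h"
    and residue: "\<And>b. b \<in> carrier B \<Longrightarrow> \<exists>a\<in>carrier A. b \<ominus>\<^bsub>B\<^esub> h a \<in> mB"
    and unramified: "genideal B (h ` mA) = mB"
    and f: "\<And>i. i \<in> I \<Longrightarrow> f i \<in> mA"
    and cotangent: "\<And>Z. additive_subgroup Z B \<Longrightarrow> (\<And>i c. i \<in> I \<Longrightarrow> c \<in> carrier B \<Longrightarrow> h (f i) \<otimes>\<^bsub>B\<^esub> c \<in> Z) \<Longrightarrow>
      (\<And>x y. x \<in> mB \<Longrightarrow> y \<in> mB \<Longrightarrow> x \<otimes>\<^bsub>B\<^esub> y \<in> Z) \<Longrightarrow> mB \<subseteq> Z"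
    and K: "ideal K A" and f_K: "\<And>i. i \<in> I \<Longrightarrow> f i \<in> K"
    and square_K: "\<And>x y. x \<in> mA \<Longrightarrow> y \<in> mA \<Longrightarrow> x \<otimes>\<^bsub>A\<^esub> y \<in> K"
  shows "mA \<subseteq> K"
proof -
  interpret A: cring A by fact
  interpret B: cring B by fact
  interpret mA: maximalideal mA A by fact
  interpret mB: maximalideal mB B by fact
  interpret K: ideal K A by fact
  have h_closed [simp]: "h a \<in> carrier B" if "a \<in> carrier A" for a using ring_hom_closed[OF h that] .
  have h_add: "h (a \<oplus>\<^bsub>A\<^esub> b) = h a \<oplus>\<^bsub>B\<^esub> h b" if "a \<in> carrier A" "b \<in> carrier A" for a b
    using ring_hom_add[OF h that] .
  have h_mult: "h (a \<otimes>\<^bsub>A\<^esub> b) = h a \<otimes>\<^bsub>B\<^esub> h b" if "a \<in> carrier A" "b \<in> carrier A" for a b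
    using ring_hom_mult[OF h that] .
  interpret h: ring_hom_ring A B h by (rule ring_hom_ringI2[OF A.ring_axioms B.ring_axioms h])
  have h_minus: "h (a \<ominus>\<^bsub>A\<^esub> b) = h a \<ominus>\<^bsub>B\<^esub> h b" if "a \<in> carrier A" "b \<in> carrier A" for a b
    using that by (simp add: A.minus_eq B.minus_eq h_add)
  \<comment> \<open>The preimage of mB is a proper ideal containing the maximal ideal mA, so the two
    coincide.\<close>
  have vimage: "a \<in> mA" if a: "a \<in> carrier A" "h a \<in> mB" for a
  proof -
    have id: "ideal {r \<in> carrier A. h r \<in> mB} A" by (rule h.ideal_vimage[OF mB.is_ideal])
    have "{r \<in> carrier A. h r \<in> mB} \<noteq> carrier A"
      using mB.I_notcarr mB.one_imp_carrier ring_hom_one[OF h] A.one_closed by force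
    moreover have "mA \<subseteq> {r \<in> carrier A. h r \<in> mB}" using local mA.a_subset by auto
    ultimately have "{r \<in> carrier A. h r \<in> mB} = mA" using mA.I_maximal[OF id] by blast
    then show ?thesis using a by blast
  qed
  \<comment> \<open>\<open>lam\<close> need not be additive or linear over A, but its defects lie in
    mA; multiplied by an element of mA they fall into K.\<close>
  define lam where "lam b = (SOME a. a \<in> carrier A \<and> b \<ominus>\<^bsub>B\<^esub> h a \<in> mB)" for b
  have lam: "lam b \<in> carrier A" "b \<ominus>\<^bsub>B\<^esub> h (lam b) \<in> mB" if "b \<in> carrier B" for b
    using someI_ex[of "\<lambda>a. a \<in> carrier A \<and> b \<ominus>\<^bsub>B\<^esub> h a \<in> mB"] residue[OF that] unfolding lam_def by blast+
  have mB_minus: "x \<ominus>\<^bsub>B\<^esub> y \<in> mB" if "x \<in> mB" "y \<in> mB" for x y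
    using that mB.a_closed[OF _ mB.a_inv_closed] by (simp add: B.minus_eq)
  have cong: "a \<ominus>\<^bsub>A\<^esub> a' \<in> mA" if "a \<in> carrier A" "a' \<in> carrier A" "b \<in> carrier B" "b \<ominus>\<^bsub>B\<^esub> h a \<in> mB" "b \<ominus>\<^bsub>B\<^esub> h a' \<in> mB" for a a' b
  proof (rule vimage)
    have "h (a \<ominus>\<^bsub>A\<^esub> a') = (b \<ominus>\<^bsub>B\<^esub> h a') \<ominus>\<^bsub>B\<^esub> (b \<ominus>\<^bsub>B\<^esub> h a)"
    proof -
      have "(b \<oplus>\<^bsub>B\<^esub> \<ominus>\<^bsub>B\<^esub> h a') \<oplus>\<^bsub>B\<^esub> (\<ominus>\<^bsub>B\<^esub> b \<oplus>\<^bsub>B\<^esub> h a) = \<ominus>\<^bsub>B\<^esub> h a' \<oplus>\<^bsub>B\<^esub> (b \<oplus>\<^bsub>B\<^esub> (\<ominus>\<^bsub>B\<^esub> b \<oplus>\<^bsub>B\<^esub> h a))"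
        using that(1-3) by (simp only: B.a_comm[of b] B.a_assoc B.a_closed B.a_inv_closed h_closed)
      also have "\<dots> = \<ominus>\<^bsub>B\<^esub> h a' \<oplus>\<^bsub>B\<^esub> h a" using that(1-3) by (simp add: B.r_neg2)
      also have "\<dots> = h a \<oplus>\<^bsub>B\<^esub> \<ominus>\<^bsub>B\<^esub> h a'" using that(1-3) by (intro B.a_comm) auto
      finally show ?thesis
        using that(1-3) h_minus[OF that(1,2)] by (simp add: B.minus_eq B.minus_add)
    qed
    then show "h (a \<ominus>\<^bsub>A\<^esub> a') \<in> mB" using mB_minus[OF that(5,4)] by simp
  qed (use that in simp)
  define N where "N = alg_module id (A\<lparr>carrier := mA\<rparr>)"
  define M where "M = alg_module h B"
  define S where "S = mA \<times> carrier B"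
  have NM: "carrier N = mA" "carrier M = carrier B" "x \<oplus>\<^bsub>N\<^esub> x' = x \<oplus>\<^bsub>A\<^esub> x'" "y \<oplus>\<^bsub>M\<^esub> y' = y \<oplus>\<^bsub>B\<^esub> y'"
    "a \<odot>\<^bsub>N\<^esub> x = a \<otimes>\<^bsub>A\<^esub> x" "a \<odot>\<^bsub>M\<^esub> y = h a \<otimes>\<^bsub>B\<^esub> y" for x x' y y' a
    by (simp_all add: N_def M_def alg_module_def)
  have S: "tensor_gens N M = S" by (simp add: tensor_gens_def S_def NM)
  have id_hom: "id \<in> Ring.ring_hom A A" by (auto intro: ring_hom_memI)
  interpret m: free_eval A B h S "\<lambda>z. h (fst z) \<otimes>\<^bsub>B\<^esub> snd z"
  proof (intro free_eval.intro free_eval_axioms.intro A B h)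
    fix z assume "z \<in> S"
    then show "h (fst z) \<otimes>\<^bsub>B\<^esub> snd z \<in> carrier B" using mA.a_subset unfolding S_def by (intro B.m_closed h_closed) auto
  qed
  interpret b: free_eval A A id S "\<lambda>z. fst z \<otimes>\<^bsub>A\<^esub> lam (snd z)"
  proof (intro free_eval.intro free_eval_axioms.intro A id_hom)
    fix z assume "z \<in> S"
    then show "fst z \<otimes>\<^bsub>A\<^esub> lam (snd z) \<in> carrier A" using mA.a_subset unfolding S_def by (intro A.m_closed lam(1)) auto
  qed
  from flat[unfolded flat_hom_def, THEN spec, THEN mp, OF mA.is_ideal]
  have "\<forall>v\<in>carrier m.FM. m.eval v = \<zero>\<^bsub>B\<^esub> \<longrightarrow> v \<in> mspan A m.FM (tensor_rels A N M)"
    unfolding Let_def N_def[symmetric] M_def[symmetric] S m.eval_def .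
  then have flat': "v \<in> mspan A m.FM (tensor_rels A N M)" if "v \<in> carrier m.FM" "m.eval v = \<zero>\<^bsub>B\<^esub>" for v
    using that by simp
  have K_minus: "x \<ominus>\<^bsub>A\<^esub> y \<in> K" if "x \<in> K" "y \<in> K" for x y
    using that K.a_closed[OF _ K.a_inv_closed] by (simp add: A.minus_eq)
  have mA_in: "x \<in> carrier A" if "x \<in> mA" for x using that mA.a_subset by blast
  \<comment> \<open>Relations in the first argument evaluate to zero. Those in the second argument
    give an element of mA times a defect of \<open>lam\<close>, hence an element of K.\<close>
  have rels: "tensor_rels A N M \<subseteq> {v \<in> carrier m.FM. b.eval v \<in> K}"
  proof
    fix r assume "r \<in> tensor_rels A N M"
    then consider
      (1) x x' y where "r = (\<lambda>z. gen A (x \<oplus>\<^bsub>A\<^esub> x', y) z \<ominus>\<^bsub>A\<^esub> gen A (x, y) z \<ominus>\<^bsub>A\<^esub> gen A (x', y) z)"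
        "x \<in> mA" "x' \<in> mA" "y \<in> carrier B"
    | (2) x y y' where "r = (\<lambda>z. gen A (x, y \<oplus>\<^bsub>B\<^esub> y') z \<ominus>\<^bsub>A\<^esub> gen A (x, y) z \<ominus>\<^bsub>A\<^esub> gen A (x, y') z)"
        "x \<in> mA" "y \<in> carrier B" "y' \<in> carrier B"
    | (3) a x y where "r = (\<lambda>z. gen A (a \<otimes>\<^bsub>A\<^esub> x, y) z \<ominus>\<^bsub>A\<^esub> a \<otimes>\<^bsub>A\<^esub> gen A (x, y) z)"
        "a \<in> carrier A" "x \<in> mA" "y \<in> carrier B"
    | (4) a x y where "r = (\<lambda>z. gen A (x, h a \<otimes>\<^bsub>B\<^esub> y) z \<ominus>\<^bsub>A\<^esub> a \<otimes>\<^bsub>A\<^esub> gen A (x, y) z)"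
        "a \<in> carrier A" "x \<in> mA" "y \<in> carrier B"
      unfolding tensor_rels_def NM by blast
    then show "r \<in> {v \<in> carrier m.FM. b.eval v \<in> K}"
    proof cases
      case 1
      have in': "(x \<oplus>\<^bsub>A\<^esub> x', y) \<in> S" "(x, y) \<in> S" "(x', y) \<in> S" using 1 by (auto simp: S_def)
      note g = b.eval_gen[OF in'(1)] b.eval_gen[OF in'(2)] b.eval_gen[OF in'(3)]
      note d1 = b.eval_minus[OF g(1,3)]
      note d2 = b.eval_minus[OF d1(1) g(5)]
      have "b.eval r = (x \<oplus>\<^bsub>A\<^esub> x') \<otimes>\<^bsub>A\<^esub> lam y \<ominus>\<^bsub>A\<^esub> x \<otimes>\<^bsub>A\<^esub> lam y \<ominus>\<^bsub>A\<^esub> x' \<otimes>\<^bsub>A\<^esub> lam y"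
        unfolding 1(1) d2(2) d1(2) g by simp
      also have "\<dots> = \<zero>\<^bsub>A\<^esub>"
        using mA_in[OF 1(2)] mA_in[OF 1(3)] lam(1)[OF 1(4)]
        by (simp add: A.l_distr A.minus_eq A.a_ac A.r_neg A.r_neg1 A.r_neg2)
      finally show ?thesis using d2(1) K.zero_closed unfolding 1(1) by simp
    next
      case 2
      have yy: "y \<oplus>\<^bsub>B\<^esub> y' \<in> carrier B" using 2 by simp
      have in': "(x, y \<oplus>\<^bsub>B\<^esub> y') \<in> S" "(x, y) \<in> S" "(x, y') \<in> S" using 2 by (auto simp: S_def)
      note g = b.eval_gen[OF in'(1)] b.eval_gen[OF in'(2)] b.eval_gen[OF in'(3)]
      note d1 = b.eval_minus[OF g(1,3)]
      note d2 = b.eval_minus[OF d1(1) g(5)]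
      have x: "x \<in> carrier A" by (rule mA_in[OF 2(2)])
      note l = lam(1)[OF yy] lam(1)[OF 2(3)] lam(1)[OF 2(4)]
      have "b.eval r = x \<otimes>\<^bsub>A\<^esub> lam (y \<oplus>\<^bsub>B\<^esub> y') \<ominus>\<^bsub>A\<^esub> x \<otimes>\<^bsub>A\<^esub> lam y \<ominus>\<^bsub>A\<^esub> x \<otimes>\<^bsub>A\<^esub> lam y'"
        unfolding 2(1) d2(2) d1(2) g by simp
      also have "\<dots> = x \<otimes>\<^bsub>A\<^esub> (lam (y \<oplus>\<^bsub>B\<^esub> y') \<ominus>\<^bsub>A\<^esub> (lam y \<oplus>\<^bsub>A\<^esub> lam y'))"
        using x l by (simp add: A.r_distr A.minus_eq A.minus_add A.r_minus A.a_assoc)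
      also have "\<dots> \<in> K"
      proof (rule square_K[OF 2(2) cong[OF l(1) _ yy lam(2)[OF yy]]])
        show "lam y \<oplus>\<^bsub>A\<^esub> lam y' \<in> carrier A" using l by simp
        have "(y \<oplus>\<^bsub>B\<^esub> y') \<ominus>\<^bsub>B\<^esub> h (lam y \<oplus>\<^bsub>A\<^esub> lam y') = (y \<ominus>\<^bsub>B\<^esub> h (lam y)) \<oplus>\<^bsub>B\<^esub> (y' \<ominus>\<^bsub>B\<^esub> h (lam y'))"
          using 2 l by (simp add: h_add B.minus_eq B.minus_add B.a_ac)
        then show "(y \<oplus>\<^bsub>B\<^esub> y') \<ominus>\<^bsub>B\<^esub> h (lam y \<oplus>\<^bsub>A\<^esub> lam y') \<in> mB"
          using mB.a_closed[OF lam(2)[OF 2(3)] lam(2)[OF 2(4)]] by simp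
      qed
      finally show ?thesis using d2(1) unfolding 2(1) by simp
    next
      case 3
      have in': "(a \<otimes>\<^bsub>A\<^esub> x, y) \<in> S" "(x, y) \<in> S" using 3 mA.I_l_closed by (auto simp: S_def)
      note g = b.eval_gen[OF in'(1)] b.eval_gen[OF in'(2)]
      note s = b.eval_smult[OF g(3) 3(2)]
      note d = b.eval_minus[OF g(1) s(1)]
      have "b.eval r = (a \<otimes>\<^bsub>A\<^esub> x) \<otimes>\<^bsub>A\<^esub> lam y \<ominus>\<^bsub>A\<^esub> a \<otimes>\<^bsub>A\<^esub> (x \<otimes>\<^bsub>A\<^esub> lam y)"
        unfolding 3(1) d(2) s(2) g by simp
      also have "\<dots> = \<zero>\<^bsub>A\<^esub>"
        using mA_in[OF 3(3)] 3(2) lam(1)[OF 3(4)] by (simp add: A.m_assoc A.minus_eq A.r_neg)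
      finally show ?thesis using d(1) K.zero_closed unfolding 3(1) by simp
    next
      case 4
      have hy: "h a \<otimes>\<^bsub>B\<^esub> y \<in> carrier B" using 4 by simp
      have in': "(x, h a \<otimes>\<^bsub>B\<^esub> y) \<in> S" "(x, y) \<in> S" using 4 by (auto simp: S_def)
      note g = b.eval_gen[OF in'(1)] b.eval_gen[OF in'(2)]
      note s = b.eval_smult[OF g(3) 4(2)]
      note d = b.eval_minus[OF g(1) s(1)]
      have x: "x \<in> carrier A" by (rule mA_in[OF 4(3)])
      note l = lam(1)[OF hy] lam(1)[OF 4(4)]
      have "b.eval r = x \<otimes>\<^bsub>A\<^esub> lam (h a \<otimes>\<^bsub>B\<^esub> y) \<ominus>\<^bsub>A\<^esub> a \<otimes>\<^bsub>A\<^esub> (x \<otimes>\<^bsub>A\<^esub> lam y)"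
        unfolding 4(1) d(2) s(2) g by simp
      also have "\<dots> = x \<otimes>\<^bsub>A\<^esub> (lam (h a \<otimes>\<^bsub>B\<^esub> y) \<ominus>\<^bsub>A\<^esub> a \<otimes>\<^bsub>A\<^esub> lam y)"
        using x l 4(2) by (simp add: A.r_distr A.minus_eq A.r_minus A.m_lcomm)
      also have "\<dots> \<in> K"
      proof (rule square_K[OF 4(3) cong[OF l(1) _ hy lam(2)[OF hy]]])
        show "a \<otimes>\<^bsub>A\<^esub> lam y \<in> carrier A" using l 4 by simp
        have "(h a \<otimes>\<^bsub>B\<^esub> y) \<ominus>\<^bsub>B\<^esub> h (a \<otimes>\<^bsub>A\<^esub> lam y) = h a \<otimes>\<^bsub>B\<^esub> (y \<ominus>\<^bsub>B\<^esub> h (lam y))"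
          using 4 l by (simp add: h_mult B.minus_eq B.r_distr B.r_minus)
        then show "(h a \<otimes>\<^bsub>B\<^esub> y) \<ominus>\<^bsub>B\<^esub> h (a \<otimes>\<^bsub>A\<^esub> lam y) \<in> mB"
          using mB.I_l_closed[OF lam(2)[OF 4(4)] h_closed[OF 4(2)]] by simp
      qed
      finally show ?thesis using d(1) unfolding 4(1) by simp
    qed
  qed
  have span_K: "b.eval v \<in> K" if "v \<in> mspan A m.FM (tensor_rels A N M)" for v
    using that rels b.submodule_vimage[OF K] unfolding mspan_def by blast
  \<comment> \<open>The kernel of the induced map on mB: elements with some representing tensor
    whose value lies in K.\<close>
  define Z where "Z = {y. \<exists>v\<in>carrier m.FM. m.eval v = y \<and> b.eval v \<in> K}"
  have Z_minus: "x \<ominus>\<^bsub>B\<^esub> y \<in> Z" if "x \<in> Z" "y \<in> Z" for x y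
  proof -
    from that obtain v v' where v: "v \<in> carrier m.FM" "m.eval v = x" "b.eval v \<in> K"
      and v': "v' \<in> carrier m.FM" "m.eval v' = y" "b.eval v' \<in> K" unfolding Z_def by blast
    have "b.eval (\<lambda>z. v z \<ominus>\<^bsub>A\<^esub> v' z) \<in> K"
      unfolding b.eval_minus(2)[OF v(1) v'(1)] by (rule K_minus[OF v(3) v'(3)])
    moreover have "m.eval (\<lambda>z. v z \<ominus>\<^bsub>A\<^esub> v' z) = x \<ominus>\<^bsub>B\<^esub> y"
      unfolding m.eval_minus(2)[OF v(1) v'(1)] v(2) v'(2) ..
    ultimately show ?thesis unfolding Z_def using m.eval_minus(1)[OF v(1) v'(1)] by blast
  qed
  have Z_sub: "Z \<subseteq> carrier B" using m.eval_closed by (auto simp: Z_def)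
  have Z_zero: "\<zero>\<^bsub>B\<^esub> \<in> Z"
  proof -
    have "(\<lambda>_. \<zero>\<^bsub>A\<^esub>) \<in> carrier m.FM" "m.eval (\<lambda>_. \<zero>\<^bsub>A\<^esub>) = \<zero>\<^bsub>B\<^esub>" "b.eval (\<lambda>_. \<zero>\<^bsub>A\<^esub>) = \<zero>\<^bsub>A\<^esub>"
      by (simp_all add: free_module_carrier m.eval_def b.eval_def)
    moreover have "\<zero>\<^bsub>A\<^esub> \<in> K" by (rule K.zero_closed)
    ultimately show ?thesis unfolding Z_def by auto
  qed
  have Z: "additive_subgroup Z B"
  proof (rule additive_subgroupI, rule B.add.subgroupI)
    show "Z \<subseteq> carrier B" by (rule Z_sub)
    show "Z \<noteq> {}" using Z_zero by blast
    show inv: "\<ominus>\<^bsub>B\<^esub> x \<in> Z" if "x \<in> Z" for x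
      using Z_minus[OF Z_zero that] Z_sub that by (auto simp: B.minus_eq)
    fix x y assume xy: "x \<in> Z" "y \<in> Z"
    then show "x \<oplus>\<^bsub>B\<^esub> y \<in> Z" using Z_minus[OF xy(1) inv[OF xy(2)]] Z_sub by (auto simp: B.minus_eq)
  qed
  have Z_gen: "h x \<otimes>\<^bsub>B\<^esub> y \<in> Z" if "x \<in> mA" "y \<in> carrier B" "x \<otimes>\<^bsub>A\<^esub> lam y \<in> K" for x y
  proof -
    have "(x, y) \<in> S" using that by (simp add: S_def)
    note g = m.eval_gen[OF this] b.eval_gen[OF this]
    have "m.eval (gen A (x, y)) = h x \<otimes>\<^bsub>B\<^esub> y" "b.eval (gen A (x, y)) \<in> K"
      using g(2,4) that(3) by simp_all
    then show ?thesis unfolding Z_def using g(1) by blast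
  qed
  have "mB \<subseteq> Z"
  proof (rule cotangent[OF Z])
    fix i c assume "i \<in> I" "c \<in> carrier B"
    then show "h (f i) \<otimes>\<^bsub>B\<^esub> c \<in> Z" using f f_K lam(1) K.I_r_closed by (intro Z_gen) auto
  next
    fix x y assume x: "x \<in> mB" and y: "y \<in> mB"
    interpret Z: additive_subgroup Z B by (rule Z)
    have yB: "y \<in> carrier B" using y mB.a_subset by blast
    \<comment> \<open>With y fixed it suffices to treat x = h(a)c with a in mA, as sums of such
      elements exhaust mB. Then cy lies in mB, so lam(cy) lies in mA, and \<open>square_K\<close>
      applies to a lam(cy).\<close>
    let ?Z' = "{x \<in> carrier B. x \<otimes>\<^bsub>B\<^esub> y \<in> Z}"
    have "additive_subgroup ?Z' B"
    proof (rule additive_subgroupI, rule B.add.subgroupI)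
      have "\<zero>\<^bsub>B\<^esub> \<in> ?Z'" using yB Z.zero_closed by simp
      then show "?Z' \<noteq> {}" by blast
      show "\<ominus>\<^bsub>B\<^esub> x \<in> ?Z'" if "x \<in> ?Z'" for x using that yB Z.a_inv_closed[of "x \<otimes>\<^bsub>B\<^esub> y"] by (simp add: B.l_minus)
    qed (use yB in \<open>auto simp: B.l_distr\<close>)
    then have "genideal B (h ` mA) \<subseteq> ?Z'"
    proof (rule B.genideal_subset_additive)
      show "h ` mA \<subseteq> carrier B" using mA_in by auto
      fix s c assume "s \<in> h ` mA" and c: "c \<in> carrier B"
      then obtain a where a: "a \<in> mA" "s = h a" by blast
      have cy: "c \<otimes>\<^bsub>B\<^esub> y \<in> mB" "c \<otimes>\<^bsub>B\<^esub> y \<in> carrier B" using mB.I_l_closed[OF y c] c yB by auto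
      have "h (lam (c \<otimes>\<^bsub>B\<^esub> y)) = c \<otimes>\<^bsub>B\<^esub> y \<ominus>\<^bsub>B\<^esub> (c \<otimes>\<^bsub>B\<^esub> y \<ominus>\<^bsub>B\<^esub> h (lam (c \<otimes>\<^bsub>B\<^esub> y)))"
        using cy lam(1)[OF cy(2)] by (simp add: B.minus_eq B.minus_add B.a_assoc[symmetric] B.r_neg)
      then have "h (lam (c \<otimes>\<^bsub>B\<^esub> y)) \<in> mB" using mB_minus[OF cy(1) lam(2)[OF cy(2)]] by simp
      then have "lam (c \<otimes>\<^bsub>B\<^esub> y) \<in> mA" by (rule vimage[OF lam(1)[OF cy(2)]])
      then have "h a \<otimes>\<^bsub>B\<^esub> (c \<otimes>\<^bsub>B\<^esub> y) \<in> Z" using a cy by (intro Z_gen square_K)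
      then show "s \<otimes>\<^bsub>B\<^esub> c \<in> ?Z'" using a c yB mA_in by (simp add: B.m_assoc)
    qed
    then show "x \<otimes>\<^bsub>B\<^esub> y \<in> Z" using x unfolding unramified by blast
  qed
  show "mA \<subseteq> K"
  proof
    fix x assume x: "x \<in> mA"
    have xA: "x \<in> carrier A" by (rule mA_in[OF x])
    have "h x \<in> Z" using x local \<open>mB \<subseteq> Z\<close> by blast
    then obtain v where v: "v \<in> carrier m.FM" "m.eval v = h x" "b.eval v \<in> K" by (auto simp: Z_def)
    have "(x, \<one>\<^bsub>B\<^esub>) \<in> S" using x by (simp add: S_def)
    note gm = m.eval_gen[OF this] and gb = b.eval_gen[OF this]
    \<comment> \<open>\<open>v\<close> and the generator (x, 1) both map to h(x). By flatness their
      difference is a combination of relations, so x lam(1) lies in K. Since lam(1) is 1 modulo mA,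
      x lies in K as well.\<close>
    have "m.eval (\<lambda>z. gen A (x, \<one>\<^bsub>B\<^esub>) z \<ominus>\<^bsub>A\<^esub> v z) = \<zero>\<^bsub>B\<^esub>"
      unfolding m.eval_minus(2)[OF gm(1) v(1)] gm v(2) using xA by (simp add: B.minus_eq B.r_neg)
    from span_K[OF flat'[OF m.eval_minus(1)[OF gm(1) v(1)] this]]
    have d: "x \<otimes>\<^bsub>A\<^esub> lam \<one>\<^bsub>B\<^esub> \<ominus>\<^bsub>A\<^esub> b.eval v \<in> K" unfolding b.eval_minus(2)[OF gm(1) v(1)] gb by simp
    have l: "lam \<one>\<^bsub>B\<^esub> \<in> carrier A" using lam(1) by simp
    have bv: "b.eval v \<in> carrier A" using b.eval_closed[OF v(1)] .
    have "x \<otimes>\<^bsub>A\<^esub> lam \<one>\<^bsub>B\<^esub> \<ominus>\<^bsub>A\<^esub> b.eval v \<oplus>\<^bsub>A\<^esub> b.eval v \<in> K" using d v(3) by (rule K.a_closed)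
    then have xl: "x \<otimes>\<^bsub>A\<^esub> lam \<one>\<^bsub>B\<^esub> \<in> K" using xA l bv by (simp add: A.minus_eq A.a_assoc A.l_neg)
    have "\<one>\<^bsub>B\<^esub> \<ominus>\<^bsub>B\<^esub> h \<one>\<^bsub>A\<^esub> \<in> mB" using mB.zero_closed by (simp add: ring_hom_one[OF h] B.minus_eq B.r_neg)
    then have "lam \<one>\<^bsub>B\<^esub> \<ominus>\<^bsub>A\<^esub> \<one>\<^bsub>A\<^esub> \<in> mA" using l lam(2)[OF B.one_closed] by (intro cong) auto
    then have "x \<otimes>\<^bsub>A\<^esub> (lam \<one>\<^bsub>B\<^esub> \<ominus>\<^bsub>A\<^esub> \<one>\<^bsub>A\<^esub>) \<in> K" by (rule square_K[OF x])
    from K_minus[OF xl this] show "x \<in> K"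
      using xA l by (simp add: A.minus_eq A.r_distr A.minus_add A.r_minus A.a_assoc[symmetric] A.r_neg)
  qed
qed

section \<open>Local rings\<close>

text \<open>An ideal outside which every element is a unit contains every proper ideal.\<close>

lemma (in cring) max_ideal_eqI:
  assumes M: "ideal M R" and proper: "\<one> \<notin> M" and units: "\<And>x. x \<in> carrier R \<Longrightarrow> x \<notin> M \<Longrightarrow> x \<in> Units R"
  shows "maximalideal M R" "max_ideal R = M"
proof -
  interpret M: ideal M R by fact
  have sub: "J \<subseteq> M" if J: "ideal J R" "\<one> \<notin> J" for J
  proof
    fix x assume x: "x \<in> J"
    interpret J: ideal J R by fact
    show "x \<in> M"
    proof (rule ccontr)
      assume "x \<notin> M"
      then have u: "x \<in> Units R" using units J.Icarr[OF x] by blast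
      then have "inv x \<otimes> x \<in> J" using J.I_l_closed[OF x, of "inv x"] u by simp
      then show False using u J(2) by simp
    qed
  qed
  show max: "maximalideal M R"
  proof (rule maximalidealI[OF M])
    show "carrier R \<noteq> M" using proper one_closed by blast
    fix J assume J: "ideal J R" "M \<subseteq> J" "J \<subseteq> carrier R"
    interpret J: ideal J R by fact
    show "J = M \<or> J = carrier R" using sub[OF J(1)] J(2) J.one_imp_carrier by blast
  qed
  have "I = M" if I: "maximalideal I R" for I
  proof -
    interpret I: maximalideal I R by fact
    have "\<one> \<notin> I" using I.I_notcarr I.one_imp_carrier by blast
    then have "I \<subseteq> M" using sub[OF I.is_ideal] by blast
    then have "M = I \<or> M = carrier R" using I.I_maximal[OF M] M.a_subset by blast
    then show ?thesis using proper one_closed by blast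
  qed
  then show "max_ideal R = M" unfolding max_ideal_def by (rule the_equality[where P = "\<lambda>I. maximalideal I R", OF max])
qed

lemma (in cring) maximal_ideal_extends:
  assumes J: "ideal J R" "\<one> \<notin> J"
  obtains M where "maximalideal M R" "J \<subseteq> M"
proof -
  let ?A = "{I. ideal I R \<and> J \<subseteq> I \<and> \<one> \<notin> I}"
  have "\<exists>M\<in>?A. \<forall>K\<in>?A. M \<subseteq> K \<longrightarrow> K = M"
  proof (rule subset_Zorn_nonempty)
    show "?A \<noteq> {}" using J by blast
    fix C assume C: "C \<noteq> {}" "subset.chain ?A C"
    then have C': "C \<subseteq> ?A" and "subset.chain {I. ideal I R} C" by (auto simp: subset_chain_def)
    then have "ideal (\<Union>C) R" using chain_Union_is_ideal[of C] C(1) by simp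
    moreover have "J \<subseteq> \<Union>C" "\<one> \<notin> \<Union>C" using C' C(1) by blast+
    ultimately show "\<Union>C \<in> ?A" by simp
  qed
  then obtain M where "M \<in> ?A" and max': "\<forall>K\<in>?A. M \<subseteq> K \<longrightarrow> K = M" by (rule bexE)
  then have M: "ideal M R" "J \<subseteq> M" "\<one> \<notin> M" by simp_all
  have max: "K = M" if "ideal K R" "J \<subseteq> K" "\<one> \<notin> K" "M \<subseteq> K" for K
    using bspec[OF max', of K] that by simp
  have "maximalideal M R"
  proof (rule maximalidealI[OF M(1)])
    show "carrier R \<noteq> M" using M(3) one_closed by blast
    fix K assume K: "ideal K R" "M \<subseteq> K" "K \<subseteq> carrier R"
    interpret K: ideal K R by fact
    show "K = M \<or> K = carrier R"
    proof (cases "\<one> \<in> K")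
      case True
      then show ?thesis using K.one_imp_carrier by simp
    next
      case False
      then show ?thesis using max[OF K(1) order_trans[OF M(2) K(2)] False K(2)] by simp
    qed
  qed
  then show thesis using M(2) by (rule that)
qed

lemma (in cring) UnitsI:
  assumes "x \<in> carrier R" "y \<in> carrier R" "y \<otimes> x = \<one>"
  shows "x \<in> Units R"
proof -
  have "x \<otimes> y = \<one>" using assms m_comm by simp
  then show ?thesis using assms unfolding Units_def by blast
qed

text \<open>By Zorn's lemma a proper ideal lies in some maximal ideal, and there is only one. A
  nonunit is covered by its principal ideal, which is proper.\<close>

lemma local_ringD:
  assumes "local_ring R"
  shows "maximalideal (max_ideal R) R"
    "ideal J R \<Longrightarrow> \<one>\<^bsub>R\<^esub> \<notin> J \<Longrightarrow> J \<subseteq> max_ideal R"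
    "x \<in> carrier R \<Longrightarrow> x \<notin> max_ideal R \<Longrightarrow> x \<in> Units R"
proof -
  interpret cring R using assms by (simp add: local_ring_def)
  have ex1: "\<exists>!I. maximalideal I R" using assms by (simp add: local_ring_def)
  show max: "maximalideal (max_ideal R) R" unfolding max_ideal_def by (rule theI'[OF ex1])
  have sub: "J \<subseteq> max_ideal R" if J: "ideal J R" "\<one>\<^bsub>R\<^esub> \<notin> J" for J
  proof -
    obtain M where M: "maximalideal M R" "J \<subseteq> M" using J by (rule maximal_ideal_extends)
    then show ?thesis using ex1 max by blast
  qed
  then show "ideal J R \<Longrightarrow> \<one>\<^bsub>R\<^esub> \<notin> J \<Longrightarrow> J \<subseteq> max_ideal R" .
  show "x \<in> Units R" if x: "x \<in> carrier R" "x \<notin> max_ideal R"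
  proof -
    have "\<one>\<^bsub>R\<^esub> \<in> cgenideal R x" using sub[OF cgenideal_ideal[OF x(1)]] cgenideal_self[OF x(1)] x(2) by blast
    then obtain y where y: "y \<in> carrier R" "\<one>\<^bsub>R\<^esub> = y \<otimes>\<^bsub>R\<^esub> x" by (auto simp: cgenideal_def)
    show ?thesis by (rule UnitsI[OF x(1) y(1) y(2)[symmetric]])
  qed
qed

section \<open>Spectra\<close>

subsection \<open>Localization at a prime, up to isomorphism\<close>

text \<open>These properties characterize the local ring of R at q up to isomorphism. They can be
  checked directly on the stalks of the spectrum, so no isomorphism with a ring of fractions has to
  be built.\<close>

locale prime_localization = R: cring R + A: cring A for R :: "('a, 'b) ring_scheme" and A :: "('c, 'd) ring_scheme" +
  fixes q :: "'a set" and \<gamma> :: "'a \<Rightarrow> 'c"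
  assumes prime: "primeideal q R" and \<gamma>: "\<gamma> \<in> Ring.ring_hom R A"
    and unit: "s \<in> carrier R - q \<Longrightarrow> \<gamma> s \<in> Units A"
    and fractions: "x \<in> carrier A \<Longrightarrow> \<exists>a\<in>carrier R. \<exists>s\<in>carrier R - q. x \<otimes>\<^bsub>A\<^esub> \<gamma> s = \<gamma> a"
    and kernel: "a \<in> carrier R \<Longrightarrow> \<gamma> a = \<zero>\<^bsub>A\<^esub> \<Longrightarrow> \<exists>u\<in>carrier R - q. u \<otimes>\<^bsub>R\<^esub> a = \<zero>\<^bsub>R\<^esub>"
begin

interpretation q: primeideal q R by (rule prime)

lemma gamma_in [simp]: "a \<in> carrier R \<Longrightarrow> \<gamma> a \<in> carrier A"
  using \<gamma> by (rule ring_hom_closed)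

lemma gamma_add: "a \<in> carrier R \<Longrightarrow> b \<in> carrier R \<Longrightarrow> \<gamma> (a \<oplus>\<^bsub>R\<^esub> b) = \<gamma> a \<oplus>\<^bsub>A\<^esub> \<gamma> b"
  using \<gamma> by (rule ring_hom_add)

lemma gamma_mult: "a \<in> carrier R \<Longrightarrow> b \<in> carrier R \<Longrightarrow> \<gamma> (a \<otimes>\<^bsub>R\<^esub> b) = \<gamma> a \<otimes>\<^bsub>A\<^esub> \<gamma> b"
  using \<gamma> by (rule ring_hom_mult)

lemma gamma_one: "\<gamma> \<one>\<^bsub>R\<^esub> = \<one>\<^bsub>A\<^esub>"
  using \<gamma> by (rule ring_hom_one)

lemma gamma_zero: "\<gamma> \<zero>\<^bsub>R\<^esub> = \<zero>\<^bsub>A\<^esub>"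
  using \<gamma> R.ring_axioms A.ring_axioms by (rule ring_hom_zero)

lemma gamma_minus: "a \<in> carrier R \<Longrightarrow> \<gamma> (\<ominus>\<^bsub>R\<^esub> a) = \<ominus>\<^bsub>A\<^esub> \<gamma> a"
  by (rule A.minus_equality[symmetric]) (simp_all add: gamma_add[symmetric] gamma_zero R.l_neg)

lemma one_compl: "\<one>\<^bsub>R\<^esub> \<in> carrier R - q"
  using q.I_notcarr q.one_imp_carrier by blast

lemma mult_compl: "s \<in> carrier R - q \<Longrightarrow> t \<in> carrier R - q \<Longrightarrow> s \<otimes>\<^bsub>R\<^esub> t \<in> carrier R - q"
  using q.I_prime by auto

text \<open>For an ideal \<open>K\<close> this is the ideal that its image generates in
  \<open>A\<close>, described by clearing one denominator.\<close>

definition extension :: "'a set \<Rightarrow> 'c set" where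
  "extension K = {x \<in> carrier A. \<exists>a\<in>K. \<exists>s\<in>carrier R - q. x \<otimes>\<^bsub>A\<^esub> \<gamma> s = \<gamma> a}"

lemma extensionI: "x \<in> carrier A \<Longrightarrow> a \<in> K \<Longrightarrow> s \<in> carrier R - q \<Longrightarrow> x \<otimes>\<^bsub>A\<^esub> \<gamma> s = \<gamma> a \<Longrightarrow> x \<in> extension K"
  unfolding extension_def by blast

lemma gamma_extension: "a \<in> carrier R \<Longrightarrow> a \<in> K \<Longrightarrow> \<gamma> a \<in> extension K"
  by (rule extensionI[OF _ _ one_compl]) (auto simp: gamma_one)

lemma ideal_extension:
  assumes K: "ideal K R"
  shows "ideal (extension K) A"
proof -
  interpret K: ideal K R by fact
  have cases: "\<exists>a s. x \<in> carrier A \<and> a \<in> K \<and> s \<in> carrier R - q \<and> x \<otimes>\<^bsub>A\<^esub> \<gamma> s = \<gamma> a" if "x \<in> extension K" for x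
    using that unfolding extension_def by blast
  have mult: "y \<otimes>\<^bsub>A\<^esub> x \<in> extension K" if x: "x \<in> extension K" and y: "y \<in> carrier A" for x y
  proof -
    obtain a s where x: "x \<in> carrier A" "a \<in> K" "s \<in> carrier R - q" "x \<otimes>\<^bsub>A\<^esub> \<gamma> s = \<gamma> a" using cases[OF x] by blast
    obtain b t where b: "b \<in> carrier R" "t \<in> carrier R - q" "y \<otimes>\<^bsub>A\<^esub> \<gamma> t = \<gamma> b" using fractions[OF y] by blast
    have "(y \<otimes>\<^bsub>A\<^esub> x) \<otimes>\<^bsub>A\<^esub> \<gamma> (t \<otimes>\<^bsub>R\<^esub> s) = (y \<otimes>\<^bsub>A\<^esub> \<gamma> t) \<otimes>\<^bsub>A\<^esub> (x \<otimes>\<^bsub>A\<^esub> \<gamma> s)"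
      using x(1,3) b(1,2) y by (simp add: gamma_mult A.m_ac)
    also have "\<dots> = \<gamma> (b \<otimes>\<^bsub>R\<^esub> a)" unfolding b(3) x(4) using b(1) x(2) K.Icarr by (simp add: gamma_mult)
    finally show ?thesis
      using x y K.I_l_closed[OF x(2) b(1)] mult_compl[OF b(2) x(3)] by (intro extensionI[of _ "b \<otimes>\<^bsub>R\<^esub> a" _ "t \<otimes>\<^bsub>R\<^esub> s"]) auto
  qed
  show ?thesis
  proof (rule idealI)
    show "ring A" by (rule A.ring_axioms)
    show "subgroup (extension K) (add_monoid A)"
    proof (rule A.add.subgroupI)
      show "extension K \<subseteq> carrier A" by (auto simp: extension_def)
      have "\<gamma> \<zero>\<^bsub>R\<^esub> \<in> extension K" by (rule gamma_extension) auto
      then show "extension K \<noteq> {}" by blast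
    next
      fix x assume x: "x \<in> extension K"
      have "\<ominus>\<^bsub>A\<^esub> \<one>\<^bsub>A\<^esub> \<otimes>\<^bsub>A\<^esub> x \<in> extension K" by (rule mult[OF x]) simp
      moreover have "\<ominus>\<^bsub>A\<^esub> \<one>\<^bsub>A\<^esub> \<otimes>\<^bsub>A\<^esub> x = \<ominus>\<^bsub>A\<^esub> x" using cases[OF x] by (auto simp: A.l_minus)
      ultimately show "\<ominus>\<^bsub>A\<^esub> x \<in> extension K" by simp
    next
      fix x y assume "x \<in> extension K" "y \<in> extension K"
      then obtain a s b t where x: "x \<in> carrier A" "a \<in> K" "s \<in> carrier R - q" "x \<otimes>\<^bsub>A\<^esub> \<gamma> s = \<gamma> a"
        and y: "y \<in> carrier A" "b \<in> K" "t \<in> carrier R - q" "y \<otimes>\<^bsub>A\<^esub> \<gamma> t = \<gamma> b" using cases by meson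
      have st: "s \<in> carrier R" "t \<in> carrier R" "a \<in> carrier R" "b \<in> carrier R" using x y K.Icarr by auto
      have "(x \<oplus>\<^bsub>A\<^esub> y) \<otimes>\<^bsub>A\<^esub> \<gamma> (s \<otimes>\<^bsub>R\<^esub> t) = \<gamma> t \<otimes>\<^bsub>A\<^esub> (x \<otimes>\<^bsub>A\<^esub> \<gamma> s) \<oplus>\<^bsub>A\<^esub> \<gamma> s \<otimes>\<^bsub>A\<^esub> (y \<otimes>\<^bsub>A\<^esub> \<gamma> t)"
        using x(1) y(1) st by (simp add: gamma_mult A.l_distr A.r_distr A.m_ac)
      also have "\<dots> = \<gamma> (t \<otimes>\<^bsub>R\<^esub> a \<oplus>\<^bsub>R\<^esub> s \<otimes>\<^bsub>R\<^esub> b)" unfolding x(4) y(4) using st by (simp add: gamma_mult gamma_add)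
      finally show "x \<oplus>\<^bsub>A\<^esub> y \<in> extension K"
        using x(1) y(1) K.a_closed[OF K.I_l_closed[OF x(2) st(2)] K.I_l_closed[OF y(2) st(1)]] mult_compl[OF x(3) y(3)]
        by (auto intro: extensionI)
    qed
    show "y \<otimes>\<^bsub>A\<^esub> x \<in> extension K" if "x \<in> extension K" "y \<in> carrier A" for x y using that by (rule mult)
    show "x \<otimes>\<^bsub>A\<^esub> y \<in> extension K" if "x \<in> extension K" "y \<in> carrier A" for x y
      using mult[OF that] cases[OF that(1)] that(2) by (auto simp: A.m_comm)
  qed
qed

text \<open>By \<open>kernel\<close>, equality of images becomes equality in R after multiplication
  by some u outside q. Saturation then removes both u and the denominator.\<close>

lemma gamma_extension_iff:
  assumes K: "ideal K R" and sat: "\<And>s a. s \<in> carrier R - q \<Longrightarrow> a \<in> carrier R \<Longrightarrow> s \<otimes>\<^bsub>R\<^esub> a \<in> K \<Longrightarrow> a \<in> K"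
    and a: "a \<in> carrier R"
  shows "\<gamma> a \<in> extension K \<longleftrightarrow> a \<in> K"
proof
  interpret K: ideal K R by fact
  assume "\<gamma> a \<in> extension K"
  then obtain b s where b: "b \<in> K" and s: "s \<in> carrier R - q" and eq: "\<gamma> a \<otimes>\<^bsub>A\<^esub> \<gamma> s = \<gamma> b" by (auto simp: extension_def)
  have bR: "b \<in> carrier R" and sR: "s \<in> carrier R" using b s K.Icarr by auto
  have "\<gamma> (a \<otimes>\<^bsub>R\<^esub> s \<oplus>\<^bsub>R\<^esub> \<ominus>\<^bsub>R\<^esub> b) = \<zero>\<^bsub>A\<^esub>"
    using a bR sR eq by (simp add: gamma_add gamma_mult gamma_minus A.r_neg)
  then obtain u where u: "u \<in> carrier R - q" "u \<otimes>\<^bsub>R\<^esub> (a \<otimes>\<^bsub>R\<^esub> s \<oplus>\<^bsub>R\<^esub> \<ominus>\<^bsub>R\<^esub> b) = \<zero>\<^bsub>R\<^esub>"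
    using kernel[of "a \<otimes>\<^bsub>R\<^esub> s \<oplus>\<^bsub>R\<^esub> \<ominus>\<^bsub>R\<^esub> b"] a bR sR by auto
  have uR: "u \<in> carrier R" using u(1) by simp
  have "(u \<otimes>\<^bsub>R\<^esub> s) \<otimes>\<^bsub>R\<^esub> a = u \<otimes>\<^bsub>R\<^esub> (a \<otimes>\<^bsub>R\<^esub> s \<oplus>\<^bsub>R\<^esub> \<ominus>\<^bsub>R\<^esub> b) \<oplus>\<^bsub>R\<^esub> u \<otimes>\<^bsub>R\<^esub> b"
    using a bR sR uR by (simp add: R.r_distr R.m_ac R.r_minus R.a_assoc R.l_neg)
  then have "(u \<otimes>\<^bsub>R\<^esub> s) \<otimes>\<^bsub>R\<^esub> a \<in> K" unfolding u(2) using uR bR K.I_l_closed[OF b uR] by simp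
  then show "a \<in> K" using sat mult_compl[OF u(1) s] a by blast
qed (rule gamma_extension[OF a])

lemma max_ideal_extension:
  shows "maximalideal (extension q) A" "max_ideal A = extension q"
proof -
  have iff: "\<gamma> a \<in> extension q \<longleftrightarrow> a \<in> q" if "a \<in> carrier R" for a
    by (rule gamma_extension_iff[OF q.is_ideal _ that]) (use q.I_prime in blast)
  have "\<one>\<^bsub>A\<^esub> \<notin> extension q" using iff[of "\<one>\<^bsub>R\<^esub>"] one_compl by (simp add: gamma_one)
  moreover have "x \<in> Units A" if x: "x \<in> carrier A" "x \<notin> extension q" for x
  proof -
    obtain a s where a: "a \<in> carrier R" "s \<in> carrier R - q" "x \<otimes>\<^bsub>A\<^esub> \<gamma> s = \<gamma> a" using fractions[OF x(1)] by blast
    then have "a \<notin> q" using x extensionI[OF x(1) _ a(2,3), of q] by blast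
    then have "x \<otimes>\<^bsub>A\<^esub> \<gamma> s \<in> Units A" unfolding a(3) using a(1) by (intro unit) simp
    then show ?thesis using A.unit_factor[of x "\<gamma> s"] x(1) a(2) by simp
  qed
  ultimately show "maximalideal (extension q) A" "max_ideal A = extension q"
    using A.max_ideal_eqI[OF ideal_extension[OF q.is_ideal]] by blast+
qed

lemma gamma_max_ideal: "a \<in> carrier R \<Longrightarrow> \<gamma> a \<in> max_ideal A \<longleftrightarrow> a \<in> q"
  unfolding max_ideal_extension by (rule gamma_extension_iff[OF q.is_ideal]) (use q.I_prime in blast)

end

subsection \<open>The structure sheaf\<close>

context cring
begin

abbreviation "frac_at P a s \<equiv> fraction R (carrier R - P) a s"

lemma Spec_simps [simp]:
  "topo (Spec R) = spec_topology R" "carrier (sect (Spec R) U) = spec_sections R U"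
  "s \<otimes>\<^bsub>sect (Spec R) U\<^esub> t = (\<lambda>P\<in>U. s P \<otimes>\<^bsub>localize_at R P\<^esub> t P)"
  "s \<oplus>\<^bsub>sect (Spec R) U\<^esub> t = (\<lambda>P\<in>U. s P \<oplus>\<^bsub>localize_at R P\<^esub> t P)"
  "\<one>\<^bsub>sect (Spec R) U\<^esub> = (\<lambda>P\<in>U. \<one>\<^bsub>localize_at R P\<^esub>)" "\<zero>\<^bsub>sect (Spec R) U\<^esub> = (\<lambda>P\<in>U. \<zero>\<^bsub>localize_at R P\<^esub>)"
  "rst (Spec R) U W s = restrict s W"
  by (simp_all add: Spec_def)

lemma openin_basic: "g \<in> carrier R \<Longrightarrow> openin (spec_topology R) {P \<in> spec_points R. g \<notin> P}"
  unfolding openin_spec_topology by (intro exI[of _ "{g}"]) auto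

lemma topspace_spec [simp]: "topspace (spec_topology R) = spec_points R"
proof
  show "topspace (spec_topology R) \<subseteq> spec_points R"
    using openin_topspace[of "spec_topology R"] unfolding openin_spec_topology by blast
  have "\<one> \<notin> P" if "P \<in> spec_points R" for P
  proof -
    interpret primeideal P R using that by (simp add: spec_points_def)
    show ?thesis using I_notcarr one_imp_carrier by blast
  qed
  then have "{P \<in> spec_points R. \<one> \<notin> P} = spec_points R" by blast
  then show "spec_points R \<subseteq> topspace (spec_topology R)" using openin_basic[of \<one>] openin_subset by fastforce
qed

lemma spec_points_sub: "openin (spec_topology R) U \<Longrightarrow> P \<in> U \<Longrightarrow> primeideal P R"
  using openin_subset[of "spec_topology R" U] by (auto simp: spec_points_def)

lemma mult_at: "openin (spec_topology R) U \<Longrightarrow> P \<in> U \<Longrightarrow> multiplicative_subset R (carrier R - P)"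
  by (rule multiplicative_subset_prime) (rule spec_points_sub)

lemma spec_sections_cases:
  assumes "s \<in> spec_sections R U" "P \<in> U"
  obtains W a g where "openin (spec_topology R) W" "P \<in> W" "W \<subseteq> U" "a \<in> carrier R" "g \<in> carrier R"
    "\<And>Q. Q \<in> W \<Longrightarrow> g \<notin> Q" "\<And>Q. Q \<in> W \<Longrightarrow> s Q = frac_at Q a g"
proof -
  have "\<forall>P\<in>U. \<exists>W a g. openin (spec_topology R) W \<and> P \<in> W \<and> W \<subseteq> U \<and> a \<in> carrier R \<and> g \<in> carrier R \<and>
       (\<forall>Q\<in>W. g \<notin> Q \<and> s Q = frac_at Q a g)"
    using assms(1) unfolding spec_sections_def mem_Collect_eq by (rule conjunct2)
  from bspec[OF this assms(2)] obtain W a g where "openin (spec_topology R) W \<and> P \<in> W \<and> W \<subseteq> U \<and> a \<in> carrier R \<and>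
      g \<in> carrier R \<and> (\<forall>Q\<in>W. g \<notin> Q \<and> s Q = frac_at Q a g)" by (elim exE)
  then show thesis by (intro that[of W a g]) simp_all
qed

lemma spec_sectionsI:
  assumes ext: "s \<in> extensional U"
    and loc: "\<And>P. P \<in> U \<Longrightarrow> \<exists>W a g. openin (spec_topology R) W \<and> P \<in> W \<and> W \<subseteq> U \<and> a \<in> carrier R \<and> g \<in> carrier R \<and>
       (\<forall>Q\<in>W. g \<notin> Q \<and> s Q = frac_at Q a g)"
  shows "s \<in> spec_sections R U"
proof -
  have "s P \<in> carrier (localize_at R P)" if "P \<in> U" for P
  proof -
    obtain W a g where W: "openin (spec_topology R) W" "P \<in> W" "a \<in> carrier R" "g \<in> carrier R" "g \<notin> P" "s P = frac_at P a g"
      using loc[OF \<open>P \<in> U\<close>] by blast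
    interpret multiplicative_subset R "carrier R - P" by (rule mult_at[OF W(1,2)])
    show ?thesis unfolding W(6) by (rule fraction_in) (use W in auto)
  qed
  then show ?thesis unfolding spec_sections_def using ext loc by (auto simp: PiE_iff)
qed

lemma fraction_section:
  assumes "openin (spec_topology R) U" "a \<in> carrier R" "g \<in> carrier R" "\<And>P. P \<in> U \<Longrightarrow> g \<notin> P"
  shows "(\<lambda>P\<in>U. frac_at P a g) \<in> spec_sections R U"
proof (rule spec_sectionsI)
  fix P assume "P \<in> U"
  then show "\<exists>W b h. openin (spec_topology R) W \<and> P \<in> W \<and> W \<subseteq> U \<and> b \<in> carrier R \<and> h \<in> carrier R \<and>
      (\<forall>Q\<in>W. h \<notin> Q \<and> (\<lambda>P\<in>U. frac_at P a g) Q = frac_at Q b h)"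
    using assms by (intro exI[of _ U] exI[of _ a] exI[of _ g]) auto
qed simp

text \<open>A common argument for sums and products: on the intersection of two neighborhoods both
  sections are single fractions, which \<open>f\<close> combines into one with denominator
  gh.\<close>

lemma spec_sections_op:
  assumes s: "s \<in> spec_sections R U" and t: "t \<in> spec_sections R U"
    and F: "\<And>a b g h. a \<in> carrier R \<Longrightarrow> b \<in> carrier R \<Longrightarrow> g \<in> carrier R \<Longrightarrow> h \<in> carrier R \<Longrightarrow> F a g b h \<in> carrier R"
    and f: "\<And>P a b g h. multiplicative_subset R (carrier R - P) \<Longrightarrow> a \<in> carrier R \<Longrightarrow> b \<in> carrier R \<Longrightarrow>
      g \<in> carrier R - P \<Longrightarrow> h \<in> carrier R - P \<Longrightarrow> f P (frac_at P a g) (frac_at P b h) = frac_at P (F a g b h) (g \<otimes> h)"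
  shows "(\<lambda>P\<in>U. f P (s P) (t P)) \<in> spec_sections R U"
proof (rule spec_sectionsI)
  fix P assume P: "P \<in> U"
  obtain W a g where W: "openin (spec_topology R) W" "P \<in> W" "W \<subseteq> U" "a \<in> carrier R" "g \<in> carrier R"
    "\<And>Q. Q \<in> W \<Longrightarrow> g \<notin> Q" "\<And>Q. Q \<in> W \<Longrightarrow> s Q = frac_at Q a g" using s P by (rule spec_sections_cases) blast
  obtain W' b h where W': "openin (spec_topology R) W'" "P \<in> W'" "W' \<subseteq> U" "b \<in> carrier R" "h \<in> carrier R"
    "\<And>Q. Q \<in> W' \<Longrightarrow> h \<notin> Q" "\<And>Q. Q \<in> W' \<Longrightarrow> t Q = frac_at Q b h" using t P by (rule spec_sections_cases) blast
  have "g \<otimes> h \<notin> Q \<and> (\<lambda>P\<in>U. f P (s P) (t P)) Q = frac_at Q (F a g b h) (g \<otimes> h)" if Q: "Q \<in> W \<inter> W'" for Q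
  proof -
    have m: "multiplicative_subset R (carrier R - Q)" using mult_at[OF W(1)] Q by blast
    interpret multiplicative_subset R "carrier R - Q" by (rule m)
    have gh: "g \<in> carrier R - Q" "h \<in> carrier R - Q" using W W' Q by auto
    have "Q \<in> U" using Q W(3) by blast
    then show ?thesis using S_mult[OF gh] f[OF m W(4) W'(4) gh] W(7)[of Q] W'(7)[of Q] Q by simp
  qed
  then show "\<exists>W a g. openin (spec_topology R) W \<and> P \<in> W \<and> W \<subseteq> U \<and> a \<in> carrier R \<and> g \<in> carrier R \<and>
      (\<forall>Q\<in>W. g \<notin> Q \<and> (\<lambda>P\<in>U. f P (s P) (t P)) Q = frac_at Q a g)"
    using openin_Int[OF W(1) W'(1)] W(2,3,5) W'(2,5) F[OF W(4) W'(4) W(5) W'(5)]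
    by (intro exI[of _ "W \<inter> W'"] exI[of _ "F a g b h"] exI[of _ "g \<otimes> h"] conjI ballI) auto
qed simp

lemma spec_sections_mult: "s \<in> spec_sections R U \<Longrightarrow> t \<in> spec_sections R U \<Longrightarrow>
    (\<lambda>P\<in>U. s P \<otimes>\<^bsub>localize_at R P\<^esub> t P) \<in> spec_sections R U"
  by (rule spec_sections_op[where F = "\<lambda>a g b h. a \<otimes> b"]) (auto simp: multiplicative_subset.Loc_mult)

lemma spec_sections_add: "s \<in> spec_sections R U \<Longrightarrow> t \<in> spec_sections R U \<Longrightarrow>
    (\<lambda>P\<in>U. s P \<oplus>\<^bsub>localize_at R P\<^esub> t P) \<in> spec_sections R U"
  by (rule spec_sections_op[where F = "\<lambda>a g b h. a \<otimes> h \<oplus> b \<otimes> g"]) (auto simp: multiplicative_subset.Loc_add)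

lemma spec_sections_in: "s \<in> spec_sections R U \<Longrightarrow> P \<in> U \<Longrightarrow> s P \<in> carrier (localize_at R P)"
  unfolding spec_sections_def by blast

lemma spec_sections_ext: "s \<in> spec_sections R U \<Longrightarrow> s \<in> extensional U"
  unfolding spec_sections_def by (simp add: PiE_def)

lemma spec_sections_eqI: "s \<in> spec_sections R U \<Longrightarrow> t \<in> spec_sections R U \<Longrightarrow> (\<And>P. P \<in> U \<Longrightarrow> s P = t P) \<Longrightarrow> s = t"
  by (rule extensionalityI[of s U t]) (auto intro: spec_sections_ext)

lemma cring_at: "openin (spec_topology R) U \<Longrightarrow> P \<in> U \<Longrightarrow> cring (localize_at R P)"
  by (rule multiplicative_subset.cring_Loc) (rule mult_at)

lemma cring_spec_sections:
  assumes U: "openin (spec_topology R) U"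
  shows "cring (sect (Spec R) U)"
proof -
  have one_at: "\<one>\<^bsub>localize_at R P\<^esub> = frac_at P \<one> \<one>" "\<zero>\<^bsub>localize_at R P\<^esub> = frac_at P \<zero> \<one>" for P
    by (simp_all add: localization_def)
  have one_not: "\<one> \<notin> P" if "P \<in> U" for P
    using multiplicative_subset.S_one[OF mult_at[OF U that]] by simp
  have one: "(\<lambda>P\<in>U. \<one>\<^bsub>localize_at R P\<^esub>) \<in> spec_sections R U" and zero: "(\<lambda>P\<in>U. \<zero>\<^bsub>localize_at R P\<^esub>) \<in> spec_sections R U"
    and m1: "(\<lambda>P\<in>U. frac_at P (\<ominus> \<one>) \<one>) \<in> spec_sections R U"
    unfolding one_at using one_not by (intro fraction_section[OF U]; simp)+
  note closed = one zero spec_sections_mult spec_sections_add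
  note L = cring_at[OF U]
  show ?thesis
  proof (rule cringI)
    show "abelian_group (sect (Spec R) U)"
    proof (rule abelian_groupI; unfold Spec_simps)
      fix x assume x: "x \<in> spec_sections R U"
      let ?m = "\<lambda>P\<in>U. frac_at P (\<ominus> \<one>) \<one>"
      let ?y = "\<lambda>P\<in>U. ?m P \<otimes>\<^bsub>localize_at R P\<^esub> x P"
      have y: "?y \<in> spec_sections R U" by (rule spec_sections_mult[OF m1 x])
      have "(\<lambda>P\<in>U. ?y P \<oplus>\<^bsub>localize_at R P\<^esub> x P) = (\<lambda>P\<in>U. \<zero>\<^bsub>localize_at R P\<^esub>)"
      proof (rule restrict_ext)
        fix P assume P: "P \<in> U"
        interpret multiplicative_subset R "carrier R - P" by (rule mult_at[OF U P])
        interpret L: cring "localize_at R P" by (rule L[OF P])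
        have x': "x P \<in> carrier (localize_at R P)" by (rule spec_sections_in[OF x P])
        have "frac_at P (\<ominus> \<one>) \<one> \<oplus>\<^bsub>localize_at R P\<^esub> \<one>\<^bsub>localize_at R P\<^esub> = \<zero>\<^bsub>localize_at R P\<^esub>"
          unfolding one_at using S_one by (simp add: Loc_add l_neg)
        then have "(frac_at P (\<ominus> \<one>) \<one> \<oplus>\<^bsub>localize_at R P\<^esub> \<one>\<^bsub>localize_at R P\<^esub>) \<otimes>\<^bsub>localize_at R P\<^esub> x P = \<zero>\<^bsub>localize_at R P\<^esub>"
          using x' by simp
        then show "?y P \<oplus>\<^bsub>localize_at R P\<^esub> x P = \<zero>\<^bsub>localize_at R P\<^esub>"
          using x' P S_one by (simp add: L.l_distr)
      qed
      then show "\<exists>y\<in>spec_sections R U. (\<lambda>P\<in>U. y P \<oplus>\<^bsub>localize_at R P\<^esub> x P) = (\<lambda>P\<in>U. \<zero>\<^bsub>localize_at R P\<^esub>)"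
        using y by blast
      show "(\<lambda>P\<in>U. (\<lambda>P\<in>U. \<zero>\<^bsub>localize_at R P\<^esub>) P \<oplus>\<^bsub>localize_at R P\<^esub> x P) = x"
        by (rule spec_sections_eqI[OF spec_sections_add[OF zero x] x])
          (simp add: cring.cring_simprules(8,12)[OF L] spec_sections_in[OF x])
      fix y assume y: "y \<in> spec_sections R U"
      show "(\<lambda>P\<in>U. x P \<oplus>\<^bsub>localize_at R P\<^esub> y P) = (\<lambda>P\<in>U. y P \<oplus>\<^bsub>localize_at R P\<^esub> x P)"
        by (rule restrict_ext) (rule cring.cring_simprules(10)[OF L spec_sections_in[OF x] spec_sections_in[OF y]])
      fix z assume z: "z \<in> spec_sections R U"
      show "(\<lambda>P\<in>U. (\<lambda>P\<in>U. x P \<oplus>\<^bsub>localize_at R P\<^esub> y P) P \<oplus>\<^bsub>localize_at R P\<^esub> z P)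
          = (\<lambda>P\<in>U. x P \<oplus>\<^bsub>localize_at R P\<^esub> (\<lambda>P\<in>U. y P \<oplus>\<^bsub>localize_at R P\<^esub> z P) P)"
        by (rule restrict_ext)
          (simp add: cring.cring_simprules(7)[OF L spec_sections_in[OF x] spec_sections_in[OF y] spec_sections_in[OF z]])
    qed (rule closed | assumption)+
    show "Group.comm_monoid (sect (Spec R) U)"
    proof (rule comm_monoidI; unfold Spec_simps)
      fix x assume x: "x \<in> spec_sections R U"
      show "(\<lambda>P\<in>U. (\<lambda>P\<in>U. \<one>\<^bsub>localize_at R P\<^esub>) P \<otimes>\<^bsub>localize_at R P\<^esub> x P) = x"
        by (rule spec_sections_eqI[OF spec_sections_mult[OF one x] x])
          (simp add: cring.cring_simprules(8,12)[OF L] spec_sections_in[OF x])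
      fix y assume y: "y \<in> spec_sections R U"
      show "(\<lambda>P\<in>U. x P \<otimes>\<^bsub>localize_at R P\<^esub> y P) = (\<lambda>P\<in>U. y P \<otimes>\<^bsub>localize_at R P\<^esub> x P)"
        by (rule restrict_ext) (rule cring.cring_simprules(14)[OF L spec_sections_in[OF x] spec_sections_in[OF y]])
      fix z assume z: "z \<in> spec_sections R U"
      show "(\<lambda>P\<in>U. (\<lambda>P\<in>U. x P \<otimes>\<^bsub>localize_at R P\<^esub> y P) P \<otimes>\<^bsub>localize_at R P\<^esub> z P)
          = (\<lambda>P\<in>U. x P \<otimes>\<^bsub>localize_at R P\<^esub> (\<lambda>P\<in>U. y P \<otimes>\<^bsub>localize_at R P\<^esub> z P) P)"
        by (rule restrict_ext)
          (simp add: cring.cring_simprules(11)[OF L spec_sections_in[OF x] spec_sections_in[OF y] spec_sections_in[OF z]])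
    qed (rule closed | assumption)+
    fix x y z assume "x \<in> carrier (sect (Spec R) U)" "y \<in> carrier (sect (Spec R) U)" "z \<in> carrier (sect (Spec R) U)"
    then have xyz: "x \<in> spec_sections R U" "y \<in> spec_sections R U" "z \<in> spec_sections R U" by simp_all
    show "(x \<oplus>\<^bsub>sect (Spec R) U\<^esub> y) \<otimes>\<^bsub>sect (Spec R) U\<^esub> z
        = x \<otimes>\<^bsub>sect (Spec R) U\<^esub> z \<oplus>\<^bsub>sect (Spec R) U\<^esub> y \<otimes>\<^bsub>sect (Spec R) U\<^esub> z"
      unfolding Spec_simps
      by (rule restrict_ext)
        (simp add: cring.cring_simprules(13)[OF L spec_sections_in[OF xyz(1)] spec_sections_in[OF xyz(2)] spec_sections_in[OF xyz(3)]])
  qed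
qed

lemma spec_sections_restrict:
  assumes s: "s \<in> spec_sections R U" and W: "openin (spec_topology R) W" "W \<subseteq> U"
  shows "restrict s W \<in> spec_sections R W"
proof (rule spec_sectionsI)
  fix P assume P: "P \<in> W"
  then have "P \<in> U" using W(2) by blast
  with s obtain V a g where V: "openin (spec_topology R) V" "P \<in> V" "V \<subseteq> U" "a \<in> carrier R" "g \<in> carrier R"
    "\<And>Q. Q \<in> V \<Longrightarrow> g \<notin> Q" "\<And>Q. Q \<in> V \<Longrightarrow> s Q = frac_at Q a g" by (rule spec_sections_cases) blast
  then show "\<exists>V a g. openin (spec_topology R) V \<and> P \<in> V \<and> V \<subseteq> W \<and> a \<in> carrier R \<and> g \<in> carrier R \<and>
      (\<forall>Q\<in>V. g \<notin> Q \<and> restrict s W Q = frac_at Q a g)"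
    using P openin_Int[OF V(1) W(1)] by (intro exI[of _ "V \<inter> W"] exI[of _ a] exI[of _ g] conjI ballI) auto
qed simp

lemma ring_presheaf_Spec: "ring_presheaf (Spec R)"
proof (rule ring_presheaf.intro)
  show "presheaf_on (topo (Spec R)) (\<lambda>U. carrier (sect (Spec R) U)) (rst (Spec R))"
    unfolding presheaf_on_def Spec_simps
    by (auto simp: spec_sections_restrict extensional_restrict spec_sections_ext Int_absorb1)
  show "cring (sect (Spec R) U)" if "openin (topo (Spec R)) U" for U
    using that by (intro cring_spec_sections) simp
  fix U W assume U: "openin (topo (Spec R)) U" and W: "openin (topo (Spec R)) W" and WU: "W \<subseteq> U"
  have sub: "restrict (restrict f U) W = restrict f W" for f :: "'a set \<Rightarrow> ('a \<times> 'a) set"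
    using WU by (simp add: Int_absorb1)
  show "rst (Spec R) U W \<in> Ring.ring_hom (sect (Spec R) U) (sect (Spec R) W)"
  proof (rule ring_hom_memI; unfold Spec_simps sub)
    fix x assume "x \<in> spec_sections R U"
    then show "restrict x W \<in> spec_sections R W" using U W WU by (simp add: spec_sections_restrict)
    fix y
    show "(\<lambda>P\<in>W. x P \<otimes>\<^bsub>localize_at R P\<^esub> y P) = (\<lambda>P\<in>W. restrict x W P \<otimes>\<^bsub>localize_at R P\<^esub> restrict y W P)"
      by (rule restrict_ext) simp
    show "(\<lambda>P\<in>W. x P \<oplus>\<^bsub>localize_at R P\<^esub> y P) = (\<lambda>P\<in>W. restrict x W P \<oplus>\<^bsub>localize_at R P\<^esub> restrict y W P)"
      by (rule restrict_ext) simp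
  qed (rule refl)
qed

text \<open>Near q a section is a single fraction a/g, and its germ times that of g is the germ of
  a. A vanishing germ has vanishing value in the localization at q, which yields the annihilating
  element outside q.\<close>

lemma prime_localization_stalk:
  assumes q: "q \<in> spec_points R"
  shows "prime_localization R (stalk (Spec R) q) q (\<lambda>a. fgerm (Spec R) q (spec_points R) (spec_fun R a))"
proof -
  interpret T: ring_presheaf "Spec R" by (rule ring_presheaf_Spec)
  have op: "openin (topo (Spec R)) (spec_points R)" using openin_topspace[of "spec_topology R"] by simp
  have prime: "primeideal P R" if "P \<in> spec_points R" for P using that by (simp add: spec_points_def)
  have mult: "multiplicative_subset R (carrier R - P)" if "P \<in> spec_points R" for P
    by (rule multiplicative_subset_prime[OF prime[OF that]])
  have one_not: "\<one> \<notin> P" if "P \<in> spec_points R" for P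
    using multiplicative_subset.S_one[OF mult[OF that]] by simp
  have spec_fun: "spec_fun R a \<in> spec_sections R (spec_points R)" if "a \<in> carrier R" for a
    unfolding spec_fun_def using op that one_not by (intro fraction_section) auto
  have hom1: "spec_fun R \<in> Ring.ring_hom R (sect (Spec R) (spec_points R))"
  proof (rule ring_hom_memI)
    fix a b assume ab: "a \<in> carrier R" "b \<in> carrier R"
    show "spec_fun R (a \<otimes> b) = spec_fun R a \<otimes>\<^bsub>sect (Spec R) (spec_points R)\<^esub> spec_fun R b"
      unfolding Spec_simps spec_fun_def
    proof (rule restrict_ext)
      fix P assume P: "P \<in> spec_points R"
      interpret M: multiplicative_subset R "carrier R - P" by (rule mult[OF P])
      show "frac_at P (a \<otimes> b) \<one> = (\<lambda>P\<in>spec_points R. frac_at P a \<one>) P \<otimes>\<^bsub>localize_at R P\<^esub> (\<lambda>P\<in>spec_points R. frac_at P b \<one>) P"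
        using ab P ring_hom_mult[OF M.fraction_hom ab] by simp
    qed
    show "spec_fun R (a \<oplus> b) = spec_fun R a \<oplus>\<^bsub>sect (Spec R) (spec_points R)\<^esub> spec_fun R b"
      unfolding Spec_simps spec_fun_def
    proof (rule restrict_ext)
      fix P assume P: "P \<in> spec_points R"
      interpret M: multiplicative_subset R "carrier R - P" by (rule mult[OF P])
      show "frac_at P (a \<oplus> b) \<one> = (\<lambda>P\<in>spec_points R. frac_at P a \<one>) P \<oplus>\<^bsub>localize_at R P\<^esub> (\<lambda>P\<in>spec_points R. frac_at P b \<one>) P"
        using ab P ring_hom_add[OF M.fraction_hom ab] by simp
    qed
  qed (auto simp: spec_fun, simp add: spec_fun_def localization_def)
  let ?\<gamma> = "\<lambda>a. fgerm (Spec R) q (spec_points R) (spec_fun R a)"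
  have sec: "T.sec q (spec_points R) (spec_fun R a)" if "a \<in> carrier R" for a
    using that q op spec_fun by (simp add: T.sec_def)
  have gamma_basic: "?\<gamma> a = fgerm (Spec R) q W (\<lambda>P\<in>W. frac_at P a \<one>)"
    if a: "a \<in> carrier R" and W: "openin (spec_topology R) W" "q \<in> W" for a W
  proof -
    have sub: "W \<subseteq> spec_points R" using openin_subset[OF W(1)] by simp
    have "rst (Spec R) (spec_points R) W (spec_fun R a) = (\<lambda>P\<in>W. frac_at P a \<one>)"
      unfolding Spec_simps spec_fun_def by (rule restrict_ext) (use sub in auto)
    then show ?thesis using T.fgerm_rst[OF sec[OF a], of W] W sub by simp
  qed
  have secW: "T.sec q W (\<lambda>P\<in>W. frac_at P a g)"
    if "openin (spec_topology R) W" "q \<in> W" "a \<in> carrier R" "g \<in> carrier R" "\<And>P. P \<in> W \<Longrightarrow> g \<notin> P" for W a g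
    using that fraction_section[OF that(1,3,4,5)] by (simp add: T.sec_def)
  have mult_fraction: "fgerm (Spec R) q W (\<lambda>P\<in>W. frac_at P a g) \<otimes>\<^bsub>stalk (Spec R) q\<^esub> ?\<gamma> g = ?\<gamma> a"
    if W: "openin (spec_topology R) W" "q \<in> W" and a: "a \<in> carrier R" and g: "g \<in> carrier R" "\<And>P. P \<in> W \<Longrightarrow> g \<notin> P" for W a g
  proof -
    have one: "\<one> \<notin> P" if "P \<in> W" for P using that openin_subset[OF W(1)] by (intro one_not) auto
    have "(\<lambda>P\<in>W. frac_at P a g) \<otimes>\<^bsub>sect (Spec R) W\<^esub> (\<lambda>P\<in>W. frac_at P g \<one>) = (\<lambda>P\<in>W. frac_at P a \<one>)"
      unfolding Spec_simps
    proof (rule restrict_ext)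
      fix P assume P: "P \<in> W"
      interpret M: multiplicative_subset R "carrier R - P" by (rule mult_at[OF W(1) P])
      have "frac_at P (a \<otimes> g) (g \<otimes> \<one>) = frac_at P a \<one>"
        by (rule M.fraction_eqI) (use a g P M.S_one in auto)
      then show "(\<lambda>P\<in>W. frac_at P a g) P \<otimes>\<^bsub>localize_at R P\<^esub> (\<lambda>P\<in>W. frac_at P g \<one>) P = frac_at P a \<one>"
        using P a g M.S_one by (simp add: M.Loc_mult)
    qed
    then show ?thesis
      unfolding gamma_basic[OF a W] gamma_basic[OF g(1) W]
      using T.stalk_mult[OF secW[OF W a g] secW[OF W g(1) one_closed one]] by simp
  qed
  have stalk: "cring (stalk (Spec R) q)" by (rule T.cring_stalk) (simp add: q)
  interpret A: cring "stalk (Spec R) q" by (rule stalk)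
  have hom: "?\<gamma> \<in> Ring.ring_hom R (stalk (Spec R) q)"
    using ring_hom_trans[OF hom1 T.fgerm_hom[OF op q]] by (simp add: comp_def)
  show ?thesis
  proof (rule prime_localization.intro[OF cring_axioms stalk prime_localization_axioms.intro])
    show "primeideal q R" by (rule prime[OF q])
    show "?\<gamma> \<in> Ring.ring_hom R (stalk (Spec R) q)" by (rule hom)
    show "?\<gamma> s \<in> Units (stalk (Spec R) q)" if s: "s \<in> carrier R - q" for s
    proof -
      let ?W = "{P \<in> spec_points R. s \<notin> P}"
      have W: "openin (spec_topology R) ?W" "q \<in> ?W" using s q openin_basic by auto
      let ?x = "fgerm (Spec R) q ?W (\<lambda>P\<in>?W. frac_at P \<one> s)"
      have x: "?x \<in> carrier (stalk (Spec R) q)" using W s by (intro T.fgerm_in secW) auto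
      have "?x \<otimes>\<^bsub>stalk (Spec R) q\<^esub> ?\<gamma> s = ?\<gamma> \<one>" using W s by (intro mult_fraction) auto
      then have m: "?x \<otimes>\<^bsub>stalk (Spec R) q\<^esub> ?\<gamma> s = \<one>\<^bsub>stalk (Spec R) q\<^esub>" using ring_hom_one[OF hom] by simp
      show ?thesis by (rule A.UnitsI[OF ring_hom_closed[OF hom] x m]) (use s in simp)
    qed
    show "\<exists>a\<in>carrier R. \<exists>s\<in>carrier R - q. x \<otimes>\<^bsub>stalk (Spec R) q\<^esub> ?\<gamma> s = ?\<gamma> a" if x: "x \<in> carrier (stalk (Spec R) q)" for x
    proof -
      obtain U s where s: "T.sec q U s" "x = fgerm (Spec R) q U s"
        using T.stalk_cases[OF x] by blast
      then have "s \<in> spec_sections R U" "q \<in> U" by (auto simp: T.sec_def)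
      then obtain W a g where W: "openin (spec_topology R) W" "q \<in> W" "W \<subseteq> U" "a \<in> carrier R" "g \<in> carrier R"
        "\<And>Q. Q \<in> W \<Longrightarrow> g \<notin> Q" "\<And>Q. Q \<in> W \<Longrightarrow> s Q = frac_at Q a g" by (rule spec_sections_cases) blast
      have "rst (Spec R) U W s = (\<lambda>P\<in>W. frac_at P a g)" unfolding Spec_simps by (rule restrict_ext) (rule W(7))
      then have "x = fgerm (Spec R) q W (\<lambda>P\<in>W. frac_at P a g)" using T.fgerm_rst[OF s(1), of W] W s(2) by simp
      then have "x \<otimes>\<^bsub>stalk (Spec R) q\<^esub> ?\<gamma> g = ?\<gamma> a" using mult_fraction[OF W(1,2,4,5,6)] by simp
      then show ?thesis using W(4,5) W(6)[OF W(2)] by blast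
    qed
    show "\<exists>u\<in>carrier R - q. u \<otimes> a = \<zero>" if a: "a \<in> carrier R" and z: "?\<gamma> a = \<zero>\<^bsub>stalk (Spec R) q\<^esub>" for a
    proof -
      have "?\<gamma> a = ?\<gamma> \<zero>" using z ring_hom_zero[OF hom ring_axioms A.ring_axioms] by simp
      then obtain N where N: "q \<in> N" "N \<subseteq> spec_points R \<inter> spec_points R"
        "rst (Spec R) (spec_points R) N (spec_fun R a) = rst (Spec R) (spec_points R) N (spec_fun R \<zero>)"
        unfolding T.fgerm_eq_iff[OF sec[OF a] sec[OF zero_closed]] by blast
      have "spec_fun R a q = spec_fun R \<zero> q" using fun_cong[OF N(3), of q] N(1) by simp
      then have "frac_at q a \<one> = frac_at q \<zero> \<one>" using q by (simp add: spec_fun_def)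
      interpret M: multiplicative_subset R "carrier R - q" by (rule mult[OF q])
      from \<open>frac_at q a \<one> = frac_at q \<zero> \<one>\<close> have "\<exists>u\<in>carrier R - q. u \<otimes> (a \<otimes> \<one>) = u \<otimes> (\<zero> \<otimes> \<one>)"
        using M.fraction_eq_iff[OF a zero_closed M.S_one M.S_one] by blast
      then show ?thesis using a by auto
    qed
  qed
qed

end

section \<open>Zeros of sections of vector bundles\<close>

subsection \<open>Coordinates\<close>

lemma lincomb_cong:
  assumes "Module.module R M" "\<And>i. i < n \<Longrightarrow> a i = b i" "\<And>i. i < n \<Longrightarrow> e i = d i"
    "\<And>i. i < n \<Longrightarrow> b i \<in> carrier R" "\<And>i. i < n \<Longrightarrow> d i \<in> carrier M"
  shows "lincomb M n a e = lincomb M n b d"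
proof -
  interpret M: Module.module R M by fact
  show ?thesis unfolding lincomb_def
    by (rule M.finsum_cong') (use assms in auto)
qed

locale based_module = Module.module R M for R :: "('a, 'c) ring_scheme" and M :: "('a, 'm) module" +
  fixes n :: nat and e :: "nat \<Rightarrow> 'm"
  assumes basis: "is_basis R M n e"
begin

abbreviation "co \<equiv> coords R M n e"

lemma basis_in: "e \<in> {..<n} \<rightarrow> carrier M"
  using basis by (simp add: is_basis_def)

lemma module: "Module.module R M"
  by (rule module_axioms)

lemma coords_props:
  assumes v: "v \<in> carrier M"
  shows "co v \<in> {..<n} \<rightarrow>\<^sub>E carrier R" "lincomb M n (co v) e = v"
proof -
  have "\<exists>!a. a \<in> {..<n} \<rightarrow>\<^sub>E carrier R \<and> v = lincomb M n a e"
    using basis v unfolding is_basis_def by blast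
  from theI'[OF this] show "co v \<in> {..<n} \<rightarrow>\<^sub>E carrier R" "lincomb M n (co v) e = v"
    unfolding coords_def by simp_all
qed

lemma coords_unique:
  assumes a: "a \<in> {..<n} \<rightarrow>\<^sub>E carrier R"
  shows "co (lincomb M n a e) = a"
proof -
  have v: "lincomb M n a e \<in> carrier M"
    using lincomb_linear(1)[OF module basis_in, of a] a by simp
  have "\<exists>!b. b \<in> {..<n} \<rightarrow>\<^sub>E carrier R \<and> lincomb M n a e = lincomb M n b e"
    using basis v unfolding is_basis_def by blast
  with a show ?thesis using coords_props[OF v] by metis
qed

lemma coords_in: "v \<in> carrier M \<Longrightarrow> i < n \<Longrightarrow> co v i \<in> carrier R"
  using coords_props(1) by (auto simp: PiE_iff)

lemma coords_add:
  assumes "v \<in> carrier M" "w \<in> carrier M" "i < n"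
  shows "co (v \<oplus>\<^bsub>M\<^esub> w) i = co v i \<oplus>\<^bsub>R\<^esub> co w i"
proof -
  let ?a = "\<lambda>i\<in>{..<n}. co v i \<oplus>\<^bsub>R\<^esub> co w i"
  have "lincomb M n ?a e = v \<oplus>\<^bsub>M\<^esub> w"
    using lincomb_linear(2)[OF module basis_in, of "co v" "co w"] coords_props assms by simp
  moreover have "co (lincomb M n ?a e) = ?a" by (rule coords_unique) (use assms in \<open>auto simp: coords_in\<close>)
  ultimately show ?thesis using assms(3) by simp
qed

lemma coords_smult:
  assumes "v \<in> carrier M" "c \<in> carrier R" "i < n"
  shows "co (c \<odot>\<^bsub>M\<^esub> v) i = c \<otimes>\<^bsub>R\<^esub> co v i"
proof -
  let ?a = "\<lambda>i\<in>{..<n}. c \<otimes>\<^bsub>R\<^esub> co v i"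
  have "lincomb M n ?a e = c \<odot>\<^bsub>M\<^esub> v"
    using lincomb_linear(3)[OF module basis_in, of c "co v"] coords_props assms by simp
  moreover have "co (lincomb M n ?a e) = ?a" by (rule coords_unique) (use assms in \<open>auto simp: coords_in\<close>)
  ultimately show ?thesis using assms(3) by simp
qed

text \<open>Serves for a change of frame: if the coefficients of a vector in one frame are sent into
  an ideal, so are its coordinates in another.\<close>

lemma coords_lincomb_ideal:
  assumes J: "ideal J B" and g: "g \<in> Ring.ring_hom R B"
    and w: "\<And>j. j < n \<Longrightarrow> w j \<in> carrier M"
    and c: "\<And>j. j < n \<Longrightarrow> c j \<in> carrier R" "\<And>j. j < n \<Longrightarrow> g (c j) \<in> J"
    and i: "i < n"
  shows "g (co (lincomb M n c w) i) \<in> J"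
proof -
  interpret J: ideal J B by fact
  have smult: "g (co (a \<odot>\<^bsub>M\<^esub> v) i) \<in> J" if "a \<in> carrier R" "g a \<in> J" "v \<in> carrier M" for a v
    using that i ring_hom_mult[OF g that(1) coords_in[OF that(3) i]]
      J.I_r_closed[OF that(2) ring_hom_closed[OF g coords_in[OF that(3) i]]] by (simp add: coords_smult)
  have "g \<zero>\<^bsub>R\<^esub> \<in> J" using ring_hom_zero[OF g R.ring_axioms J.ring_axioms] by simp
  then have zero: "g (co \<zero>\<^bsub>M\<^esub> i) \<in> J" using smult[of "\<zero>\<^bsub>R\<^esub>" "\<zero>\<^bsub>M\<^esub>"] by simp
  have "A \<subseteq> {..<n} \<Longrightarrow> g (co (\<Oplus>\<^bsub>M\<^esub>j\<in>A. c j \<odot>\<^bsub>M\<^esub> w j) i) \<in> J" if "finite A" for A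
    using that
  proof (induction A rule: finite_induct)
    case empty
    then show ?case using zero by simp
  next
    case (insert j A)
    then have j: "j < n" and A: "A \<subseteq> {..<n}" by auto
    have t: "(\<Oplus>\<^bsub>M\<^esub>j\<in>A. c j \<odot>\<^bsub>M\<^esub> w j) \<in> carrier M" using A c w by (intro finsum_closed) auto
    have s: "c j \<odot>\<^bsub>M\<^esub> w j \<in> carrier M" using j c w by simp
    have "(\<Oplus>\<^bsub>M\<^esub>j\<in>insert j A. c j \<odot>\<^bsub>M\<^esub> w j) = c j \<odot>\<^bsub>M\<^esub> w j \<oplus>\<^bsub>M\<^esub> (\<Oplus>\<^bsub>M\<^esub>j\<in>A. c j \<odot>\<^bsub>M\<^esub> w j)"
      by (rule finsum_insert[OF insert(1,2)]) (use A s c w in auto)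
    then show ?case
      using ring_hom_add[OF g coords_in[OF s i] coords_in[OF t i]] coords_add[OF s t i]
        additive_subgroup.a_closed[OF ideal.axioms(1)[OF J] smult[OF c(1)[OF j] c(2)[OF j] w[OF j]] insert(3)[OF A]] by simp
  qed
  from this[of "{..<n}"] show ?thesis by (simp add: lincomb_def)
qed

end

subsection \<open>The zero ideal\<close>

locale bundle_section = ring_presheaf S
  for S :: "('p, 'r, 'z) ringed_space_scheme" +
  fixes n :: nat and V :: "('p, 'r, 'm) mod_sheaf" and \<sigma> :: 'm
  assumes V: "module_sheaf S V" and sigma: "\<sigma> \<in> carrier (msec V (pts S))"
begin

lemma msec_module: "openin (topo S) U \<Longrightarrow> Module.module (sect S U) (msec V U)"
  using V unfolding module_sheaf_def by blast

lemma mrst_linear: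
  assumes U: "openin (topo S) U" and W: "openin (topo S) W" "W \<subseteq> U"
  shows "(\<forall>v\<in>carrier (msec V U). \<forall>w\<in>carrier (msec V U).
           mrst V U W (v \<oplus>\<^bsub>msec V U\<^esub> w) = mrst V U W v \<oplus>\<^bsub>msec V W\<^esub> mrst V U W w) \<and>
        (\<forall>a\<in>carrier (sect S U). \<forall>v\<in>carrier (msec V U).
           mrst V U W (a \<odot>\<^bsub>msec V U\<^esub> v) = rst S U W a \<odot>\<^bsub>msec V W\<^esub> mrst V U W v)"
  by (rule V[unfolded module_sheaf_def, THEN conjunct2, THEN conjunct2, THEN spec[of _ U], THEN spec[of _ W],
        THEN mp, OF conjI[OF U conjI[OF W]]])

lemma mrst_add: "openin (topo S) U \<Longrightarrow> openin (topo S) W \<Longrightarrow> W \<subseteq> U \<Longrightarrow> v \<in> carrier (msec V U) \<Longrightarrow>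
    w \<in> carrier (msec V U) \<Longrightarrow> mrst V U W (v \<oplus>\<^bsub>msec V U\<^esub> w) = mrst V U W v \<oplus>\<^bsub>msec V W\<^esub> mrst V U W w"
  by (rule bspec[OF bspec[OF conjunct1[OF mrst_linear]]])

lemma mrst_smult: "openin (topo S) U \<Longrightarrow> openin (topo S) W \<Longrightarrow> W \<subseteq> U \<Longrightarrow> a \<in> carrier (sect S U) \<Longrightarrow>
    v \<in> carrier (msec V U) \<Longrightarrow> mrst V U W (a \<odot>\<^bsub>msec V U\<^esub> v) = rst S U W a \<odot>\<^bsub>msec V W\<^esub> mrst V U W v"
  by (rule bspec[OF bspec[OF conjunct2[OF mrst_linear]]])

lemma mrst_presheaf: "presheaf_on (topo S) (\<lambda>U. carrier (msec V U)) (mrst V)"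
  using V unfolding module_sheaf_def sheaf_on_def by blast

lemma mrst_in:
  assumes U: "openin (topo S) U" and W: "openin (topo S) W" "W \<subseteq> U" and v: "v \<in> carrier (msec V U)"
  shows "mrst V U W v \<in> carrier (msec V W)"
  using funcset_mem[OF mrst_presheaf[unfolded presheaf_on_def, THEN conjunct1, THEN spec[of _ U], THEN spec[of _ W],
        THEN mp, OF conjI[OF U conjI[OF W]]] v] .

lemma mrst_id:
  assumes U: "openin (topo S) U" and v: "v \<in> carrier (msec V U)"
  shows "mrst V U U v = v"
  by (rule mrst_presheaf[unfolded presheaf_on_def, THEN conjunct2, THEN conjunct1, THEN spec[of _ U], THEN mp, OF U,
        THEN bspec, OF v])

lemma mrst_mrst:
  assumes U: "openin (topo S) U" "openin (topo S) W" "openin (topo S) W'" and sub: "W \<subseteq> U" "W' \<subseteq> W"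
    and v: "v \<in> carrier (msec V U)"
  shows "mrst V W W' (mrst V U W v) = mrst V U W' v"
  by (rule mrst_presheaf[unfolded presheaf_on_def, THEN conjunct2, THEN conjunct2, THEN spec[of _ U], THEN spec[of _ W],
        THEN spec[of _ W'], THEN mp, OF conjI[OF U(1) conjI[OF U(2) conjI[OF U(3) conjI[OF sub]]]], THEN bspec, OF v])

lemma mrst_lincomb:
  assumes U: "openin (topo S) U" and W: "openin (topo S) W" "W \<subseteq> U"
    and a: "\<And>i. i < n \<Longrightarrow> a i \<in> carrier (sect S U)" and e: "\<And>i. i < n \<Longrightarrow> e i \<in> carrier (msec V U)"
  shows "mrst V U W (lincomb (msec V U) n a e) = lincomb (msec V W) n (\<lambda>i. rst S U W (a i)) (\<lambda>i. mrst V U W (e i))"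
proof -
  interpret U: Module.module "sect S U" "msec V U" by (rule msec_module[OF U])
  interpret W: Module.module "sect S W" "msec V W" by (rule msec_module[OF W(1)])
  have zero: "mrst V U W \<zero>\<^bsub>msec V U\<^esub> = \<zero>\<^bsub>msec V W\<^esub>"
    using mrst_smult[OF U W, of "\<zero>\<^bsub>sect S U\<^esub>" "\<zero>\<^bsub>msec V U\<^esub>"] rst_zero[OF U W] mrst_in[OF U W, of "\<zero>\<^bsub>msec V U\<^esub>"] by simp
  have "A \<subseteq> {..<n} \<Longrightarrow> mrst V U W (\<Oplus>\<^bsub>msec V U\<^esub>i\<in>A. a i \<odot>\<^bsub>msec V U\<^esub> e i)
      = (\<Oplus>\<^bsub>msec V W\<^esub>i\<in>A. rst S U W (a i) \<odot>\<^bsub>msec V W\<^esub> mrst V U W (e i))" if "finite A" for A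
    using that
  proof (induction A rule: finite_induct)
    case empty
    then show ?case using zero by simp
  next
    case (insert j A)
    then have j: "j < n" and A: "A \<subseteq> {..<n}" by auto
    have s: "a j \<odot>\<^bsub>msec V U\<^esub> e j \<in> carrier (msec V U)" using j a e by simp
    have t: "(\<Oplus>\<^bsub>msec V U\<^esub>i\<in>A. a i \<odot>\<^bsub>msec V U\<^esub> e i) \<in> carrier (msec V U)" using A a e by (intro U.finsum_closed) auto
    have "(\<Oplus>\<^bsub>msec V U\<^esub>i\<in>insert j A. a i \<odot>\<^bsub>msec V U\<^esub> e i) = a j \<odot>\<^bsub>msec V U\<^esub> e j \<oplus>\<^bsub>msec V U\<^esub> (\<Oplus>\<^bsub>msec V U\<^esub>i\<in>A. a i \<odot>\<^bsub>msec V U\<^esub> e i)"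
      by (rule U.finsum_insert[OF insert(1,2)]) (use A s a e in auto)
    moreover have "(\<Oplus>\<^bsub>msec V W\<^esub>i\<in>insert j A. rst S U W (a i) \<odot>\<^bsub>msec V W\<^esub> mrst V U W (e i))
        = rst S U W (a j) \<odot>\<^bsub>msec V W\<^esub> mrst V U W (e j) \<oplus>\<^bsub>msec V W\<^esub> (\<Oplus>\<^bsub>msec V W\<^esub>i\<in>A. rst S U W (a i) \<odot>\<^bsub>msec V W\<^esub> mrst V U W (e i))"
      by (rule W.finsum_insert[OF insert(1,2)]) (use A j a e rst_closed[OF U W] mrst_in[OF U W] in auto)
    ultimately show ?case using insert(3)[OF A] mrst_add[OF U W s t] mrst_smult[OF U W a[OF j] e[OF j]] by simp
  qed
  from this[of "{..<n}"] show ?thesis by (simp add: lincomb_def)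
qed

lemma frame_based:
  assumes e: "local_frame S V n U e" and W: "openin (topo S) W" "W \<subseteq> U"
  shows "based_module (sect S W) (msec V W) n (\<lambda>i. mrst V U W (e i))"
  using e W by (intro based_module.intro based_module_axioms.intro msec_module) (auto simp: local_frame_def)

text \<open>\<open>local_frame\<close> speaks of bases after restriction; restricting to U itself
  changes nothing.\<close>

lemma frame_based_self:
  assumes e: "local_frame S V n U e"
  shows "based_module (sect S U) (msec V U) n e"
proof -
  have U: "openin (topo S) U" and e_in: "\<And>i. i < n \<Longrightarrow> e i \<in> carrier (msec V U)" using e by (auto simp: local_frame_def)
  interpret b: based_module "sect S U" "msec V U" n "\<lambda>i. mrst V U U (e i)" by (rule frame_based[OF e U]) simp
  have eq: "lincomb (msec V U) n a (\<lambda>i. mrst V U U (e i)) = lincomb (msec V U) n a e" if "a \<in> {..<n} \<rightarrow>\<^sub>E carrier (sect S U)" for a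
    by (rule lincomb_cong[OF b.module]) (use e_in that mrst_id[OF U] in \<open>auto simp: PiE_iff\<close>)
  have "is_basis (sect S U) (msec V U) n e"
    unfolding is_basis_def
  proof (intro conjI ballI)
    show "e \<in> {..<n} \<rightarrow> carrier (msec V U)" using e_in by auto
    fix v assume "v \<in> carrier (msec V U)"
    then have "\<exists>!a. a \<in> {..<n} \<rightarrow>\<^sub>E carrier (sect S U) \<and> v = lincomb (msec V U) n a (\<lambda>i. mrst V U U (e i))"
      using b.basis unfolding is_basis_def by blast
    then show "\<exists>!a. a \<in> {..<n} \<rightarrow>\<^sub>E carrier (sect S U) \<and> v = lincomb (msec V U) n a e"
      using eq by (simp cong: conj_cong)
  qed
  then show ?thesis by (intro based_module.intro based_module_axioms.intro b.module)
qed

abbreviation "component U e \<equiv> coords (sect S U) (msec V U) n e (mrst V (pts S) U \<sigma>)"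

lemma sigma_in: "openin (topo S) U \<Longrightarrow> mrst V (pts S) U \<sigma> \<in> carrier (msec V U)"
  using sigma by (intro mrst_in openin_topspace openin_subset)

lemma component_sec:
  assumes e: "local_frame S V n U e" and "x \<in> U" "i < n"
  shows "sec x U (component U e i)"
proof -
  interpret based_module "sect S U" "msec V U" n e by (rule frame_based_self[OF e])
  show ?thesis using assms coords_in sigma_in by (simp add: sec_def local_frame_def)
qed

text \<open>Restriction turns the expansion of the section in the frame into one in the restricted
  frame, and coordinates are unique.\<close>

lemma component_rst:
  assumes e: "local_frame S V n U e" and W: "openin (topo S) W" "W \<subseteq> U" and i: "i < n"
  shows "component W (\<lambda>i. mrst V U W (e i)) i = rst S U W (component U e i)"
proof -
  have U: "openin (topo S) U" and e_in: "\<And>i. i < n \<Longrightarrow> e i \<in> carrier (msec V U)" using e by (auto simp: local_frame_def)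
  have sub: "U \<subseteq> pts S" using U by (rule openin_subset)
  interpret u: based_module "sect S U" "msec V U" n e by (rule frame_based_self[OF e])
  interpret w: based_module "sect S W" "msec V W" n "\<lambda>i. mrst V U W (e i)" by (rule frame_based[OF e W])
  let ?a = "\<lambda>i\<in>{..<n}. rst S U W (component U e i)"
  have a: "?a \<in> {..<n} \<rightarrow>\<^sub>E carrier (sect S W)"
    using u.coords_in[OF sigma_in[OF U]] rst_closed[OF U W] by auto
  have "mrst V (pts S) W \<sigma> = mrst V U W (mrst V (pts S) U \<sigma>)"
    using mrst_mrst[OF openin_topspace U W(1) sub W(2) sigma] by simp
  also have "\<dots> = mrst V U W (lincomb (msec V U) n (component U e) e)"
    using u.coords_props(2)[OF sigma_in[OF U]] by simp
  also have "\<dots> = lincomb (msec V W) n (\<lambda>i. rst S U W (component U e i)) (\<lambda>i. mrst V U W (e i))"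
    by (rule mrst_lincomb[OF U W u.coords_in[OF sigma_in[OF U]] e_in])
  also have "\<dots> = lincomb (msec V W) n ?a (\<lambda>i. mrst V U W (e i))"
    by (rule lincomb_cong[OF w.module]) (use a mrst_in[OF U W e_in] in \<open>auto simp: PiE_iff\<close>)
  finally have "component W (\<lambda>i. mrst V U W (e i)) = ?a" using w.coords_unique[OF a] by simp
  then show ?thesis using i by simp
qed

lemma ideal_zero_ideal: "x \<in> pts S \<Longrightarrow> ideal (zero_ideal S n V \<sigma> x) (stalk S x)"
  unfolding zero_ideal_def using component_sec
  by (intro ring.genideal_ideal cring.axioms(1) cring_stalk) (auto intro!: fgerm_in)

lemma component_zero_ideal:
  assumes "x \<in> pts S" "local_frame S V n U e" "x \<in> U" "i < n"
  shows "fgerm S x U (component U e i) \<in> zero_ideal S n V \<sigma> x"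
proof -
  interpret cring "stalk S x" by (rule cring_stalk) fact
  let ?G = "{fgerm S x U (component U e i) | U e i. x \<in> U \<and> local_frame S V n U e \<and> i < n}"
  have "?G \<subseteq> carrier (stalk S x)" using component_sec by (auto intro!: fgerm_in)
  then have "?G \<subseteq> zero_ideal S n V \<sigma> x" unfolding zero_ideal_def by (rule genideal_self)
  then show ?thesis using assms by blast
qed

text \<open>On the overlap of two frames the components in one are linear combinations of those in
  the other, so a single frame generates the zero ideal.\<close>

lemma zero_ideal_frame:
  assumes x: "x \<in> pts S" and e: "local_frame S V n U e" "x \<in> U"
  shows "zero_ideal S n V \<sigma> x \<subseteq> genideal (stalk S x) ((\<lambda>i. fgerm S x U (component U e i)) ` {..<n})"
proof -
  interpret A: cring "stalk S x" by (rule cring_stalk) fact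
  let ?J = "genideal (stalk S x) ((\<lambda>i. fgerm S x U (component U e i)) ` {..<n})"
  have G: "(\<lambda>i. fgerm S x U (component U e i)) ` {..<n} \<subseteq> carrier (stalk S x)"
    using component_sec[OF e] by (auto intro!: fgerm_in)
  have J: "ideal ?J (stalk S x)" by (rule A.genideal_ideal[OF G])
  have U: "openin (topo S) U" and e_in: "\<And>i. i < n \<Longrightarrow> e i \<in> carrier (msec V U)" using e(1) by (auto simp: local_frame_def)
  have "fgerm S x U' (component U' e' i) \<in> ?J" if e': "local_frame S V n U' e'" "x \<in> U'" and i: "i < n" for U' e' i
  proof -
    have U': "openin (topo S) U'" using e'(1) by (auto simp: local_frame_def)
    let ?W = "U \<inter> U'"
    have W: "openin (topo S) ?W" "?W \<subseteq> U" "?W \<subseteq> U'" "x \<in> ?W" using U U' e(2) e'(2) by auto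
    interpret w: based_module "sect S ?W" "msec V ?W" n "\<lambda>i. mrst V U ?W (e i)" by (rule frame_based[OF e(1) W(1,2)])
    interpret w': based_module "sect S ?W" "msec V ?W" n "\<lambda>i. mrst V U' ?W (e' i)" by (rule frame_based[OF e'(1) W(1,3)])
    let ?c = "component ?W (\<lambda>i. mrst V U ?W (e i))"
    have "fgerm S x ?W (?c j) \<in> ?J" if j: "j < n" for j
    proof -
      have "fgerm S x ?W (?c j) = fgerm S x U (component U e j)"
        unfolding component_rst[OF e(1) W(1,2) j] by (rule fgerm_rst[OF component_sec[OF e j] W(1,4,2)])
      then show ?thesis using A.genideal_self[OF G] j by auto
    qed
    then have "fgerm S x ?W (w'.co (lincomb (msec V ?W) n ?c (\<lambda>i. mrst V U ?W (e i))) i) \<in> ?J"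
      by (intro w'.coords_lincomb_ideal[OF J fgerm_hom[OF W(1,4)]] i mrst_in[OF U W(1,2)] e_in w.coords_in sigma_in W(1))
    then have "fgerm S x ?W (component ?W (\<lambda>i. mrst V U' ?W (e' i)) i) \<in> ?J"
      using w.coords_props(2)[OF sigma_in[OF W(1)]] by simp
    then show ?thesis
      unfolding component_rst[OF e'(1) W(1,3) i] fgerm_rst[OF component_sec[OF e' i] W(1,4,3)] .
  qed
  then show ?thesis unfolding zero_ideal_def by (intro A.genideal_minimal[OF J]) blast
qed

end

subsection \<open>Simple zeros\<close>

context field
begin

lemma spec_points_field: "spec_points R = {{\<zero>}}"
proof
  show "spec_points R \<subseteq> {{\<zero>}}"
  proof
    fix P assume "P \<in> spec_points R"
    then interpret P: primeideal P R by (simp add: spec_points_def)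
    have "P = {\<zero>} \<or> P = carrier R" using all_ideals P.is_ideal by blast
    then show "P \<in> {{\<zero>}}" using P.I_notcarr by blast
  qed
  show "{{\<zero>}} \<subseteq> spec_points R" using zeroprimeideal by (simp add: spec_points_def)
qed

text \<open>A nonzero function is a nonzero fraction at the only point, and the inverse fraction is
  again a section. In this form invertibility passes through the isomorphism with the zero scheme,
  without identifying the functions with elements of the field.\<close>

lemma spec_section_unit:
  assumes s: "s \<in> spec_sections R (spec_points R)" "s \<noteq> \<zero>\<^bsub>sect (Spec R) (spec_points R)\<^esub>"
  shows "\<exists>t\<in>spec_sections R (spec_points R). s \<otimes>\<^bsub>sect (Spec R) (spec_points R)\<^esub> t = \<one>\<^bsub>sect (Spec R) (spec_points R)\<^esub>"
proof -
  let ?P = "{\<zero>}"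
  have op: "openin (spec_topology R) (spec_points R)" using openin_topspace[of "spec_topology R"] by simp
  interpret M: multiplicative_subset R "carrier R - ?P" by (rule multiplicative_subset_prime[OF zeroprimeideal])
  have P: "?P \<in> spec_points R" by (simp add: spec_points_field)
  obtain W a g where W: "openin (spec_topology R) W" "?P \<in> W" "W \<subseteq> spec_points R" and a: "a \<in> carrier R" "g \<in> carrier R"
    and W_g: "\<And>Q. Q \<in> W \<Longrightarrow> g \<notin> Q" "\<And>Q. Q \<in> W \<Longrightarrow> s Q = frac_at Q a g"
    using s(1) P by (rule spec_sections_cases) blast
  have g: "g \<noteq> \<zero>" using W_g(1)[OF W(2)] by simp
  have sP: "s ?P = frac_at ?P a g" by (rule W_g(2)[OF W(2)])
  have zero_loc: "\<zero>\<^bsub>localize_at R ?P\<^esub> = frac_at ?P \<zero> \<one>" and one_loc: "\<one>\<^bsub>localize_at R ?P\<^esub> = frac_at ?P \<one> \<one>"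
    by (simp_all add: localization_def)
  interpret C: cring "sect (Spec R) (spec_points R)" by (rule cring_spec_sections[OF op])
  have a0: "a \<noteq> \<zero>"
  proof
    assume "a = \<zero>"
    then have "frac_at ?P a g = frac_at ?P \<zero> \<one>" by (intro M.fraction_eqI) (use a g in auto)
    then have "s ?P = \<zero>\<^bsub>localize_at R ?P\<^esub>" using sP zero_loc by simp
    then have "s = \<zero>\<^bsub>sect (Spec R) (spec_points R)\<^esub>"
      using C.zero_closed by (intro spec_sections_eqI[OF s(1)]) (auto simp: spec_points_field)
    with s(2) show False by simp
  qed
  let ?t = "\<lambda>P\<in>spec_points R. frac_at P g a"
  have t: "?t \<in> spec_sections R (spec_points R)" by (rule fraction_section[OF op]) (use a a0 in \<open>auto simp: spec_points_field\<close>)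
  have "s ?P \<otimes>\<^bsub>localize_at R ?P\<^esub> frac_at ?P g a = frac_at ?P (a \<otimes> g) (g \<otimes> a)"
    unfolding sP by (rule M.Loc_mult) (use a g a0 in auto)
  also have "\<dots> = frac_at ?P \<one> \<one>"
    by (rule M.fraction_eqI) (use a g a0 m_comm in \<open>auto simp: integral_iff\<close>)
  finally have "s \<otimes>\<^bsub>sect (Spec R) (spec_points R)\<^esub> ?t = \<one>\<^bsub>sect (Spec R) (spec_points R)\<^esub>"
    unfolding Spec_simps one_loc[symmetric] by (intro restrict_ext) (auto simp: spec_points_field)
  with t show ?thesis by blast
qed

end

context bundle_section
begin

text \<open>An isomorphism with a one-point space forces W = {p}, and the functions on {p} are given
  by the elements of B/J. Nonzero functions on the spectrum of a field are units, so every element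
  outside J is invertible modulo J, and J is the maximal ideal.\<close>

lemma simple_zero_ideal:
  assumes p: "p \<in> pts S" and local: "local_ring (stalk S p)" and simple: "simple_zero S n V \<sigma> p"
  shows "zero_ideal S n V \<sigma> p = max_ideal (stalk S p)"
proof -
  let ?B = "stalk S p" and ?J = "zero_ideal S n V \<sigma> p" and ?Z = "zero_locus S n V \<sigma>" and ?Zs = "zero_scheme S n V \<sigma>"
  let ?E = "residue_field S p"
  interpret B: cring ?B by (rule cring_stalk[OF p])
  interpret J: ideal ?J ?B by (rule ideal_zero_ideal[OF p])
  interpret m: maximalideal "max_ideal ?B" ?B by (rule local_ringD(1)[OF local])
  interpret E: field ?E unfolding residue_field_def by (rule m.quotient_is_field[OF B.is_cring])
  have pZ: "p \<in> ?Z" and "\<one>\<^bsub>?B\<^esub> \<notin> ?J"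
    using simple J.one_imp_carrier by (auto simp: simple_zero_def zero_locus_def)
  then have sub: "?J \<subseteq> max_ideal ?B" by (intro local_ringD(2)[OF local] J.is_ideal)
  from simple obtain W where W: "openin (topo ?Zs) W" "p \<in> W" "rs_isomorphic (open_sub ?Zs W) (Spec ?E)"
    unfolding simple_zero_def by blast
  from W(3) obtain \<phi> :: "('p, 'p \<Rightarrow> ('p set \<times> 'r) set set, ('p set \<times> 'r) set set set,
      ('p set \<times> 'r) set set set \<Rightarrow> (('p set \<times> 'r) set set \<times> ('p set \<times> 'r) set set) set) rs_map" where
    homeo: "homeomorphic_map (topo (open_sub ?Zs W)) (spec_topology ?E) (pmap \<phi>)"
    and iso: "\<And>V. openin (spec_topology ?E) V \<Longrightarrow> pull \<phi> V \<in> ring_iso (sect (Spec ?E) V) (sect (open_sub ?Zs W) (preim (open_sub ?Zs W) \<phi> V))"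
    unfolding rs_isomorphic_def by (auto simp: E.Spec_simps(1))
  have topo_Z: "topo ?Zs = subtopology (topo S) ?Z" by (simp add: zero_scheme_def Let_def)
  have pts_W: "topspace (topo (open_sub ?Zs W)) = W"
    using openin_subset[OF W(1)] by (auto simp: open_sub_def)
  have image: "pmap \<phi> ` W = {{\<zero>\<^bsub>?E\<^esub>}}"
    using homeomorphic_imp_surjective_map[OF homeo] by (simp add: pts_W E.spec_points_field)
  have inj: "inj_on (pmap \<phi>) W" using homeomorphic_imp_injective_map[OF homeo] unfolding pts_W .
  have pmap: "pmap \<phi> x = {\<zero>\<^bsub>?E\<^esub>}" if "x \<in> W" for x using imageI[OF that, of "pmap \<phi>"] unfolding image by simp
  have "x = p" if "x \<in> W" for x
    by (rule inj_onD[OF inj _ that W(2)]) (simp add: pmap that W(2))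
  then have Wp: "W = {p}" using W(2) by blast
  have "{x \<in> W. pmap \<phi> x \<in> spec_points ?E} = W" using pmap by (auto simp: E.spec_points_field)
  then have preim: "preim (open_sub ?Zs W) \<phi> (spec_points ?E) = {p}"
    unfolding preim_def pts_W using Wp by simp
  have opE: "openin (spec_topology ?E) (spec_points ?E)" using openin_topspace[of "spec_topology ?E"] by simp
  let ?T = "sect (Spec ?E) (spec_points ?E)" and ?C = "sect ?Zs {p}" and ?i = "pull \<phi> (spec_points ?E)"
  have i: "?i \<in> ring_iso ?T ?C" using iso[OF opE] unfolding preim by (simp add: open_sub_def)
  interpret T: cring ?T by (rule E.cring_spec_sections[OF opE])
  have C: "carrier ?C = {s \<in> (\<Pi>\<^sub>E x\<in>{p}. carrier (stalk S x Quot zero_ideal S n V \<sigma> x)). \<forall>x\<in>{p}. \<exists>W t.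
          openin (topo S) W \<and> x \<in> W \<and> W \<inter> ?Z \<subseteq> {p} \<and> t \<in> carrier (sect S W) \<and>
          (\<forall>y\<in>W \<inter> ?Z. s y = zero_ideal S n V \<sigma> y +>\<^bsub>stalk S y\<^esub> fgerm S y W t)}"
    and C_mult: "\<And>s t. (s \<otimes>\<^bsub>?C\<^esub> t) p = s p \<otimes>\<^bsub>?B Quot ?J\<^esub> t p"
    and C_one: "\<one>\<^bsub>?C\<^esub> p = \<one>\<^bsub>?B Quot ?J\<^esub>"
    and C_add: "\<And>s t. (s \<oplus>\<^bsub>?C\<^esub> t) p = s p \<oplus>\<^bsub>?B Quot ?J\<^esub> t p"
    by (simp_all add: zero_scheme_def Let_def)
  note hom_J = J.rcos_ring_hom
  interpret Q: ring "?B Quot ?J" by (rule J.quotient_is_ring)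
  \<comment> \<open>p is isolated in the zero locus. Inside \<open>W0\<close> the local condition on
    functions concerns p alone, so every germ at p induces a function on {p}.\<close>
  obtain W0 where W0: "openin (topo S) W0" "{p} = W0 \<inter> ?Z"
    using W(1) unfolding topo_Z Wp openin_subtopology by blast
  have inverse: "\<exists>c\<in>carrier ?B. b \<otimes>\<^bsub>?B\<^esub> c \<ominus>\<^bsub>?B\<^esub> \<one>\<^bsub>?B\<^esub> \<in> ?J" if b: "b \<in> carrier ?B" "b \<notin> ?J" for b
  proof -
    obtain U t where t: "sec p U t" "b = fgerm S p U t" using b(1) by (rule stalk_cases)
    have U: "openin (topo S) U" "p \<in> U" using t(1) by (auto simp: sec_def)
    let ?W = "W0 \<inter> U"
    have W': "openin (topo S) ?W" "p \<in> ?W" "?W \<subseteq> U" using W0 U by auto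
    let ?s = "\<lambda>y\<in>{p}. ?J +>\<^bsub>?B\<^esub> b"
    have germ: "fgerm S p ?W (rst S U ?W t) = b" unfolding t(2) by (rule fgerm_rst[OF t(1) W'])
    have only: "y = p" if "y \<in> ?W \<inter> ?Z" for y using that W0(2) by blast
    have s_in: "?s \<in> carrier ?C"
      unfolding C
    proof (intro CollectI conjI ballI)
      show "?s \<in> (\<Pi>\<^sub>E x\<in>{p}. carrier (stalk S x Quot zero_ideal S n V \<sigma> x))"
        using ring_hom_closed[OF hom_J b(1)] by auto
      fix x assume "x \<in> {p}"
      then have x: "x = p" by simp
      have "\<forall>y\<in>?W \<inter> ?Z. ?s y = zero_ideal S n V \<sigma> y +>\<^bsub>stalk S y\<^esub> fgerm S y ?W (rst S U ?W t)"
      proof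
        fix y assume "y \<in> ?W \<inter> ?Z"
        then have "y = p" by (rule only)
        then show "?s y = zero_ideal S n V \<sigma> y +>\<^bsub>stalk S y\<^esub> fgerm S y ?W (rst S U ?W t)" using germ by simp
      qed
      moreover have "?W \<inter> ?Z \<subseteq> {p}" using only by blast
      moreover have "rst S U ?W t \<in> carrier (sect S ?W)" using t(1) W' by (intro rst_closed) (auto simp: sec_def)
      ultimately show "\<exists>W t. openin (topo S) W \<and> x \<in> W \<and> W \<inter> ?Z \<subseteq> {p} \<and> t \<in> carrier (sect S W) \<and>
          (\<forall>y\<in>W \<inter> ?Z. ?s y = zero_ideal S n V \<sigma> y +>\<^bsub>stalk S y\<^esub> fgerm S y W t)"
        unfolding x using W' by (intro exI[of _ ?W] exI[of _ "rst S U ?W t"] conjI)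
    qed
    then have "?s \<in> ?i ` carrier ?T" unfolding bij_betw_imp_surj_on[OF ring_iso_memE(5)[OF i]] .
    then obtain s' where "?s = ?i s'" and s'1: "s' \<in> carrier ?T" by (rule imageE)
    then have s': "s' \<in> carrier ?T" "?i s' = ?s" by simp_all
    have nz: "s' \<noteq> \<zero>\<^bsub>?T\<^esub>"
    proof
      assume z: "s' = \<zero>\<^bsub>?T\<^esub>"
      have b': "?J +>\<^bsub>?B\<^esub> b \<in> carrier (?B Quot ?J)" by (rule ring_hom_closed[OF hom_J b(1)])
      \<comment> \<open>The functions on {p} are not known to form a ring at this point, so zero is
        recognized by z + z = z.\<close>
      have double: "s' \<oplus>\<^bsub>?T\<^esub> s' = s'" unfolding z by (rule T.l_zero[OF T.zero_closed])
      have "?s \<oplus>\<^bsub>?C\<^esub> ?s = ?s"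
        using ring_iso_memE(3)[OF i s'(1) s'(1)] unfolding double s'(2) by (rule sym)
      then have "(?J +>\<^bsub>?B\<^esub> b) \<oplus>\<^bsub>?B Quot ?J\<^esub> (?J +>\<^bsub>?B\<^esub> b) = ?J +>\<^bsub>?B\<^esub> b"
        using C_add[of ?s ?s] by simp
      then have "?J +>\<^bsub>?B\<^esub> b = \<zero>\<^bsub>?B Quot ?J\<^esub>" using b' Q.add.l_cancel_one by simp
      then have "?J +>\<^bsub>?B\<^esub> b = ?J" by (simp add: FactRing_def)
      then show False using J.rcos_const_imp_mem[OF b(1)] b(2) by blast
    qed
    from E.spec_section_unit[OF s'1[unfolded E.Spec_simps(2)] nz]
    obtain t' where "t' \<in> spec_sections ?E (spec_points ?E)" and t'2: "s' \<otimes>\<^bsub>?T\<^esub> t' = \<one>\<^bsub>?T\<^esub>" by (rule bexE)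
    then have t': "t' \<in> carrier ?T" "s' \<otimes>\<^bsub>?T\<^esub> t' = \<one>\<^bsub>?T\<^esub>" unfolding E.Spec_simps(2) by blast+
    have "?i t' \<in> (\<Pi>\<^sub>E x\<in>{p}. carrier (stalk S x Quot zero_ideal S n V \<sigma> x))"
      using ring_iso_memE(1)[OF i t'(1)] unfolding C mem_Collect_eq by (rule conjunct1)
    then have "?i t' p \<in> carrier (?B Quot ?J)" by (rule PiE_mem) simp
    then obtain c where c: "c \<in> carrier ?B" "?i t' p = ?J +>\<^bsub>?B\<^esub> c"
      by (auto simp: FactRing_def A_RCOSETS_def')
    have "?s \<otimes>\<^bsub>?C\<^esub> ?i t' = \<one>\<^bsub>?C\<^esub>"
      using ring_iso_memE(2)[OF i s'(1) t'(1)] unfolding t'(2) ring_iso_memE(4)[OF i] s'(2) by (rule sym)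
    then have "(?J +>\<^bsub>?B\<^esub> b) \<otimes>\<^bsub>?B Quot ?J\<^esub> (?J +>\<^bsub>?B\<^esub> c) = \<one>\<^bsub>?B Quot ?J\<^esub>"
      using C_mult[of ?s "?i t'"] C_one c(2) by simp
    then have "?J +>\<^bsub>?B\<^esub> (b \<otimes>\<^bsub>?B\<^esub> c) = ?J +>\<^bsub>?B\<^esub> \<one>\<^bsub>?B\<^esub>"
      using ring_hom_mult[OF hom_J b(1) c(1)] ring_hom_one[OF hom_J] by simp
    then have "b \<otimes>\<^bsub>?B\<^esub> c \<ominus>\<^bsub>?B\<^esub> \<one>\<^bsub>?B\<^esub> \<in> ?J"
      using B.quotient_eq_iff_same_a_r_cos[OF J.is_ideal, of "b \<otimes>\<^bsub>?B\<^esub> c" "\<one>\<^bsub>?B\<^esub>"] b(1) c(1) by simp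
    then show ?thesis using c(1) by blast
  qed
  have "max_ideal ?B \<subseteq> ?J"
  proof
    fix b assume b: "b \<in> max_ideal ?B"
    then have b': "b \<in> carrier ?B" by (rule m.Icarr)
    show "b \<in> ?J"
    proof (rule ccontr)
      assume "b \<notin> ?J"
      then obtain c where c: "c \<in> carrier ?B" "b \<otimes>\<^bsub>?B\<^esub> c \<ominus>\<^bsub>?B\<^esub> \<one>\<^bsub>?B\<^esub> \<in> ?J" using inverse[OF b'] by blast
      have "b \<otimes>\<^bsub>?B\<^esub> c \<oplus>\<^bsub>?B\<^esub> \<ominus>\<^bsub>?B\<^esub> (b \<otimes>\<^bsub>?B\<^esub> c \<ominus>\<^bsub>?B\<^esub> \<one>\<^bsub>?B\<^esub>) \<in> max_ideal ?B"
        using m.a_closed[OF m.I_r_closed[OF b c(1)] m.a_inv_closed[OF subsetD[OF sub c(2)]]] .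
      moreover have "b \<otimes>\<^bsub>?B\<^esub> c \<oplus>\<^bsub>?B\<^esub> \<ominus>\<^bsub>?B\<^esub> (b \<otimes>\<^bsub>?B\<^esub> c \<ominus>\<^bsub>?B\<^esub> \<one>\<^bsub>?B\<^esub>) = \<one>\<^bsub>?B\<^esub>"
        using b' c(1) by (simp add: B.minus_eq B.minus_add B.a_assoc[symmetric] B.r_neg)
      ultimately show False using m.one_imp_carrier m.I_notcarr by auto
    qed
  qed
  with sub show ?thesis by blast
qed

end

section \<open>Morphisms on stalks\<close>

text \<open>Locality is known for the stalk of the scheme, while the coordinates are a morphism on
  an open subspace; this carries the maximal ideal over to the stalk of the subspace.\<close>

lemma local_ring_iso:
  assumes A: "cring A" and B: "local_ring B" and i: "i \<in> ring_iso A B"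
  shows "maximalideal {x \<in> carrier A. i x \<in> max_ideal B} A" "max_ideal A = {x \<in> carrier A. i x \<in> max_ideal B}"
proof -
  interpret A: cring A by fact
  interpret B: cring B using B by (simp add: local_ring_def)
  interpret m: maximalideal "max_ideal B" B by (rule local_ringD(1)[OF B])
  have hom: "i \<in> Ring.ring_hom A B" using i by (simp add: ring_iso_def)
  interpret i: ring_hom_ring A B i by (rule ring_hom_ringI2[OF A.ring_axioms B.ring_axioms hom])
  let ?M = "{x \<in> carrier A. i x \<in> max_ideal B}"
  have M: "ideal ?M A" by (rule i.ideal_vimage[OF m.is_ideal])
  have one: "\<one>\<^bsub>A\<^esub> \<notin> ?M" using m.I_notcarr m.one_imp_carrier ring_hom_one[OF hom] by auto
  have units: "x \<in> Units A" if x: "x \<in> carrier A" "x \<notin> ?M" for x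
  proof -
    have "i x \<in> Units B" using x by (intro local_ringD(3)[OF B]) auto
    then obtain y where y: "y \<in> carrier B" "y \<otimes>\<^bsub>B\<^esub> i x = \<one>\<^bsub>B\<^esub>" unfolding Units_def by blast
    have "y \<in> i ` carrier A" using y(1) unfolding bij_betw_imp_surj_on[OF ring_iso_memE(5)[OF i]] .
    then obtain z where z: "y = i z" "z \<in> carrier A" by (rule imageE)
    have "i (z \<otimes>\<^bsub>A\<^esub> x) = i \<one>\<^bsub>A\<^esub>" using y(2) x z by simp
    then have "z \<otimes>\<^bsub>A\<^esub> x = \<one>\<^bsub>A\<^esub>"
      by (rule inj_onD[OF bij_betw_imp_inj_on[OF ring_iso_memE(5)[OF i]]]) (use x z in auto)
    then show ?thesis by (rule A.UnitsI[OF x(1) z(2)])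
  qed
  show "maximalideal ?M A" "max_ideal A = ?M"
    using A.max_ideal_eqI[OF M one units] by blast+
qed

section \<open>Stalks of an open subspace\<close>

locale open_neighborhood = ring_presheaf S for S :: "('k, 'p, 'r) k_space" +
  fixes U :: "'p set" and p :: 'p
  assumes U: "openin (topo S) U" and pU: "p \<in> U"
begin

sublocale sub: ring_presheaf "k_open_sub S U"
  by (rule ring_presheaf_k_open_sub[OF ring_presheaf_axioms U])

lemma sub_simps: "sect (k_open_sub S U) = sect S" "rst (k_open_sub S U) = rst S"
    "openin (topo (k_open_sub S U)) W \<longleftrightarrow> openin (topo S) W \<and> W \<subseteq> U" "pts (k_open_sub S U) = U"
  using U openin_subset[OF U] by (auto simp: k_open_sub_def openin_open_subtopology)

lemma sub_sec: "sub.sec x W s \<longleftrightarrow> sec x W s \<and> W \<subseteq> U"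
  by (auto simp: sub.sec_def sec_def sub_simps)

text \<open>Germs on the open subspace consist of pairs over open subsets of U only, so its stalk is
  a different set. This map enlarges a germ by the pairs over arbitrary neighborhoods.\<close>

definition from_sub :: "('p set \<times> 'r) set \<Rightarrow> ('p set \<times> 'r) set" where
  "from_sub a = \<Union>{fgerm S p W s | W s. (W, s) \<in> a}"

lemma from_sub_fgerm:
  assumes s: "sub.sec p W s"
  shows "from_sub (fgerm (k_open_sub S U) p W s) = fgerm S p W s"
proof -
  have "{fgerm S p W' t | W' t. (W', t) \<in> fgerm (k_open_sub S U) p W s} = {fgerm S p W s}"
    by (rule sub.germ_image[where F = "fgerm S p", OF _ s]) (simp add: sub_sec sub_simps fgerm_rst)
  then show ?thesis by (simp add: from_sub_def)
qed

lemma from_sub_iso: "from_sub \<in> ring_iso (stalk (k_open_sub S U) p) (stalk S p)"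
proof (rule ring_iso_memI)
  let ?S = "k_open_sub S U"
  fix a b assume "a \<in> carrier (stalk ?S p)" "b \<in> carrier (stalk ?S p)"
  then obtain W s t where st: "sub.sec p W s" "sub.sec p W t" "a = fgerm ?S p W s" "b = fgerm ?S p W t"
    by (rule sub.stalk_cases2)
  have st': "sec p W s" "sec p W t" using st by (auto simp: sub_sec)
  show "from_sub (a \<otimes>\<^bsub>stalk ?S p\<^esub> b) = from_sub a \<otimes>\<^bsub>stalk S p\<^esub> from_sub b"
    unfolding st(3,4) sub.stalk_mult[OF st(1,2)] from_sub_fgerm[OF st(1)] from_sub_fgerm[OF st(2)] stalk_mult[OF st']
      from_sub_fgerm[OF sub.sec_mult[OF st(1,2)]] by (simp add: sub_simps)
  show "from_sub (a \<oplus>\<^bsub>stalk ?S p\<^esub> b) = from_sub a \<oplus>\<^bsub>stalk S p\<^esub> from_sub b"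
    unfolding st(3,4) sub.stalk_add[OF st(1,2)] from_sub_fgerm[OF st(1)] from_sub_fgerm[OF st(2)] stalk_add[OF st']
      from_sub_fgerm[OF sub.sec_add[OF st(1,2)]] by (simp add: sub_simps)
next
  fix a assume "a \<in> carrier (stalk (k_open_sub S U) p)"
  then obtain W s where s: "sub.sec p W s" "a = fgerm (k_open_sub S U) p W s" by (rule sub.stalk_cases)
  have "sec p W s" using s(1) by (simp add: sub_sec)
  then show "from_sub a \<in> carrier (stalk S p)" unfolding s(2) from_sub_fgerm[OF s(1)] by (rule fgerm_in)
next
  let ?S = "k_open_sub S U"
  have U': "openin (topo ?S) U" using U by (simp add: sub_simps)
  show "from_sub \<one>\<^bsub>stalk ?S p\<^esub> = \<one>\<^bsub>stalk S p\<^esub>"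
    unfolding sub.stalk_one[OF U' pU] stalk_one[OF U pU] from_sub_fgerm[OF sub.sec_one[OF U' pU]] by (simp add: sub_simps)
  show "bij_betw from_sub (carrier (stalk ?S p)) (carrier (stalk S p))"
    unfolding bij_betw_def
  proof (intro conjI inj_onI)
    fix a b assume ab: "a \<in> carrier (stalk ?S p)" "b \<in> carrier (stalk ?S p)" and eq: "from_sub a = from_sub b"
    from ab obtain W s t where st: "sub.sec p W s" "sub.sec p W t" "a = fgerm ?S p W s" "b = fgerm ?S p W t"
      by (rule sub.stalk_cases2)
    have st': "sec p W s" "sec p W t" "W \<subseteq> U" using st by (auto simp: sub_sec)
    from eq have "fgerm S p W s = fgerm S p W t"
      unfolding st(3,4) from_sub_fgerm[OF st(1)] from_sub_fgerm[OF st(2)] .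
    then obtain N where N: "openin (topo S) N" "p \<in> N" "N \<subseteq> W \<inter> W" "rst S W N s = rst S W N t"
      unfolding fgerm_eq_iff[OF st'(1,2)] by (elim exE conjE)
    then show "a = b"
      unfolding st(3,4) sub.fgerm_eq_iff[OF st(1,2)] using st'(3) by (intro exI[of _ N] conjI) (auto simp: sub_simps)
  next
    show "from_sub ` carrier (stalk ?S p) = carrier (stalk S p)"
    proof (intro equalityI subsetI)
    fix b assume "b \<in> from_sub ` carrier (stalk ?S p)"
    then obtain a where a: "b = from_sub a" "a \<in> carrier (stalk ?S p)" by (rule imageE)
    from a(2) obtain W s where s: "sub.sec p W s" "a = fgerm ?S p W s" by (rule sub.stalk_cases)
    have "sec p W s" using s(1) by (simp add: sub_sec)
    then show "b \<in> carrier (stalk S p)" unfolding a(1) s(2) from_sub_fgerm[OF s(1)] by (rule fgerm_in)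
  next
    fix b assume "b \<in> carrier (stalk S p)"
    then obtain W s where s: "sec p W s" "b = fgerm S p W s" by (rule stalk_cases)
    have W: "openin (topo S) (W \<inter> U)" "p \<in> W \<inter> U" "W \<inter> U \<subseteq> W" using s(1) U pU by (auto simp: sec_def)
    have s': "sub.sec p (W \<inter> U) (rst S W (W \<inter> U) s)" using sec_rst[OF s(1) W] by (simp add: sub_sec)
    have "from_sub (fgerm ?S p (W \<inter> U) (rst S W (W \<inter> U) s)) = b"
      unfolding from_sub_fgerm[OF s'] s(2) by (rule fgerm_rst[OF s(1) W])
    then show "b \<in> from_sub ` carrier (stalk ?S p)" using sub.fgerm_in[OF s'] by (intro image_eqI) auto
    qed
  qed
qed

end

section \<open>The map of stalks induced by a morphism\<close>

locale morphism_at = S: ring_presheaf S + T: ring_presheaf T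
  for S :: "('p, 'r, 'z) ringed_space_scheme" and T :: "('q, 's, 'y) ringed_space_scheme" +
  fixes \<phi> :: "('p, 'r, 'q, 's) rs_map" and p :: 'p
  assumes morphism: "rs_morphism S T \<phi>" and p: "p \<in> pts S"
begin

lemma pmap_pts: "pmap \<phi> p \<in> pts T"
  using morphism p continuous_map_image_subset_topspace[of "topo S" "topo T" "pmap \<phi>"]
  unfolding rs_morphism_def by auto

lemma openin_preim: "openin (topo T) V \<Longrightarrow> openin (topo S) (preim S \<phi> V)"
  using morphism openin_continuous_map_preimage[of "topo S" "topo T" "pmap \<phi>" V] unfolding rs_morphism_def preim_def by simp

lemma pull_hom: "openin (topo T) V \<Longrightarrow> pull \<phi> V \<in> Ring.ring_hom (sect T V) (sect S (preim S \<phi> V))"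
  using morphism[unfolded rs_morphism_def, THEN conjunct2, THEN conjunct1, THEN spec[of _ V]] by (rule mp)

lemma pull_rst:
  assumes V: "openin (topo T) V" and W: "openin (topo T) W" "W \<subseteq> V" and s: "s \<in> carrier (sect T V)"
  shows "pull \<phi> W (rst T V W s) = rst S (preim S \<phi> V) (preim S \<phi> W) (pull \<phi> V s)"
  by (rule morphism[unfolded rs_morphism_def, THEN conjunct2, THEN conjunct2, THEN spec[of _ V], THEN spec[of _ W],
        THEN mp, OF conjI[OF V conjI[OF W]], THEN bspec, OF s])

lemma preim_mono: "W \<subseteq> V \<Longrightarrow> preim S \<phi> W \<subseteq> preim S \<phi> V"
  by (auto simp: preim_def)

lemma sec_pull: "T.sec (pmap \<phi> p) V s \<Longrightarrow> S.sec p (preim S \<phi> V) (pull \<phi> V s)"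
  using ring_hom_closed[OF pull_hom] openin_preim p by (auto simp: S.sec_def T.sec_def preim_def)

abbreviation "h \<equiv> stalk_map S \<phi> p"

lemma stalk_map_fgerm:
  assumes s: "T.sec (pmap \<phi> p) V s"
  shows "h (fgerm T (pmap \<phi> p) V s) = fgerm S p (preim S \<phi> V) (pull \<phi> V s)"
proof -
  have "{fgerm S p (preim S \<phi> W) (pull \<phi> W t) | W t. (W, t) \<in> fgerm T (pmap \<phi> p) V s}
      = {fgerm S p (preim S \<phi> V) (pull \<phi> V s)}"
  proof (rule T.germ_image[where F = "\<lambda>V s. fgerm S p (preim S \<phi> V) (pull \<phi> V s)", OF _ s])
    fix W N t assume t: "T.sec (pmap \<phi> p) W t" and N: "openin (topo T) N" "pmap \<phi> p \<in> N" "N \<subseteq> W"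
    have "pull \<phi> N (rst T W N t) = rst S (preim S \<phi> W) (preim S \<phi> N) (pull \<phi> W t)"
      using t N by (intro pull_rst) (auto simp: T.sec_def)
    then show "fgerm S p (preim S \<phi> N) (pull \<phi> N (rst T W N t)) = fgerm S p (preim S \<phi> W) (pull \<phi> W t)"
      using S.fgerm_rst[OF sec_pull[OF t] openin_preim[OF N(1)] _ preim_mono[OF N(3)]] p N(2) by (simp add: preim_def)
  qed
  then show ?thesis unfolding stalk_map_def by simp
qed

lemma stalk_map_hom: "h \<in> Ring.ring_hom (stalk T (pmap \<phi> p)) (stalk S p)"
proof (rule ring_hom_memI)
  fix a assume "a \<in> carrier (stalk T (pmap \<phi> p))"
  then obtain V s where s: "T.sec (pmap \<phi> p) V s" "a = fgerm T (pmap \<phi> p) V s" by (rule T.stalk_cases)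
  show "h a \<in> carrier (stalk S p)" unfolding s(2) stalk_map_fgerm[OF s(1)] by (rule S.fgerm_in[OF sec_pull[OF s(1)]])
next
  fix a b assume "a \<in> carrier (stalk T (pmap \<phi> p))" "b \<in> carrier (stalk T (pmap \<phi> p))"
  then obtain V s t where st: "T.sec (pmap \<phi> p) V s" "T.sec (pmap \<phi> p) V t"
    "a = fgerm T (pmap \<phi> p) V s" "b = fgerm T (pmap \<phi> p) V t" by (rule T.stalk_cases2)
  have V: "openin (topo T) V" and in': "s \<in> carrier (sect T V)" "t \<in> carrier (sect T V)" using st by (auto simp: T.sec_def)
  note hom = pull_hom[OF V]
  show "h (a \<otimes>\<^bsub>stalk T (pmap \<phi> p)\<^esub> b) = h a \<otimes>\<^bsub>stalk S p\<^esub> h b"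
    unfolding st(3,4) T.stalk_mult[OF st(1,2)] stalk_map_fgerm[OF st(1)] stalk_map_fgerm[OF st(2)]
      stalk_map_fgerm[OF T.sec_mult[OF st(1,2)]] S.stalk_mult[OF sec_pull[OF st(1)] sec_pull[OF st(2)]]
      ring_hom_mult[OF hom in'] ..
  show "h (a \<oplus>\<^bsub>stalk T (pmap \<phi> p)\<^esub> b) = h a \<oplus>\<^bsub>stalk S p\<^esub> h b"
    unfolding st(3,4) T.stalk_add[OF st(1,2)] stalk_map_fgerm[OF st(1)] stalk_map_fgerm[OF st(2)]
      stalk_map_fgerm[OF T.sec_add[OF st(1,2)]] S.stalk_add[OF sec_pull[OF st(1)] sec_pull[OF st(2)]]
      ring_hom_add[OF hom in'] ..
next
  have T: "openin (topo T) (pts T)" by (rule openin_topspace)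
  have p': "p \<in> preim S \<phi> (pts T)" using p pmap_pts by (simp add: preim_def)
  show "h \<one>\<^bsub>stalk T (pmap \<phi> p)\<^esub> = \<one>\<^bsub>stalk S p\<^esub>"
    unfolding T.stalk_one[OF T pmap_pts] S.stalk_one[OF openin_preim[OF T] p'] stalk_map_fgerm[OF T.sec_one[OF T pmap_pts]]
      ring_hom_one[OF pull_hom[OF T]] ..
qed

lemma residue_map_surj:
  assumes mS: "ideal (max_ideal (stalk S p)) (stalk S p)" and mT: "ideal (max_ideal (stalk T (pmap \<phi> p))) (stalk T (pmap \<phi> p))"
    and surj: "residue_map S \<phi> p ` carrier (residue_field T (pmap \<phi> p)) = carrier (residue_field S p)"
    and b: "b \<in> carrier (stalk S p)"
  shows "\<exists>a\<in>carrier (stalk T (pmap \<phi> p)). b \<ominus>\<^bsub>stalk S p\<^esub> h a \<in> max_ideal (stalk S p)"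
proof -
  interpret S: cring "stalk S p" by (rule S.cring_stalk[OF p])
  interpret T: cring "stalk T (pmap \<phi> p)" by (rule T.cring_stalk[OF pmap_pts])
  interpret mS: ideal "max_ideal (stalk S p)" "stalk S p" by fact
  interpret mT: ideal "max_ideal (stalk T (pmap \<phi> p))" "stalk T (pmap \<phi> p)" by fact
  let ?C = "max_ideal (stalk S p) +>\<^bsub>stalk S p\<^esub> b"
  have "?C \<in> carrier (residue_field S p)" unfolding residue_field_def using ring_hom_closed[OF mS.rcos_ring_hom b] .
  then have "?C \<in> residue_map S \<phi> p ` carrier (residue_field T (pmap \<phi> p))" unfolding surj .
  then obtain D where D: "?C = residue_map S \<phi> p D" "D \<in> carrier (residue_field T (pmap \<phi> p))" by (rule imageE)
  have D_sub: "D \<subseteq> carrier (stalk T (pmap \<phi> p))"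
    using D(2) mT.a_subset by (auto simp: residue_field_def FactRing_def A_RCOSETS_def' a_r_coset_def')
  \<comment> \<open>The coset contains b, and the residue map is a union of cosets, so b lies in the
    coset of h(a) for some member a of \<open>D\<close>.\<close>
  have "b \<in> ?C" by (rule mS.a_rcos_self[OF b])
  then obtain a where a: "a \<in> D" "b \<in> max_ideal (stalk S p) +>\<^bsub>stalk S p\<^esub> h a"
    unfolding D(1) residue_map_def by (rule UN_E)
  have ha: "h a \<in> carrier (stalk S p)" by (rule ring_hom_closed[OF stalk_map_hom subsetD[OF D_sub a(1)]])
  have "b \<ominus>\<^bsub>stalk S p\<^esub> h a \<in> max_ideal (stalk S p)"
    using mS.a_rcos_module_minus[OF S.ring_axioms ha b] a(2) by simp
  then show ?thesis using subsetD[OF D_sub a(1)] by (intro bexI)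
qed

end

section \<open>The local index at a simple zero\<close>

text \<open>For N = M + 1 the power 2N is m times m times the power 2M, and the last two factors
  together lie in m.\<close>

lemma (in cring) ideal_pow_square:
  assumes m: "ideal m R" and N: "N \<noteq> 0"
  shows "ideal_pow R m (2 * N) \<subseteq> ideal_prod R m m"
proof -
  have ideal: "ideal (ideal_pow R m k) R" for k
    by (induction k) (simp_all add: oneideal ideal_prod_is_ideal[OF m])
  from N obtain M where "N = Suc M" using not0_implies_Suc by blast
  then have eq: "ideal_pow R m (2 * N) = ideal_prod R m (ideal_prod R m (ideal_pow R m (2 * M)))" by simp
  have sub: "ideal_prod R m (ideal_pow R m (2 * M)) \<subseteq> m" using ideal_prod_inter[OF m ideal] by blast
  show ?thesis
  proof
    fix x assume "x \<in> ideal_pow R m (2 * N)"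
    then have "x \<in> ideal_prod R m (ideal_prod R m (ideal_pow R m (2 * M)))" unfolding eq .
    then show "x \<in> ideal_prod R m m"
    proof (induction rule: ideal_prod.induct)
      case (prod i j)
      then show ?case using sub by (intro ideal_prod.prod) auto
    next
      case (sum s t)
      then show ?case by (intro ideal_prod.sum)
    qed
  qed
qed

lemma poly_ideal_ideal:
  assumes I: "poly_ideal n (I :: 'k::field mpoly set)"
  shows "ideal I (mpoly_ring n)"
proof -
  interpret R: cring "mpoly_ring n :: 'k mpoly ring" by (rule cring_mpoly_ring)
  note D = poly_idealD[OF I]
  show ?thesis
  proof (rule idealI[OF R.ring_axioms])
    show "subgroup I (add_monoid (mpoly_ring n))"
    proof (rule R.add.subgroupI)
      show "I \<subseteq> mpolys n" by (rule D(1))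
      show "I \<noteq> {}" using D(3) by blast
      fix a assume a: "a \<in> I"
      have "(\<ominus>\<^bsub>mpoly_ring n\<^esub> \<one>\<^bsub>mpoly_ring n\<^esub>) \<otimes>\<^bsub>mpoly_ring n\<^esub> a \<in> I"
        using D(5)[OF R.a_inv_closed[OF R.one_closed] a] by simp
      then show "\<ominus>\<^bsub>mpoly_ring n\<^esub> a \<in> I"
        unfolding R.l_minus[OF R.one_closed D(2)[OF a]] R.l_one[OF D(2)[OF a]] .
      fix b assume "b \<in> I"
      then show "a \<oplus>\<^bsub>mpoly_ring n\<^esub> b \<in> I" using D(4)[OF a] by simp
    qed
    fix a c :: "'k mpoly" assume "a \<in> I" and "c \<in> mpolys n"
    then show "c \<otimes>\<^bsub>mpoly_ring n\<^esub> a \<in> I" "a \<otimes>\<^bsub>mpoly_ring n\<^esub> c \<in> I"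
      using D(5)[of c a] by (simp_all add: mult.commute)
  qed
qed

text \<open>The bridge from the geometric data to the algebraic situation. \<open>f\<close>
  generates the maximal ideal at p modulo squares, and \<open>flat_hom_cotangent\<close> with
  Nakayama's lemma brings this down to the image point in affine space.\<close>

lemma residue_point_system_index_data:
  fixes S :: "('k::field, 'p, 'r) k_space"
  assumes S: "k_scheme S" and V: "module_sheaf S V" and sigma: "\<sigma> \<in> carrier (msec V (pts S))"
    and simple: "simple_zero S n V \<sigma> p"
    and separable: "separable_ext field_ring (residue_field S p) (scal_at S p)"
    and coordinates: "nisnevich_coordinates S n p U \<phi>" and frame: "local_frame S V n U e"
    and expresses: "expresses_section S n V \<sigma> p U \<phi> e f"
  shows "residue_point_system n (residue_field S p) (scal_at S p)
    (\<lambda>g. value_at S p U (pull_poly n \<phi> g)) (pmap \<phi> p) f"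
proof -
  let ?R = "mpoly_ring n :: 'k mpoly ring"
  let ?T = "affine_space n :: ('k, 'k mpoly set, 'k mpoly set \<Rightarrow> ('k mpoly \<times> 'k mpoly) set) k_space"
  let ?S = "k_open_sub S U" and ?q = "pmap \<phi> p"
  let ?A = "stalk ?T ?q" and ?B = "stalk S p" and ?C = "stalk ?S p" and ?E = "residue_field S p"
  let ?h = "stalk_map ?S \<phi> p"

  \<comment> \<open>The stalk of S at p and its zero ideal\<close>
  have U: "openin (topo S) U" and pU: "p \<in> U" and k_mor: "k_morphism ?S ?T \<phi>"
    and etale: "etale_to_noetherian ?S ?T \<phi>"
    and res_iso: "residue_map ?S \<phi> p \<in> ring_iso (residue_field ?T ?q) (residue_field ?S p)"
    using coordinates unfolding nisnevich_coordinates_def by simp_all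
  have lr: "locally_ringed S" and scal: "scal S \<in> Ring.ring_hom field_ring (sect S (pts S))"
    using S unfolding k_scheme_def is_scheme_def by simp_all
  have p: "p \<in> pts S" using openin_subset[OF U] pU by blast
  have local: "local_ring ?B" and ringed: "ringed S" using lr p unfolding locally_ringed_def by simp_all
  interpret N: open_neighborhood S U p
    by (rule open_neighborhood.intro[OF ring_presheaf_ringed[OF ringed] open_neighborhood_axioms.intro[OF U pU]])
  interpret sec: bundle_section S n V \<sigma>
    by (rule bundle_section.intro[OF N.ring_presheaf_axioms bundle_section_axioms.intro[OF V sigma]])
  define m where "m = max_ideal ?B"
  interpret B: cring ?B by (rule N.cring_stalk[OF p])
  interpret m: maximalideal m ?B unfolding m_def by (rule local_ringD(1)[OF local])
  have zero_m: "zero_ideal S n V \<sigma> p = m" unfolding m_def by (rule sec.simple_zero_ideal[OF p local simple])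
  have one_m: "\<one>\<^bsub>?B\<^esub> \<notin> m" using m.I_notcarr m.one_imp_carrier by blast

  \<comment> \<open>The stalk of affine space at the image point and the map of stalks\<close>
  interpret R: cring ?R by (rule cring_mpoly_ring)
  have eqs: "topo ?T = topo (Spec ?R)" "sect ?T = sect (Spec ?R)" "rst ?T = rst (Spec ?R)"
    by (simp_all add: affine_space_def)
  have T: "ring_presheaf ?T" using R.ring_presheaf_Spec unfolding ring_presheaf_def eqs .
  have fg: "fgerm ?T = fgerm (Spec ?R)" unfolding fgerm_def eqs ..
  have stalk_T: "stalk ?T = stalk (Spec ?R)" by (rule ext) (unfold stalk_def fg eqs, rule refl)
  have pts_T: "pts ?T = spec_points ?R" unfolding eqs by simp
  have lrs: "lrs_morphism ?S ?T \<phi>" and k_lin: "\<And>c. pull \<phi> (pts ?T) (scal ?T c) = scal ?S c"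
    using k_mor unfolding k_morphism_def by simp_all
  have pS: "p \<in> pts ?S" unfolding N.sub_simps(4) by (rule pU)
  have rs: "rs_morphism ?S ?T \<phi>" using lrs unfolding lrs_morphism_def by (rule conjunct1)
  have local_h: "?h ` max_ideal ?A \<subseteq> max_ideal ?C"
    using lrs[unfolded lrs_morphism_def, THEN conjunct2] pS by (rule bspec)
  interpret M: morphism_at ?S ?T \<phi> p
    by (rule morphism_at.intro[OF N.sub.ring_presheaf_axioms T morphism_at_axioms.intro[OF rs pS]])
  have q: "?q \<in> spec_points ?R" using M.pmap_pts unfolding pts_T .
  define \<gamma> where "\<gamma> = (\<lambda>a. fgerm ?T ?q (spec_points ?R) (spec_fun ?R a))"
  have loc: "prime_localization ?R ?A ?q \<gamma>"
    unfolding \<gamma>_def stalk_T fg by (rule R.prime_localization_stalk[OF q])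
  interpret L: prime_localization ?R ?A ?q \<gamma> by (rule loc)
  have cring_A: "cring ?A" by (rule L.A.is_cring)
  have max_A: "maximalideal (max_ideal ?A) ?A" using L.max_ideal_extension by simp
  have cring_C: "cring ?C" by (rule N.sub.cring_stalk[OF pS])
  interpret C: cring ?C by (rule cring_C)
  note iso = N.from_sub_iso
  let ?i = N.from_sub
  have max_C: "maximalideal (max_ideal ?C) ?C" and max_C_eq: "max_ideal ?C = {x \<in> carrier ?C. ?i x \<in> m}"
    unfolding m_def local_ring_iso(2)[OF cring_C local iso] by (rule local_ring_iso(1)[OF cring_C local iso], rule refl)
  have i_hom: "?i \<in> Ring.ring_hom ?C ?B" using iso unfolding ring_iso_def by blast
  interpret i: ring_hom_ring ?C ?B ?i by (rule ring_hom_ringI2[OF C.ring_axioms B.ring_axioms i_hom])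
  have i_inj: "inj_on ?i (carrier ?C)" and i_surj: "?i ` carrier ?C = carrier ?B"
    using ring_iso_memE(5)[OF iso] unfolding bij_betw_def by simp_all
  have h_hom: "?h \<in> Ring.ring_hom ?A ?C" by (rule M.stalk_map_hom)
  have residue: "\<exists>a\<in>carrier ?A. b \<ominus>\<^bsub>?C\<^esub> ?h a \<in> max_ideal ?C" if "b \<in> carrier ?C" for b
    by (rule M.residue_map_surj[OF maximalideal.axioms(1)[OF max_C] maximalideal.axioms(1)[OF max_A]
          bij_betw_imp_surj_on[OF ring_iso_memE(5)[OF res_iso]] that])
  note et = etale[unfolded etale_to_noetherian_def Let_def, THEN bspec, OF pS, THEN conjunct1]
  note flat = et[THEN conjunct1] and unramified = et[THEN conjunct2, THEN conjunct1]

  \<comment> \<open>Pulling polynomials back to the stalk at p\<close>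
  have opR: "openin (spec_topology ?R) (spec_points ?R)" using openin_topspace[of "spec_topology ?R"] by simp
  have sec_fun: "M.T.sec ?q (spec_points ?R) (spec_fun ?R a)" if "a \<in> mpolys n" for a
  proof -
    have "\<one>\<^bsub>?R\<^esub> \<notin> P" if "P \<in> spec_points ?R" for P
    proof -
      interpret P: primeideal P ?R using that by (simp only: spec_points_def mem_Collect_eq)
      show ?thesis using P.I_notcarr P.one_imp_carrier by blast
    qed
    then have "spec_fun ?R a \<in> spec_sections ?R (spec_points ?R)"
      unfolding spec_fun_def by (rule R.fraction_section[OF opR that R.one_closed])
    then show ?thesis using q opR by (simp add: M.T.sec_def eqs)
  qed
  have preim_U: "preim ?S \<phi> (spec_points ?R) = U"
    using continuous_map_image_subset_topspace[of "topo ?S" "topo ?T" "pmap \<phi>"] rs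
    unfolding rs_morphism_def preim_def N.sub_simps(4) pts_T by blast
  \<comment> \<open>The morphism lives on the open subspace, so a polynomial is pulled back to the
    stalk of the subspace first; \<open>?i\<close> leads from there to the stalk of S.\<close>
  define \<beta> where "\<beta> = (\<lambda>a. ?i (?h (\<gamma> a)))"
  have beta: "\<beta> a = fgerm S p U (pull_poly n \<phi> a)" if "a \<in> mpolys n" for a
    using N.from_sub_fgerm[OF M.sec_pull[OF sec_fun[OF that]]]
    unfolding \<beta>_def \<gamma>_def M.stalk_map_fgerm[OF sec_fun[OF that]] preim_U pull_poly_def pts_T .
  have beta_hom: "\<beta> \<in> Ring.ring_hom ?R ?B"
    using ring_hom_trans[OF ring_hom_trans[OF L.\<gamma> h_hom] i_hom] by (simp add: \<beta>_def comp_def)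
  have gamma_in: "\<gamma> a \<in> carrier ?A" if "a \<in> mpolys n" for a using L.gamma_in[OF that] .
  have beta_in: "\<beta> a \<in> carrier ?B" if "a \<in> mpolys n" for a using ring_hom_closed[OF beta_hom that] .
  have q_sub: "a \<in> mpolys n" if "a \<in> ?q" for a
  proof -
    interpret Q: primeideal ?q ?R using q by (simp only: spec_points_def mem_Collect_eq)
    show ?thesis by (rule Q.Icarr[OF that])
  qed
  have beta_q: "\<beta> a \<in> m \<longleftrightarrow> a \<in> ?q" if a: "a \<in> mpolys n" for a
  proof
    assume "a \<in> ?q"
    then have "\<gamma> a \<in> max_ideal ?A" using L.gamma_max_ideal[OF a] by simp
    then have "?h (\<gamma> a) \<in> max_ideal ?C" using local_h by blast
    then show "\<beta> a \<in> m" unfolding max_C_eq \<beta>_def by simp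
  next
    assume m: "\<beta> a \<in> m"
    \<comment> \<open>Outside the prime the germ of a is a unit, and homomorphisms send units to
      units, which avoid m.\<close>
    show "a \<in> ?q"
    proof (rule ccontr)
      assume "a \<notin> ?q"
      then have "\<gamma> a \<in> Units ?A" using a by (intro L.unit) simp
      then obtain y where y: "y \<in> carrier ?A" "y \<otimes>\<^bsub>?A\<^esub> \<gamma> a = \<one>\<^bsub>?A\<^esub>" unfolding Units_def by blast
      have hy: "?h y \<in> carrier ?C" by (rule ring_hom_closed[OF h_hom y(1)])
      have "?i (?h (y \<otimes>\<^bsub>?A\<^esub> \<gamma> a)) = ?i (?h y) \<otimes>\<^bsub>?B\<^esub> \<beta> a"
        unfolding \<beta>_def ring_hom_mult[OF h_hom y(1) gamma_in[OF a]]
        by (rule ring_hom_mult[OF i_hom hy ring_hom_closed[OF h_hom gamma_in[OF a]]])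
      then have "\<one>\<^bsub>?B\<^esub> = ?i (?h y) \<otimes>\<^bsub>?B\<^esub> \<beta> a"
        unfolding y(2) ring_hom_one[OF h_hom] ring_hom_one[OF i_hom] .
      then show False using m.I_l_closed[OF m ring_hom_closed[OF i_hom hy]] one_m by simp
    qed
  qed

  \<comment> \<open>The residue field of p as a field of values of polynomials\<close>
  define \<epsilon> where "\<epsilon> = (\<lambda>g. value_at S p U (pull_poly n \<phi> g))"
  have eps: "\<epsilon> a = m +>\<^bsub>?B\<^esub> \<beta> a" if "a \<in> mpolys n" for a
    unfolding \<epsilon>_def value_at_def m_def beta[OF that] ..
  have E_def: "?E = ?B Quot m" unfolding residue_field_def m_def ..
  have field_E: "field ?E" unfolding E_def by (rule m.quotient_is_field[OF B.is_cring])
  have coset_hom: "(\<lambda>b. m +>\<^bsub>?B\<^esub> b) \<in> Ring.ring_hom ?B ?E" unfolding E_def by (rule m.rcos_ring_hom)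
  have zero_E: "\<zero>\<^bsub>?E\<^esub> = m" unfolding E_def by (simp add: FactRing_def)
  have coset_eq: "m +>\<^bsub>?B\<^esub> b = m +>\<^bsub>?B\<^esub> c \<longleftrightarrow> b \<ominus>\<^bsub>?B\<^esub> c \<in> m" if "b \<in> carrier ?B" "c \<in> carrier ?B" for b c
    using B.quotient_eq_iff_same_a_r_cos[OF m.is_ideal that] by simp
  have coset_zero: "m +>\<^bsub>?B\<^esub> b = \<zero>\<^bsub>?E\<^esub> \<longleftrightarrow> b \<in> m" if b: "b \<in> carrier ?B" for b
    unfolding zero_E using m.rcos_const_imp_mem[OF b] B.a_rcos_zero[OF m.is_ideal, of b] by blast
  have eps_hom: "\<epsilon> \<in> Ring.ring_hom ?R ?E"
    by (rule R.ring_hom_restrict[OF ring_hom_trans[OF beta_hom coset_hom]]) (simp add: eps)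
  have eps_zero: "\<epsilon> a = \<zero>\<^bsub>?E\<^esub> \<longleftrightarrow> a \<in> ?q" if "a \<in> mpolys n" for a
    unfolding eps[OF that] coset_zero[OF beta_in[OF that]] by (rule beta_q[OF that])

  have point: "residue_point n ?E (scal_at S p) \<epsilon> ?q"
  proof (rule residue_point.intro)
    show "field ?E" by (rule field_E)
    have op: "openin (topo S) (pts S)" by (rule openin_topspace)
    have scal_eq: "scal_at S p = (\<lambda>b. m +>\<^bsub>?B\<^esub> b) \<circ> (fgerm S p (pts S) \<circ> scal S)"
      unfolding scal_at_def value_at_def m_def comp_def ..
    show "scal_at S p \<in> Ring.ring_hom field_ring ?E"
      unfolding scal_eq by (rule ring_hom_trans[OF ring_hom_trans[OF scal N.fgerm_hom[OF op p]] coset_hom])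
    show "\<epsilon> \<in> Ring.ring_hom ?R ?E" by (rule eps_hom)
    show "\<epsilon> (mconst c) = scal_at S p c" for c
    proof -
      have "pull_poly n \<phi> (mconst c) = scal ?S c"
        using k_lin[of c] unfolding pull_poly_def by (simp add: affine_space_def)
      then have eq: "pull_poly n \<phi> (mconst c) = rst S (pts S) U (scal S c)" by (simp add: k_open_sub_def)
      have "N.sec p (pts S) (scal S c)"
        using p ring_hom_closed[OF scal, of c] by (simp add: N.sec_def)
      then have "fgerm S p U (rst S (pts S) U (scal S c)) = fgerm S p (pts S) (scal S c)"
        by (rule N.fgerm_rst[OF _ U pU openin_subset[OF U]])
      then show ?thesis unfolding \<epsilon>_def scal_at_def value_at_def eq by simp
    qed
    show "separable_ext field_ring ?E (scal_at S p)" by (rule separable)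
    show "?q = {a \<in> mpolys n. \<epsilon> a = \<zero>\<^bsub>?E\<^esub>}" using eps_zero q_sub by blast
    \<comment> \<open>A residue class at p is represented by the image of some germ x of affine
      space, and x is a fraction a/s. Hence y times the value of s is the value of a.\<close>
    fix y assume "y \<in> carrier ?E"
    then obtain b where b: "b \<in> carrier ?B" "y = m +>\<^bsub>?B\<^esub> b" unfolding E_def by (auto simp: FactRing_def A_RCOSETS_def')
    have "b \<in> ?i ` carrier ?C" unfolding i_surj by (rule b(1))
    then obtain c where bc: "b = ?i c" and c: "c \<in> carrier ?C" by (rule imageE)
    from residue[OF c] obtain x where x: "x \<in> carrier ?A" and cx: "c \<ominus>\<^bsub>?C\<^esub> ?h x \<in> max_ideal ?C" by (rule bexE)
    obtain a s where a: "a \<in> mpolys n" and s: "s \<in> mpolys n - ?q" and xs: "x \<otimes>\<^bsub>?A\<^esub> \<gamma> s = \<gamma> a"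
      using L.fractions[OF x] by (elim bexE)
    have s': "s \<in> mpolys n" using s by simp
    let ?x = "?i (?h x)"
    have hx: "?h x \<in> carrier ?C" by (rule ring_hom_closed[OF h_hom x])
    then have ix: "?x \<in> carrier ?B" by (rule ring_hom_closed[OF i_hom])
    have "?i (?h (x \<otimes>\<^bsub>?A\<^esub> \<gamma> s)) = ?x \<otimes>\<^bsub>?B\<^esub> \<beta> s"
      unfolding \<beta>_def ring_hom_mult[OF h_hom x gamma_in[OF s']]
      by (rule ring_hom_mult[OF i_hom hx ring_hom_closed[OF h_hom gamma_in[OF s']]])
    then have xs': "\<beta> a = ?x \<otimes>\<^bsub>?B\<^esub> \<beta> s" unfolding xs \<beta>_def .
    have "?i (c \<ominus>\<^bsub>?C\<^esub> ?h x) \<in> m" using cx unfolding max_C_eq by simp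
    then have "b \<ominus>\<^bsub>?B\<^esub> ?x \<in> m" using c hx bc by (simp add: C.minus_eq B.minus_eq)
    then have "m +>\<^bsub>?B\<^esub> b = m +>\<^bsub>?B\<^esub> ?x" using coset_eq[OF b(1) ix] by simp
    then have "y \<otimes>\<^bsub>?E\<^esub> \<epsilon> s = \<epsilon> a"
      unfolding b(2) eps[OF s'] eps[OF a] xs' ring_hom_mult[OF coset_hom ix beta_in[OF s']] by simp
    moreover have "\<epsilon> s \<noteq> \<zero>\<^bsub>?E\<^esub>" using eps_zero[OF s'] s by simp
    ultimately show "\<exists>a\<in>mpolys n. \<exists>s\<in>mpolys n. \<epsilon> s \<noteq> \<zero>\<^bsub>?E\<^esub> \<and> y \<otimes>\<^bsub>?E\<^esub> \<epsilon> s = \<epsilon> a"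
      by (intro bexI[OF _ a] bexI[OF _ s'] conjI)
  qed
  interpret P: residue_point n ?E "scal_at S p" \<epsilon> ?q by (rule point)

  \<comment> \<open>The polynomials \<open>f\<close> generate the maximal ideal at the image
    point\<close>
  let ?g = "\<lambda>i. fgerm S p U (coords (sect S U) (msec V U) n e (mrst V (pts S) U \<sigma>) i)"
  have f: "f i \<in> mpolys n" if "i < n" for i using expresses that unfolding expresses_section_def by simp
  obtain N where N: "ideal_pow ?B m N \<subseteq> m" "\<forall>i<n. ?g i \<ominus>\<^bsub>?B\<^esub> fgerm S p U (pull_poly n \<phi> (f i)) \<in> ideal_pow ?B m (2 * N)"
    using expresses unfolding expresses_section_def zero_m m_def[symmetric] by (elim conjE exE)
  \<comment> \<open>For N = 0 the power would be the whole ring, which the proper ideal m cannot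
    contain. Thus 2N is at least 2, and the error of \<open>f\<close> lies in the square of
    m.\<close>
  have "N \<noteq> 0" using N(1) one_m by (cases "N = 0") auto
  then have square: "ideal_pow ?B m (2 * N) \<subseteq> ideal_prod ?B m m" by (rule B.ideal_pow_square[OF m.is_ideal])
  have approx: "?g i \<ominus>\<^bsub>?B\<^esub> \<beta> (f i) \<in> ideal_prod ?B m m" if "i < n" for i
    using subsetD[OF square N(2)[THEN spec, THEN mp, OF that]] unfolding beta[OF f[OF that]] .
  have mm: "ideal (ideal_prod ?B m m) ?B" by (rule B.ideal_prod_is_ideal[OF m.is_ideal m.is_ideal])
  have mm_m: "ideal_prod ?B m m \<subseteq> m" using B.ideal_prod_inter[OF m.is_ideal m.is_ideal] by simp
  have g_in: "?g i \<in> carrier ?B" if "i < n" for i by (rule N.fgerm_in[OF sec.component_sec[OF frame pU that]])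
  have g_m: "?g i \<in> m" if "i < n" for i using sec.component_zero_ideal[OF p frame pU that] unfolding zero_m .
  have f_q: "f i \<in> ?q" if i: "i < n" for i
  proof -
    have "?g i \<ominus>\<^bsub>?B\<^esub> (?g i \<ominus>\<^bsub>?B\<^esub> \<beta> (f i)) \<in> m"
      unfolding B.minus_eq[of "?g i" "?g i \<ominus>\<^bsub>?B\<^esub> \<beta> (f i)"]
      by (rule m.a_closed[OF g_m[OF i] m.a_inv_closed[OF subsetD[OF mm_m approx[OF i]]]])
    moreover have "?g i \<ominus>\<^bsub>?B\<^esub> (?g i \<ominus>\<^bsub>?B\<^esub> \<beta> (f i)) = \<beta> (f i)"
      using g_in[OF i] beta_in[OF f[OF i]] by (simp add: B.minus_eq B.minus_add B.a_assoc[symmetric] B.r_neg)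
    ultimately show ?thesis using beta_q[OF f[OF i]] by simp
  qed
  \<comment> \<open>The components of the section generate m, and each differs from the pulled-back
    polynomial by an element of the square of m. The argument takes place in the stalk of S, to
    which \<open>Z\<close> is transported by \<open>?i\<close>.\<close>
  have cotangent: "max_ideal ?C \<subseteq> Z" if Z: "additive_subgroup Z ?C"
    and Z_f: "\<And>i c. i \<in> {..<n} \<Longrightarrow> c \<in> carrier ?C \<Longrightarrow> ?h (\<gamma> (f i)) \<otimes>\<^bsub>?C\<^esub> c \<in> Z"
    and Z_mm: "\<And>x y. x \<in> max_ideal ?C \<Longrightarrow> y \<in> max_ideal ?C \<Longrightarrow> x \<otimes>\<^bsub>?C\<^esub> y \<in> Z" for Z
  proof -
    interpret Z: additive_subgroup Z ?C by (rule Z)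
    have Z_in: "z \<in> carrier ?C" if "z \<in> Z" for z by (rule Z.a_Hcarr[OF that])
    let ?Z = "?i ` Z"
    have add_Z: "x \<oplus>\<^bsub>?B\<^esub> y \<in> ?Z" if "x \<in> ?Z" "y \<in> ?Z" for x y
    proof -
      from that(1) obtain z where z: "x = ?i z" "z \<in> Z" by (rule imageE)
      from that(2) obtain w where w: "y = ?i w" "w \<in> Z" by (rule imageE)
      have "?i (z \<oplus>\<^bsub>?C\<^esub> w) \<in> ?Z" by (rule imageI[OF Z.a_closed[OF z(2) w(2)]])
      then show ?thesis unfolding z(1) w(1) ring_hom_add[OF i_hom Z_in[OF z(2)] Z_in[OF w(2)]] .
    qed
    have sub_Z: "additive_subgroup ?Z ?B"
    proof (rule additive_subgroupI, rule B.add.subgroupI)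
      show "?Z \<subseteq> carrier ?B" using Z_in ring_hom_closed[OF i_hom] by blast
      show "?Z \<noteq> {}" using Z.zero_closed by blast
      show "\<ominus>\<^bsub>?B\<^esub> x \<in> ?Z" if "x \<in> ?Z" for x
      proof -
        from that obtain z where z: "x = ?i z" "z \<in> Z" by (rule imageE)
        have "?i (\<ominus>\<^bsub>?C\<^esub> z) \<in> ?Z" by (rule imageI[OF Z.a_inv_closed[OF z(2)]])
        then show ?thesis unfolding z(1) i.hom_a_inv[OF Z_in[OF z(2)]] .
      qed
    qed (rule add_Z)
    have lift: "\<exists>y\<in>max_ideal ?C. x = ?i y" if "x \<in> m" for x
    proof -
      have "x \<in> ?i ` carrier ?C" unfolding i_surj by (rule m.Icarr[OF that])
      then obtain y where y: "x = ?i y" "y \<in> carrier ?C" by (rule imageE)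
      then have "y \<in> max_ideal ?C" unfolding max_C_eq using that by simp
      with y(1) show ?thesis by (rule bexI)
    qed
    have mm_Z: "x \<in> ?Z" if "x \<in> ideal_prod ?B m m" for x
      using that
    proof (induction rule: ideal_prod.induct)
      case (prod x y)
      from lift[OF prod(1)] obtain z where z: "z \<in> max_ideal ?C" "x = ?i z" by (rule bexE)
      from lift[OF prod(2)] obtain w where w: "w \<in> max_ideal ?C" "y = ?i w" by (rule bexE)
      have zw: "z \<in> carrier ?C" "w \<in> carrier ?C" using z(1) w(1) unfolding max_C_eq by simp_all
      have "?i (z \<otimes>\<^bsub>?C\<^esub> w) \<in> ?Z" by (rule imageI[OF Z_mm[OF z(1) w(1)]])
      then show ?case unfolding z(2) w(2) ring_hom_mult[OF i_hom zw] .
    next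
      case (sum x y)
      then show ?case by (intro add_Z)
    qed
    have g_Z: "?g j \<otimes>\<^bsub>?B\<^esub> c \<in> ?Z" if j: "j < n" and c: "c \<in> carrier ?B" for j c
    proof -
      have "c \<in> ?i ` carrier ?C" unfolding i_surj by (rule c)
      then obtain d where d: "c = ?i d" "d \<in> carrier ?C" by (rule imageE)
      have "?i (?h (\<gamma> (f j)) \<otimes>\<^bsub>?C\<^esub> d) \<in> ?Z" by (rule imageI[OF Z_f]) (simp_all add: j d(2))
      then have 1: "\<beta> (f j) \<otimes>\<^bsub>?B\<^esub> c \<in> ?Z"
        unfolding \<beta>_def d(1) ring_hom_mult[OF i_hom ring_hom_closed[OF h_hom gamma_in[OF f[OF j]]] d(2)] .
      have 2: "(?g j \<ominus>\<^bsub>?B\<^esub> \<beta> (f j)) \<otimes>\<^bsub>?B\<^esub> c \<in> ?Z"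
        by (rule mm_Z[OF ideal.I_r_closed[OF mm approx[OF j] c]])
      have d_in: "?g j \<ominus>\<^bsub>?B\<^esub> \<beta> (f j) \<in> carrier ?B" by (rule B.minus_closed[OF g_in[OF j] beta_in[OF f[OF j]]])
      have "(?g j \<ominus>\<^bsub>?B\<^esub> \<beta> (f j)) \<oplus>\<^bsub>?B\<^esub> \<beta> (f j) = ?g j"
        using g_in[OF j] beta_in[OF f[OF j]] by (simp add: B.minus_eq B.a_assoc B.l_neg)
      then have "?g j \<otimes>\<^bsub>?B\<^esub> c = (?g j \<ominus>\<^bsub>?B\<^esub> \<beta> (f j)) \<otimes>\<^bsub>?B\<^esub> c \<oplus>\<^bsub>?B\<^esub> \<beta> (f j) \<otimes>\<^bsub>?B\<^esub> c"
        using B.l_distr[OF d_in beta_in[OF f[OF j]] c] by simp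
      then show ?thesis using add_Z[OF 2 1] by simp
    qed
    have "genideal ?B (?g ` {..<n}) \<subseteq> ?Z"
      by (rule B.genideal_subset_additive[OF sub_Z]) (use g_in g_Z in auto)
    then have m_Z: "m \<subseteq> ?Z" using sec.zero_ideal_frame[OF p frame pU] unfolding zero_m by (rule order_trans[rotated])
    show ?thesis
    proof
      fix x assume "x \<in> max_ideal ?C"
      then have x: "x \<in> carrier ?C" "?i x \<in> m" unfolding max_C_eq by simp_all
      from subsetD[OF m_Z x(2)] obtain z where z: "?i x = ?i z" "z \<in> Z" by (rule imageE)
      have "x = z" by (rule inj_onD[OF i_inj z(1) x(1) Z_in[OF z(2)]])
      then show "x \<in> Z" using z(2) by simp
    qed
  qed
  \<comment> \<open>By Nakayama's lemma it suffices to consider saturated \<open>K\<close> that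
    contain all products of two elements of the prime. For these \<open>flat_hom_cotangent\<close>
    applies to the extension of \<open>K\<close> to the stalk.\<close>
  have f_generate: "?q \<subseteq> I" if I: "P.saturated_ideal I" and f_I: "\<And>j. j < n \<Longrightarrow> f j \<in> I" for I
  proof (rule P.nakayama[OF I])
    fix K assume K: "P.saturated_ideal K" and IK: "I \<subseteq> K" and qq: "\<And>a b. a \<in> ?q \<Longrightarrow> b \<in> ?q \<Longrightarrow> a * b \<in> K"
    have K_ideal: "ideal K ?R" using K unfolding P.saturated_ideal_def by (intro poly_ideal_ideal) simp
    have K_sat: "a \<in> K" if "s \<in> mpolys n - ?q" "a \<in> mpolys n" "s \<otimes>\<^bsub>?R\<^esub> a \<in> K" for s a
      using K that unfolding P.saturated_ideal_def by simp
    have "max_ideal ?A \<subseteq> L.extension K"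
    proof (rule flat_hom_cotangent[OF cring_A cring_C h_hom max_A max_C local_h flat residue unramified,
          where I = "{..<n}" and f = "\<lambda>i. \<gamma> (f i)"])
      show "\<gamma> (f i) \<in> max_ideal ?A" if "i \<in> {..<n}" for i
        using that f_q[of i] L.gamma_max_ideal[OF f[of i]] by simp
      show "max_ideal ?C \<subseteq> Z" if "additive_subgroup Z ?C"
        "\<And>i c. i \<in> {..<n} \<Longrightarrow> c \<in> carrier ?C \<Longrightarrow> ?h (\<gamma> (f i)) \<otimes>\<^bsub>?C\<^esub> c \<in> Z"
        "\<And>x y. x \<in> max_ideal ?C \<Longrightarrow> y \<in> max_ideal ?C \<Longrightarrow> x \<otimes>\<^bsub>?C\<^esub> y \<in> Z" for Z
        using that by (rule cotangent)
      show "ideal (L.extension K) ?A" by (rule L.ideal_extension[OF K_ideal])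
      show "\<gamma> (f i) \<in> L.extension K" if "i \<in> {..<n}" for i
        using that f_I[of i] IK by (intro L.gamma_extension f) auto
      fix x y assume "x \<in> max_ideal ?A" "y \<in> max_ideal ?A"
      then have xy: "x \<in> L.extension ?q" "y \<in> L.extension ?q" unfolding L.max_ideal_extension(2) .
      obtain a s where x: "x \<in> carrier ?A" "a \<in> ?q" "s \<in> mpolys n - ?q" "x \<otimes>\<^bsub>?A\<^esub> \<gamma> s = \<gamma> a"
        using xy(1) unfolding L.extension_def mem_Collect_eq by (elim conjE bexE)
      obtain b t where y: "y \<in> carrier ?A" "b \<in> ?q" "t \<in> mpolys n - ?q" "y \<otimes>\<^bsub>?A\<^esub> \<gamma> t = \<gamma> b"
        using xy(2) unfolding L.extension_def mem_Collect_eq by (elim conjE bexE)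
      have st: "s \<in> carrier ?R" "t \<in> carrier ?R" using x(3) y(3) by auto
      have "(x \<otimes>\<^bsub>?A\<^esub> y) \<otimes>\<^bsub>?A\<^esub> \<gamma> (s \<otimes>\<^bsub>?R\<^esub> t) = (x \<otimes>\<^bsub>?A\<^esub> \<gamma> s) \<otimes>\<^bsub>?A\<^esub> (y \<otimes>\<^bsub>?A\<^esub> \<gamma> t)"
        unfolding L.gamma_mult[OF st] using x(1) y(1) gamma_in[OF st(1)] gamma_in[OF st(2)] by (simp add: L.A.m_ac)
      also have "\<dots> = \<gamma> (a \<otimes>\<^bsub>?R\<^esub> b)"
        unfolding x(4) y(4) by (rule L.gamma_mult[symmetric, OF q_sub[OF x(2)] q_sub[OF y(2)]])
      finally have eq: "(x \<otimes>\<^bsub>?A\<^esub> y) \<otimes>\<^bsub>?A\<^esub> \<gamma> (s \<otimes>\<^bsub>?R\<^esub> t) = \<gamma> (a \<otimes>\<^bsub>?R\<^esub> b)" .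
      have ab: "a \<otimes>\<^bsub>?R\<^esub> b \<in> K" using qq[OF x(2) y(2)] by simp
      show "x \<otimes>\<^bsub>?A\<^esub> y \<in> L.extension K"
        by (rule L.extensionI[OF L.A.m_closed[OF x(1) y(1)] ab L.mult_compl[OF x(3) y(3)] eq])
    qed
    note sub = this
    show "?q \<subseteq> K"
    proof
      fix a assume a: "a \<in> ?q"
      have a': "a \<in> carrier ?R" by (rule q_sub[OF a])
      have "\<gamma> a \<in> max_ideal ?A" using L.gamma_max_ideal[OF a'] a by simp
      then have "\<gamma> a \<in> L.extension K" by (rule subsetD[OF sub])
      moreover have "\<gamma> a \<in> L.extension K \<longleftrightarrow> a \<in> K"
        by (rule L.gamma_extension_iff[OF K_ideal _ a']) (rule K_sat)
      ultimately show "a \<in> K" by simp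
    qed
  qed
  show ?thesis
    unfolding \<epsilon>_def[symmetric]
    by (rule residue_point_system.intro[OF point residue_point_system_axioms.intro[OF f_q f_generate]])
qed

theorem proposition5p6:
  fixes S :: "('k::field, 'p, 'r) k_space"
    and n :: nat
    and V :: "('p, 'r, 'v) mod_sheaf"
    and L :: "('p, 'r, 'l) mod_sheaf"
  assumes char: "CHAR('k) \<noteq> 2"
    and S: "k_scheme S" "has_krull_dim (topo S) n"
    and V: "vector_bundle S n V"
    and orientation: "relative_orientation S n V L \<rho>"
    and sigma: "\<sigma> \<in> carrier (msec V (pts S))"
    and simple: "simple_zero S n V \<sigma> p"
    and separable: "separable_ext field_ring (residue_field S p) (scal_at S p)"
    and data: "index_data S n V L \<rho> \<sigma> p U \<phi> \<psi> f"
  shows "local_index n p \<phi> f =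
    gw_trace field_ring (residue_field S p) (scal_at S p)
      (gw_rank_one (residue_field S p) (intersection_volume S n p U \<phi> f))"
proof -
  have "nisnevich_coordinates S n p U \<phi>" "local_frame S V n U \<psi>" "expresses_section S n V \<sigma> p U \<phi> \<psi> f"
    using data unfolding index_data_def compatible_frame_def by simp_all
  moreover have "module_sheaf S V" using V unfolding vector_bundle_def by (rule conjunct1)
  ultimately interpret residue_point_system n "residue_field S p" "scal_at S p"
    "\<lambda>g. value_at S p U (pull_poly n \<phi> g)" "pmap \<phi> p" f
    using S(1) sigma simple separable by (intro residue_point_system_index_data)
  show ?thesis
    unfolding local_index_def intersection_volume_def by (rule local_A1_degree_eq)
qed

end
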